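(* Let $(\Omega,T)$ be a topologically mixing countable Markov shift endowed with a null recurrent potential $\phi$ satisfying Walters' condition and $P_G(\phi)<+\infty$, and let $\mu$ be the associated invariant measure. Assume that the (non-decreasing) normalizing sequence $(a_n)$ of $(\Omega,T,\mu)$ is regularly varying of index $\alpha$ for some $0<\alpha\le1$. Let $x\in\Omega$ be periodic of prime period $q$, let $B_n:=[x_0^{n-1}]$ for $n\ge1$, and set $\theta:=1-\exp(S_q\phi(x)-qP_G(\phi))$. Then, as $n\to+\infty$, $N_{B_n}^\gamma$ converges in law to $\mathrm{CFPP}_\alpha(\theta\Gamma(1+\alpha),\mathrm{Geo}(\theta))$ under every probability measure absolutely continuous with respect to $\mu$, and to $\mathrm{RPP}(W_{\alpha,\theta}(\theta\Gamma(1+\alpha)))$ under $\mu_{B_n}$.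
   Context: Topological Markov shifts. Let $V$ be an at most countable alphabet and $A:V\times V\to\{0,1\}$ a transition matrix. $\Omega=\{x=(x_n)_{n\ge0}\in V^{\mathbb N}: A(x_n,x_{n+1})=1\ \forall n\ge0\}$, $T$ is the left shift, topology given by $d(x,y)=\eta^{\min\{n\ge0:x_n\ne y_n\}}$, $\eta\in(0,1)$ fixed; this is a countable Markov shift (CMS) when $V$ is infinite. A word $v_0^{n-1}=(v_0,\dots,v_{n-1})$ is admissible if $A(v_i,v_{i+1})=1$ for all $i$; $[v_0^{n-1}]=\{x\in\Omega:x_i=v_i,\ 0\le i<n\}$. Topologically mixing: for all $v,w\in V$ there is $N$ such that for all $n\ge N$ there is an admissible path of $n$ steps from $v$ to $w$. Potentials. $\phi:\Omega\to\mathbb R$ is measurable, $S_n\phi=\sum_{k=0}^{n-1}\phi\circ T^k$, $\mathrm{var}_n(\phi)=\sup\{|\phi(x)-\phi(y)|:x_0^{n-1}=y_0^{n-1}\}$. Walters' condition: for all $k\ge1$, $W_k(\phi):=\sup_{n\ge1}\mathrm{var}_{n+k}(S_n\phi)<\infty$, and $W_k(\phi)\to0$ as $k\to\infty$. For measurable $B$, $r_B=r_B^{(1)}(x)=\inf\{n\ge1:T^nx\in B\}$, $r_B^{(k+1)}(x)=\inf\{n>r_B^{(k)}(x):T^nx\in B\}$. $Z_n(\phi,v)=\sum_{T^nx=x}e^{S_n\phi(x)}\mathbf 1_{[v]}(x)$, $Z_n^*(\phi,v)=\sum_{T^nx=x}e^{S_n\phi(x)}\mathbf 1_{\{r_{[v]}=n\}}(x)\mathbf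 1_{[v]}(x)$. $P_G(\phi)=\lim_n\frac1n\log Z_n(\phi,v)$ (independent of $v$), $\lambda_\phi=e^{P_G(\phi)}$. $\phi$ is null recurrent if $\sum_n\lambda_\phi^{-n}Z_n(\phi,v)=\infty$ and $\sum_n n\lambda_\phi^{-n}Z_n^*(\phi,v)=\infty$ for some (all) $v$. Then, with $L_\phi f(x)=\sum_{Ty=x}e^{\phi(y)}f(y)$, there are a continuous $h_\phi>0$ and a conservative measure $\nu_\phi$, finite on cylinders, with $L_\phi h_\phi=\lambda_\phi h_\phi$, $L_\phi^*\nu_\phi=\lambda_\phi\nu_\phi$, $\int h_\phi\,d\nu_\phi=+\infty$; $\mu=h_\phi\nu_\phi$ is a conservative ergodic shift-invariant $\sigma$-finite infinite measure. $(\Omega,T,\mu)$ is pointwise dual ergodic: with $\widehat T$ the transfer operator ($\int f\cdot g\circ T\,d\mu=\int(\widehat Tf)g\,d\mu$), there is a normalizing sequence $(a_n)$ with $\frac1{a_n}\sum_{k=0}^{n-1}\widehat T^kf\to\int f\,d\mu$ $\mu$-a.e. for all $f\in L^1(\mu)$; one has $a_n\sim\frac1{\mu[v]}\sum_{k=1}^n\lambda_\phi^{-k}Z_k(\phi,v)$. Scaling. With $a(s)=a_{\lfloor s\rfloor}$ and $a^{\leftarrow}(y)=\inf\{s\ge0:a(s)>y\}$, put $\gamma(s)=1/a^{\leftarrow}(1/s)$. For $\mu(B)>0$, $\mu_B=\mu(\cdot\cap B)/\mu(B)$ and $N_B^\gamma=\sum_{k\ge1}\delta_{\gamma(\mu(B))\,r_B^{(k)}}$.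 Point processes on $\mathbb R_+=[0,\infty)$ are random boundedly finite counting measures; convergence in law is for the weak$^*$ (vague) topology. $\mathrm{RPP}(W)=\sum_{i\ge1}\delta_{W_1+\dots+W_i}$, $(W_i)$ i.i.d. copies of $W\ge0$. $H_\alpha(\lambda)$ is the nonnegative random variable with $\mathbb E[e^{-sH_\alpha(\lambda)}]=\lambda/(\lambda+s^\alpha)$, $s\ge0$; $\mathrm{FPP}_\alpha(\lambda)=\mathrm{RPP}(H_\alpha(\lambda))$. $\mathrm{Geo}(\theta)$ is the law $\pi(k)=\theta(1-\theta)^{k-1}$, $k\ge1$. $\mathrm{CFPP}_\alpha(\lambda,\pi)=\sum_iX_i\delta_{T_i}$ where $\sum_i\delta_{T_i}$ is $\mathrm{FPP}_\alpha(\lambda)$ and $(X_i)$ are i.i.d. of law $\pi$ independent of $(T_i)$. $W_{\alpha,\theta}(\lambda)$ has $\mathbb P(W_{\alpha,\theta}(\lambda)\le t)=1-\theta+\theta\,\mathbb P(H_\alpha(\lambda)\le t)$, $t\ge0$. *)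

theory Defs
  imports "HOL-Probability.Probability"
begin

section \<open>Topological Markov shifts\<close>

text \<open>The alphabet is the whole type \<open>'v\<close>; it is at most countable by the class
  \<open>countable\<close>. The relation \<open>A v w\<close> stands for the entry \<open>1\<close> of the transition matrix
  at \<open>(v, w)\<close>.\<close>

definition markov_space :: "('v \<Rightarrow> 'v \<Rightarrow> bool) \<Rightarrow> (nat \<Rightarrow> 'v) set" where
  "markov_space A = {x. \<forall>n. A (x n) (x (Suc n))}"

definition lshift :: "(nat \<Rightarrow> 'v) \<Rightarrow> nat \<Rightarrow> 'v" where
  "lshift x = (\<lambda>n. x (Suc n))"

definition shift_dist :: "real \<Rightarrow> (nat \<Rightarrow> 'v) \<Rightarrow> (nat \<Rightarrow> 'v) \<Rightarrow> real" where
  "shift_dist \<eta> x y = (if x = y then 0 else \<eta> ^ (LEAST n. x n \<noteq> y n))"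

lemma Metric_space_shift_dist:
  assumes "0 < \<eta>" "\<eta> < 1"
  shows "Metric_space (markov_space A) (shift_dist \<eta>)"
proof
  fix x y z :: "nat \<Rightarrow> 'v"
  have sd: "shift_dist \<eta> u v = (if u = v then 0 else \<eta> ^ (LEAST n. u n \<noteq> v n))" for u v :: "nat \<Rightarrow> 'v"
    by (rule shift_dist_def)
  show "0 \<le> shift_dist \<eta> x y" unfolding sd using assms by auto
  have "(\<lambda>n. x n \<noteq> y n) = (\<lambda>n. y n \<noteq> x n)" by auto
  then show "shift_dist \<eta> x y = shift_dist \<eta> y x" unfolding sd by (cases "x = y") auto
  show "shift_dist \<eta> x y = 0 \<longleftrightarrow> x = y" unfolding sd using assms by auto
  show "shift_dist \<eta> x z \<le> shift_dist \<eta> x y + shift_dist \<eta> y z"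
  proof (cases "x = y \<or> y = z \<or> x = z")
    case True
    then show ?thesis unfolding sd using assms by auto
  next
    case False
    define k where "k = (LEAST n. x n \<noteq> z n)"
    define l where "l = (LEAST n. x n \<noteq> y n)"
    define m where "m = (LEAST n. y n \<noteq> z n)"
    have eq: "shift_dist \<eta> x z = \<eta> ^ k" "shift_dist \<eta> x y = \<eta> ^ l" "shift_dist \<eta> y z = \<eta> ^ m"
      unfolding sd k_def l_def m_def using False by auto
    have pos: "0 \<le> \<eta> ^ l" "0 \<le> \<eta> ^ m" using assms by auto
    have "\<exists>n. x n \<noteq> z n" using False by blast
    then have "x k \<noteq> z k" unfolding k_def by (rule LeastI_ex)
    then have "x k \<noteq> y k \<or> y k \<noteq> z k" by metis
    then have "l \<le> k \<or> m \<le> k" unfolding l_def m_def by (meson Least_le)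
    then have "\<eta> ^ k \<le> \<eta> ^ l \<or> \<eta> ^ k \<le> \<eta> ^ m"
      using assms by (meson less_imp_le power_decreasing)
    then show ?thesis unfolding eq using pos by linarith
  qed
qed

definition markov_topology :: "real \<Rightarrow> ('v \<Rightarrow> 'v \<Rightarrow> bool) \<Rightarrow> (nat \<Rightarrow> 'v) topology" where
  "markov_topology \<eta> A = Metric_space.mtopology (markov_space A) (shift_dist \<eta>)"

definition markov_borel :: "real \<Rightarrow> ('v \<Rightarrow> 'v \<Rightarrow> bool) \<Rightarrow> (nat \<Rightarrow> 'v) measure" where
  "markov_borel \<eta> A = sigma (markov_space A) {U. openin (markov_topology \<eta> A) U}"

definition cylinder :: "('v \<Rightarrow> 'v \<Rightarrow> bool) \<Rightarrow> 'v list \<Rightarrow> (nat \<Rightarrow> 'v) set" where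
  "cylinder A w = {x \<in> markov_space A. \<forall>i<length w. x i = w ! i}"

definition topologically_mixing :: "('v \<Rightarrow> 'v \<Rightarrow> bool) \<Rightarrow> bool" where
  "topologically_mixing A \<longleftrightarrow>
     (\<forall>v w. \<exists>N. \<forall>n\<ge>N. \<exists>p. p 0 = v \<and> p n = w \<and> (\<forall>i<n. A (p i) (p (Suc i))))"

definition prime_period :: "(nat \<Rightarrow> 'v) \<Rightarrow> nat \<Rightarrow> bool" where
  "prime_period x q \<longleftrightarrow>
     0 < q \<and> (lshift ^^ q) x = x \<and> (\<forall>j. 0 < j \<and> j < q \<longrightarrow> (lshift ^^ j) x \<noteq> x)"

section \<open>Potentials\<close>

definition birkhoff_sum :: "((nat \<Rightarrow> 'v) \<Rightarrow> real) \<Rightarrow> nat \<Rightarrow> (nat \<Rightarrow> 'v) \<Rightarrow> real" where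
  "birkhoff_sum \<phi> n x = (\<Sum>k<n. \<phi> ((lshift ^^ k) x))"

definition var_n :: "('v \<Rightarrow> 'v \<Rightarrow> bool) \<Rightarrow> nat \<Rightarrow> ((nat \<Rightarrow> 'v) \<Rightarrow> real) \<Rightarrow> ennreal" where
  "var_n A n f = (SUP (x, y) \<in> {(x, y). x \<in> markov_space A \<and> y \<in> markov_space A \<and> (\<forall>i<n. x i = y i)}.
     ennreal \<bar>f x - f y\<bar>)"

definition walters_W :: "('v \<Rightarrow> 'v \<Rightarrow> bool) \<Rightarrow> ((nat \<Rightarrow> 'v) \<Rightarrow> real) \<Rightarrow> nat \<Rightarrow> ennreal" where
  "walters_W A \<phi> k = (SUP n\<in>{1..}. var_n A (n + k) (birkhoff_sum \<phi> n))"

definition walters_condition :: "('v \<Rightarrow> 'v \<Rightarrow> bool) \<Rightarrow> ((nat \<Rightarrow> 'v) \<Rightarrow> real) \<Rightarrow> bool" where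
  "walters_condition A \<phi> \<longleftrightarrow> (\<forall>k\<ge>1. walters_W A \<phi> k < \<infinity>) \<and> walters_W A \<phi> \<longlonglongrightarrow> 0"

text \<open>\<open>return_time B k x\<close> is the k-th return time for \<open>k \<ge> 1\<close>; it is \<open>\<infinity>\<close> (the infimum of the
  empty set) if there are fewer than \<open>k\<close> returns. The value \<open>0\<close> at \<open>k = 0\<close> only starts the
  recursion.\<close>

fun return_time :: "(nat \<Rightarrow> 'v) set \<Rightarrow> nat \<Rightarrow> (nat \<Rightarrow> 'v) \<Rightarrow> enat" where
  "return_time B 0 x = 0"
| "return_time B (Suc k) x = Inf {enat n |n. return_time B k x < enat n \<and> (lshift ^^ n) x \<in> B}"

text \<open>The sums over periodic points may be infinite, hence the values in \<open>ennreal\<close>.\<close>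

definition Z_sum :: "('v \<Rightarrow> 'v \<Rightarrow> bool) \<Rightarrow> ((nat \<Rightarrow> 'v) \<Rightarrow> real) \<Rightarrow> nat \<Rightarrow> 'v \<Rightarrow> ennreal" where
  "Z_sum A \<phi> n v = (\<Sum>\<^sub>\<infinity>x\<in>{x \<in> markov_space A. (lshift ^^ n) x = x}.
     ennreal (exp (birkhoff_sum \<phi> n x)) * indicator (cylinder A [v]) x)"

definition Z_star_sum :: "('v \<Rightarrow> 'v \<Rightarrow> bool) \<Rightarrow> ((nat \<Rightarrow> 'v) \<Rightarrow> real) \<Rightarrow> nat \<Rightarrow> 'v \<Rightarrow> ennreal" where
  "Z_star_sum A \<phi> n v = (\<Sum>\<^sub>\<infinity>x\<in>{x \<in> markov_space A. (lshift ^^ n) x = x}.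
     ennreal (exp (birkhoff_sum \<phi> n x)) * indicator {y. return_time (cylinder A [v]) 1 y = enat n} x *
     indicator (cylinder A [v]) x)"

definition ln_ext :: "ennreal \<Rightarrow> ereal" where
  "ln_ext z = (if z = 0 then - \<infinity> else if z = \<infinity> then \<infinity> else ereal (ln (enn2real z)))"

definition gurevich_pressure :: "('v \<Rightarrow> 'v \<Rightarrow> bool) \<Rightarrow> ((nat \<Rightarrow> 'v) \<Rightarrow> real) \<Rightarrow> ereal" where
  "gurevich_pressure A \<phi> =
     (THE P. \<forall>v. (\<lambda>n. ereal (1 / real n) * ln_ext (Z_sum A \<phi> n v)) \<longlonglongrightarrow> P)"

text \<open>\<open>\<lambda>\<^sub>\<phi>\<close>; only meaningful when the pressure is finite.\<close>

definition pressure_eigenvalue :: "('v \<Rightarrow> 'v \<Rightarrow> bool) \<Rightarrow> ((nat \<Rightarrow> 'v) \<Rightarrow> real) \<Rightarrow> real" where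
  "pressure_eigenvalue A \<phi> = exp (real_of_ereal (gurevich_pressure A \<phi>))"

text \<open>Both series run over \<open>n \<ge> 1\<close>.\<close>

definition null_recurrent :: "('v \<Rightarrow> 'v \<Rightarrow> bool) \<Rightarrow> ((nat \<Rightarrow> 'v) \<Rightarrow> real) \<Rightarrow> bool" where
  "null_recurrent A \<phi> \<longleftrightarrow> (\<exists>v.
     (\<Sum>n. ennreal (1 / pressure_eigenvalue A \<phi> ^ Suc n) * Z_sum A \<phi> (Suc n) v) = \<infinity> \<and>
     (\<Sum>n. ennreal (real (Suc n) / pressure_eigenvalue A \<phi> ^ Suc n) * Z_star_sum A \<phi> (Suc n) v) = \<infinity>)"

definition ruelle :: "('v \<Rightarrow> 'v \<Rightarrow> bool) \<Rightarrow> ((nat \<Rightarrow> 'v) \<Rightarrow> real) \<Rightarrow> ((nat \<Rightarrow> 'v) \<Rightarrow> ennreal)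
    \<Rightarrow> (nat \<Rightarrow> 'v) \<Rightarrow> ennreal" where
  "ruelle A \<phi> f x = (\<Sum>\<^sub>\<infinity>y\<in>{y \<in> markov_space A. lshift y = x}. ennreal (exp (\<phi> y)) * f y)"

section \<open>Infinite ergodic theory\<close>

definition conservative :: "'a measure \<Rightarrow> ('a \<Rightarrow> 'a) \<Rightarrow> bool" where
  "conservative M T \<longleftrightarrow>
     (\<forall>W\<in>sets M. disjoint_family (\<lambda>n. (T ^^ n) -` W \<inter> space M) \<longrightarrow> emeasure M W = 0)"

text \<open>The eigenfunction and eigenmeasure attached to a null recurrent potential. The identity
  \<open>L\<^sub>\<phi>\<^sup>* \<nu> = \<lambda>\<^sub>\<phi> \<nu>\<close> is tested on nonnegative measurable functions. The pair is unique up to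
  positive scalars.\<close>

definition ruelle_eigenpair :: "real \<Rightarrow> ('v \<Rightarrow> 'v \<Rightarrow> bool) \<Rightarrow> ((nat \<Rightarrow> 'v) \<Rightarrow> real)
    \<Rightarrow> ((nat \<Rightarrow> 'v) \<Rightarrow> real) \<Rightarrow> (nat \<Rightarrow> 'v) measure \<Rightarrow> bool" where
  "ruelle_eigenpair \<eta> A \<phi> h \<nu> \<longleftrightarrow>
     continuous_map (markov_topology \<eta> A) euclideanreal h \<and>
     (\<forall>x\<in>markov_space A. 0 < h x) \<and>
     sets \<nu> = sets (markov_borel \<eta> A) \<and>
     conservative \<nu> lshift \<and>
     (\<forall>w. w \<noteq> [] \<longrightarrow> emeasure \<nu> (cylinder A w) < \<infinity>) \<and>
     (\<forall>x\<in>markov_space A.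
        ruelle A \<phi> (\<lambda>y. ennreal (h y)) x = ennreal (pressure_eigenvalue A \<phi> * h x)) \<and>
     (\<forall>f\<in>borel_measurable \<nu>.
        (\<integral>\<^sup>+x. ruelle A \<phi> f x \<partial>\<nu>) = ennreal (pressure_eigenvalue A \<phi>) * (\<integral>\<^sup>+x. f x \<partial>\<nu>)) \<and>
     (\<integral>\<^sup>+x. ennreal (h x) \<partial>\<nu>) = \<infinity>"

text \<open>A version of the transfer operator on integrable functions, dual to composition with \<open>T\<close>
  on bounded measurable functions; its values are determined up to null sets.\<close>

definition transfer_op :: "'a measure \<Rightarrow> ('a \<Rightarrow> 'a) \<Rightarrow> ('a \<Rightarrow> real) \<Rightarrow> 'a \<Rightarrow> real" where
  "transfer_op M T f = (SOME g. integrable M g \<and>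
     (\<forall>u\<in>borel_measurable M. (\<exists>c. \<forall>x\<in>space M. \<bar>u x\<bar> \<le> c) \<longrightarrow>
        (\<integral>x. f x * u (T x) \<partial>M) = (\<integral>x. g x * u x \<partial>M)))"

text \<open>\<open>a\<close> is a normalizing sequence witnessing pointwise dual ergodicity of \<open>T\<close>.\<close>

definition normalizing_sequence :: "'a measure \<Rightarrow> ('a \<Rightarrow> 'a) \<Rightarrow> (nat \<Rightarrow> real) \<Rightarrow> bool" where
  "normalizing_sequence M T a \<longleftrightarrow> (\<forall>f. integrable M f \<longrightarrow>
     (AE x in M. (\<lambda>n. (1 / a n) * (\<Sum>k<n. ((transfer_op M T) ^^ k) f x)) \<longlonglongrightarrow> (\<integral>x. f x \<partial>M)))"

definition regularly_varying_seq :: "real \<Rightarrow> (nat \<Rightarrow> real) \<Rightarrow> bool" where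
  "regularly_varying_seq \<alpha> a \<longleftrightarrow> (\<forall>\<^sub>F n in sequentially. 0 < a n) \<and>
     (\<forall>c>0. (\<lambda>n. a (nat \<lfloor>c * real n\<rfloor>) / a n) \<longlonglongrightarrow> c powr \<alpha>)"

definition gen_inverse :: "(nat \<Rightarrow> real) \<Rightarrow> real \<Rightarrow> real" where
  "gen_inverse a y = Inf {s. 0 \<le> s \<and> y < a (nat \<lfloor>s\<rfloor>)}"

definition scaling :: "(nat \<Rightarrow> real) \<Rightarrow> real \<Rightarrow> real" where
  "scaling a s = 1 / gen_inverse a (1 / s)"

section \<open>Point processes on the half-line\<close>

definition half_line :: "real measure" where
  "half_line = restrict_space borel {0..}"

definition pp_space :: "real measure set" where
  "pp_space = {\<xi>. sets \<xi> = sets half_line \<and>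
     (\<forall>B\<in>sets half_line. bounded B \<longrightarrow> (\<exists>k::nat. emeasure \<xi> B = of_nat k))}"

text \<open>Bounded subsets of \<open>[0, \<infinity>)\<close> are relatively compact, so the test functions of the vague
  topology are the continuous functions on \<open>[0, \<infinity>)\<close> with bounded support. The topology is the
  initial one for the integrals against these functions.\<close>

definition vague_tests :: "(real \<Rightarrow> real) set" where
  "vague_tests = {f. continuous_on {0..} f \<and> (\<exists>R. \<forall>x>R. f x = 0)}"

definition pp_topology :: "real measure topology" where
  "pp_topology = pullback_topology pp_space
     (\<lambda>\<xi>. restrict (\<lambda>f. \<integral>x. f x \<partial>\<xi>) vague_tests)
     (product_topology (\<lambda>_. euclideanreal) vague_tests)"

lemma topspace_pp_topology: "topspace pp_topology = pp_space"
  by (auto simp: pp_topology_def topspace_pullback_topology)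

definition pp_borel :: "real measure measure" where
  "pp_borel = sigma pp_space {U. openin pp_topology U}"

definition pp_converges_in_law :: "(nat \<Rightarrow> real measure measure) \<Rightarrow> real measure measure \<Rightarrow> bool" where
  "pp_converges_in_law L L' \<longleftrightarrow>
     (\<forall>F. continuous_map pp_topology euclideanreal F \<and> bounded (F ` pp_space) \<longrightarrow>
        (\<lambda>n. \<integral>\<xi>. F \<xi> \<partial>(L n)) \<longlonglongrightarrow> (\<integral>\<xi>. F \<xi> \<partial>L'))"

text \<open>\<open>point_sum I m t\<close> is the sum over \<open>i \<in> I\<close> of \<open>m i\<close> times the Dirac mass at \<open>t i\<close>.\<close>

definition point_sum :: "nat set \<Rightarrow> (nat \<Rightarrow> nat) \<Rightarrow> (nat \<Rightarrow> real) \<Rightarrow> real measure" where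
  "point_sum I m t = distr (density (count_space I) (\<lambda>i. of_nat (m i))) half_line t"

lemma emeasure_point_sum:
  assumes "\<And>i. i \<in> I \<Longrightarrow> 0 \<le> t i" "B \<in> sets half_line"
  shows "emeasure (point_sum I m t) B = (\<integral>\<^sup>+i. of_nat (m i) * indicator B (t i) \<partial>count_space I)"
proof -
  have t: "t \<in> measurable (density (count_space I) (\<lambda>i. of_nat (m i))) half_line"
    using assms(1) by (auto simp: half_line_def space_restrict_space)
  have "emeasure (point_sum I m t) B
      = (\<integral>\<^sup>+i. of_nat (m i) * indicator (t -` B \<inter> I) i \<partial>count_space I)"
    unfolding point_sum_def using t assms(2) by (simp add: emeasure_distr emeasure_density)
  also have "\<dots> = (\<integral>\<^sup>+i. of_nat (m i) * indicator B (t i) \<partial>count_space I)"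
    by (intro nn_integral_cong) (auto simp: indicator_def)
  finally show ?thesis .
qed

text \<open>The law of \<open>RPP(W)\<close>, where \<open>W\<close> is given by its law on the real line, so that
  \<open>w 0, w 1, \<dots>\<close> are the i.i.d. waiting times.\<close>

definition RPP :: "real measure \<Rightarrow> real measure measure" where
  "RPP W = distr (Pi\<^sub>M UNIV (\<lambda>_::nat. W)) pp_borel
     (\<lambda>w. point_sum UNIV (\<lambda>_. 1) (\<lambda>i. \<Sum>j\<le>i. w j))"

text \<open>The law of \<open>H\<^sub>\<alpha>(\<lambda>)\<close>, determined by its Laplace transform.\<close>

definition H_law :: "real \<Rightarrow> real \<Rightarrow> real measure" where
  "H_law \<alpha> l = (THE M. prob_space M \<and> sets M = sets borel \<and> (AE x in M. 0 \<le> x) \<and>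
     (\<forall>s\<ge>0. (\<integral>x. exp (- s * x) \<partial>M) = l / (l + s powr \<alpha>)))"

definition FPP :: "real \<Rightarrow> real \<Rightarrow> real measure measure" where
  "FPP \<alpha> l = RPP (H_law \<alpha> l)"

text \<open>The first component is the sequence of waiting times of \<open>FPP \<alpha> l\<close>, the second the
  independent sequence of multiplicities.\<close>

definition CFPP :: "real \<Rightarrow> real \<Rightarrow> nat pmf \<Rightarrow> real measure measure" where
  "CFPP \<alpha> l p = distr
     (Pi\<^sub>M UNIV (\<lambda>_::nat. H_law \<alpha> l) \<Otimes>\<^sub>M Pi\<^sub>M UNIV (\<lambda>_::nat. measure_pmf p)) pp_borel
     (\<lambda>(w, k). point_sum UNIV k (\<lambda>i. \<Sum>j\<le>i. w j))"

text \<open>The library's \<open>geometric_pmf\<close> starts at \<open>0\<close>.\<close>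

definition Geo :: "real \<Rightarrow> nat pmf" where
  "Geo \<theta> = map_pmf Suc (geometric_pmf \<theta>)"

definition W_law :: "real \<Rightarrow> real \<Rightarrow> real \<Rightarrow> real measure" where
  "W_law \<alpha> \<theta> l = (THE M. prob_space M \<and> sets M = sets borel \<and> (AE x in M. 0 \<le> x) \<and>
     (\<forall>t\<ge>0. measure M {..t} = 1 - \<theta> + \<theta> * measure (H_law \<alpha> l) {..t}))"

text \<open>Returns at infinite time contribute no point.\<close>

definition return_process :: "(nat \<Rightarrow> real) \<Rightarrow> (nat \<Rightarrow> 'v) measure \<Rightarrow> (nat \<Rightarrow> 'v) set
    \<Rightarrow> (nat \<Rightarrow> 'v) \<Rightarrow> real measure" where
  "return_process a \<mu> B x = point_sum {k. 1 \<le> k \<and> return_time B k x < \<infinity>} (\<lambda>_. 1)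
     (\<lambda>k. scaling a (measure \<mu> B) * real (the_enat (return_time B k x)))"

end

theory Submission
  imports Defs
begin

text \<open>
  A point process on the half-line is encoded by the numbers \<open>exp (- w)\<close>, where \<open>w\<close> runs through the
  successive waiting times and an infinite wait is encoded by \<open>0\<close>. This is a point of a compact cube, so
  by Stone-Weierstrass convergence in law follows from the convergence of mixed moments. For the
  return process these moments are integrals of products of \<open>exp (- s \<gamma> r)\<close> over successive
  hitting times \<open>r\<close> of \<open>B n\<close>. By Walters' condition the images of the relevant functions under the transfer
  operator of the map induced on \<open>B n\<close> are nearly constant on \<open>B n\<close>, so the integrals factorise
  asymptotically: one factor for the first hit, depending on the initial law, and one
  for each return from \<open>B n\<close> to itself.

  A renewal identity expresses the single factors through the discounted Green function. Visits after
  a short time occur at multiples of the period only and contribute the geometric series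
  \<open>1 / \<theta>\<close>; the later ones are governed by the normalizing sequence, and an Abelian
  theorem gives \<open>\<Gamma>(1 + \<alpha>) s powr - \<alpha>\<close>. So the first hit has Laplace transform
  \<open>l / (l + s powr \<alpha>)\<close> with \<open>l = \<theta> \<Gamma>(1 + \<alpha>)\<close>, and each return has \<open>1 - \<theta>\<close> plus
  \<open>\<theta>\<close> times it. The moments of the two limits are the products of these factors. That the law
  \<open>H_law\<close> exists at all is obtained from tightness along the way.
\<close>

section \<open>The Ruelle operator and distortion\<close>

text \<open>Three obstacles shape the argument. The normalizing sequence controls Green functions of
  fixed cylinders, and only almost everywhere, while the renewal identity needs that of
  \<open>B n\<close> integrated over \<open>B n\<close>. Distortion closes both gaps: one good point
  of \<open>B m\<close> represents all points of \<open>B n\<close> for n >= m, and after n - M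
  steps the indicator of \<open>B n\<close> is almost a multiple of that of a cylinder of length M,
  of which periodicity leaves at most q; M tends to infinity after n. Secondly, a time of order n
  must vanish on the limiting time scale: the measure of \<open>B n\<close> decays geometrically,
  while the normalizing sequence grows at most polynomially. The decay rate \<open>\<rho>\<close>
  per period is below 1 because a letter off the orbit of \<open>x\<close> gives the eigenvalue
  equation at \<open>x\<close> a second positive term. Thirdly, the point process is boundedly
  finite and continuous in the encoded waits where the arrival times tend to infinity; the limit
  laws charge only such sequences, so weak convergence on the cube still transfers. Integrals are
  taken against \<open>\<nu>\<close>, where duality is exact; on \<open>B n\<close> the density h is
  replaced by its value at \<open>x\<close>.\<close>

lemma lshift_funpow: "(lshift ^^ n) x i = x (n + i)"
  by (induction n arbitrary: i) (simp_all add: lshift_def)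

lemma mem_cylinder: "y \<in> cylinder A w \<longleftrightarrow> y \<in> markov_space A \<and> (\<forall>i<length w. y i = w ! i)"
  by (auto simp: cylinder_def)

lemma mem_prefix: "y \<in> cylinder A (map x [0..<n]) \<longleftrightarrow> y \<in> markov_space A \<and> (\<forall>i<n. y i = x i)"
  by (auto simp: cylinder_def)

lemma lshift_markov: "x \<in> markov_space A \<Longrightarrow> (lshift ^^ n) x \<in> markov_space A"
  by (auto simp: markov_space_def lshift_funpow)

lemma lshift_prefix:
  "(\<forall>i<n + N. z i = z' i) \<Longrightarrow> k \<le> n \<Longrightarrow> i < N \<Longrightarrow> (lshift ^^ k) z i = (lshift ^^ k) z' i"
  by (simp add: lshift_funpow)

text \<open>Balls and cylinders are cofinal around each point: the ball of radius
  \<open>\<eta> ^ n\<close> lies in the n-cylinder of its centre, and the n-cylinder lies in every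
  ball of larger radius. Below, the metric enters only through this description.\<close>

lemma openin_markov:
  assumes "0 < \<eta>" "\<eta> < 1"
  shows "openin (markov_topology \<eta> A) U \<longleftrightarrow>
    U \<subseteq> markov_space A \<and> (\<forall>x\<in>U. \<exists>n. cylinder A (map x [0..<n]) \<subseteq> U)"
proof -
  interpret Metric_space "markov_space A" "shift_dist \<eta>" by (rule Metric_space_shift_dist[OF assms])
  have 1: "\<exists>n. cylinder A (map x [0..<n]) \<subseteq> mball x r" if "x \<in> markov_space A" "0 < r" for x r
  proof -
    obtain n where n: "\<eta> ^ n < r" using real_arch_pow_inv[OF \<open>0 < r\<close> assms(2)] by blast
    have "shift_dist \<eta> x y < r" if y: "\<forall>i<n. y i = x i" for y
    proof (cases "x = y")
      case False
      then have "\<exists>k. x k \<noteq> y k" by blast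
      then have "x (LEAST k. x k \<noteq> y k) \<noteq> y (LEAST k. x k \<noteq> y k)" by (rule LeastI_ex)
      then have "n \<le> (LEAST k. x k \<noteq> y k)" using y by (metis not_le_imp_less)
      then have "\<eta> ^ (LEAST k. x k \<noteq> y k) \<le> \<eta> ^ n" using assms by (intro power_decreasing) auto
      then show ?thesis using False n by (simp add: shift_dist_def)
    qed (simp add: shift_dist_def \<open>0 < r\<close>)
    then show ?thesis using that(1) by (intro exI[of _ n]) (auto simp: mem_prefix)
  qed
  have 2: "mball x (\<eta> ^ n) \<subseteq> cylinder A (map x [0..<n])" for x n
  proof
    fix y assume "y \<in> mball x (\<eta> ^ n)"
    then have y: "y \<in> markov_space A" "shift_dist \<eta> x y < \<eta> ^ n" by auto
    have "y i = x i" if "i < n" for i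
    proof (rule ccontr)
      assume ne: "y i \<noteq> x i"
      then have "(LEAST k. x k \<noteq> y k) \<le> i" by (intro Least_le) auto
      then have "\<eta> ^ n \<le> \<eta> ^ (LEAST k. x k \<noteq> y k)" using assms that by (intro power_decreasing) auto
      then show False using y(2) ne by (auto simp: shift_dist_def split: if_splits)
    qed
    then show "y \<in> cylinder A (map x [0..<n])" using y by (simp add: mem_prefix)
  qed
  show ?thesis
    unfolding markov_topology_def openin_mtopology
  proof (intro conj_cong refl ball_cong iffI)
    assume "U \<subseteq> markov_space A"
    then show "\<forall>x\<in>U. \<exists>n. cylinder A (map x [0..<n]) \<subseteq> U" if "\<forall>x. x \<in> U \<longrightarrow> (\<exists>r>0. mball x r \<subseteq> U)"
      using that 1 by (meson order_trans subsetD)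
    show "\<forall>x. x \<in> U \<longrightarrow> (\<exists>r>0. mball x r \<subseteq> U)" if *: "\<forall>x\<in>U. \<exists>n. cylinder A (map x [0..<n]) \<subseteq> U"
    proof (intro allI impI)
      fix x assume "x \<in> U"
      then obtain n where "cylinder A (map x [0..<n]) \<subseteq> U" using * by blast
      then show "\<exists>r>0. mball x r \<subseteq> U" using 2[of x n] assms by (intro exI[of _ "\<eta> ^ n"]) auto
    qed
  qed
qed

text \<open>An open set is the union of the cylinders it contains, and a countable alphabet has
  countably many words, so the cylinders already generate the Borel sets.\<close>

lemma sets_markov_borel:
  fixes A :: "'v::countable \<Rightarrow> 'v \<Rightarrow> bool"
  assumes "0 < \<eta>" "\<eta> < 1"
  shows "sets (markov_borel \<eta> A) = sigma_sets (markov_space A) (range (cylinder A))"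
    and "space (markov_borel \<eta> A) = markov_space A"
proof -
  have sub: "{U. openin (markov_topology \<eta> A) U} \<subseteq> Pow (markov_space A)"
    by (auto simp: openin_markov[OF assms])
  show "space (markov_borel \<eta> A) = markov_space A"
    unfolding markov_borel_def by (rule space_measure_of[OF sub])
  have op: "openin (markov_topology \<eta> A) (cylinder A w)" for w
    unfolding openin_markov[OF assms]
    by (auto simp: mem_cylinder intro!: exI[of _ "length w"])
  have "sigma_sets (markov_space A) {U. openin (markov_topology \<eta> A) U}
    = sigma_sets (markov_space A) (range (cylinder A))"
  proof (rule sigma_sets_eqI)
    fix U assume "U \<in> {U. openin (markov_topology \<eta> A) U}"
    then have "U \<subseteq> markov_space A" "\<forall>x\<in>U. \<exists>n. cylinder A (map x [0..<n]) \<subseteq> U"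
      by (auto simp: openin_markov[OF assms])
    then have "U = (\<Union>w\<in>{w. cylinder A w \<subseteq> U}. cylinder A w)"
      by (auto simp: mem_prefix) (metis mem_prefix subsetD)
    then have U: "U = \<Union> (cylinder A ` {w. cylinder A w \<subseteq> U})" by simp
    show "U \<in> sigma_sets (markov_space A) (range (cylinder A))"
      by (subst U, rule sigma_sets_UNION) (auto intro: countableI_type)
  next
    fix U assume "U \<in> range (cylinder A)"
    then show "U \<in> sigma_sets (markov_space A) {U. openin (markov_topology \<eta> A) U}" using op by auto
  qed
  then show "sets (markov_borel \<eta> A) = sigma_sets (markov_space A) (range (cylinder A))"
    unfolding markov_borel_def by (simp add: sets_measure_of[OF sub])
qed

text \<open>Unordered sums over fibres are converted once and for all into integrals against a
  counting measure, where Tonelli and monotone convergence are at hand. An infinite \<open>S\<close>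
  is enumerated, so that the integral becomes a series whose partial sums are finite
  subsums.\<close>

lemma infsum_eq_nn_integral:
  fixes f :: "'a \<Rightarrow> ennreal"
  assumes S: "countable S"
  shows "(\<Sum>\<^sub>\<infinity>x\<in>S. f x) = (\<integral>\<^sup>+x. f x \<partial>count_space S)"
proof (rule antisym)
  have sup: "(\<Sum>\<^sub>\<infinity>x\<in>S. f x) = (SUP F\<in>{F. finite F \<and> F \<subseteq> S}. sum f F)"
    by (rule nonneg_infsum_complete) simp
  show "(\<Sum>\<^sub>\<infinity>x\<in>S. f x) \<le> (\<integral>\<^sup>+x. f x \<partial>count_space S)"
    unfolding sup
  proof (rule SUP_least, clarify)
    fix F assume F: "finite F" "F \<subseteq> S"
    have "sum f F = (\<integral>\<^sup>+x. f x \<partial>count_space F)" using F by (simp add: nn_integral_count_space_finite)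
    also have "\<dots> = (\<integral>\<^sup>+x. f x * indicator F x \<partial>count_space S)"
      using F by (subst (1 2) nn_integral_count_space_indicator) (auto intro!: nn_integral_cong simp: indicator_def)
    also have "\<dots> \<le> (\<integral>\<^sup>+x. f x \<partial>count_space S)"
      by (intro nn_integral_mono) (auto simp: indicator_def)
    finally show "sum f F \<le> (\<integral>\<^sup>+x. f x \<partial>count_space S)" .
  qed
  show "(\<integral>\<^sup>+x. f x \<partial>count_space S) \<le> (\<Sum>\<^sub>\<infinity>x\<in>S. f x)"
  proof (cases "finite S")
    case True
    then show ?thesis by (simp add: nn_integral_count_space_finite)
  next
    case False
    let ?e = "from_nat_into S"
    have bij: "bij_betw ?e UNIV S" using S False by (rule bij_betw_from_nat_into)
    have "(\<integral>\<^sup>+x. f x \<partial>count_space S) = (\<Sum>n. f (?e n))"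
      by (subst nn_integral_bij_count_space[OF bij, symmetric]) (simp add: nn_integral_count_space_nat)
    also have "\<dots> \<le> (SUP F\<in>{F. finite F \<and> F \<subseteq> S}. sum f F)"
      unfolding suminf_eq_SUP
    proof (rule SUP_mono)
      fix n
      have "(\<Sum>i<n. f (?e i)) = sum f (?e ` {..<n})"
        using bij by (subst sum.reindex) (auto simp: bij_betw_def intro: inj_on_subset)
      then show "\<exists>F\<in>{F. finite F \<and> F \<subseteq> S}. (\<Sum>i<n. f (?e i)) \<le> sum f F"
        using bij by (intro bexI[of _ "?e ` {..<n}"]) (auto simp: bij_betw_def)
    qed
    finally show ?thesis unfolding sup .
  qed
qed

text \<open>A point of the fibre is determined by its first n letters.\<close>

lemma lshift_fiber_countable: "countable {z \<in> markov_space A. (lshift ^^ n) z = (y :: nat \<Rightarrow> 'v::countable)}"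
proof (rule countableI'[where f="\<lambda>z. to_nat (map z [0..<n])"])
  show "inj_on (\<lambda>z. to_nat (map z [0..<n])) {z \<in> markov_space A. (lshift ^^ n) z = y}"
  proof (rule inj_onI)
    fix z z' assume z: "z \<in> {z \<in> markov_space A. (lshift ^^ n) z = y}" "z' \<in> {z \<in> markov_space A. (lshift ^^ n) z = y}"
      and eq: "to_nat (map z [0..<n]) = to_nat (map z' [0..<n])"
    have "z i = z' i" for i
    proof (cases "i < n")
      case True
      then show ?thesis using eq by simp
    next
      case False
      then have "z i = (lshift ^^ n) z (i - n)" "z' i = (lshift ^^ n) z' (i - n)" by (simp_all add: lshift_funpow)
      then show ?thesis using z by simp
    qed
    then show "z = z'" by blast
  qed
qed

section \<open>Iterated Ruelle operators and bounded distortion\<close>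

lemma birkhoff_sum_Suc: "birkhoff_sum \<phi> (Suc n) z = birkhoff_sum \<phi> n z + \<phi> ((lshift ^^ n) z)"
  by (simp add: birkhoff_sum_def)

text \<open>The supremum over n inside \<open>walters_W\<close> makes the bound independent of the
  number of summands: N further letters of agreement control the whole Birkhoff sum. That supremum
  starts at 1, hence the separate case of the empty sum.\<close>

lemma walters_birkhoff:
  assumes W: "walters_condition A \<phi>" and N: "1 \<le> N"
    and z: "z \<in> markov_space A" "z' \<in> markov_space A" "\<And>i. i < n + N \<Longrightarrow> z i = z' i"
  shows "\<bar>birkhoff_sum \<phi> n z - birkhoff_sum \<phi> n z'\<bar> \<le> enn2real (walters_W A \<phi> N)"
proof (cases "n = 0")
  case True
  then show ?thesis by (simp add: birkhoff_sum_def)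
next
  case False
  have "ennreal \<bar>birkhoff_sum \<phi> n z - birkhoff_sum \<phi> n z'\<bar> \<le> var_n A (n + N) (birkhoff_sum \<phi> n)"
    unfolding var_n_def by (rule SUP_upper2[of "(z, z')"]) (use z in auto)
  also have "\<dots> \<le> walters_W A \<phi> N"
    unfolding walters_W_def by (rule SUP_upper) (use False in auto)
  finally have "ennreal \<bar>birkhoff_sum \<phi> n z - birkhoff_sum \<phi> n z'\<bar> \<le> walters_W A \<phi> N" .
  moreover have "walters_W A \<phi> N < \<top>" using W N by (auto simp: walters_condition_def)
  ultimately show ?thesis by (metis abs_ge_zero enn2real_ennreal enn2real_mono)
qed

lemma walters_const_tendsto:
  assumes "walters_condition A \<phi>"
  shows "(\<lambda>N. enn2real (walters_W A \<phi> N)) \<longlonglongrightarrow> 0"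
  using tendsto_enn2real[of "\<lambda>N. walters_W A \<phi> N" 0 sequentially] assms by (simp add: walters_condition_def)

text \<open>The iterate is written as a single sum over n-step preimages, because in this form two
  fibres can be matched point by point.\<close>

definition ruelle_iter :: "('v \<Rightarrow> 'v \<Rightarrow> bool) \<Rightarrow> ((nat \<Rightarrow> 'v) \<Rightarrow> real) \<Rightarrow> nat \<Rightarrow>
    ((nat \<Rightarrow> 'v) \<Rightarrow> ennreal) \<Rightarrow> (nat \<Rightarrow> 'v) \<Rightarrow> ennreal" where
  "ruelle_iter A \<phi> n f y = (\<integral>\<^sup>+z. ennreal (exp (birkhoff_sum \<phi> n z)) * f z
     \<partial>count_space {z \<in> markov_space A. (lshift ^^ n) z = y})"

lemma ruelle_iter_1:
  "ruelle_iter A \<phi> 1 f y = ruelle A \<phi> f (y :: nat \<Rightarrow> 'v::countable)"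
  unfolding ruelle_iter_def ruelle_def
  using lshift_fiber_countable[of A 1 y] by (subst infsum_eq_nn_integral) (auto simp: birkhoff_sum_def)

lemma ruelle_iter_0: "y \<in> markov_space A \<Longrightarrow> ruelle_iter A \<phi> 0 f y = f y"
proof -
  assume "y \<in> markov_space A"
  then have "{z \<in> markov_space A. (lshift ^^ 0) z = y} = {y}" by auto
  then show ?thesis by (simp add: ruelle_iter_def nn_integral_count_space_finite birkhoff_sum_def)
qed

lemma ruelle_iter_Suc: "ruelle_iter A \<phi> (Suc n) f y = ruelle_iter A \<phi> 1 (ruelle_iter A \<phi> n f) y"
proof -
  \<comment> \<open>A redundant double sum over an n-step preimage \<open>z\<close> and the
    intermediate point \<open>w\<close>. The last indicator ties \<open>w\<close> to
    \<open>z\<close>, so summing out \<open>z\<close> first gives the composed operator and summing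
    out \<open>w\<close> first gives the iterate.\<close>
  let ?F = "\<lambda>w z. ennreal (exp (\<phi> w)) * (ennreal (exp (birkhoff_sum \<phi> n z)) * f z) * of_bool (z \<in> markov_space A \<and> lshift w = y) * indicator {(lshift ^^ n) z} w"
  have "ruelle_iter A \<phi> 1 (ruelle_iter A \<phi> n f) y = (\<integral>\<^sup>+w. \<integral>\<^sup>+z. ?F w z \<partial>count_space UNIV \<partial>count_space UNIV)"
  proof -
    have "ruelle_iter A \<phi> 1 (ruelle_iter A \<phi> n f) y
      = (\<integral>\<^sup>+w. ennreal (exp (\<phi> w)) * ruelle_iter A \<phi> n f w * indicator {w \<in> markov_space A. lshift w = y} w \<partial>count_space UNIV)"
      unfolding ruelle_iter_def[of A \<phi> 1] by (subst nn_integral_count_space_indicator) (auto simp: birkhoff_sum_def)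
    also have "\<dots> = (\<integral>\<^sup>+w. \<integral>\<^sup>+z. ?F w z \<partial>count_space UNIV \<partial>count_space UNIV)"
    proof (rule nn_integral_cong)
      fix w
      have "ruelle_iter A \<phi> n f w = (\<integral>\<^sup>+z. ennreal (exp (birkhoff_sum \<phi> n z)) * f z * indicator {z \<in> markov_space A. (lshift ^^ n) z = w} z \<partial>count_space UNIV)"
        unfolding ruelle_iter_def by (rule nn_integral_count_space_indicator) simp
      then have "ennreal (exp (\<phi> w)) * ruelle_iter A \<phi> n f w * indicator {w \<in> markov_space A. lshift w = y} w
        = (\<integral>\<^sup>+z. (ennreal (exp (\<phi> w)) * indicator {w \<in> markov_space A. lshift w = y} w) * (ennreal (exp (birkhoff_sum \<phi> n z)) * f z * indicator {z \<in> markov_space A. (lshift ^^ n) z = w} z) \<partial>count_space UNIV)"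
        by (subst nn_integral_cmult) (auto simp: mult_ac)
      also have "\<dots> = (\<integral>\<^sup>+z. ?F w z \<partial>count_space UNIV)"
        by (intro nn_integral_cong) (auto simp: indicator_def mult_ac lshift_markov)
      finally show "ennreal (exp (\<phi> w)) * ruelle_iter A \<phi> n f w * indicator {w \<in> markov_space A. lshift w = y} w
        = (\<integral>\<^sup>+z. ?F w z \<partial>count_space UNIV)" .
    qed
    finally show ?thesis .
  qed
  also have "\<dots> = (\<integral>\<^sup>+z. \<integral>\<^sup>+w. ?F w z \<partial>count_space UNIV \<partial>count_space UNIV)"
    using nn_integral_fst_count_space[of "\<lambda>(w, z). ?F w z"] nn_integral_snd_count_space[of "\<lambda>(w, z). ?F w z"] by simp
  also have "\<dots> = (\<integral>\<^sup>+z. ennreal (exp (birkhoff_sum \<phi> (Suc n) z)) * f z * indicator {z \<in> markov_space A. (lshift ^^ Suc n) z = y} z \<partial>count_space UNIV)"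
    by (intro nn_integral_cong, subst nn_integral_indicator_singleton)
       (auto simp: birkhoff_sum_Suc exp_add ennreal_mult indicator_def mult_ac)
  also have "\<dots> = ruelle_iter A \<phi> (Suc n) f y"
    unfolding ruelle_iter_def by (rule nn_integral_count_space_indicator[symmetric]) simp
  finally show ?thesis by simp
qed

text \<open>The factor \<open>g\<close> is constant along the fibre over \<open>y\<close>. This is
  the algebra behind the duality \<open>Pit_dual\<close>.\<close>

lemma ruelle_iter_mult_lshift:
  "ruelle_iter A \<phi> n (\<lambda>z. f z * g ((lshift ^^ n) z)) y = ruelle_iter A \<phi> n f y * g y"
  unfolding ruelle_iter_def
  by (subst nn_integral_multc[symmetric]) (auto intro!: nn_integral_cong simp: mult_ac)

lemma ruelle_iter_cmult: "ruelle_iter A \<phi> n (\<lambda>z. c * f z) y = c * ruelle_iter A \<phi> n f y"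
  unfolding ruelle_iter_def
  by (subst nn_integral_cmult[symmetric]) (auto intro!: nn_integral_cong simp: mult_ac)

lemma ruelle_iter_mono: "(\<And>z. z \<in> markov_space A \<Longrightarrow> f z \<le> g z) \<Longrightarrow> ruelle_iter A \<phi> n f y \<le> ruelle_iter A \<phi> n g y"
  unfolding ruelle_iter_def by (intro nn_integral_mono mult_left_mono) auto

text \<open>Exchanging the tail \<open>y\<close> for \<open>y'\<close> matches the two fibres
  bijectively. The new sequence is admissible because \<open>y\<close> and \<open>y'\<close> share
  their first letter (here N >= 1 matters), and matched preimages agree on n + N letters, so
  Walters' condition bounds the ratio of their weights uniformly in n. Two functions
  \<open>f\<close> and \<open>g\<close> are allowed because they are only compared along matched
  pairs.\<close>

lemma ruelle_iter_distortion:
  assumes W: "walters_condition A \<phi>" and N: "1 \<le> N"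
    and y: "y \<in> markov_space A" "y' \<in> markov_space A" "\<And>i. i < N \<Longrightarrow> y i = y' i"
    and f: "\<And>z z'. z \<in> markov_space A \<Longrightarrow> z' \<in> markov_space A \<Longrightarrow> (lshift ^^ n) z = y \<Longrightarrow> (lshift ^^ n) z' = y' \<Longrightarrow>
      (\<forall>i<n + N. z i = z' i) \<Longrightarrow> f z \<le> g z'"
  shows "ruelle_iter A \<phi> n f y \<le> ennreal (exp (enn2real (walters_W A \<phi> N))) * ruelle_iter A \<phi> n g y'"
proof -
  \<comment> \<open>\<open>G u z\<close> keeps the first n letters of \<open>z\<close> and continues
    with \<open>u\<close>. Overwriting twice forgets the middle tail, so \<open>G y'\<close> and
    \<open>G y\<close> are inverse to each other between the two fibres.\<close>
  define G where "G u z = (\<lambda>i. if i < n then z i else u (i - n))" for u z :: "nat \<Rightarrow> 'a"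
  have G_shift: "(lshift ^^ n) (G u z) = u" for u z by (auto simp: G_def lshift_funpow)
  have G_mem: "G u z \<in> markov_space A" if "z \<in> markov_space A" "u \<in> markov_space A" "u 0 = z n" for u z
    unfolding markov_space_def
  proof (intro CollectI allI)
    fix i
    have Az: "A (z i) (z (Suc i))" and Au: "\<And>j. A (u j) (u (Suc j))" using that by (auto simp: markov_space_def)
    consider "Suc i < n" | "Suc i = n" | "n \<le> i" by linarith
    then show "A (G u z i) (G u z (Suc i))"
    proof cases
      case 3
      then have "Suc i - n = Suc (i - n)" by simp
      then show ?thesis using 3 Au[of "i - n"] by (simp add: G_def)
    qed (use Az that(3) in \<open>auto simp: G_def\<close>)
  qed
  have G_inv: "G u z = z" if "(lshift ^^ n) z = u" for u z
  proof
    fix i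
    show "G u z i = z i"
      using that[symmetric] by (cases "i < n") (simp_all add: G_def lshift_funpow)
  qed
  have G_G: "G u (G v z) = G u z" for u v z by (auto simp: G_def)
  let ?S = "\<lambda>u. {z \<in> markov_space A. (lshift ^^ n) z = u}"
  have head: "u 0 = z n" if "(lshift ^^ n) z = u" for u z using that by (auto simp: lshift_funpow)
  have y0: "y 0 = y' 0" using y(3) N by simp
  have bij: "bij_betw (G y') (?S y) (?S y')"
  proof (rule bij_betwI[where g="G y"])
    show "G y' \<in> ?S y \<rightarrow> ?S y'"
    proof
      fix z assume "z \<in> ?S y"
      then have "z \<in> markov_space A" "y' 0 = z n" using head[of z y] y0 by auto
      then show "G y' z \<in> ?S y'" using G_mem[OF _ y(2)] G_shift by auto
    qed
    show "G y \<in> ?S y' \<rightarrow> ?S y"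
    proof
      fix z assume "z \<in> ?S y'"
      then have "z \<in> markov_space A" "y 0 = z n" using head[of z y'] y0 by auto
      then show "G y z \<in> ?S y" using G_mem[OF _ y(1)] G_shift by auto
    qed
    show "G y (G y' z) = z" if "z \<in> ?S y" for z using that by (simp add: G_G G_inv)
    show "G y' (G y z) = z" if "z \<in> ?S y'" for z using that by (simp add: G_G G_inv)
  qed
  let ?C = "ennreal (exp (enn2real (walters_W A \<phi> N)))"
  have "ruelle_iter A \<phi> n f y \<le> (\<integral>\<^sup>+z. ?C * (ennreal (exp (birkhoff_sum \<phi> n (G y' z))) * g (G y' z)) \<partial>count_space (?S y))"
    unfolding ruelle_iter_def
  proof (rule nn_integral_mono)
    fix z assume "z \<in> space (count_space (?S y))"
    then have z: "z \<in> markov_space A" "(lshift ^^ n) z = y" by auto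
    have z': "G y' z \<in> markov_space A" "(lshift ^^ n) (G y' z) = y'"
      using bij z by (auto simp: bij_betw_def G_shift)
    have agree: "z i = G y' z i" if "i < n + N" for i
      using that y(3)[of "i - n"] z(2) by (auto simp: G_def lshift_funpow)
    have "birkhoff_sum \<phi> n z \<le> enn2real (walters_W A \<phi> N) + birkhoff_sum \<phi> n (G y' z)"
      using walters_birkhoff[where n=n, OF W N z(1) z'(1) agree] by linarith
    then have "ennreal (exp (birkhoff_sum \<phi> n z)) \<le> ?C * ennreal (exp (birkhoff_sum \<phi> n (G y' z)))"
      by (subst ennreal_mult[symmetric]) (auto simp: exp_add[symmetric] intro!: ennreal_leI)
    moreover have "f z \<le> g (G y' z)" by (rule f[OF z(1) z'(1) z(2) z'(2)]) (use agree in auto)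
    ultimately show "ennreal (exp (birkhoff_sum \<phi> n z)) * f z
        \<le> ?C * (ennreal (exp (birkhoff_sum \<phi> n (G y' z))) * g (G y' z))"
      unfolding mult.assoc[symmetric] by (intro mult_mono) auto
  qed
  also have "\<dots> = ?C * (\<integral>\<^sup>+z. ennreal (exp (birkhoff_sum \<phi> n (G y' z))) * g (G y' z) \<partial>count_space (?S y))"
    by (rule nn_integral_cmult) simp
  also have "\<dots> = ?C * ruelle_iter A \<phi> n g y'"
    unfolding ruelle_iter_def by (subst nn_integral_bij_count_space[OF bij]) simp
  finally show ?thesis .
qed

section \<open>The eigenpair and the transfer operator of the eigenmeasure\<close>

locale walters_system =
  fixes A :: "'v::countable \<Rightarrow> 'v \<Rightarrow> bool" and \<phi> h :: "(nat \<Rightarrow> 'v) \<Rightarrow> real" and \<eta> lam :: real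
    and \<nu> :: "(nat \<Rightarrow> 'v) measure"
  assumes eta: "0 < \<eta>" "\<eta> < 1"
    and infinite_alphabet: "infinite (UNIV :: 'v set)"
    and mixing: "topologically_mixing A"
    and phi_measurable: "\<phi> \<in> borel_measurable (markov_borel \<eta> A)"
    and walters: "walters_condition A \<phi>"
    and lam_pos: "0 < lam"
    and h_continuous: "continuous_map (markov_topology \<eta> A) euclideanreal h"
    and h_pos: "\<And>y. y \<in> markov_space A \<Longrightarrow> 0 < h y"
    and sets_nu: "sets \<nu> = sets (markov_borel \<eta> A)"
    and cylinder_finite: "\<And>w. w \<noteq> [] \<Longrightarrow> emeasure \<nu> (cylinder A w) < \<infinity>"
    and h_eigen: "\<And>y. y \<in> markov_space A \<Longrightarrow> ruelle A \<phi> (\<lambda>y. ennreal (h y)) y = ennreal (lam * h y)"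
    and nu_eigen: "\<And>f. f \<in> borel_measurable \<nu> \<Longrightarrow> (\<integral>\<^sup>+y. ruelle A \<phi> f y \<partial>\<nu>) = ennreal lam * (\<integral>\<^sup>+y. f y \<partial>\<nu>)"
    and h_integral: "(\<integral>\<^sup>+y. ennreal (h y) \<partial>\<nu>) = \<infinity>"
begin

lemma space_nu: "space \<nu> = markov_space A"
  using sets_eq_imp_space_eq[OF sets_nu] sets_markov_borel(2)[OF eta] by simp

lemma sets_nu': "sets \<nu> = sigma_sets (markov_space A) (range (cylinder A))"
  using sets_nu sets_markov_borel(1)[OF eta] by simp

lemma cylinder_sets [measurable, simp]: "cylinder A w \<in> sets \<nu>"
  unfolding sets_nu' by auto

lemma openin_sets: "openin (markov_topology \<eta> A) U \<Longrightarrow> U \<in> sets \<nu>"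
  unfolding sets_nu markov_borel_def
  by (subst sets_measure_of) (auto simp: openin_markov[OF eta])

lemma coord_measurable [measurable]: "(\<lambda>y. y i) \<in> measurable \<nu> (count_space UNIV)"
proof (subst measurable_count_space_eq_countable, safe)
  fix v
  have "openin (markov_topology \<eta> A) ((\<lambda>y. y i) -` {v} \<inter> space \<nu>)"
    unfolding openin_markov[OF eta] space_nu
    by (auto simp: mem_prefix simp del: upt_Suc intro!: exI[of _ "Suc i"])
  then show "(\<lambda>y. y i) -` {v} \<inter> space \<nu> \<in> sets \<nu>" by (rule openin_sets)
qed auto

lemma measurable_into_nu:
  assumes "\<And>y. y \<in> space M \<Longrightarrow> f y \<in> markov_space A"
    and [measurable]: "\<And>i. (\<lambda>y. f y i) \<in> measurable M (count_space UNIV)"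
  shows "f \<in> measurable M \<nu>"
proof (rule measurable_sigma_sets[OF sets_nu'])
  show "range (cylinder A) \<subseteq> Pow (markov_space A)" by (auto simp: mem_cylinder)
  show "f \<in> space M \<rightarrow> markov_space A" using assms(1) by auto
  fix U assume "U \<in> range (cylinder A)"
  then obtain w where w: "U = cylinder A w" by blast
  have "f -` U \<inter> space M = {y \<in> space M. \<forall>i<length w. f y i = w ! i}"
    using assms(1) by (auto simp: w mem_cylinder)
  also have "\<dots> \<in> sets M" by measurable
  finally show "f -` U \<inter> space M \<in> sets M" .
qed

lemma lshift_measurable [measurable]: "(lshift ^^ n) \<in> measurable \<nu> \<nu>"
  by (rule measurable_into_nu) (simp_all add: space_nu lshift_markov, simp add: lshift_funpow)

lemma phi_meas [measurable]: "\<phi> \<in> borel_measurable \<nu>"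
  using phi_measurable measurable_cong_sets[OF sets_nu refl] by blast

lemma h_meas [measurable]: "h \<in> borel_measurable \<nu>"
proof (rule borel_measurableI)
  fix S :: "real set" assume "open S"
  then have "openin (markov_topology \<eta> A) {y \<in> topspace (markov_topology \<eta> A). h y \<in> S}"
    using h_continuous by (auto simp: continuous_map_def)
  moreover have "topspace (markov_topology \<eta> A) = markov_space A"
  proof
    show "topspace (markov_topology \<eta> A) \<subseteq> markov_space A"
      using openin_topspace openin_markov[OF eta] by blast
    have "openin (markov_topology \<eta> A) (markov_space A)"
      unfolding openin_markov[OF eta] by (auto simp: mem_prefix)
    then show "markov_space A \<subseteq> topspace (markov_topology \<eta> A)" by (rule openin_subset)
  qed
  ultimately show "h -` S \<inter> space \<nu> \<in> sets \<nu>"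
    using openin_sets by (simp add: space_nu vimage_def Int_def conj_commute)
qed

lemma h_near:
  assumes x: "x \<in> markov_space A" and e: "0 < e"
  shows "\<exists>n. \<forall>m\<ge>n. \<forall>y\<in>cylinder A (map x [0..<m]). \<bar>h y - h x\<bar> < e"
proof -
  have "topspace (markov_topology \<eta> A) = markov_space A"
    using openin_markov[OF eta, of A "markov_space A"] openin_topspace[of "markov_topology \<eta> A"]
      openin_markov[OF eta, of A] openin_subset by (metis mem_prefix subsetI subset_antisym)
  then have "openin (markov_topology \<eta> A) {y \<in> markov_space A. h y \<in> ball (h x) e}"
    using h_continuous by (auto simp: continuous_map_def)
  then obtain n where n: "cylinder A (map x [0..<n]) \<subseteq> {y \<in> markov_space A. h y \<in> ball (h x) e}"
    unfolding openin_markov[OF eta] using x e by auto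
  have "\<bar>h y - h x\<bar> < e" if "n \<le> m" "y \<in> cylinder A (map x [0..<m])" for m y
  proof -
    have "y \<in> cylinder A (map x [0..<n])" using that by (auto simp: mem_prefix)
    then show ?thesis using n by (auto simp: dist_real_def)
  qed
  then show ?thesis by blast
qed

text \<open>The index set becomes the alphabet, which does not vary with \<open>y\<close>, so
  measurability in \<open>y\<close> can be read off term by term. Where the transition is forbidden
  \<open>z\<close> is set to \<open>y\<close>, a harmless value that keeps every branch a map of the
  shift space into itself.\<close>

lemma ruelle_iter_1_alt:
  assumes y: "y \<in> markov_space A"
  shows "ruelle_iter A \<phi> 1 f y = (\<integral>\<^sup>+v. (let z = (if A v (y 0) then case_nat v y else y) in
     of_bool (A v (y 0)) * (ennreal (exp (\<phi> z)) * f z)) \<partial>count_space UNIV)"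
proof -
  have bij: "bij_betw (\<lambda>v. case_nat v y) {v. A v (y 0)} {z \<in> markov_space A. (lshift ^^ 1) z = y}"
  proof (rule bij_betwI[where g="\<lambda>z. z 0"])
    show "(\<lambda>v. case_nat v y) \<in> {v. A v (y 0)} \<rightarrow> {z \<in> markov_space A. (lshift ^^ 1) z = y}"
      using y by (auto simp: markov_space_def lshift_def split: nat.split)
    show "(\<lambda>z. z 0) \<in> {z \<in> markov_space A. (lshift ^^ 1) z = y} \<rightarrow> {v. A v (y 0)}"
      by (auto simp: markov_space_def lshift_def)
  qed (auto simp: lshift_def fun_eq_iff split: nat.split)
  have "ruelle_iter A \<phi> 1 f y = (\<integral>\<^sup>+v. ennreal (exp (\<phi> (case_nat v y))) * f (case_nat v y) \<partial>count_space {v. A v (y 0)})"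
    unfolding ruelle_iter_def by (subst nn_integral_bij_count_space[OF bij, symmetric]) (simp add: birkhoff_sum_def)
  also have "\<dots> = (\<integral>\<^sup>+v. (let z = (if A v (y 0) then case_nat v y else y) in
     of_bool (A v (y 0)) * (ennreal (exp (\<phi> z)) * f z)) \<partial>count_space UNIV)"
    by (subst nn_integral_count_space_indicator) (auto intro!: nn_integral_cong simp: indicator_def Let_def)
  finally show ?thesis .
qed

lemma ruelle_iter_measurable [measurable]:
  assumes "f \<in> borel_measurable \<nu>"
  shows "ruelle_iter A \<phi> n f \<in> borel_measurable \<nu>"
proof (induction n)
  case 0
  show ?case using assms by (subst measurable_cong[where g=f]) (auto simp: space_nu ruelle_iter_0)
next
  case (Suc n)
  let ?f = "ruelle_iter A \<phi> n f"
  let ?g = "\<lambda>v y. if A v (y 0) then case_nat v y else y"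
  interpret C: sigma_finite_measure "count_space (UNIV :: 'v set)"
    by (rule sigma_finite_measure_count_space_countable) (rule countableI_type)
  have g [measurable]: "?g v \<in> measurable \<nu> \<nu>" for v
  proof (rule measurable_into_nu)
    show "?g v y \<in> markov_space A" if "y \<in> space \<nu>" for y
      using that by (auto simp: space_nu markov_space_def split: nat.split)
    show "(\<lambda>y. ?g v y i) \<in> measurable \<nu> (count_space UNIV)" for i
    proof -
      have "(\<lambda>y. ?g v y i) = (\<lambda>y. if A v (y 0) then (case i of 0 \<Rightarrow> v | Suc j \<Rightarrow> y j) else y i)"
        by (auto simp: fun_eq_iff)
      also have "\<dots> \<in> measurable \<nu> (count_space UNIV)" by (cases i) measurable
      finally show ?thesis .
    qed
  qed
  have "(\<lambda>y. \<integral>\<^sup>+v. of_bool (A v (y 0)) * (ennreal (exp (\<phi> (?g v y))) * ?f (?g v y)) \<partial>count_space UNIV) \<in> borel_measurable \<nu>"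
  proof -
    have "(\<lambda>y. of_bool (A v (y 0)) * (ennreal (exp (\<phi> (?g v y))) * ?f (?g v y))) \<in> borel_measurable \<nu>" for v
      using measurable_compose[OF g phi_meas] measurable_compose[OF g Suc.IH] by measurable
    then have "(\<lambda>p. of_bool (A (fst p) (snd p 0)) * (ennreal (exp (\<phi> (?g (fst p) (snd p)))) * ?f (?g (fst p) (snd p))))
        \<in> borel_measurable (count_space UNIV \<Otimes>\<^sub>M \<nu>)"
      by (intro measurable_pair_measure_countable1 countableI_type) (simp only: fst_conv snd_conv)
    from C.borel_measurable_nn_integral_fst[OF measurable_pair_swap[OF this]]
    show ?thesis by (simp only: split_conv fst_conv snd_conv)
  qed
  moreover have "ruelle_iter A \<phi> (Suc n) f y = (\<integral>\<^sup>+v. of_bool (A v (y 0)) * (ennreal (exp (\<phi> (?g v y))) * ?f (?g v y)) \<partial>count_space UNIV)"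
    if "y \<in> space \<nu>" for y
    using that unfolding ruelle_iter_Suc[of _ _ n] space_nu by (simp only: ruelle_iter_1_alt Let_def)
  ultimately show ?case by (subst measurable_cong) auto
qed

lemma ruelle_iter_integral:
  assumes f: "f \<in> borel_measurable \<nu>"
  shows "(\<integral>\<^sup>+y. ruelle_iter A \<phi> n f y \<partial>\<nu>) = ennreal (lam ^ n) * (\<integral>\<^sup>+y. f y \<partial>\<nu>)"
proof (induction n)
  case 0
  have "(\<integral>\<^sup>+y. ruelle_iter A \<phi> 0 f y \<partial>\<nu>) = (\<integral>\<^sup>+y. f y \<partial>\<nu>)"
    by (rule nn_integral_cong) (simp add: space_nu ruelle_iter_0)
  then show ?case by simp
next
  case (Suc n)
  have "(\<integral>\<^sup>+y. ruelle_iter A \<phi> (Suc n) f y \<partial>\<nu>) = (\<integral>\<^sup>+y. ruelle A \<phi> (ruelle_iter A \<phi> n f) y \<partial>\<nu>)"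
    by (simp only: ruelle_iter_Suc[of _ _ n] ruelle_iter_1)
  also have "\<dots> = ennreal lam * (ennreal (lam ^ n) * (\<integral>\<^sup>+y. f y \<partial>\<nu>))"
    by (subst nu_eigen[OF ruelle_iter_measurable[OF f]]) (simp only: Suc.IH)
  finally show ?case using lam_pos by (simp add: ennreal_mult mult.assoc)
qed

text \<open>This is the transfer operator of \<open>\<nu>\<close>, dual to composition with the n-th
  shift. The transfer operator of \<open>\<mu>\<close> is its conjugate by h.\<close>

definition Pit :: "nat \<Rightarrow> ((nat \<Rightarrow> 'v) \<Rightarrow> ennreal) \<Rightarrow> (nat \<Rightarrow> 'v) \<Rightarrow> ennreal" where
  "Pit n f y = ennreal (1 / lam ^ n) * ruelle_iter A \<phi> n f y"

lemma Pit_measurable [measurable]: "f \<in> borel_measurable \<nu> \<Longrightarrow> Pit n f \<in> borel_measurable \<nu>"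
  unfolding Pit_def by measurable

lemma Pit_0: "y \<in> markov_space A \<Longrightarrow> Pit 0 f y = f y"
  by (simp add: Pit_def ruelle_iter_0)

lemma Pit_integral: "f \<in> borel_measurable \<nu> \<Longrightarrow> (\<integral>\<^sup>+y. Pit n f y \<partial>\<nu>) = (\<integral>\<^sup>+y. f y \<partial>\<nu>)"
  unfolding Pit_def using lam_pos
  by (subst nn_integral_cmult) (auto simp: ruelle_iter_integral mult.assoc[symmetric] ennreal_mult[symmetric])

lemma Pit_dual:
  assumes [measurable]: "f \<in> borel_measurable \<nu>" "g \<in> borel_measurable \<nu>"
  shows "(\<integral>\<^sup>+y. Pit n f y * g y \<partial>\<nu>) = (\<integral>\<^sup>+y. f y * g ((lshift ^^ n) y) \<partial>\<nu>)"
proof -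
  have "Pit n f y * g y = Pit n (\<lambda>z. f z * g ((lshift ^^ n) z)) y" for y
    by (simp add: Pit_def ruelle_iter_mult_lshift mult.assoc)
  then show ?thesis by (simp add: Pit_integral)
qed

lemma Pit_Suc: "Pit (Suc n) f y = Pit 1 (Pit n f) y"
proof -
  have "Pit 1 (Pit n f) y = ennreal (1 / lam ^ 1) * (ennreal (1 / lam ^ n) * ruelle_iter A \<phi> 1 (ruelle_iter A \<phi> n f) y)"
    unfolding Pit_def ruelle_iter_cmult ..
  also have "\<dots> = ennreal (1 / lam ^ 1) * ennreal (1 / lam ^ n) * ruelle_iter A \<phi> (Suc n) f y"
    by (simp only: mult.assoc ruelle_iter_Suc[of _ _ n])
  also have "ennreal (1 / lam ^ 1) * ennreal (1 / lam ^ n) = ennreal (1 / lam ^ Suc n)"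
    using lam_pos by (subst ennreal_mult[symmetric]) auto
  finally show ?thesis unfolding Pit_def[of "Suc n"] by (rule sym)
qed

lemma Pit_cong: "(\<And>z. z \<in> markov_space A \<Longrightarrow> f z = g z) \<Longrightarrow> Pit n f y = Pit n g y"
  unfolding Pit_def ruelle_iter_def by (auto intro!: arg_cong2[where f="(*)"] nn_integral_cong)

lemma Pit_add: "y \<in> markov_space A \<Longrightarrow> Pit (m + n) f y = Pit m (Pit n f) y"
proof (induction m arbitrary: y)
  case 0
  then show ?case by (simp add: Pit_0)
next
  case (Suc m)
  have "Pit (Suc m + n) f y = Pit 1 (Pit (m + n) f) y" unfolding add_Suc by (rule Pit_Suc)
  also have "\<dots> = Pit 1 (Pit m (Pit n f)) y" by (rule Pit_cong) (rule Suc.IH)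
  finally show ?case unfolding Pit_Suc[of m] .
qed

lemma Pit_mono: "(\<And>z. z \<in> markov_space A \<Longrightarrow> f z \<le> g z) \<Longrightarrow> Pit n f y \<le> Pit n g y"
  unfolding Pit_def by (intro mult_left_mono ruelle_iter_mono) auto

lemma Pit_cmult: "Pit n (\<lambda>z. c * f z) y = c * Pit n f y"
  unfolding Pit_def ruelle_iter_cmult by (simp add: mult_ac)

definition distortion :: "nat \<Rightarrow> real" where
  "distortion N = exp (enn2real (walters_W A \<phi> N))"

lemma distortion_ge_1: "1 \<le> distortion N"
  by (simp add: distortion_def)

lemma distortion_tendsto: "distortion \<longlonglongrightarrow> 1"
  unfolding distortion_def using tendsto_exp[OF walters_const_tendsto[OF walters]] by simp

lemma Pit_distortion:
  assumes "1 \<le> N" "y \<in> markov_space A" "y' \<in> markov_space A" "\<And>i. i < N \<Longrightarrow> y i = y' i"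
    and "\<And>z z'. z \<in> markov_space A \<Longrightarrow> z' \<in> markov_space A \<Longrightarrow> (lshift ^^ n) z = y \<Longrightarrow> (lshift ^^ n) z' = y' \<Longrightarrow>
      (\<forall>i<n + N. z i = z' i) \<Longrightarrow> f z \<le> g z'"
  shows "Pit n f y \<le> ennreal (distortion N) * Pit n g y'"
proof -
  have "ruelle_iter A \<phi> n f y \<le> ennreal (distortion N) * ruelle_iter A \<phi> n g y'"
    unfolding distortion_def using assms by (intro ruelle_iter_distortion[OF walters]) auto
  then have "ennreal (1 / lam ^ n) * ruelle_iter A \<phi> n f y
      \<le> ennreal (1 / lam ^ n) * (ennreal (distortion N) * ruelle_iter A \<phi> n g y')"
    by (rule mult_left_mono) simp
  then show ?thesis by (simp add: Pit_def mult_ac)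
qed

lemma ruelle_iter_ge:
  assumes "z \<in> markov_space A" "(lshift ^^ n) z = y"
  shows "ennreal (exp (birkhoff_sum \<phi> n z)) * f z \<le> ruelle_iter A \<phi> n f y"
proof -
  let ?S = "{z \<in> markov_space A. (lshift ^^ n) z = y}"
  have "ennreal (exp (birkhoff_sum \<phi> n z)) * f z
      = (\<integral>\<^sup>+u. ennreal (exp (birkhoff_sum \<phi> n u)) * f u * indicator {z} u \<partial>count_space ?S)"
    using assms by (subst nn_integral_indicator_singleton) auto
  also have "\<dots> \<le> ruelle_iter A \<phi> n f y"
    unfolding ruelle_iter_def by (intro nn_integral_mono) (auto simp: indicator_def)
  finally show ?thesis .
qed

lemma ruelle_iter_h:
  assumes "y \<in> markov_space A"
  shows "ruelle_iter A \<phi> n (\<lambda>z. ennreal (h z)) y = ennreal (lam ^ n * h y)"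
  using assms
proof (induction n arbitrary: y)
  case 0
  then show ?case by (simp add: ruelle_iter_0)
next
  case (Suc n)
  have "ruelle_iter A \<phi> (Suc n) (\<lambda>z. ennreal (h z)) y = ruelle_iter A \<phi> 1 (\<lambda>z. ennreal (lam ^ n) * ennreal (h z)) y"
    unfolding ruelle_iter_Suc[of _ _ n] ruelle_iter_def[of A \<phi> 1]
    by (intro nn_integral_cong) (use Suc.IH lam_pos h_pos in \<open>auto simp: ennreal_mult less_imp_le\<close>)
  also have "\<dots> = ennreal (lam ^ n) * ennreal (lam * h y)"
    unfolding ruelle_iter_cmult ruelle_iter_1 using h_eigen[OF Suc.prems] by simp
  finally show ?case using lam_pos h_pos[OF Suc.prems] by (simp add: ennreal_mult[symmetric] mult_ac)
qed

lemma splice_mem: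
  assumes "x \<in> markov_space A" "y \<in> markov_space A" "p 0 = x n" "p k = y 0" "\<forall>i<k. A (p i) (p (Suc i))"
  shows "(\<lambda>i. if i < n then x i else if i < n + k then p (i - n) else y (i - (n + k))) \<in> markov_space A"
    (is "?z \<in> _")
  unfolding markov_space_def
proof (intro CollectI allI)
  fix i
  have Ax: "\<And>i. A (x i) (x (Suc i))" and Ay: "\<And>i. A (y i) (y (Suc i))"
    using assms by (auto simp: markov_space_def)
  have zp: "?z i = p (i - n)" if "n \<le> i" "i \<le> n + k" for i using that assms(4) by auto
  consider "Suc i < n" | "Suc i = n" | "n \<le> i" "i < n + k" | "n + k \<le> i" by linarith
  then show "A (?z i) (?z (Suc i))"
  proof cases
    case 2
    then show ?thesis using Ax[of i] zp[of n] assms(3) by auto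
  next
    case 3
    then show ?thesis using zp[of i] zp[of "Suc i"] assms(5)[rule_format, of "i - n"] by (auto simp: Suc_diff_le)
  next
    case 4
    then show ?thesis using Ay[of "i - (n + k)"] by (auto simp: Suc_diff_le)
  qed (use Ax in auto)
qed

text \<open>Some one-letter cylinder has positive mass, since otherwise h would have integral 0
  instead of infinity. Mixing provides a word that leads from the prefix of \<open>x\<close> to that
  letter, so an iterate of the Ruelle operator is positive there when applied to the indicator of
  the prefix cylinder, and the eigenmeasure equation carries the positivity back.\<close>

lemma cylinder_positive:
  assumes x: "x \<in> markov_space A"
  shows "0 < emeasure \<nu> (cylinder A (map x [0..<n]))"
proof -
  let ?C = "cylinder A (map x [0..<n])"
  have "\<exists>v. emeasure \<nu> (cylinder A [v]) \<noteq> 0"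
  proof (rule ccontr)
    assume "\<not> ?thesis"
    then have "\<And>v. cylinder A [v] \<in> null_sets \<nu>" by (auto intro: null_setsI)
    then have "(\<Union>v. cylinder A [v]) \<in> null_sets \<nu>" by (intro null_sets_UN) auto
    moreover have "(\<Union>v. cylinder A [v]) = space \<nu>" by (auto simp: space_nu mem_cylinder)
    ultimately have "space \<nu> \<in> null_sets \<nu>" by simp
    then have "AE y in \<nu>. ennreal (h y) = 0" by (rule AE_I') auto
    then have "(\<integral>\<^sup>+y. ennreal (h y) \<partial>\<nu>) = (\<integral>\<^sup>+y. 0 \<partial>\<nu>)" by (rule nn_integral_cong_AE)
    then show False using h_integral by simp
  qed
  then obtain v where v: "emeasure \<nu> (cylinder A [v]) \<noteq> 0" by blast
  obtain k p where p: "p 0 = x n" "p k = v" "\<forall>i<k. A (p i) (p (Suc i))"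
    using mixing unfolding topologically_mixing_def by (meson order_refl)
  have pos: "0 < ruelle_iter A \<phi> (n + k) (indicator ?C) y" if y: "y \<in> cylinder A [v]" for y
  proof -
    let ?z = "\<lambda>i. if i < n then x i else if i < n + k then p (i - n) else y (i - (n + k))"
    have yA: "y \<in> markov_space A" "y 0 = v" using y by (auto simp: mem_cylinder)
    have z: "?z \<in> markov_space A" by (rule splice_mem) (use x yA p in auto)
    have "?z \<in> ?C" using z by (simp add: mem_prefix)
    moreover have "(lshift ^^ (n + k)) ?z = y" by (auto simp: lshift_funpow)
    ultimately have "ennreal (exp (birkhoff_sum \<phi> (n + k) ?z)) * 1 \<le> ruelle_iter A \<phi> (n + k) (indicator ?C) y"
      using ruelle_iter_ge[OF z, of "n + k" y "indicator ?C"] by simp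
    then show ?thesis by (rule less_le_trans[rotated]) simp
  qed
  show ?thesis
  proof (rule ccontr)
    assume "\<not> ?thesis"
    then have "(\<integral>\<^sup>+y. ruelle_iter A \<phi> (n + k) (indicator ?C) y \<partial>\<nu>) = 0"
      by (subst ruelle_iter_integral) auto
    then have "AE y in \<nu>. ruelle_iter A \<phi> (n + k) (indicator ?C) y = 0"
      by (subst (asm) nn_integral_0_iff_AE) auto
    then have "AE y in \<nu>. y \<notin> cylinder A [v]" by eventually_elim (use pos in force)
    then have "emeasure \<nu> (cylinder A [v]) = 0"
      by (subst (asm) AE_iff_measurable[OF cylinder_sets, of _ "[v]"]) (auto simp: space_nu mem_cylinder)
    then show False using v by simp
  qed
qed

end

section \<open>Cylinders around a periodic point\<close>

lemma birkhoff_sum_add: "birkhoff_sum \<phi> (m + n) z = birkhoff_sum \<phi> m z + birkhoff_sum \<phi> n ((lshift ^^ m) z)"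
proof (induction n)
  case (Suc n)
  have "(lshift ^^ (m + n)) z = (lshift ^^ n) ((lshift ^^ m) z)" by (auto simp: lshift_funpow fun_eq_iff add_ac)
  then show ?case using Suc by (simp add: birkhoff_sum_Suc)
qed (simp add: birkhoff_sum_def)

lemma periodic_coord:
  assumes "(lshift ^^ q) x = x"
  shows "x (i + q * j) = x i"
proof -
  have 1: "x (i + q) = x i" for i using fun_cong[OF assms, of i] by (simp add: lshift_funpow add.commute)
  show ?thesis
  proof (induction j)
    case (Suc j)
    then show ?case using 1[of "i + q * j"] by (simp add: add_ac)
  qed simp
qed

lemma birkhoff_sum_periodic:
  assumes "(lshift ^^ q) x = x"
  shows "birkhoff_sum \<phi> (q * j) x = real j * birkhoff_sum \<phi> q x"
proof (induction j)
  case 0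
  then show ?case by (simp add: birkhoff_sum_def)
next
  case (Suc j)
  have "(lshift ^^ (q * j)) x = x"
    using periodic_coord[OF assms] by (auto simp: fun_eq_iff lshift_funpow add.commute)
  then have "birkhoff_sum \<phi> (q * j + q) x = birkhoff_sum \<phi> (q * j) x + birkhoff_sum \<phi> q x"
    by (simp add: birkhoff_sum_add)
  then show ?case using Suc by (simp add: algebra_simps)
qed

locale periodic_point = walters_system +
  fixes x :: "nat \<Rightarrow> 'a" and q :: nat
  assumes x_mem: "x \<in> markov_space A" and period: "prime_period x q"
begin

definition B :: "nat \<Rightarrow> (nat \<Rightarrow> 'a) set" where
  "B n = cylinder A (map x [0..<n])"

text \<open>This is 1 - \<theta> of the theorem. By \<open>measure_B_ratio\<close> it is the
  limiting probability that a point of \<open>B n\<close> follows the periodic orbit for one more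
  period.\<close>

definition \<rho> :: real where
  "\<rho> = exp (birkhoff_sum \<phi> q x) / lam ^ q"

lemma q_pos: "0 < q" and q_per: "(lshift ^^ q) x = x"
  using period by (auto simp: prime_period_def)

lemma mem_B: "y \<in> B n \<longleftrightarrow> y \<in> markov_space A \<and> (\<forall>i<n. y i = x i)"
  unfolding B_def by (rule mem_prefix)

lemma x_in_B: "x \<in> B n" by (simp add: mem_B x_mem)

lemma B_sets [measurable, simp]: "B n \<in> sets \<nu>" by (simp add: B_def)

lemma B_mono: "m \<le> n \<Longrightarrow> B n \<subseteq> B m" by (auto simp: mem_B)

lemma B_finite: "1 \<le> n \<Longrightarrow> emeasure \<nu> (B n) < \<infinity>"
  unfolding B_def by (rule cylinder_finite) auto

lemma B_emeasure: "1 \<le> n \<Longrightarrow> emeasure \<nu> (B n) = ennreal (measure \<nu> (B n))"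
  using B_finite[of n] by (simp add: emeasure_eq_ennreal_measure less_top)

lemma B_pos: "1 \<le> n \<Longrightarrow> 0 < measure \<nu> (B n)"
  using cylinder_positive[OF x_mem, of n] B_emeasure[of n] by (simp add: B_def)

lemma rho_pos: "0 < \<rho>" using lam_pos by (simp add: \<rho>_def)

text \<open>In the eigenvalue equation for h at \<open>x\<close>, iterated over a multiple n of the
  period, \<open>x\<close> itself is one preimage. A path starting at a letter off the orbit gives a
  second one with a strictly positive term, so the term of \<open>x\<close> is strictly smaller than
  the total. Only finitely many letters lie on the orbit, hence the infinite alphabet has such a
  letter.\<close>

lemma rho_less_1: "\<rho> < 1"
proof -
  have "finite (x ` {..<q})" by simp
  then obtain v where v: "v \<notin> x ` {..<q}" using infinite_alphabet by (metis UNIV_eq_I)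
  obtain N where N: "\<And>n. n \<ge> N \<Longrightarrow> \<exists>p. p 0 = v \<and> p n = x 0 \<and> (\<forall>i<n. A (p i) (p (Suc i)))"
    using mixing unfolding topologically_mixing_def by blast
  \<comment> \<open>A multiple of q, so that the n-th shift fixes \<open>x\<close>, and at least N,
    so that mixing supplies a path of exactly n steps.\<close>
  define n where "n = q * Suc N"
  have "N \<le> n" unfolding n_def using q_pos by (metis Suc_leD le_refl mult_le_mono1 mult_1 Suc_leI One_nat_def le_trans)
  then obtain p where p: "p 0 = v" "p n = x 0" "\<forall>i<n. A (p i) (p (Suc i))" using N by blast
  have n0: "0 < n" using q_pos by (simp add: n_def)
  define z where "z = (\<lambda>i. if i < n then p i else x (i - n))"
  have zM: "z \<in> markov_space A"
    unfolding markov_space_def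
  proof (intro CollectI allI)
    fix i
    consider "Suc i < n" | "Suc i = n" | "n \<le> i" by linarith
    then show "A (z i) (z (Suc i))"
    proof cases
      case 1
      then show ?thesis using p(3) by (simp add: z_def)
    next
      case 2
      then show ?thesis using p(3)[rule_format, of i] p(2) by (simp add: z_def)
    next
      case 3
      have "A (x (i - n)) (x (Suc (i - n)))" using x_mem by (simp add: markov_space_def)
      then show ?thesis using 3 by (simp add: z_def Suc_diff_le)
    qed
  qed
  have nx: "(lshift ^^ n) x = x" using periodic_coord[OF q_per] by (auto simp: fun_eq_iff lshift_funpow n_def add.commute simp del: mult_Suc_right)
  have nz: "(lshift ^^ n) z = x" by (auto simp: z_def lshift_funpow)
  have zx: "z \<noteq> x"
  proof
    assume "z = x"
    then have "x 0 = z 0" by simp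
    also have "\<dots> = v" using n0 p by (simp add: z_def)
    finally have "x 0 = v" .
    then show False using v q_pos by auto
  qed
  let ?e = "\<lambda>u. exp (birkhoff_sum \<phi> n u) * h u"
  have "ennreal (?e x + ?e z) = (\<Sum>u\<in>{x, z}. ennreal (exp (birkhoff_sum \<phi> n u)) * ennreal (h u))"
    using zx h_pos[OF x_mem] h_pos[OF zM] by (simp add: ennreal_plus ennreal_mult less_imp_le)
  also have "\<dots> = (\<integral>\<^sup>+u. ennreal (exp (birkhoff_sum \<phi> n u)) * ennreal (h u) \<partial>count_space {x, z})"
    by (rule nn_integral_count_space_finite[symmetric]) simp
  also have "\<dots> = (\<integral>\<^sup>+u. ennreal (exp (birkhoff_sum \<phi> n u)) * ennreal (h u) * indicator {x, z} u
      \<partial>count_space {u \<in> markov_space A. (lshift ^^ n) u = x})"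
    by (subst (1 2) nn_integral_count_space_indicator)
       (use nx nz zM x_mem in \<open>auto intro!: nn_integral_cong simp: indicator_def\<close>)
  also have "\<dots> \<le> ruelle_iter A \<phi> n (\<lambda>u. ennreal (h u)) x"
    unfolding ruelle_iter_def by (intro nn_integral_mono) (auto simp: indicator_def)
  also have "\<dots> = ennreal (lam ^ n * h x)" by (rule ruelle_iter_h[OF x_mem])
  finally have "?e x + ?e z \<le> lam ^ n * h x"
    using lam_pos h_pos[OF x_mem] by (subst (asm) ennreal_le_iff) auto
  moreover have "0 < ?e z" using h_pos[OF zM] by simp
  ultimately have "exp (birkhoff_sum \<phi> n x) * h x < lam ^ n * h x" by linarith
  then have "exp (birkhoff_sum \<phi> n x) < lam ^ n" using h_pos[OF x_mem] by simp
  moreover have "exp (birkhoff_sum \<phi> n x) = exp (birkhoff_sum \<phi> q x) ^ Suc N"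
    unfolding n_def birkhoff_sum_periodic[OF q_per] by (rule exp_of_nat_mult)
  moreover have "lam ^ n = (lam ^ q) ^ Suc N" unfolding n_def by (rule power_mult)
  ultimately have "exp (birkhoff_sum \<phi> q x) < lam ^ q"
    using lam_pos by (metis power_less_imp_less_base zero_le_power less_imp_le)
  then show ?thesis using lam_pos by (simp add: \<rho>_def)
qed

text \<open>A q-step preimage of \<open>x\<close> that starts with the first q letters of
  \<open>x\<close> is \<open>x\<close> itself, so the sum over preimages has a single term.\<close>

lemma Pit_return_at_x: "Pit q (indicator (B (n + q))) x = ennreal \<rho>"
proof -
  have "ruelle_iter A \<phi> q (indicator (B (n + q))) x
      = (\<integral>\<^sup>+u. ennreal (exp (birkhoff_sum \<phi> q u)) * indicator {x} u \<partial>count_space {u \<in> markov_space A. (lshift ^^ q) u = x})"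
    unfolding ruelle_iter_def
  proof (rule nn_integral_cong)
    fix u assume "u \<in> space (count_space {u \<in> markov_space A. (lshift ^^ q) u = x})"
    then have u: "u \<in> markov_space A" "(lshift ^^ q) u = x" by auto
    have "u = x" if "u \<in> B (n + q)"
    proof
      fix i show "u i = x i"
      proof (cases "i < q")
        case False
        have "u i = (lshift ^^ q) u (i - q)" "x i = (lshift ^^ q) x (i - q)" using False by (simp_all add: lshift_funpow)
        then show ?thesis using u(2) q_per by simp
      qed (use that in \<open>simp add: mem_B\<close>)
    qed
    then have "u \<in> B (n + q) \<longleftrightarrow> u = x" using x_in_B by blast
    then show "ennreal (exp (birkhoff_sum \<phi> q u)) * indicator (B (n + q)) u = ennreal (exp (birkhoff_sum \<phi> q u)) * indicator {x} u"
      by (simp add: indicator_def)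
  qed
  also have "\<dots> = ennreal (exp (birkhoff_sum \<phi> q x))"
    using x_mem q_per by (subst nn_integral_indicator_singleton) auto
  finally show ?thesis
    using lam_pos by (simp add: Pit_def \<rho>_def ennreal_mult[symmetric] field_simps)
qed


text \<open>The image of the indicator of \<open>B (n + q)\<close> under q steps lives on
  \<open>B n\<close>, has the value \<open>\<rho>\<close> at \<open>x\<close> and is constant on
  \<open>B n\<close> up to distortion. Integrating it gives both inequalities, because the
  normalised operator preserves the integral.\<close>

lemma measure_B_bounds:
  assumes n: "1 \<le> n"
  shows "measure \<nu> (B (n + q)) \<le> distortion n * \<rho> * measure \<nu> (B n)"
    and "\<rho> * measure \<nu> (B n) \<le> distortion n * measure \<nu> (B (n + q))"
proof -
  let ?f = "indicator (B (n + q)) :: _ \<Rightarrow> ennreal"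
  have agree: "?f z \<le> ?f z'" if "z \<in> markov_space A" "z' \<in> markov_space A" "\<forall>i<q + n. z i = z' i" for z z'
    using that by (auto simp: indicator_def mem_B add.commute)
  have up: "Pit q ?f y \<le> ennreal (distortion n * \<rho>) * indicator (B n) y" if y: "y \<in> space \<nu>" for y
  proof (cases "y \<in> B n")
    case True
    have "Pit q ?f y \<le> ennreal (distortion n) * Pit q ?f x"
      by (rule Pit_distortion[OF n]) (use True x_mem agree in \<open>auto simp: mem_B\<close>)
    then show ?thesis using True distortion_ge_1[of n] rho_pos by (simp add: Pit_return_at_x ennreal_mult)
  next
    case False
    have "Pit q ?f y = 0"
    proof -
      have "?f z = 0" if "z \<in> markov_space A" "(lshift ^^ q) z = y" for z
      proof -
        have "z \<notin> B (n + q)"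
        proof
          assume z: "z \<in> B (n + q)"
          have "y i = x i" if "i < n" for i
          proof -
            have "y i = z (q + i)" using \<open>(lshift ^^ q) z = y\<close> by (auto simp: lshift_funpow)
            also have "\<dots> = x (i + q * 1)" using z that by (simp add: mem_B add.commute)
            also have "\<dots> = x i" by (rule periodic_coord[OF q_per])
            finally show ?thesis .
          qed
          then show False using False y by (simp add: mem_B space_nu)
        qed
        then show ?thesis by simp
      qed
      then have "ruelle_iter A \<phi> q ?f y = (\<integral>\<^sup>+z. 0 \<partial>count_space {z \<in> markov_space A. (lshift ^^ q) z = y})"
        unfolding ruelle_iter_def by (intro nn_integral_cong) auto
      then show ?thesis by (simp add: Pit_def)
    qed
    then show ?thesis by simp
  qed
  have lo: "ennreal \<rho> * indicator (B n) y \<le> ennreal (distortion n) * Pit q ?f y" for y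
  proof (cases "y \<in> B n")
    case True
    have "Pit q ?f x \<le> ennreal (distortion n) * Pit q ?f y"
      by (rule Pit_distortion[OF n]) (use True x_mem agree in \<open>auto simp: mem_B\<close>)
    then show ?thesis using True by (simp add: Pit_return_at_x)
  qed simp
  have int: "(\<integral>\<^sup>+y. Pit q ?f y \<partial>\<nu>) = ennreal (measure \<nu> (B (n + q)))"
    using n B_emeasure[of "n + q"] by (simp add: Pit_integral)
  have "ennreal (measure \<nu> (B (n + q))) \<le> (\<integral>\<^sup>+y. ennreal (distortion n * \<rho>) * indicator (B n) y \<partial>\<nu>)"
    unfolding int[symmetric] by (intro nn_integral_mono up)
  also have "\<dots> = ennreal (distortion n * \<rho> * measure \<nu> (B n))"
    using n B_emeasure[of n] distortion_ge_1[of n] rho_pos by (simp add: nn_integral_cmult ennreal_mult)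
  finally show "measure \<nu> (B (n + q)) \<le> distortion n * \<rho> * measure \<nu> (B n)"
    using distortion_ge_1[of n] rho_pos by (subst (asm) ennreal_le_iff) auto
  have "ennreal (\<rho> * measure \<nu> (B n)) = (\<integral>\<^sup>+y. ennreal \<rho> * indicator (B n) y \<partial>\<nu>)"
    using n B_emeasure[of n] rho_pos by (simp add: nn_integral_cmult ennreal_mult)
  also have "\<dots> \<le> (\<integral>\<^sup>+y. ennreal (distortion n) * Pit q ?f y \<partial>\<nu>)" by (intro nn_integral_mono lo)
  also have "\<dots> = ennreal (distortion n * measure \<nu> (B (n + q)))"
    using distortion_ge_1[of n] by (simp add: nn_integral_cmult int ennreal_mult)
  finally show "\<rho> * measure \<nu> (B n) \<le> distortion n * measure \<nu> (B (n + q))"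
    using distortion_ge_1[of n] by (subst (asm) ennreal_le_iff) auto
qed

lemma measure_B_ratio: "(\<lambda>n. measure \<nu> (B (n + q)) / measure \<nu> (B n)) \<longlonglongrightarrow> \<rho>"
proof (rule tendsto_sandwich)
  have "(\<lambda>n. \<rho> / distortion n) \<longlonglongrightarrow> \<rho> / 1" by (intro tendsto_divide tendsto_const distortion_tendsto) simp
  then show "(\<lambda>n. \<rho> / distortion n) \<longlonglongrightarrow> \<rho>" by simp
  have "(\<lambda>n. distortion n * \<rho>) \<longlonglongrightarrow> 1 * \<rho>" by (intro tendsto_mult tendsto_const distortion_tendsto)
  then show "(\<lambda>n. distortion n * \<rho>) \<longlonglongrightarrow> \<rho>" by simp
  show "\<forall>\<^sub>F n in sequentially. \<rho> / distortion n \<le> measure \<nu> (B (n + q)) / measure \<nu> (B n)"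
    using eventually_ge_at_top[of 1]
  proof eventually_elim
    case (elim n)
    have "0 < distortion n" using distortion_ge_1[of n] by linarith
    then show ?case using measure_B_bounds(2)[OF elim] B_pos[OF elim] by (simp add: field_simps)
  qed
  show "\<forall>\<^sub>F n in sequentially. measure \<nu> (B (n + q)) / measure \<nu> (B n) \<le> distortion n * \<rho>"
    using eventually_ge_at_top[of 1]
    by eventually_elim (use measure_B_bounds(1) B_pos in \<open>simp add: field_simps\<close>)
qed

text \<open>An overlap of period words: a return at time k makes \<open>x\<close> agree with its
  k-th shift along a full period, so \<open>x\<close> has period k mod q. Primality of q leaves only
  the remainder 0.\<close>

lemma return_multiple:
  assumes "z \<in> B n" "(lshift ^^ k) z \<in> B n" "k + q \<le> n"
  shows "q dvd k"
proof -
  have per: "x (k + i) = x i" if "i < q" for i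
  proof -
    have "x (k + i) = z (k + i)" using assms(1,3) that by (simp add: mem_B)
    also have "\<dots> = (lshift ^^ k) z i" by (simp add: lshift_funpow)
    also have "\<dots> = x i" using assms(2,3) that by (simp add: mem_B)
    finally show ?thesis .
  qed
  define r where "r = k mod q"
  have "(lshift ^^ r) x = x"
  proof
    fix i
    have "x (r + i) = x (k + i)"
      using periodic_coord[OF q_per, of "r + i" "k div q"] by (simp add: r_def add_ac)
    also have "\<dots> = x (k + i mod q)"
      using periodic_coord[OF q_per, of "k + i mod q" "i div q"] by (simp add: add_ac)
    also have "\<dots> = x (i mod q)" using per[of "i mod q"] q_pos by simp
    also have "\<dots> = x i" using periodic_coord[OF q_per, of "i mod q" "i div q"] by simp
    finally show "(lshift ^^ r) x i = x i" by (simp add: lshift_funpow)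
  qed
  moreover have "r < q" using q_pos by (simp add: r_def)
  ultimately have "r = 0" using period by (auto simp: prime_period_def)
  then show ?thesis by (auto simp: r_def)
qed

text \<open>For early times the return event is again a cylinder around \<open>x\<close>, so its
  probability is a ratio of the measures of two such cylinders.\<close>

lemma return_multiple_set:
  assumes "k + q \<le> n"
  shows "B n \<inter> (lshift ^^ k) -` B n = (if q dvd k then B (n + k) else {})"
proof (cases "q dvd k")
  case True
  then obtain j where k: "k = q * j" by blast
  have "z \<in> B (n + k)" if z: "z \<in> B n" "(lshift ^^ k) z \<in> B n" for z
    unfolding mem_B
  proof safe
    fix i assume i: "i < n + k"
    show "z i = x i"
    proof (cases "i < n")
      case False
      then have "k \<le> i" using assms by simp
      have "z i = (lshift ^^ k) z (i - k)" using \<open>k \<le> i\<close> by (simp add: lshift_funpow)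
      also have "\<dots> = x (i - k)" using z(2) i \<open>k \<le> i\<close> by (simp add: mem_B)
      also have "\<dots> = x i" using periodic_coord[OF q_per, of "i - k" j] \<open>k \<le> i\<close> by (simp add: k)
      finally show ?thesis .
    qed (use z in \<open>simp add: mem_B\<close>)
  qed (use z in \<open>simp add: mem_B\<close>)
  moreover have "(lshift ^^ k) z \<in> B n" if z: "z \<in> B (n + k)" for z
  proof -
    have "z (k + i) = x i" if "i < n" for i
      using z that periodic_coord[OF q_per, of i j] by (simp add: mem_B k add.commute)
    then show ?thesis using z by (simp add: mem_B lshift_markov) (simp add: lshift_funpow)
  qed
  moreover have "B (n + k) \<subseteq> B n" by (rule B_mono) simp
  ultimately show ?thesis using True by auto
next
  case False
  then show ?thesis using return_multiple[OF _ _ assms] by auto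
qed

end

section \<open>Hitting times and renewal\<close>

lemma suminf_single_ennreal:
  fixes f :: "nat \<Rightarrow> ennreal"
  assumes "\<And>n. n \<noteq> m \<Longrightarrow> f n = 0"
  shows "(\<Sum>n. f n) = f m"
  using suminf_finite[of "{m}" f] assms by simp

context walters_system
begin

definition first_hit :: "(nat \<Rightarrow> 'v) set \<Rightarrow> nat \<Rightarrow> (nat \<Rightarrow> 'v) set" where
  "first_hit D n = {y \<in> markov_space A. 0 < n \<and> (lshift ^^ n) y \<in> D \<and> (\<forall>j. 0 < j \<and> j < n \<longrightarrow> (lshift ^^ j) y \<notin> D)}"

lemma first_hit_sets [measurable]:
  assumes [measurable]: "D \<in> sets \<nu>"
  shows "first_hit D n \<in> sets \<nu>"
proof -
  have "first_hit D n = {y \<in> space \<nu>. 0 < n \<and> (lshift ^^ n) y \<in> D \<and> (\<forall>j. 0 < j \<and> j < n \<longrightarrow> (lshift ^^ j) y \<notin> D)}"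
    by (simp add: first_hit_def space_nu)
  also have "\<dots> \<in> sets \<nu>" by measurable
  finally show ?thesis .
qed

lemma first_hit_unique: "y \<in> first_hit D n \<Longrightarrow> y \<in> first_hit D m \<Longrightarrow> n = m"
  unfolding first_hit_def by (metis (mono_tags, lifting) linorder_less_linear mem_Collect_eq)

lemma first_hit_exists:
  assumes "y \<in> markov_space A" "0 < k" "(lshift ^^ k) y \<in> D"
  obtains n where "y \<in> first_hit D n" "n \<le> k"
proof -
  define n where "n = (LEAST n. 0 < n \<and> (lshift ^^ n) y \<in> D)"
  have n: "0 < n \<and> (lshift ^^ n) y \<in> D" unfolding n_def by (rule LeastI[of _ k]) (use assms in auto)
  have "n \<le> k" unfolding n_def by (rule Least_le) (use assms in auto)
  moreover have "(lshift ^^ j) y \<notin> D" if "0 < j" "j < n" for j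
    using that not_less_Least[of j "\<lambda>n. 0 < n \<and> (lshift ^^ n) y \<in> D"] unfolding n_def by blast
  ultimately show ?thesis using n assms(1) that by (auto simp: first_hit_def)
qed

text \<open>With r the first hitting time of \<open>D\<close> this is z^r times \<open>g\<close> at
  the hitting point, and 0 if \<open>D\<close> is never hit. Summing over the possible values of r
  makes measurability and duality termwise statements.\<close>

definition hit_sum :: "(nat \<Rightarrow> 'v) set \<Rightarrow> real \<Rightarrow> ((nat \<Rightarrow> 'v) \<Rightarrow> ennreal) \<Rightarrow> (nat \<Rightarrow> 'v) \<Rightarrow> ennreal" where
  "hit_sum D z g y = (\<Sum>n. indicator (first_hit D n) y * (ennreal (z ^ n) * g ((lshift ^^ n) y)))"

lemma hit_sum_hit:
  assumes "y \<in> first_hit D n"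
  shows "hit_sum D z g y = ennreal (z ^ n) * g ((lshift ^^ n) y)"
proof -
  have "indicator (first_hit D m) y = (0::ennreal)" if "m \<noteq> n" for m
    using first_hit_unique[OF assms, of m] that by (auto simp: indicator_def)
  then show ?thesis unfolding hit_sum_def using assms by (subst suminf_single_ennreal[of n]) auto
qed

lemma hit_sum_no_hit:
  assumes "\<And>n. y \<notin> first_hit D n"
  shows "hit_sum D z g y = 0"
  unfolding hit_sum_def using assms by simp

lemma hit_sum_measurable [measurable]:
  assumes [measurable]: "D \<in> sets \<nu>" "g \<in> borel_measurable \<nu>"
  shows "hit_sum D z g \<in> borel_measurable \<nu>"
  unfolding hit_sum_def by measurable

text \<open>The transfer operator of the map induced on \<open>D\<close>, weighted by \<open>z\<close> to the power of the
  first hitting time.\<close>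

definition induced_op :: "(nat \<Rightarrow> 'v) set \<Rightarrow> real \<Rightarrow> ((nat \<Rightarrow> 'v) \<Rightarrow> ennreal) \<Rightarrow> (nat \<Rightarrow> 'v) \<Rightarrow> ennreal" where
  "induced_op D z f y = (\<Sum>n. ennreal (z ^ n) * Pit n (\<lambda>u. f u * indicator (first_hit D n) u) y) * indicator D y"

lemma induced_op_measurable [measurable]:
  assumes [measurable]: "D \<in> sets \<nu>" "f \<in> borel_measurable \<nu>"
  shows "induced_op D z f \<in> borel_measurable \<nu>"
  unfolding induced_op_def by measurable

text \<open>Each term of the series is an instance of \<open>Pit_dual\<close>; the indicator of
  \<open>D\<close> disappears because a point that first hits at time n has its n-th shift in
  \<open>D\<close>.\<close>

lemma induced_op_dual:
  assumes [measurable]: "D \<in> sets \<nu>" "f \<in> borel_measurable \<nu>" "g \<in> borel_measurable \<nu>"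
  shows "(\<integral>\<^sup>+y. induced_op D z f y * g y \<partial>\<nu>) = (\<integral>\<^sup>+y. f y * hit_sum D z g y \<partial>\<nu>)"
proof -
  let ?f = "\<lambda>n u. f u * indicator (first_hit D n) u"
  have "(\<integral>\<^sup>+y. induced_op D z f y * g y \<partial>\<nu>)
      = (\<integral>\<^sup>+y. (\<Sum>n. ennreal (z ^ n) * (Pit n (?f n) y * (g y * indicator D y))) \<partial>\<nu>)"
    unfolding induced_op_def
    by (intro nn_integral_cong) (simp add: mult_ac flip: ennreal_suminf_cmult)
  also have "\<dots> = (\<Sum>n. ennreal (z ^ n) * (\<integral>\<^sup>+y. Pit n (?f n) y * (g y * indicator D y) \<partial>\<nu>))"
    by (subst nn_integral_suminf) (auto simp: nn_integral_cmult)
  also have "\<dots> = (\<Sum>n. \<integral>\<^sup>+y. ennreal (z ^ n) * (?f n y * (g ((lshift ^^ n) y) * indicator D ((lshift ^^ n) y))) \<partial>\<nu>)"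
    by (subst Pit_dual) (auto simp: nn_integral_cmult)
  also have "\<dots> = (\<integral>\<^sup>+y. (\<Sum>n. ennreal (z ^ n) * (?f n y * (g ((lshift ^^ n) y) * indicator D ((lshift ^^ n) y)))) \<partial>\<nu>)"
    by (rule nn_integral_suminf[symmetric]) measurable
  also have "\<dots> = (\<integral>\<^sup>+y. f y * hit_sum D z g y \<partial>\<nu>)"
  proof (rule nn_integral_cong)
    fix y
    have "ennreal (z ^ n) * (?f n y * (g ((lshift ^^ n) y) * indicator D ((lshift ^^ n) y)))
      = f y * (indicator (first_hit D n) y * (ennreal (z ^ n) * g ((lshift ^^ n) y)))" for n
      by (auto simp: indicator_def first_hit_def mult_ac)
    then show "(\<Sum>n. ennreal (z ^ n) * (?f n y * (g ((lshift ^^ n) y) * indicator D ((lshift ^^ n) y)))) = f y * hit_sum D z g y"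
      unfolding hit_sum_def by simp
  qed
  finally show ?thesis .
qed

text \<open>The product of z_i raised to the i-th gap between successive hits, for the first K hits.
  It vanishes if fewer than K hits occur, whatever the z_i are.\<close>

fun hit_prod :: "(nat \<Rightarrow> 'v) set \<Rightarrow> nat \<Rightarrow> (nat \<Rightarrow> real) \<Rightarrow> (nat \<Rightarrow> 'v) \<Rightarrow> ennreal" where
  "hit_prod D 0 z = (\<lambda>y. 1)"
| "hit_prod D (Suc K) z = hit_sum D (z 0) (hit_prod D K (\<lambda>i. z (Suc i)))"

lemma hit_prod_measurable [measurable]:
  assumes [measurable]: "D \<in> sets \<nu>"
  shows "hit_prod D K z \<in> borel_measurable \<nu>"
  by (induction K arbitrary: z) auto

lemma hit_sum_le_1:
  assumes "0 \<le> z" "z \<le> 1" "\<And>y. g y \<le> 1"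
  shows "hit_sum D z g y \<le> 1"
proof (cases "\<exists>n. y \<in> first_hit D n")
  case True
  then obtain n where n: "y \<in> first_hit D n" by blast
  have "ennreal (z ^ n) * g ((lshift ^^ n) y) \<le> 1 * 1"
    using assms by (intro mult_mono) (auto simp: power_le_one)
  then show ?thesis unfolding hit_sum_hit[OF n] by simp
next
  case False
  then show ?thesis by (subst hit_sum_no_hit) auto
qed

lemma hit_prod_le_1: "(\<And>i. 0 \<le> z i \<and> z i \<le> 1) \<Longrightarrow> hit_prod D K z y \<le> 1"
proof (induction K arbitrary: z y)
  case (Suc K)
  then show ?case by (auto intro!: hit_sum_le_1)
qed simp

end

section \<open>Asymptotic independence across a hit of the cylinder\<close>

context periodic_point
begin

text \<open>The condition is symmetric in the two points, so it says that \<open>f\<close> depends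
  on the first N letters only. The one-sided form is what the distortion lemma consumes.\<close>

definition prefix_mono :: "nat \<Rightarrow> ((nat \<Rightarrow> 'a) \<Rightarrow> ennreal) \<Rightarrow> bool" where
  "prefix_mono N f \<longleftrightarrow> (\<forall>u u'. u \<in> markov_space A \<longrightarrow> u' \<in> markov_space A \<longrightarrow> (\<forall>i<N. u i = u' i) \<longrightarrow> f u \<le> f u')"

lemma prefix_mono_cylinder: "length w \<le> N \<Longrightarrow> prefix_mono N (indicator (cylinder A w))"
  by (auto simp: prefix_mono_def indicator_def mem_cylinder)

lemma prefix_mono_B: "prefix_mono N (indicator (B N))"
  unfolding B_def by (rule prefix_mono_cylinder) simp

lemma first_hit_prefix:
  assumes "u \<in> markov_space A" "u' \<in> markov_space A" "\<forall>i<n + N. u i = u' i"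
  shows "u \<in> first_hit (B N) n \<longleftrightarrow> u' \<in> first_hit (B N) n"
proof -
  have "(lshift ^^ j) u \<in> B N \<longleftrightarrow> (lshift ^^ j) u' \<in> B N" if "j \<le> n" for j
    using assms that lshift_prefix[of n N u u' j] by (auto simp: mem_B lshift_markov)
  then show ?thesis using assms(1,2) by (auto simp: first_hit_def)
qed

text \<open>Whether the first hit of \<open>B N\<close> happens at time n is decided by the first n
  + N letters, and \<open>f\<close> by the first N. Matched preimages therefore carry the same
  indicators, and distortion applies to every term with a constant independent of n.\<close>

lemma induced_op_distortion:
  assumes N: "1 \<le> N" and f: "prefix_mono N f" and y: "y \<in> B N" "y' \<in> B N"
  shows "induced_op (B N) z f y \<le> ennreal (distortion N) * induced_op (B N) z f y'"
proof -
  have "Pit n (\<lambda>u. f u * indicator (first_hit (B N) n) u) y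
      \<le> ennreal (distortion N) * Pit n (\<lambda>u. f u * indicator (first_hit (B N) n) u) y'" for n
  proof (rule Pit_distortion[OF N])
    fix u u' assume u: "u \<in> markov_space A" "u' \<in> markov_space A" "\<forall>i<n + N. u i = u' i"
    have "f u \<le> f u'" using f u by (auto simp: prefix_mono_def)
    then show "f u * indicator (first_hit (B N) n) u \<le> f u' * indicator (first_hit (B N) n) u'"
      using first_hit_prefix[OF u] by (auto simp: indicator_def)
  qed (use y in \<open>auto simp: mem_B\<close>)
  then have "(\<Sum>n. ennreal (z ^ n) * Pit n (\<lambda>u. f u * indicator (first_hit (B N) n) u) y)
      \<le> (\<Sum>n. ennreal (distortion N) * (ennreal (z ^ n) * Pit n (\<lambda>u. f u * indicator (first_hit (B N) n) u) y'))"
    by (intro suminf_le) (auto simp: mult.left_commute intro!: mult_left_mono)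
  then show ?thesis using y by (simp add: induced_op_def)
qed

text \<open>Approximate factorisation at a hit. The induced image of \<open>f\<close> vanishes off
  \<open>B N\<close> and is constant there up to distortion, so its integral against
  \<open>g\<close> is nearly its total mass times the mean of \<open>g\<close> over
  \<open>B N\<close>. The inequalities are multiplied out by the measure of \<open>B N\<close>,
  which avoids division in \<open>ennreal\<close>.\<close>

lemma induced_op_bounds:
  assumes N: "1 \<le> N" and f: "prefix_mono N f" "f \<in> borel_measurable \<nu>" and g: "g \<in> borel_measurable \<nu>"
  shows "emeasure \<nu> (B N) * (\<integral>\<^sup>+y. f y * hit_sum (B N) z g y \<partial>\<nu>)
      \<le> ennreal (distortion N) * (\<integral>\<^sup>+y. f y * hit_sum (B N) z (\<lambda>_. 1) y \<partial>\<nu>) * (\<integral>\<^sup>+y. indicator (B N) y * g y \<partial>\<nu>)"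
    and "(\<integral>\<^sup>+y. f y * hit_sum (B N) z (\<lambda>_. 1) y \<partial>\<nu>) * (\<integral>\<^sup>+y. indicator (B N) y * g y \<partial>\<nu>)
      \<le> ennreal (distortion N) * emeasure \<nu> (B N) * (\<integral>\<^sup>+y. f y * hit_sum (B N) z g y \<partial>\<nu>)"
proof -
  let ?R = "induced_op (B N) z f" and ?D = "ennreal (distortion N)"
  have [measurable]: "?R \<in> borel_measurable \<nu>" "g \<in> borel_measurable \<nu>" using f g by auto
  have R_ind: "?R y = ?R y * indicator (B N) y" for y by (simp add: induced_op_def mult.assoc indicator_def)
  have tot: "(\<integral>\<^sup>+y. f y * hit_sum (B N) z (\<lambda>_. 1) y \<partial>\<nu>) = (\<integral>\<^sup>+y. ?R y \<partial>\<nu>)"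
    using induced_op_dual[of "B N" f "\<lambda>_. 1" z] f by simp
  have dual: "(\<integral>\<^sup>+y. f y * hit_sum (B N) z g y \<partial>\<nu>) = (\<integral>\<^sup>+y. ?R y * g y \<partial>\<nu>)"
    by (rule induced_op_dual[symmetric]) (use f g in auto)
  have up: "emeasure \<nu> (B N) * ?R y \<le> ?D * (\<integral>\<^sup>+y. ?R y \<partial>\<nu>)" if "y \<in> B N" for y
  proof -
    have "emeasure \<nu> (B N) * ?R y = (\<integral>\<^sup>+u. ?R y * indicator (B N) u \<partial>\<nu>)"
      by (subst nn_integral_cmult) (auto simp: mult.commute)
    also have "\<dots> \<le> (\<integral>\<^sup>+u. ?D * ?R u \<partial>\<nu>)"
      by (intro nn_integral_mono) (use induced_op_distortion[OF N f(1) that] in \<open>auto simp: indicator_def\<close>)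
    finally show ?thesis by (simp add: nn_integral_cmult)
  qed
  have lo: "(\<integral>\<^sup>+y. ?R y \<partial>\<nu>) \<le> ?D * emeasure \<nu> (B N) * ?R y" if "y \<in> B N" for y
  proof -
    have "(\<integral>\<^sup>+y. ?R y \<partial>\<nu>) \<le> (\<integral>\<^sup>+u. (?D * ?R y) * indicator (B N) u \<partial>\<nu>)"
    proof (intro nn_integral_mono)
      fix u show "?R u \<le> (?D * ?R y) * indicator (B N) u"
        using induced_op_distortion[OF N f(1) _ that, of u z] R_ind[of u] by (cases "u \<in> B N") auto
    qed
    then show ?thesis by (subst (asm) nn_integral_cmult_indicator) (auto simp: mult_ac)
  qed
  have "emeasure \<nu> (B N) * (\<integral>\<^sup>+y. ?R y * g y \<partial>\<nu>) = (\<integral>\<^sup>+y. emeasure \<nu> (B N) * (?R y * g y) \<partial>\<nu>)"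
    by (simp add: nn_integral_cmult)
  also have "\<dots> \<le> (\<integral>\<^sup>+y. (?D * (\<integral>\<^sup>+y. ?R y \<partial>\<nu>)) * (indicator (B N) y * g y) \<partial>\<nu>)"
  proof (intro nn_integral_mono)
    fix y
    show "emeasure \<nu> (B N) * (?R y * g y) \<le> (?D * (\<integral>\<^sup>+y. ?R y \<partial>\<nu>)) * (indicator (B N) y * g y)"
    proof (cases "y \<in> B N")
      case True
      then show ?thesis using mult_right_mono[OF up[OF True], of "g y"] by (simp add: mult.assoc)
    next
      case False
      then show ?thesis using R_ind[of y] by simp
    qed
  qed
  also have "\<dots> = ?D * (\<integral>\<^sup>+y. ?R y \<partial>\<nu>) * (\<integral>\<^sup>+y. indicator (B N) y * g y \<partial>\<nu>)"
    by (simp add: nn_integral_cmult)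
  finally show "emeasure \<nu> (B N) * (\<integral>\<^sup>+y. f y * hit_sum (B N) z g y \<partial>\<nu>)
      \<le> ennreal (distortion N) * (\<integral>\<^sup>+y. f y * hit_sum (B N) z (\<lambda>_. 1) y \<partial>\<nu>) * (\<integral>\<^sup>+y. indicator (B N) y * g y \<partial>\<nu>)"
    unfolding tot dual .
  have "(\<integral>\<^sup>+y. ?R y \<partial>\<nu>) * (\<integral>\<^sup>+y. indicator (B N) y * g y \<partial>\<nu>) = (\<integral>\<^sup>+y. (\<integral>\<^sup>+y. ?R y \<partial>\<nu>) * (indicator (B N) y * g y) \<partial>\<nu>)"
    by (simp add: nn_integral_cmult)
  also have "\<dots> \<le> (\<integral>\<^sup>+y. (?D * emeasure \<nu> (B N)) * (?R y * g y) \<partial>\<nu>)"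
  proof (intro nn_integral_mono)
    fix y
    show "(\<integral>\<^sup>+y. ?R y \<partial>\<nu>) * (indicator (B N) y * g y) \<le> (?D * emeasure \<nu> (B N)) * (?R y * g y)"
    proof (cases "y \<in> B N")
      case True
      then show ?thesis using mult_right_mono[OF lo[OF True], of "g y"] by (simp add: mult.assoc)
    qed simp
  qed
  also have "\<dots> = ?D * emeasure \<nu> (B N) * (\<integral>\<^sup>+y. ?R y * g y \<partial>\<nu>)"
    by (simp add: nn_integral_cmult)
  finally show "(\<integral>\<^sup>+y. f y * hit_sum (B N) z (\<lambda>_. 1) y \<partial>\<nu>) * (\<integral>\<^sup>+y. indicator (B N) y * g y \<partial>\<nu>)
      \<le> ennreal (distortion N) * emeasure \<nu> (B N) * (\<integral>\<^sup>+y. f y * hit_sum (B N) z g y \<partial>\<nu>)"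
    unfolding tot dual .
qed

end

section \<open>Discounted visits and the renewal identity\<close>

context walters_system
begin

definition visit_sum :: "(nat \<Rightarrow> 'v) set \<Rightarrow> real \<Rightarrow> (nat \<Rightarrow> 'v) \<Rightarrow> ennreal" where
  "visit_sum D z y = (\<Sum>k. ennreal (z ^ k) * indicator D ((lshift ^^ k) y))"

lemma visit_sum_measurable [measurable]:
  assumes [measurable]: "D \<in> sets \<nu>"
  shows "visit_sum D z \<in> borel_measurable \<nu>"
  unfolding visit_sum_def by measurable

text \<open>Every visit at a positive time takes place at or after the first hit. Time 0 counts as a
  visit but never as a hit, which produces the separate indicator.\<close>

lemma visit_sum_renewal:
  assumes y: "y \<in> markov_space A" and z: "0 \<le> z"
  shows "visit_sum D z y = indicator D y + hit_sum D z (visit_sum D z) y"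
proof -
  let ?a = "\<lambda>k. ennreal (z ^ k) * indicator D ((lshift ^^ k) y) :: ennreal"
  have "visit_sum D z y = ?a 0 + (\<Sum>k. ?a (Suc k))"
    unfolding visit_sum_def using suminf_offset[of ?a 1] by simp
  also have "(\<Sum>k. ?a (Suc k)) = hit_sum D z (visit_sum D z) y"
  proof (cases "\<exists>n. y \<in> first_hit D n")
    case True
    then obtain n where n: "y \<in> first_hit D n" by blast
    then have n0: "0 < n" "\<And>k. 0 < k \<Longrightarrow> k < n \<Longrightarrow> ?a k = 0" by (auto simp: first_hit_def)
    have "(\<Sum>k. ?a (Suc k)) = (\<Sum>k. ?a (Suc (k + (n - 1)))) + (\<Sum>k<n - 1. ?a (Suc k))"
      by (rule suminf_offset[of "\<lambda>k. ?a (Suc k)" "n - 1", simplified add.commute[of "sum _ _"]]) simp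
    also have "(\<Sum>k<n - 1. ?a (Suc k)) = 0" by (intro sum.neutral ballI n0(2)) auto
    also have "(\<Sum>k. ?a (Suc (k + (n - 1)))) = (\<Sum>k. ennreal (z ^ n) * (ennreal (z ^ k) * indicator D ((lshift ^^ k) ((lshift ^^ n) y))))"
    proof (rule suminf_cong)
      fix k
      have "(lshift ^^ (k + n)) y = (lshift ^^ k) ((lshift ^^ n) y)" by (simp add: funpow_add)
      then show "?a (Suc (k + (n - 1))) = ennreal (z ^ n) * (ennreal (z ^ k) * indicator D ((lshift ^^ k) ((lshift ^^ n) y)))"
        using n0(1) z by (simp add: power_add ennreal_mult mult_ac)
    qed
    also have "\<dots> = hit_sum D z (visit_sum D z) y"
      unfolding hit_sum_hit[OF n] visit_sum_def by simp
    finally show ?thesis by simp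
  next
    case False
    have "?a (Suc k) = 0" for k
      using first_hit_exists[OF y, of "Suc k" D] False by (auto simp: indicator_def simp del: funpow.simps)
    then have "(\<Sum>k. ?a (Suc k)) = 0" by (simp only: suminf_zero)
    then show ?thesis using False by (simp add: hit_sum_no_hit)
  qed
  finally show ?thesis by simp
qed

end

section \<open>Asymptotics of hitting times\<close>

text \<open>A squeeze with an auxiliary parameter: for each fixed m the bounds converge as n grows,
  and their limits close up only when m grows afterwards. This is how constants such as
  \<open>distortion m\<close> are removed.\<close>

lemma tendsto_squeeze_family:
  fixes L :: "'a::order_topology"
  assumes ev: "\<And>m. start \<le> m \<Longrightarrow> \<forall>\<^sub>F n in sequentially. lo m n \<le> G n \<and> G n \<le> up m n"
    and lo: "\<And>m. start \<le> m \<Longrightarrow> (\<lambda>n. lo m n) \<longlonglongrightarrow> Lo m" and up: "\<And>m. start \<le> m \<Longrightarrow> (\<lambda>n. up m n) \<longlonglongrightarrow> Up m"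
    and Lo: "Lo \<longlonglongrightarrow> L" and Up: "Up \<longlonglongrightarrow> L"
  shows "G \<longlonglongrightarrow> L"
proof (rule order_tendstoI)
  fix a assume "a < L"
  then have "\<forall>\<^sub>F m in sequentially. a < Lo m \<and> start \<le> m"
    using order_tendstoD(1)[OF Lo] eventually_ge_at_top by (auto intro: eventually_conj)
  then obtain m where m: "a < Lo m" "start \<le> m" by (auto simp: eventually_sequentially)
  show "\<forall>\<^sub>F n in sequentially. a < G n"
    using order_tendstoD(1)[OF lo[OF m(2)] m(1)] ev[OF m(2)] by eventually_elim auto
next
  fix a assume "L < a"
  then have "\<forall>\<^sub>F m in sequentially. Up m < a \<and> start \<le> m"
    using order_tendstoD(2)[OF Up] eventually_ge_at_top by (auto intro: eventually_conj)
  then obtain m where m: "Up m < a" "start \<le> m" by (auto simp: eventually_sequentially)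
  show "\<forall>\<^sub>F n in sequentially. G n < a"
    using order_tendstoD(2)[OF up[OF m(2)] m(1)] ev[OF m(2)] by eventually_elim auto
qed

section \<open>The discounted Green function on shrinking cylinders\<close>

context walters_system
begin

definition green :: "real \<Rightarrow> ((nat \<Rightarrow> 'v) \<Rightarrow> ennreal) \<Rightarrow> (nat \<Rightarrow> 'v) \<Rightarrow> ennreal" where
  "green z f y = (\<Sum>k. ennreal (z ^ k) * Pit k f y)"

lemma green_measurable [measurable]: "f \<in> borel_measurable \<nu> \<Longrightarrow> green z f \<in> borel_measurable \<nu>"
  unfolding green_def by measurable

lemma visit_sum_integral:
  assumes [measurable]: "D \<in> sets \<nu>" "f \<in> borel_measurable \<nu>"
  shows "(\<integral>\<^sup>+y. f y * visit_sum D z y \<partial>\<nu>) = (\<integral>\<^sup>+y. green z f y * indicator D y \<partial>\<nu>)"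
proof -
  have "(\<integral>\<^sup>+y. f y * visit_sum D z y \<partial>\<nu>) = (\<integral>\<^sup>+y. (\<Sum>k. ennreal (z ^ k) * (f y * indicator D ((lshift ^^ k) y))) \<partial>\<nu>)"
    unfolding visit_sum_def by (intro nn_integral_cong) (simp add: mult_ac flip: ennreal_suminf_cmult)
  also have "\<dots> = (\<Sum>k. ennreal (z ^ k) * (\<integral>\<^sup>+y. f y * indicator D ((lshift ^^ k) y) \<partial>\<nu>))"
    by (subst nn_integral_suminf) (auto simp: nn_integral_cmult)
  also have "\<dots> = (\<Sum>k. ennreal (z ^ k) * (\<integral>\<^sup>+y. Pit k f y * indicator D y \<partial>\<nu>))"
    by (subst Pit_dual) auto
  also have "\<dots> = (\<integral>\<^sup>+y. (\<Sum>k. ennreal (z ^ k) * (Pit k f y * indicator D y)) \<partial>\<nu>)"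
    by (subst nn_integral_suminf) (auto simp: nn_integral_cmult)
  also have "\<dots> = (\<integral>\<^sup>+y. green z f y * indicator D y \<partial>\<nu>)"
    unfolding green_def by (intro nn_integral_cong) (simp add: mult_ac flip: ennreal_suminf_cmult)
  finally show ?thesis .
qed

lemma green_mono: "(\<And>u. u \<in> markov_space A \<Longrightarrow> f u \<le> g u) \<Longrightarrow> green z f y \<le> green z g y"
  unfolding green_def by (intro suminf_le mult_left_mono Pit_mono) auto

lemma green_cmult: "green z (\<lambda>u. c * f u) y = c * green z f y"
  unfolding green_def Pit_cmult by (simp add: mult.left_commute flip: ennreal_suminf_cmult)

end

text \<open>The renewal argument needs only a time scale \<open>\<gamma>\<close> and a limit
  \<open>\<kappa>\<close> of the rescaled Green function, so regular variation stays outside.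
  \<open>gamma_small\<close> makes times of order n invisible, and \<open>kappa_infinity\<close>,
  the form recurrence takes here, prevents mass from escaping to infinite waiting times.\<close>

locale hitting_asymptotics = periodic_point +
  fixes \<gamma> :: "nat \<Rightarrow> real" and \<kappa> :: "real \<Rightarrow> real"
  assumes gamma_pos: "\<And>n. 0 < \<gamma> n"
    and gamma_small: "(\<lambda>n. real n * \<gamma> n) \<longlonglongrightarrow> 0"
    and kappa_pos: "\<And>s. 0 < s \<Longrightarrow> 0 < \<kappa> s"
    and kappa_infinity: "filterlim (\<lambda>m. \<kappa> (1 / real (Suc m))) at_top sequentially"
    and green_limit: "\<And>w. w \<noteq> [] \<Longrightarrow> AE y in \<nu>. \<forall>s>0.
      (\<lambda>n. ennreal (measure \<nu> (B n)) * green (exp (- s * \<gamma> n)) (indicator (cylinder A w)) y)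
        \<longlonglongrightarrow> ennreal (h y / h x * measure \<nu> (cylinder A w) * \<kappa> s)"
begin

lemma green_distortion:
  assumes "1 \<le> N" "y \<in> B N" "y' \<in> B N" "length w \<le> N"
  shows "green z (indicator (cylinder A w)) y \<le> ennreal (distortion N) * green z (indicator (cylinder A w)) y'"
proof -
  have "Pit k (indicator (cylinder A w)) y \<le> ennreal (distortion N) * Pit k (indicator (cylinder A w)) y'" for k
    by (rule Pit_distortion[OF assms(1)])
       (use assms in \<open>auto simp: mem_B mem_cylinder indicator_def\<close>)
  then have "green z (indicator (cylinder A w)) y \<le> (\<Sum>k. ennreal (distortion N) * (ennreal (z ^ k) * Pit k (indicator (cylinder A w)) y'))"
    unfolding green_def by (intro suminf_le) (auto simp: mult.left_commute intro!: mult_left_mono)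
  then show ?thesis by (simp add: green_def)
qed

text \<open>The pointwise limit holds almost everywhere, while \<open>B n\<close> shrinks to one
  point and no majorant is at hand. Instead a single good point is fixed in each \<open>B m\<close>;
  distortion compares it with all points of \<open>B n\<close> for n >= m. Then m grows, which
  removes the distortion and moves the value of h at the good point to h x.\<close>

lemma green_integral_limit:
  assumes w: "w \<noteq> []" and s: "0 < s"
  shows "(\<lambda>n. \<integral>\<^sup>+y. green (exp (- s * \<gamma> n)) (indicator (cylinder A w)) y * indicator (B n) y \<partial>\<nu>)
    \<longlonglongrightarrow> ennreal (measure \<nu> (cylinder A w) * \<kappa> s)"
proof -
  let ?C = "cylinder A w" and ?L = "measure \<nu> (cylinder A w) * \<kappa> s"
  let ?g = "\<lambda>n y. green (exp (- s * \<gamma> n)) (indicator ?C) y"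
  have L: "0 \<le> ?L" using kappa_pos[OF s] by simp
  \<comment> \<open>\<open>B m\<close> has positive measure, so it cannot lie inside the exceptional
    null set.\<close>
  have "\<exists>y. y \<in> B m \<and> (\<lambda>n. ennreal (measure \<nu> (B n)) * ?g n y) \<longlonglongrightarrow> ennreal (h y / h x * measure \<nu> ?C * \<kappa> s)" for m
  proof (rule ccontr)
    assume neg: "\<not> ?thesis"
    have "AE y in \<nu>. y \<notin> B m"
      using green_limit[OF w]
    proof eventually_elim
      case (elim y)
      then show ?case using neg s by blast
    qed
    then have "emeasure \<nu> (B m) = 0"
      by (subst (asm) AE_iff_measurable[OF B_sets, of _ m]) (auto simp: space_nu mem_B)
    then show False using cylinder_positive[OF x_mem, of m] by (simp add: B_def)
  qed
  then have "\<exists>y0. \<forall>m. y0 m \<in> B m \<and> (\<lambda>n. ennreal (measure \<nu> (B n)) * ?g n (y0 m)) \<longlonglongrightarrow> ennreal (h (y0 m) / h x * measure \<nu> ?C * \<kappa> s)"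
    by (intro choice allI)
  then obtain y0 where y0: "\<And>m. y0 m \<in> B m"
    "\<And>m. (\<lambda>n. ennreal (measure \<nu> (B n)) * ?g n (y0 m)) \<longlonglongrightarrow> ennreal (h (y0 m) / h x * measure \<nu> ?C * \<kappa> s)"
    by (elim exE) blast
  have "(\<lambda>m. h (y0 m)) \<longlonglongrightarrow> h x"
  proof (rule LIMSEQ_I)
    fix e :: real assume "0 < e"
    then obtain n where "\<forall>m\<ge>n. \<forall>y\<in>B m. \<bar>h y - h x\<bar> < e"
      using h_near[OF x_mem] unfolding B_def by blast
    then show "\<exists>n. \<forall>m\<ge>n. norm (h (y0 m) - h x) < e" using y0(1) by (intro exI[of _ n]) auto
  qed
  then have r: "(\<lambda>m. h (y0 m) / h x) \<longlonglongrightarrow> 1"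
    using tendsto_divide[of "\<lambda>m. h (y0 m)" "h x" sequentially "\<lambda>_. h x" "h x"] h_pos[OF x_mem] by simp
  have r_pos: "0 \<le> h (y0 m) / h x" for m
    using h_pos[OF x_mem] h_pos[of "y0 m"] y0(1)[of m] by (simp add: mem_B)
  define c where "c m n = ennreal (measure \<nu> (B n)) * ?g n (y0 m)" for m n
  have c: "c m \<longlonglongrightarrow> ennreal (h (y0 m) / h x * ?L)" for m
    using y0(2)[of m] by (simp add: c_def[abs_def] mult.assoc)
  have D: "0 < distortion m" for m using distortion_ge_1[of m] by linarith
  show ?thesis
  proof (rule tendsto_squeeze_family[where start="max 1 (length w)" and lo="\<lambda>m n. ennreal (1 / distortion m) * c m n"
        and up="\<lambda>m n. ennreal (distortion m) * c m n"
        and Lo="\<lambda>m. ennreal (1 / distortion m) * ennreal (h (y0 m) / h x * ?L)"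
        and Up="\<lambda>m. ennreal (distortion m) * ennreal (h (y0 m) / h x * ?L)"])
    fix m assume m: "max 1 (length w) \<le> m"
    show "(\<lambda>n. ennreal (1 / distortion m) * c m n) \<longlonglongrightarrow> ennreal (1 / distortion m) * ennreal (h (y0 m) / h x * ?L)"
      "(\<lambda>n. ennreal (distortion m) * c m n) \<longlonglongrightarrow> ennreal (distortion m) * ennreal (h (y0 m) / h x * ?L)"
      by (intro ennreal_tendsto_cmult c; simp)+
    show "\<forall>\<^sub>F n in sequentially. ennreal (1 / distortion m) * c m n \<le> (\<integral>\<^sup>+y. ?g n y * indicator (B n) y \<partial>\<nu>) \<and>
       (\<integral>\<^sup>+y. ?g n y * indicator (B n) y \<partial>\<nu>) \<le> ennreal (distortion m) * c m n"
      using eventually_ge_at_top[of m]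
    proof eventually_elim
      case (elim n)
      have em: "emeasure \<nu> (B n) = ennreal (measure \<nu> (B n))" using elim m by (intro B_emeasure) auto
      have sub: "y \<in> B n \<Longrightarrow> y \<in> B m" for y using B_mono[OF elim] by auto
      have "ennreal (1 / distortion m) * c m n = (\<integral>\<^sup>+y. (ennreal (1 / distortion m) * ?g n (y0 m)) * indicator (B n) y \<partial>\<nu>)"
        unfolding c_def by (subst nn_integral_cmult_indicator) (auto simp: em mult_ac)
      also have "\<dots> \<le> (\<integral>\<^sup>+y. ?g n y * indicator (B n) y \<partial>\<nu>)"
      proof (intro nn_integral_mono)
        fix y
        show "(ennreal (1 / distortion m) * ?g n (y0 m)) * indicator (B n) y \<le> ?g n y * indicator (B n) y"
        proof (cases "y \<in> B n")
          case True
          have "ennreal (1 / distortion m) * ?g n (y0 m) \<le> ennreal (1 / distortion m) * (ennreal (distortion m) * ?g n y)"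
            by (intro mult_left_mono green_distortion y0 sub[OF True]) (use m in auto)
          also have "\<dots> = ?g n y"
            using D[of m] by (simp add: mult.assoc[symmetric] ennreal_mult[symmetric])
          finally show ?thesis using True by simp
        qed simp
      qed
      moreover have "(\<integral>\<^sup>+y. ?g n y * indicator (B n) y \<partial>\<nu>)
          \<le> (\<integral>\<^sup>+y. (ennreal (distortion m) * ?g n (y0 m)) * indicator (B n) y \<partial>\<nu>)"
      proof (intro nn_integral_mono)
        fix y
        show "?g n y * indicator (B n) y \<le> (ennreal (distortion m) * ?g n (y0 m)) * indicator (B n) y"
          using green_distortion[of m y "y0 m" w, OF _ sub y0(1)] m by (cases "y \<in> B n") auto
      qed
      moreover have "(\<integral>\<^sup>+y. (ennreal (distortion m) * ?g n (y0 m)) * indicator (B n) y \<partial>\<nu>) = ennreal (distortion m) * c m n"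
        unfolding c_def by (subst nn_integral_cmult_indicator) (auto simp: em mult_ac)
      ultimately show ?case by simp
    qed
  next
    have "(\<lambda>m. 1 / distortion m * (h (y0 m) / h x * ?L)) \<longlonglongrightarrow> 1 / 1 * (1 * ?L)"
      by (intro tendsto_intros distortion_tendsto r) auto
    then have "(\<lambda>m. ennreal (1 / distortion m * (h (y0 m) / h x * ?L))) \<longlonglongrightarrow> ennreal ?L"
      by (intro tendsto_ennrealI) simp
    moreover have "ennreal (1 / distortion m) * ennreal (h (y0 m) / h x * ?L) = ennreal (1 / distortion m * (h (y0 m) / h x * ?L))" for m
      using mult_nonneg_nonneg[OF r_pos L, of m] D[of m] by (intro ennreal_mult[symmetric]) auto
    ultimately show "(\<lambda>m. ennreal (1 / distortion m) * ennreal (h (y0 m) / h x * ?L)) \<longlonglongrightarrow> ennreal ?L"  by (simp only:)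
    have "(\<lambda>m. distortion m * (h (y0 m) / h x * ?L)) \<longlonglongrightarrow> 1 * (1 * ?L)"
      by (intro tendsto_intros distortion_tendsto r)
    then have "(\<lambda>m. ennreal (distortion m * (h (y0 m) / h x * ?L))) \<longlonglongrightarrow> ennreal ?L"
      by (intro tendsto_ennrealI) simp
    moreover have "ennreal (distortion m) * ennreal (h (y0 m) / h x * ?L) = ennreal (distortion m * (h (y0 m) / h x * ?L))" for m
      using mult_nonneg_nonneg[OF r_pos L, of m] D[of m] by (intro ennreal_mult[symmetric]) auto
    ultimately show "(\<lambda>m. ennreal (distortion m) * ennreal (h (y0 m) / h x * ?L)) \<longlonglongrightarrow> ennreal ?L" by (simp only:)
  qed
qed

end

section \<open>Short returns and late returns to the cylinder\<close>

context periodic_point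
begin

lemma measure_B_power: "(\<lambda>n. measure \<nu> (B (n + q * j)) / measure \<nu> (B n)) \<longlonglongrightarrow> \<rho> ^ j"
proof (induction j)
  case 0
  have "\<forall>\<^sub>F n in sequentially. measure \<nu> (B (n + q * 0)) / measure \<nu> (B n) = 1"
    using eventually_ge_at_top[of 1] by eventually_elim (use B_pos in force)
  then show ?case by (simp add: tendsto_eventually)
next
  case (Suc j)
  have "(\<lambda>n. measure \<nu> (B (n + q * j + q)) / measure \<nu> (B (n + q * j))) \<longlonglongrightarrow> \<rho>"
    using LIMSEQ_ignore_initial_segment[OF measure_B_ratio, of "q * j"] .
  from tendsto_mult[OF this Suc]
  have "(\<lambda>n. measure \<nu> (B (n + q * j + q)) / measure \<nu> (B (n + q * j)) * (measure \<nu> (B (n + q * j)) / measure \<nu> (B n)))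
      \<longlonglongrightarrow> \<rho> ^ Suc j" by simp
  moreover have "\<forall>\<^sub>F n in sequentially. measure \<nu> (B (n + q * j + q)) / measure \<nu> (B (n + q * j)) * (measure \<nu> (B (n + q * j)) / measure \<nu> (B n))
      = measure \<nu> (B (n + q * Suc j)) / measure \<nu> (B n)"
    using eventually_ge_at_top[of 1]
  proof eventually_elim
    case (elim n)
    then show ?case using B_pos[of "n + q * j"] by (simp add: add_ac)
  qed
  ultimately show ?case by (rule Lim_transform_eventually)
qed

text \<open>Uniformity in j is the point: one threshold on n serves all periods at once, which
  yields the summable majorant for \<open>return_part_limit\<close> and the decay used in
  \<open>square_measure_B\<close>.\<close>

lemma measure_B_geometric:
  assumes "\<rho> < \<sigma>"
  shows "\<forall>\<^sub>F n in sequentially. 1 \<le> n \<and> (\<forall>j. measure \<nu> (B (n + q * j)) \<le> \<sigma> ^ j * measure \<nu> (B n))"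
proof -
  have "\<forall>\<^sub>F n in sequentially. measure \<nu> (B (n + q)) / measure \<nu> (B n) < \<sigma>"
    using order_tendstoD(2)[OF measure_B_ratio assms] .
  then obtain n0 where n0: "\<And>n. n \<ge> n0 \<Longrightarrow> measure \<nu> (B (n + q)) / measure \<nu> (B n) < \<sigma>"
    by (auto simp: eventually_sequentially)
  have \<sigma>: "0 < \<sigma>" using assms rho_pos by linarith
  have "measure \<nu> (B (n + q * j)) \<le> \<sigma> ^ j * measure \<nu> (B n)" if n: "max 1 n0 \<le> n" for n j
  proof (induction j)
    case (Suc j)
    have "measure \<nu> (B (n + q * j + q)) \<le> \<sigma> * measure \<nu> (B (n + q * j))"
      using n0[of "n + q * j"] B_pos[of "n + q * j"] n by (simp add: divide_less_eq)
    also have "\<dots> \<le> \<sigma> * (\<sigma> ^ j * measure \<nu> (B n))" using Suc \<sigma> by simp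
    finally show ?case by (simp add: add_ac mult_ac)
  qed simp
  then show ?thesis
    unfolding eventually_sequentially by (intro exI[of _ "max 1 n0"]) auto
qed

text \<open>The discounted probability of a visit at time k when the start is uniform on
  \<open>B n\<close>, kept for k < n - M only. With M >= q these are the times covered by
  \<open>return_multiple_set\<close>.\<close>

definition return_part :: "nat \<Rightarrow> real \<Rightarrow> nat \<Rightarrow> nat \<Rightarrow> real" where
  "return_part M z n k = (if k < n - M \<and> q dvd k then z ^ k * (measure \<nu> (B (n + k)) / measure \<nu> (B n)) else 0)"

text \<open>For k = q j the term tends to \<open>\<rho> ^ j\<close>, the other terms vanish, and the
  sum and the limit are exchanged by Tannery's theorem. The geometric series is the mean size of a
  cluster.\<close>

lemma return_part_limit:
  assumes z: "\<And>n. 0 \<le> z n" "\<And>n. z n \<le> 1" "z \<longlonglongrightarrow> 1"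
  shows "(\<lambda>n. \<Sum>k. return_part M (z n) n k) \<longlonglongrightarrow> 1 / (1 - \<rho>)"
proof -
  \<comment> \<open>Any number strictly between \<open>\<rho>\<close> and 1 would do; it leaves room
    for the ratios of measures to exceed their limit.\<close>
  define \<sigma> where "\<sigma> = (1 + \<rho>) / 2"
  have \<sigma>: "\<rho> < \<sigma>" "\<sigma> < 1" "0 < \<sigma>" using rho_less_1 rho_pos by (auto simp: \<sigma>_def)
  define b where "b r k = (if q dvd k then r ^ (k div q) else 0)" for r :: real and k
  have b_sums: "b r sums (1 / (1 - r))" if "0 < r" "r < 1" for r
  proof -
    have "strict_mono (\<lambda>j. q * j)" using q_pos by (simp add: strict_mono_def)
    moreover have "b r k = 0" if "k \<notin> range (\<lambda>j. q * j)" for k using that by (auto simp: b_def)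
    moreover have "(\<lambda>j. b r (q * j)) sums (1 / (1 - r))"
      using geometric_sums[of r] that q_pos by (simp add: b_def)
    ultimately show ?thesis using sums_mono_reindex[of "\<lambda>j. q * j" "b r" "1 / (1 - r)"] by blast
  qed
  have lim: "(\<lambda>n. return_part M (z n) n k) \<longlonglongrightarrow> b \<rho> k" for k
  proof (cases "q dvd k")
    case True
    then obtain j where k: "k = q * j" by blast
    have "(\<lambda>n. z n ^ k * (measure \<nu> (B (n + q * j)) / measure \<nu> (B n))) \<longlonglongrightarrow> 1 ^ k * \<rho> ^ j"
      by (intro tendsto_intros z measure_B_power)
    moreover have "\<forall>\<^sub>F n in sequentially. z n ^ k * (measure \<nu> (B (n + q * j)) / measure \<nu> (B n)) = return_part M (z n) n k"
      using eventually_gt_at_top[of "k + M"] by eventually_elim (use True in \<open>auto simp: return_part_def k\<close>)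
    ultimately show ?thesis using q_pos by (auto simp: b_def k intro: Lim_transform_eventually)
  qed (simp add: return_part_def b_def)
  have "\<forall>\<^sub>F n in sequentially. \<forall>k. norm (return_part M (z n) n k) \<le> b \<sigma> k"
    using measure_B_geometric[OF \<sigma>(1)]
  proof eventually_elim
    case (elim n)
    show ?case
    proof
      fix k
      show "norm (return_part M (z n) n k) \<le> b \<sigma> k"
      proof (cases "k < n - M \<and> q dvd k")
        case True
        then obtain j where k: "k = q * j" by blast
        have "measure \<nu> (B (n + q * j)) / measure \<nu> (B n) \<le> \<sigma> ^ j"
          using elim B_pos[of n] by (simp add: divide_le_eq)
        then have "z n ^ k * (measure \<nu> (B (n + q * j)) / measure \<nu> (B n)) \<le> 1 * \<sigma> ^ j"
          using z by (intro mult_mono) (auto simp: power_le_one)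
        then show ?thesis using True q_pos z by (simp add: return_part_def b_def k)
      qed (use \<sigma> in \<open>simp add: return_part_def b_def\<close>)
    qed
  qed
  from eventually_prodI[OF eventually_True this, of at_top]
  have bound: "\<forall>\<^sub>F (k, n) in at_top \<times>\<^sub>F sequentially. norm (return_part M (z n) n k) \<le> b \<sigma> k"
    by (rule eventually_mono) auto
  have "(\<lambda>n. \<Sum>k. return_part M (z n) n k) \<longlonglongrightarrow> suminf (b \<rho>)"
    using tannerys_theorem[OF lim bound] b_sums[OF \<sigma>(3,2)] by (auto simp: sums_iff)
  then show ?thesis using b_sums[OF rho_pos rho_less_1] by (simp add: sums_iff)
qed

lemma return_part_summable: "summable (return_part M z n)"
  by (rule summable_finite[of "{..<n - M}"]) (auto simp: return_part_def)

text \<open>These words are what is left of \<open>B n\<close> after all but its last M letters have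
  been shifted away. By periodicity there are at most q of them for each M.\<close>

definition window :: "nat \<Rightarrow> nat \<Rightarrow> 'a list" where
  "window M i = map (\<lambda>t. x (i + t)) [0..<M]"

lemma window_mod: "window M (i mod q) = window M i"
proof -
  have "x (i mod q + t) = x (i + t)" for t
    using periodic_coord[OF q_per, of "i mod q + t" "i div q"] by (simp add: add_ac)
  then show ?thesis by (simp add: window_def)
qed

lemma window_pos: "1 \<le> M \<Longrightarrow> 0 < measure \<nu> (cylinder A (window M i))"
proof -
  assume M: "1 \<le> M"
  have w: "window M i = map ((lshift ^^ i) x) [0..<M]" by (simp add: window_def lshift_funpow)
  have "0 < emeasure \<nu> (cylinder A (window M i))"
    unfolding w by (rule cylinder_positive[OF lshift_markov[OF x_mem]])
  moreover have "emeasure \<nu> (cylinder A (window M i)) < \<infinity>"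
    using M by (intro cylinder_finite) (auto simp: window_def)
  ultimately show ?thesis by (simp add: measure_def enn2real_positive_iff)
qed

text \<open>After n - M steps only the last M letters of the word defining \<open>B n\<close> still
  constrain the point. The image of the indicator is thus supported on the window cylinder and
  constant there up to \<open>distortion M\<close>; its integral is still the measure of
  \<open>B n\<close>, which fixes the constant.\<close>

lemma Pit_B_window:
  assumes M: "1 \<le> M" "M \<le> n" and u: "u \<in> markov_space A"
  defines "C \<equiv> cylinder A (window M (n - M))"
  shows "Pit (n - M) (indicator (B n)) u \<le> ennreal (distortion M * (measure \<nu> (B n) / measure \<nu> C)) * indicator C u"
    and "ennreal (1 / distortion M * (measure \<nu> (B n) / measure \<nu> C)) * indicator C u \<le> Pit (n - M) (indicator (B n)) u"
proof -
  let ?p = "Pit (n - M) (indicator (B n))"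
  have mC: "u \<in> C \<longleftrightarrow> u \<in> markov_space A \<and> (\<forall>t<M. u t = x (n - M + t))" for u
    by (auto simp: C_def mem_cylinder window_def)
  have C_sets [measurable]: "C \<in> sets \<nu>" by (simp add: C_def)
  have C_em: "emeasure \<nu> C = ennreal (measure \<nu> C)"
    using cylinder_finite[of "window M (n - M)"] M by (auto simp: C_def window_def emeasure_eq_ennreal_measure less_top)
  have C_pos: "0 < measure \<nu> C" unfolding C_def by (rule window_pos[OF M(1)])
  have n: "1 \<le> n" using M by simp
  have zero: "?p v = 0" if "v \<in> markov_space A" "v \<notin> C" for v
  proof -
    have "indicator (B n) z = (0::ennreal)" if z: "z \<in> markov_space A" "(lshift ^^ (n - M)) z = v" for z
    proof -
      have "z \<notin> B n"
      proof
        assume "z \<in> B n"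
        then have "v t = x (n - M + t)" if "t < M" for t
          using that M z(2)[symmetric] by (simp add: mem_B lshift_funpow)
        then show False using \<open>v \<notin> C\<close> \<open>v \<in> markov_space A\<close> by (simp add: mC)
      qed
      then show ?thesis by simp
    qed
    then have "ruelle_iter A \<phi> (n - M) (indicator (B n)) v = (\<integral>\<^sup>+z. 0 \<partial>count_space {z \<in> markov_space A. (lshift ^^ (n - M)) z = v})"
      unfolding ruelle_iter_def by (intro nn_integral_cong) auto
    then show ?thesis by (simp add: Pit_def)
  qed
  have dist: "?p v \<le> ennreal (distortion M) * ?p v'" if "v \<in> C" "v' \<in> C" for v v'
    by (rule Pit_distortion[OF M(1)]) (use that M in \<open>auto simp: mC mem_B indicator_def\<close>)
  have tot: "(\<integral>\<^sup>+v. ?p v \<partial>\<nu>) = ennreal (measure \<nu> (B n))"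
    using B_emeasure[OF n] by (simp add: Pit_integral)
  have D: "0 < distortion M" using distortion_ge_1[of M] by linarith
  have up: "?p v \<le> ennreal (distortion M * (measure \<nu> (B n) / measure \<nu> C))" if v: "v \<in> C" for v
  proof -
    have "ennreal (measure \<nu> C) * ?p v = (\<integral>\<^sup>+v'. ?p v * indicator C v' \<partial>\<nu>)"
      by (subst nn_integral_cmult_indicator) (auto simp: C_em mult.commute)
    also have "\<dots> \<le> (\<integral>\<^sup>+v'. ennreal (distortion M) * ?p v' \<partial>\<nu>)"
      by (intro nn_integral_mono) (use dist[OF v] in \<open>auto simp: indicator_def\<close>)
    also have "\<dots> = ennreal (distortion M * measure \<nu> (B n))"
      using D by (simp add: nn_integral_cmult tot ennreal_mult)
    finally have "ennreal (1 / measure \<nu> C) * (ennreal (measure \<nu> C) * ?p v)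
        \<le> ennreal (1 / measure \<nu> C) * ennreal (distortion M * measure \<nu> (B n))" by (rule mult_left_mono) simp
    then show ?thesis using C_pos D by (simp add: mult.assoc[symmetric] ennreal_mult[symmetric])
  qed
  have lo: "ennreal (1 / distortion M * (measure \<nu> (B n) / measure \<nu> C)) \<le> ?p v" if v: "v \<in> C" for v
  proof -
    have "ennreal (measure \<nu> (B n)) \<le> (\<integral>\<^sup>+v'. (ennreal (distortion M) * ?p v) * indicator C v' \<partial>\<nu>)"
      unfolding tot[symmetric]
    proof (rule nn_integral_mono)
      fix v' assume "v' \<in> space \<nu>"
      then show "?p v' \<le> (ennreal (distortion M) * ?p v) * indicator C v'"
        using dist[OF _ v, of v'] zero[of v'] by (cases "v' \<in> C") (auto simp: space_nu)
    qed
    also have "\<dots> = ennreal (distortion M * measure \<nu> C) * ?p v"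
      using D by (subst nn_integral_cmult_indicator) (auto simp: C_em ennreal_mult mult_ac)
    finally have "ennreal (1 / (distortion M * measure \<nu> C)) * ennreal (measure \<nu> (B n))
       \<le> ennreal (1 / (distortion M * measure \<nu> C)) * (ennreal (distortion M * measure \<nu> C) * ?p v)"
      by (rule mult_left_mono) simp
    also have "\<dots> = ?p v"
      using C_pos D by (simp add: mult.assoc[symmetric] ennreal_mult[symmetric])
    finally show ?thesis using C_pos D by (simp add: ennreal_mult[symmetric])
  qed
  show "?p u \<le> ennreal (distortion M * (measure \<nu> (B n) / measure \<nu> C)) * indicator C u"
    using up[of u] zero[OF u] by (cases "u \<in> C") auto
  show "ennreal (1 / distortion M * (measure \<nu> (B n) / measure \<nu> C)) * indicator C u \<le> ?p u"
    using lo[of u] by (cases "u \<in> C") auto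
qed

text \<open>The series of visits is cut at time n - M. Before it the return events are cylinders and
  are evaluated exactly; from then on n - M steps are taken off every term, which leaves the Green
  function of an almost fixed function.\<close>

lemma visit_split:
  assumes M: "q \<le> M" "M \<le> n" and z: "0 \<le> z" "z \<le> 1"
  shows "(\<integral>\<^sup>+y. indicator (B n) y * visit_sum (B n) z y \<partial>\<nu>)
    = ennreal (measure \<nu> (B n) * (\<Sum>k. return_part M z n k))
      + ennreal (z ^ (n - M)) * (\<integral>\<^sup>+y. green z (Pit (n - M) (indicator (B n))) y * indicator (B n) y \<partial>\<nu>)"
proof -
  have n: "1 \<le> n" using M q_pos by simp
  let ?I = "indicator (B n) :: _ \<Rightarrow> ennreal"
  define Q where "Q k = (\<integral>\<^sup>+y. Pit k ?I y * ?I y \<partial>\<nu>)" for k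
  have Q_em: "Q k = emeasure \<nu> (B n \<inter> (lshift ^^ k) -` B n)" for k
  proof -
    have "Q k = (\<integral>\<^sup>+y. ?I y * ?I ((lshift ^^ k) y) \<partial>\<nu>)" unfolding Q_def by (rule Pit_dual) auto
    also have "\<dots> = (\<integral>\<^sup>+y. indicator (B n \<inter> (lshift ^^ k) -` B n) y \<partial>\<nu>)"
      by (intro nn_integral_cong) (auto simp: indicator_def)
    also have "\<dots> = emeasure \<nu> (B n \<inter> (lshift ^^ k) -` B n)"
    proof (rule nn_integral_indicator)
      have "B n \<inter> (lshift ^^ k) -` B n = B n \<inter> ((lshift ^^ k) -` B n \<inter> space \<nu>)"
        by (auto simp: space_nu mem_B)
      then show "B n \<inter> (lshift ^^ k) -` B n \<in> sets \<nu>" by simp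
    qed
    finally show ?thesis .
  qed
  have "(\<integral>\<^sup>+y. ?I y * visit_sum (B n) z y \<partial>\<nu>) = (\<integral>\<^sup>+y. green z ?I y * ?I y \<partial>\<nu>)"
    by (rule visit_sum_integral) auto
  also have "\<dots> = (\<integral>\<^sup>+y. (\<Sum>k. ennreal (z ^ k) * (Pit k ?I y * ?I y)) \<partial>\<nu>)"
    unfolding green_def by (intro nn_integral_cong) (simp add: mult_ac flip: ennreal_suminf_cmult)
  also have "\<dots> = (\<Sum>k. ennreal (z ^ k) * Q k)"
    unfolding Q_def by (subst nn_integral_suminf) (auto simp: nn_integral_cmult)
  also have "\<dots> = (\<Sum>k. ennreal (z ^ (k + (n - M))) * Q (k + (n - M))) + (\<Sum>k<n - M. ennreal (z ^ k) * Q k)"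
    by (rule suminf_offset) simp
  also have "(\<Sum>k<n - M. ennreal (z ^ k) * Q k) = (\<Sum>k<n - M. ennreal (measure \<nu> (B n) * return_part M z n k))"
  proof (rule sum.cong)
    fix k assume k: "k \<in> {..<n - M}"
    then have "k + q \<le> n" using M by auto
    then have "Q k = (if q dvd k then emeasure \<nu> (B (n + k)) else 0)"
      unfolding Q_em by (simp add: return_multiple_set)
    then show "ennreal (z ^ k) * Q k = ennreal (measure \<nu> (B n) * return_part M z n k)"
      using k n z B_emeasure[of "n + k"] B_pos[of n] by (auto simp: return_part_def ennreal_mult[symmetric])
  qed simp
  also have "\<dots> = ennreal (measure \<nu> (B n) * (\<Sum>k<n - M. return_part M z n k))"
    using z by (subst sum_ennreal) (auto simp: return_part_def sum_distrib_left)
  also have "(\<Sum>k<n - M. return_part M z n k) = (\<Sum>k. return_part M z n k)"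
    by (rule suminf_finite[symmetric]) (auto simp: return_part_def)
  also have "(\<Sum>k. ennreal (z ^ (k + (n - M))) * Q (k + (n - M)))
      = (\<Sum>k. ennreal (z ^ (n - M)) * (ennreal (z ^ k) * (\<integral>\<^sup>+y. Pit k (Pit (n - M) ?I) y * ?I y \<partial>\<nu>)))"
  proof (rule suminf_cong)
    fix k
    have "Q (k + (n - M)) = (\<integral>\<^sup>+y. Pit k (Pit (n - M) ?I) y * ?I y \<partial>\<nu>)"
      unfolding Q_def by (intro nn_integral_cong) (simp add: Pit_add space_nu)
    then show "ennreal (z ^ (k + (n - M))) * Q (k + (n - M))
      = ennreal (z ^ (n - M)) * (ennreal (z ^ k) * (\<integral>\<^sup>+y. Pit k (Pit (n - M) ?I) y * ?I y \<partial>\<nu>))"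
      using z by (simp add: power_add ennreal_mult mult_ac)
  qed
  also have "\<dots> = ennreal (z ^ (n - M)) * (\<Sum>k. ennreal (z ^ k) * (\<integral>\<^sup>+y. Pit k (Pit (n - M) ?I) y * ?I y \<partial>\<nu>))"
    by simp
  also have "(\<Sum>k. ennreal (z ^ k) * (\<integral>\<^sup>+y. Pit k (Pit (n - M) ?I) y * ?I y \<partial>\<nu>))
      = (\<integral>\<^sup>+y. green z (Pit (n - M) ?I) y * ?I y \<partial>\<nu>)"
  proof -
    have "(\<integral>\<^sup>+y. green z (Pit (n - M) ?I) y * ?I y \<partial>\<nu>) = (\<integral>\<^sup>+y. (\<Sum>k. ennreal (z ^ k) * (Pit k (Pit (n - M) ?I) y * ?I y)) \<partial>\<nu>)"
      unfolding green_def by (intro nn_integral_cong) (simp add: mult_ac flip: ennreal_suminf_cmult)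
    then show ?thesis by (subst (asm) nn_integral_suminf) (auto simp: nn_integral_cmult)
  qed
  finally show ?thesis by (simp add: add.commute)
qed


text \<open>A positive limit of this decreasing sequence would force the ratios of
  \<open>measure_B_ratio\<close> to tend to 1, against \<open>rho_less_1\<close>.\<close>

lemma measure_B_tendsto_0: "(\<lambda>n. measure \<nu> (B n)) \<longlonglongrightarrow> 0"
proof -
  have "decseq (\<lambda>n. measure \<nu> (B (Suc n)))"
  proof (rule decseq_SucI)
    fix n
    show "measure \<nu> (B (Suc (Suc n))) \<le> measure \<nu> (B (Suc n))"
    proof -
      have "emeasure \<nu> (B (Suc (Suc n))) \<le> emeasure \<nu> (B (Suc n))" by (intro emeasure_mono B_mono) auto
      then show ?thesis by (subst (asm) (1 2) B_emeasure) (auto simp: ennreal_le_iff)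
    qed
  qed
  then obtain L where L: "(\<lambda>n. measure \<nu> (B (Suc n))) \<longlonglongrightarrow> L"
    using decseq_convergent[of "\<lambda>n. measure \<nu> (B (Suc n))" 0] by auto
  then have L1: "(\<lambda>n. measure \<nu> (B n)) \<longlonglongrightarrow> L" by (subst (asm) filterlim_sequentially_Suc)
  have "L = 0"
  proof (rule ccontr)
    assume "L \<noteq> 0"
    then have "(\<lambda>n. measure \<nu> (B (n + q)) / measure \<nu> (B n)) \<longlonglongrightarrow> L / L"
      by (intro tendsto_divide L1 LIMSEQ_ignore_initial_segment[OF L1])
    then have "\<rho> = 1" using LIMSEQ_unique[OF measure_B_ratio] \<open>L \<noteq> 0\<close> by fastforce
    then show False using rho_less_1 by simp
  qed
  then show ?thesis using L1 by simp
qed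

end

context hitting_asymptotics
begin

lemma gamma_tendsto_0: "\<gamma> \<longlonglongrightarrow> 0"
proof (rule tendsto_sandwich[OF _ _ tendsto_const gamma_small])
  show "\<forall>\<^sub>F n in sequentially. 0 \<le> \<gamma> n" using gamma_pos by (auto intro: always_eventually less_imp_le)
  show "\<forall>\<^sub>F n in sequentially. \<gamma> n \<le> real n * \<gamma> n"
    using eventually_ge_at_top[of 1]
  proof eventually_elim
    case (elim n)
    then show ?case using mult_right_mono[of 1 "real n" "\<gamma> n"] gamma_pos[of n] by simp
  qed
qed

definition disc :: "real \<Rightarrow> nat \<Rightarrow> real" where
  "disc s n = exp (- s * \<gamma> n)"

lemma disc_bounds: "0 < disc s n" "0 \<le> s \<Longrightarrow> disc s n \<le> 1"
  using gamma_pos[of n] by (auto simp: disc_def less_imp_le)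

lemma disc_tendsto_1: "disc s \<longlonglongrightarrow> 1"
  unfolding disc_def using tendsto_exp[OF tendsto_mult_left[OF gamma_tendsto_0, of "- s"]] by simp

text \<open>Discounting over at most n steps has no effect in the limit, because n times
  \<open>\<gamma> n\<close> tends to 0.\<close>

lemma disc_power:
  assumes "0 \<le> s" "c < 1"
  shows "\<forall>\<^sub>F n in sequentially. c \<le> disc s n ^ (n - M)"
proof -
  have "(\<lambda>n. exp (- s * (real n * \<gamma> n))) \<longlonglongrightarrow> 1"
    using tendsto_exp[OF tendsto_mult_left[OF gamma_small, of "- s"]] by simp
  from order_tendstoD(1)[OF this assms(2)] show ?thesis
  proof eventually_elim
    case (elim n)
    have "disc s n ^ (n - M) = exp (- (s * (real (n - M) * \<gamma> n)))"
      unfolding disc_def by (simp add: exp_of_nat_mult[symmetric] mult_ac)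
    moreover have "s * (real (n - M) * \<gamma> n) \<le> s * (real n * \<gamma> n)"
      using assms(1) gamma_pos[of n] by (intro mult_left_mono mult_right_mono) auto
    ultimately show ?case using elim by (smt (verit) exp_le_cancel_iff mult_minus_left)
  qed
qed

text \<open>Seen from \<open>B n\<close>, the mean number of discounted visits has two sources: the
  cluster of immediate periodic returns, with mean 1 / (1 - \<open>\<rho>\<close>), and the late
  visits, which contribute \<open>\<kappa> s\<close> as if the start were an ordinary
  cylinder.\<close>

lemma visit_limit:
  assumes s: "0 < s"
  shows "(\<lambda>n. ennreal (1 / measure \<nu> (B n)) * (\<integral>\<^sup>+y. indicator (B n) y * visit_sum (B n) (disc s n) y \<partial>\<nu>))
    \<longlonglongrightarrow> ennreal (1 / (1 - \<rho>) + \<kappa> s)"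
proof -
  define S where "S M n = (\<Sum>k. return_part M (disc s n) n k)" for M n
  define g where "g M i n = ennreal (1 / measure \<nu> (cylinder A (window M i))) *
    (\<integral>\<^sup>+y. green (disc s n) (indicator (cylinder A (window M i))) y * indicator (B n) y \<partial>\<nu>)" for M i n
  have S_lim: "S M \<longlonglongrightarrow> 1 / (1 - \<rho>)" for M
    unfolding S_def using disc_bounds s by (intro return_part_limit disc_tendsto_1) (auto intro: less_imp_le)
  have S_nonneg: "0 \<le> S M n" for M n
    unfolding S_def using return_part_summable disc_bounds(1)[of s n]
    by (intro suminf_nonneg) (auto simp: return_part_def)
  have g_lim: "g M i \<longlonglongrightarrow> ennreal (\<kappa> s)" if M: "1 \<le> M" for M i
  proof -
    have "g M i \<longlonglongrightarrow> ennreal (1 / measure \<nu> (cylinder A (window M i))) * ennreal (measure \<nu> (cylinder A (window M i)) * \<kappa> s)"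
      unfolding g_def disc_def using M s
      by (intro ennreal_tendsto_cmult green_integral_limit) (auto simp: window_def)
    then show ?thesis using window_pos[OF M, of i] kappa_pos[OF s] by (simp add: ennreal_mult[symmetric])
  qed
  \<comment> \<open>The window moves with n, but only through n - M modulo q, so finitely many
    convergent sequences cover all cases.\<close>
  have g_mod: "(\<lambda>n. g M (n - M) n) \<longlonglongrightarrow> ennreal (\<kappa> s)" if M: "1 \<le> M" for M
  proof -
    have eq: "g M (n - M) n = g M ((n - M) mod q) n" for n unfolding g_def window_mod ..
    show ?thesis
    proof (rule order_tendstoI)
      fix a assume "a < ennreal (\<kappa> s)"
      then have "\<forall>\<^sub>F n in sequentially. \<forall>i\<in>{..<q}. a < g M i n"
        using order_tendstoD(1)[OF g_lim[OF M]] by (intro eventually_ball_finite) auto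
      then show "\<forall>\<^sub>F n in sequentially. a < g M (n - M) n"
        by eventually_elim (use q_pos in \<open>auto simp: eq\<close>)
    next
      fix a assume "ennreal (\<kappa> s) < a"
      then have "\<forall>\<^sub>F n in sequentially. \<forall>i\<in>{..<q}. g M i n < a"
        using order_tendstoD(2)[OF g_lim[OF M]] by (intro eventually_ball_finite) auto
      then show "\<forall>\<^sub>F n in sequentially. g M (n - M) n < a"
        by eventually_elim (use q_pos in \<open>auto simp: eq\<close>)
    qed
  qed
  \<comment> \<open>The lower bound loses one factor for the discount over the first n - M steps and
    one for distortion. The number 1 - 1/(M + 1) is merely a choice below 1 that tends to 1.\<close>
  define e where "e M = (1 - 1 / real (Suc M)) / distortion M" for M
  have e_nonneg: "0 \<le> e M" for M using distortion_ge_1[of M] by (simp add: e_def divide_simps)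
  have D: "0 < distortion M" for M using distortion_ge_1[of M] by linarith
  show ?thesis
  proof (rule tendsto_squeeze_family[where start="max 1 q"
      and lo="\<lambda>M n. ennreal (S M n) + ennreal (e M) * g M (n - M) n"
      and up="\<lambda>M n. ennreal (S M n) + ennreal (distortion M) * g M (n - M) n"
      and Lo="\<lambda>M. ennreal (1 / (1 - \<rho>)) + ennreal (e M) * ennreal (\<kappa> s)"
      and Up="\<lambda>M. ennreal (1 / (1 - \<rho>)) + ennreal (distortion M) * ennreal (\<kappa> s)"])
    fix M assume M: "max 1 q \<le> M"
    then have M1: "1 \<le> M" "q \<le> M" by auto
    show "(\<lambda>n. ennreal (S M n) + ennreal (e M) * g M (n - M) n) \<longlonglongrightarrow> ennreal (1 / (1 - \<rho>)) + ennreal (e M) * ennreal (\<kappa> s)"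
      "(\<lambda>n. ennreal (S M n) + ennreal (distortion M) * g M (n - M) n) \<longlonglongrightarrow> ennreal (1 / (1 - \<rho>)) + ennreal (distortion M) * ennreal (\<kappa> s)"
      by (intro tendsto_add tendsto_ennrealI S_lim ennreal_tendsto_cmult g_mod M1; simp)+
    have "1 - 1 / real (Suc M) < 1" by simp
    from disc_power[OF less_imp_le[OF s] this, where M=M] eventually_ge_at_top[of M]
    show "\<forall>\<^sub>F n in sequentially. ennreal (S M n) + ennreal (e M) * g M (n - M) n
        \<le> ennreal (1 / measure \<nu> (B n)) * (\<integral>\<^sup>+y. indicator (B n) y * visit_sum (B n) (disc s n) y \<partial>\<nu>) \<and>
        ennreal (1 / measure \<nu> (B n)) * (\<integral>\<^sup>+y. indicator (B n) y * visit_sum (B n) (disc s n) y \<partial>\<nu>)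
        \<le> ennreal (S M n) + ennreal (distortion M) * g M (n - M) n"
    proof eventually_elim
      case (elim n)
      let ?C = "cylinder A (window M (n - M))" and ?z = "disc s n"
      let ?P = "Pit (n - M) (indicator (B n))" and ?m = "measure \<nu> (B n)"
      let ?G = "\<integral>\<^sup>+y. green ?z (indicator ?C) y * indicator (B n) y \<partial>\<nu>"
      let ?X = "\<integral>\<^sup>+y. green ?z ?P y * indicator (B n) y \<partial>\<nu>"
      have n: "1 \<le> n" using elim M1 by simp
      have m: "0 < ?m" by (rule B_pos[OF n])
      have C: "0 < measure \<nu> ?C" by (rule window_pos[OF M1(1)])
      have gG: "g M (n - M) n = ennreal (1 / measure \<nu> ?C) * ?G" by (simp add: g_def)
      have green_up: "green ?z ?P y \<le> ennreal (distortion M * (?m / measure \<nu> ?C)) * green ?z (indicator ?C) y" for y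
        unfolding green_cmult[symmetric] by (intro green_mono Pit_B_window M1 elim)
      have green_lo: "ennreal (1 / distortion M * (?m / measure \<nu> ?C)) * green ?z (indicator ?C) y \<le> green ?z ?P y" for y
        unfolding green_cmult[symmetric] by (intro green_mono Pit_B_window M1 elim)
      have "?X \<le> (\<integral>\<^sup>+y. ennreal (distortion M * (?m / measure \<nu> ?C)) * (green ?z (indicator ?C) y * indicator (B n) y) \<partial>\<nu>)"
        unfolding mult.assoc[symmetric] by (intro nn_integral_mono mult_right_mono green_up) auto
      also have "\<dots> = ennreal (distortion M * (?m / measure \<nu> ?C)) * ?G"
        by (rule nn_integral_cmult) measurable
      also have "\<dots> = ennreal ?m * (ennreal (distortion M) * g M (n - M) n)"
        unfolding gG using m C D[of M] by (simp add: ennreal_mult[symmetric] mult.assoc[symmetric] mult_ac)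
      finally have X_up: "?X \<le> ennreal ?m * (ennreal (distortion M) * g M (n - M) n)" .
      have "ennreal ?m * (ennreal (1 / distortion M) * g M (n - M) n) = ennreal (1 / distortion M * (?m / measure \<nu> ?C)) * ?G"
        unfolding gG using m C D[of M] by (simp add: ennreal_mult[symmetric] mult.assoc[symmetric] mult_ac)
      also have "\<dots> = (\<integral>\<^sup>+y. ennreal (1 / distortion M * (?m / measure \<nu> ?C)) * (green ?z (indicator ?C) y * indicator (B n) y) \<partial>\<nu>)"
        by (rule nn_integral_cmult[symmetric]) measurable
      also have "\<dots> \<le> ?X"
        unfolding mult.assoc[symmetric] by (intro nn_integral_mono mult_right_mono green_lo) auto
      finally have X_lo: "ennreal ?m * (ennreal (1 / distortion M) * g M (n - M) n) \<le> ?X" .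
      have split: "ennreal (1 / ?m) * (\<integral>\<^sup>+y. indicator (B n) y * visit_sum (B n) ?z y \<partial>\<nu>)
          = ennreal (S M n) + ennreal (?z ^ (n - M)) * (ennreal (1 / ?m) * ?X)"
      proof -
        have z: "0 \<le> ?z" "?z \<le> 1" using disc_bounds[of s n] s by (auto intro: less_imp_le)
        have "ennreal (1 / ?m) * ennreal (?m * S M n) = ennreal (S M n)"
          using m S_nonneg[of M n] by (simp add: ennreal_mult[symmetric])
        then show ?thesis
          unfolding visit_split[OF M1(2) elim(2) z] S_def[symmetric] by (simp add: distrib_left mult_ac)
      qed
      have m1: "ennreal (1 / ?m) * ennreal ?m = 1" using m by (simp add: ennreal_mult[symmetric])
      have "ennreal (1 / ?m) * ?X \<le> ennreal (1 / ?m) * (ennreal ?m * (ennreal (distortion M) * g M (n - M) n))"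
        by (rule mult_left_mono[OF X_up]) simp
      then have 1: "ennreal (1 / ?m) * ?X \<le> ennreal (distortion M) * g M (n - M) n"
        using m1 by (simp add: mult.assoc[symmetric])
      have "ennreal (1 / ?m) * (ennreal ?m * (ennreal (1 / distortion M) * g M (n - M) n)) \<le> ennreal (1 / ?m) * ?X"
        by (rule mult_left_mono[OF X_lo]) simp
      then have 2: "ennreal (1 / distortion M) * g M (n - M) n \<le> ennreal (1 / ?m) * ?X"
        using m1 by (simp add: mult.assoc[symmetric])
      have "ennreal (?z ^ (n - M)) * (ennreal (1 / ?m) * ?X) \<le> 1 * (ennreal (distortion M) * g M (n - M) n)"
        using disc_bounds[of s n] s by (intro mult_mono 1) (auto simp: power_le_one less_imp_le)
      moreover have "ennreal (e M) * g M (n - M) n \<le> ennreal (?z ^ (n - M)) * (ennreal (1 / ?m) * ?X)"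
      proof -
        have "ennreal (e M) * g M (n - M) n = ennreal (1 - 1 / real (Suc M)) * (ennreal (1 / distortion M) * g M (n - M) n)"
          using D[of M] by (simp add: e_def mult.assoc[symmetric] ennreal_mult[symmetric])
        also have "\<dots> \<le> ennreal (?z ^ (n - M)) * (ennreal (1 / ?m) * ?X)"
          using elim(1) by (intro mult_mono 2 ennreal_leI) auto
        finally show ?thesis .
      qed
      ultimately show ?case unfolding split by (auto intro: add_left_mono)
    qed
  next
    have pos: "0 \<le> 1 / (1 - \<rho>)" using rho_less_1 by simp
    have "e \<longlonglongrightarrow> (1 - 0) / 1"
      unfolding e_def using LIMSEQ_inverse_real_of_nat
      by (intro tendsto_divide tendsto_diff tendsto_const distortion_tendsto) (auto simp: inverse_eq_divide)
    then have "(\<lambda>M. 1 / (1 - \<rho>) + e M * \<kappa> s) \<longlonglongrightarrow> 1 / (1 - \<rho>) + 1 * \<kappa> s" by (intro tendsto_intros) simp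
    then have "(\<lambda>M. ennreal (1 / (1 - \<rho>) + e M * \<kappa> s)) \<longlonglongrightarrow> ennreal (1 / (1 - \<rho>) + \<kappa> s)" by (intro tendsto_ennrealI) simp
    then show "(\<lambda>M. ennreal (1 / (1 - \<rho>)) + ennreal (e M) * ennreal (\<kappa> s)) \<longlonglongrightarrow> ennreal (1 / (1 - \<rho>) + \<kappa> s)"
      using pos e_nonneg kappa_pos[OF s] by (simp add: ennreal_mult ennreal_plus)
    have "(\<lambda>M. 1 / (1 - \<rho>) + distortion M * \<kappa> s) \<longlonglongrightarrow> 1 / (1 - \<rho>) + 1 * \<kappa> s" by (intro tendsto_intros distortion_tendsto)
    then have "(\<lambda>M. ennreal (1 / (1 - \<rho>) + distortion M * \<kappa> s)) \<longlonglongrightarrow> ennreal (1 / (1 - \<rho>) + \<kappa> s)" by (intro tendsto_ennrealI) simp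
    then show "(\<lambda>M. ennreal (1 / (1 - \<rho>)) + ennreal (distortion M) * ennreal (\<kappa> s)) \<longlonglongrightarrow> ennreal (1 / (1 - \<rho>) + \<kappa> s)"
      using pos D kappa_pos[OF s] by (simp add: ennreal_mult ennreal_plus less_imp_le)
  qed
qed

end

text \<open>Solves the two-sided renewal inequality for the unknown factor k, once the mean number
  of visits a has a positive limit and the distortion factor D tends to 1.\<close>

lemma ratio_limit:
  fixes D k a H :: "nat \<Rightarrow> real"
  assumes D: "D \<longlonglongrightarrow> 1" "\<And>n. 0 < D n" and a: "a \<longlonglongrightarrow> a0" "0 < a0" and H: "H \<longlonglongrightarrow> c"
    and ev: "\<forall>\<^sub>F n in sequentially. H n \<le> D n * k n * a n \<and> k n * a n \<le> D n * H n"
  shows "k \<longlonglongrightarrow> c / a0"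
proof (rule tendsto_sandwich)
  have apos: "\<forall>\<^sub>F n in sequentially. 0 < a n" using order_tendstoD(1)[OF a] .
  show "\<forall>\<^sub>F n in sequentially. H n / (D n * a n) \<le> k n"
    using ev apos by eventually_elim (use D(2) in \<open>auto simp: divide_le_eq mult_ac\<close>)
  show "\<forall>\<^sub>F n in sequentially. k n \<le> D n * H n / a n"
    using ev apos by eventually_elim (auto simp: le_divide_eq)
  have "(\<lambda>n. H n / (D n * a n)) \<longlonglongrightarrow> c / (1 * a0)" using a by (intro tendsto_intros H D) auto
  then show "(\<lambda>n. H n / (D n * a n)) \<longlonglongrightarrow> c / a0" by simp
  have "(\<lambda>n. D n * H n / a n) \<longlonglongrightarrow> 1 * c / a0" using a by (intro tendsto_intros H D) auto
  then show "(\<lambda>n. D n * H n / a n) \<longlonglongrightarrow> c / a0" by simp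
qed

section \<open>Laplace transforms of the first hit and of a return\<close>

context hitting_asymptotics
begin

text \<open>The late contribution \<open>\<kappa> s\<close> divided by all visits seen from the
  cylinder. At s = 0 the formula is replaced by its limit 1, because \<open>\<kappa>\<close> blows
  up there.\<close>

definition H_hat :: "real \<Rightarrow> real" where
  "H_hat s = (if s = 0 then 1 else \<kappa> s / (1 / (1 - \<rho>) + \<kappa> s))"

text \<open>With probability \<open>\<rho>\<close> a return follows the periodic orbit and takes no
  time on the limiting scale; otherwise it behaves like a first hit from elsewhere.\<close>

definition W_hat :: "real \<Rightarrow> real" where
  "W_hat s = \<rho> + (1 - \<rho>) * H_hat s"

lemma distortion_pos: "0 < distortion n"
  using distortion_ge_1[of n] by linarith

text \<open>The renewal identity integrated against \<open>f\<close>, with its last term factorised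
  at the first hit. Here X is the discounted number of visits, e the part from time 0, k the Laplace
  transform of the first hit and a the mean number of visits seen from \<open>B n\<close>; up to
  distortion X - e equals k a.\<close>

lemma hit_bounds_real:
  assumes n: "1 \<le> n" and f: "prefix_mono n f" "f \<in> borel_measurable \<nu>"
    and z: "0 \<le> z" and z1: "z \<le> 1" and a: "0 \<le> a"
    and I: "(\<integral>\<^sup>+y. indicator (B n) y * visit_sum (B n) z y \<partial>\<nu>) = ennreal (measure \<nu> (B n) * a)"
    and X: "(\<integral>\<^sup>+y. f y * visit_sum (B n) z y \<partial>\<nu>) = ennreal X" "0 \<le> X"
    and E: "(\<integral>\<^sup>+y. f y * indicator (B n) y \<partial>\<nu>) = ennreal e" "0 \<le> e"
    and k: "(\<integral>\<^sup>+y. f y * hit_sum (B n) z (\<lambda>_. 1) y \<partial>\<nu>) = ennreal k" "0 \<le> k"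
  shows "X - e \<le> distortion n * k * a \<and> k * a \<le> distortion n * (X - e)"
proof -
  have m: "0 < measure \<nu> (B n)" "emeasure \<nu> (B n) = ennreal (measure \<nu> (B n))"
    using B_pos[OF n] B_emeasure[OF n] by auto
  have D: "0 < distortion n" by (rule distortion_pos)
  let ?H = "\<integral>\<^sup>+y. f y * hit_sum (B n) z (visit_sum (B n) z) y \<partial>\<nu>"
  have "ennreal X = (\<integral>\<^sup>+y. f y * indicator (B n) y + f y * hit_sum (B n) z (visit_sum (B n) z) y \<partial>\<nu>)"
    unfolding X(1)[symmetric] using z
    by (intro nn_integral_cong) (subst visit_sum_renewal, auto simp: space_nu distrib_left)
  also have "\<dots> = ennreal e + ?H" unfolding E(1)[symmetric] using f by (intro nn_integral_add) auto
  finally have XH: "ennreal X = ennreal e + ?H" .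
  then have "?H < \<infinity>" by (metis ennreal_less_top ennreal_add_eq_top infinity_ennreal_def less_top)
  then obtain H where H: "?H = ennreal H" "0 \<le> H" by (cases ?H) auto
  have HX: "H = X - e" using XH H X(2) E(2) by (simp add: ennreal_plus[symmetric] del: ennreal_plus)
  have "ennreal (measure \<nu> (B n) * H) \<le> ennreal (distortion n * k * (measure \<nu> (B n) * a))"
    using induced_op_bounds(1)[OF n f, of "visit_sum (B n) z" z] m D H k a
    by (simp add: I H(1) k(1) ennreal_mult)
  then have "measure \<nu> (B n) * H \<le> distortion n * k * (measure \<nu> (B n) * a)"
    using D k a m by (subst (asm) ennreal_le_iff) auto
  then have 1: "H \<le> distortion n * k * a" using m(1) by (simp add: mult.left_commute mult.commute)
  have "ennreal (k * (measure \<nu> (B n) * a)) \<le> ennreal (distortion n * measure \<nu> (B n) * H)"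
    using induced_op_bounds(2)[OF n f, of "visit_sum (B n) z" z] m D H k a
    by (simp add: I H(1) k(1) ennreal_mult)
  then have "k * (measure \<nu> (B n) * a) \<le> distortion n * measure \<nu> (B n) * H"
    using D H m by (subst (asm) ennreal_le_iff) auto
  then have 2: "k * a \<le> distortion n * H" using m(1) by (simp add: mult.left_commute mult.commute mult.assoc)
  show ?thesis using 1 2 by (simp add: HX)
qed


definition visit_real :: "real \<Rightarrow> nat \<Rightarrow> real" where
  "visit_real s n = enn2real (ennreal (1 / measure \<nu> (B n)) * (\<integral>\<^sup>+y. indicator (B n) y * visit_sum (B n) (disc s n) y \<partial>\<nu>))"

lemma visit_real_limit: "0 < s \<Longrightarrow> visit_real s \<longlonglongrightarrow> 1 / (1 - \<rho>) + \<kappa> s"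
  unfolding visit_real_def using kappa_pos[of s] rho_less_1 by (intro tendsto_enn2real visit_limit) auto

lemma visit_real_eq:
  assumes s: "0 < s"
  shows "\<forall>\<^sub>F n in sequentially. (\<integral>\<^sup>+y. indicator (B n) y * visit_sum (B n) (disc s n) y \<partial>\<nu>)
    = ennreal (measure \<nu> (B n) * visit_real s n)"
proof -
  have "\<forall>\<^sub>F n in sequentially. ennreal (1 / measure \<nu> (B n)) * (\<integral>\<^sup>+y. indicator (B n) y * visit_sum (B n) (disc s n) y \<partial>\<nu>) < \<top>"
    using order_tendstoD(2)[OF visit_limit[OF s], of \<top>] by simp
  then show ?thesis using eventually_ge_at_top[of 1]
  proof eventually_elim
    case (elim n)
    let ?I = "\<integral>\<^sup>+y. indicator (B n) y * visit_sum (B n) (disc s n) y \<partial>\<nu>"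
    have m: "0 < measure \<nu> (B n)" by (rule B_pos[OF elim(2)])
    have "ennreal (visit_real s n) = ennreal (1 / measure \<nu> (B n)) * ?I"
      unfolding visit_real_def using elim(1) by simp
    then have "ennreal (measure \<nu> (B n)) * ennreal (visit_real s n) = ennreal (measure \<nu> (B n)) * ennreal (1 / measure \<nu> (B n)) * ?I"
      by (simp add: mult.assoc)
    then show ?case using m by (simp add: ennreal_mult[symmetric] visit_real_def enn2real_nonneg)
  qed
qed

definition hit_real :: "((nat \<Rightarrow> 'a) \<Rightarrow> ennreal) \<Rightarrow> nat \<Rightarrow> (nat \<Rightarrow> real) \<Rightarrow> nat \<Rightarrow> real" where
  "hit_real f K s n = enn2real (\<integral>\<^sup>+y. f y * hit_prod (B n) K (\<lambda>i. disc (s i) n) y \<partial>\<nu>)"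

lemma hit_real_eq:
  assumes f: "(\<integral>\<^sup>+y. f y \<partial>\<nu>) < \<infinity>" and s: "\<And>i. 0 \<le> s i"
  shows "(\<integral>\<^sup>+y. f y * hit_prod (B n) K (\<lambda>i. disc (s i) n) y \<partial>\<nu>) = ennreal (hit_real f K s n)"
    and "hit_real f K s n \<le> enn2real (\<integral>\<^sup>+y. f y \<partial>\<nu>)"
proof -
  have le: "(\<integral>\<^sup>+y. f y * hit_prod (B n) K (\<lambda>i. disc (s i) n) y \<partial>\<nu>) \<le> (\<integral>\<^sup>+y. f y * 1 \<partial>\<nu>)"
    using disc_bounds s by (intro nn_integral_mono mult_left_mono hit_prod_le_1) (auto intro: less_imp_le)
  then show "(\<integral>\<^sup>+y. f y * hit_prod (B n) K (\<lambda>i. disc (s i) n) y \<partial>\<nu>) = ennreal (hit_real f K s n)"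
    unfolding hit_real_def using f le_less_trans[OF le] by simp
  show "hit_real f K s n \<le> enn2real (\<integral>\<^sup>+y. f y \<partial>\<nu>)"
    unfolding hit_real_def using le f by (intro enn2real_mono) auto
qed

lemma hit_real_nonneg: "0 \<le> hit_real f K s n"
  by (simp add: hit_real_def)

lemma cylinder_integral_finite: "w \<noteq> [] \<Longrightarrow> (\<integral>\<^sup>+y. indicator (cylinder A w) y \<partial>\<nu>) < \<infinity>"
  using cylinder_finite[of w] by simp

text \<open>For a fixed cylinder the visit at time 0 contributes at most the measure of
  \<open>B n\<close>, which vanishes, so the renewal relation leaves the limit of X divided by that
  of a.\<close>

lemma hit_cylinder_limit_pos:
  assumes w: "w \<noteq> []" and s: "0 < s"
  shows "hit_real (indicator (cylinder A w)) 1 (\<lambda>_. s) \<longlonglongrightarrow> measure \<nu> (cylinder A w) * H_hat s"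
proof -
  let ?C = "cylinder A w" and ?a = "1 / (1 - \<rho>) + \<kappa> s"
  define X where "X n = enn2real (\<integral>\<^sup>+y. green (disc s n) (indicator ?C) y * indicator (B n) y \<partial>\<nu>)" for n
  define e where "e n = measure \<nu> (?C \<inter> B n)" for n
  have Glim: "(\<lambda>n. \<integral>\<^sup>+y. green (disc s n) (indicator ?C) y * indicator (B n) y \<partial>\<nu>) \<longlonglongrightarrow> ennreal (measure \<nu> ?C * \<kappa> s)"
    unfolding disc_def by (rule green_integral_limit[OF w s])
  have X: "X \<longlonglongrightarrow> measure \<nu> ?C * \<kappa> s"
    unfolding X_def using Glim kappa_pos[OF s] by (intro tendsto_enn2real) auto
  have X_eq: "\<forall>\<^sub>F n in sequentially. (\<integral>\<^sup>+y. indicator ?C y * visit_sum (B n) (disc s n) y \<partial>\<nu>) = ennreal (X n)"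
  proof -
    have "\<forall>\<^sub>F n in sequentially. (\<integral>\<^sup>+y. green (disc s n) (indicator ?C) y * indicator (B n) y \<partial>\<nu>) < \<top>"
      using order_tendstoD(2)[OF Glim, of \<top>] by simp
    then show ?thesis by eventually_elim (simp add: X_def visit_sum_integral)
  qed
  have e_le: "e n \<le> measure \<nu> (B n)" if "1 \<le> n" for n
    unfolding e_def using B_finite[OF that] by (intro measure_mono_fmeasurable) (auto simp: fmeasurable_def)
  have e: "e \<longlonglongrightarrow> 0"
  proof (rule tendsto_sandwich[OF _ _ tendsto_const measure_B_tendsto_0])
    show "\<forall>\<^sub>F n in sequentially. 0 \<le> e n" by (simp add: e_def)
    show "\<forall>\<^sub>F n in sequentially. e n \<le> measure \<nu> (B n)"
      using eventually_ge_at_top[of 1] by eventually_elim (rule e_le)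
  qed
  have "hit_real (indicator ?C) 1 (\<lambda>_. s) \<longlonglongrightarrow> (measure \<nu> ?C * \<kappa> s - 0) / ?a"
  proof (rule ratio_limit[OF distortion_tendsto distortion_pos visit_real_limit[OF s] _ tendsto_diff[OF X e]])
    show "0 < ?a" using kappa_pos[OF s] rho_less_1 by (intro add_pos_pos) auto
    show "\<forall>\<^sub>F n in sequentially. X n - e n \<le> distortion n * hit_real (indicator ?C) 1 (\<lambda>_. s) n * visit_real s n \<and>
       hit_real (indicator ?C) 1 (\<lambda>_. s) n * visit_real s n \<le> distortion n * (X n - e n)"
      using X_eq visit_real_eq[OF s] eventually_ge_at_top[of "max 1 (length w)"]
    proof eventually_elim
      case (elim n)
      show ?case
      proof (rule hit_bounds_real[where f="indicator ?C" and z="disc s n"])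
        show "prefix_mono n (indicator ?C)" using elim by (intro prefix_mono_cylinder) auto
        show "(\<integral>\<^sup>+y. indicator ?C y * indicator (B n) y \<partial>\<nu>) = ennreal (e n)"
        proof -
          have "(\<integral>\<^sup>+y. indicator ?C y * indicator (B n) y \<partial>\<nu>) = (\<integral>\<^sup>+y. indicator (?C \<inter> B n) y \<partial>\<nu>)"
            by (intro nn_integral_cong) (auto simp: indicator_def)
          then have "(\<integral>\<^sup>+y. indicator ?C y * indicator (B n) y \<partial>\<nu>) = emeasure \<nu> (?C \<inter> B n)"
            by simp
          moreover have "emeasure \<nu> (?C \<inter> B n) < \<infinity>"
            using B_finite[of n] elim emeasure_mono[of "?C \<inter> B n" "B n" \<nu>] by (auto intro: le_less_trans)
          ultimately show ?thesis by (simp add: e_def emeasure_eq_ennreal_measure less_top)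
        qed
        show "(\<integral>\<^sup>+y. indicator ?C y * hit_sum (B n) (disc s n) (\<lambda>_. 1) y \<partial>\<nu>) = ennreal (hit_real (indicator ?C) 1 (\<lambda>_. s) n)"
          using hit_real_eq(1)[OF cylinder_integral_finite[OF w], of "\<lambda>_. s" n 1] s by simp
      qed (use elim disc_bounds[of s n] s in \<open>auto simp: X_def e_def hit_real_nonneg visit_real_def less_imp_le\<close>)
    qed
  qed
  then show ?thesis using s by (simp add: H_hat_def)
qed

lemma B_integral: "1 \<le> n \<Longrightarrow> (\<integral>\<^sup>+y. indicator (B n) y \<partial>\<nu>) = ennreal (measure \<nu> (B n))"
  using B_emeasure[of n] by simp

text \<open>Starting in \<open>B n\<close> the visit at time 0 always counts, and X is a itself
  after normalisation, so the renewal relation leaves (a - 1) / a.\<close>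

lemma hit_B_limit_pos:
  assumes s: "0 < s"
  shows "(\<lambda>n. hit_real (indicator (B n)) 1 (\<lambda>_. s) n / measure \<nu> (B n)) \<longlonglongrightarrow> W_hat s"
proof -
  let ?a = "1 / (1 - \<rho>) + \<kappa> s"
  have a_pos: "0 < ?a" using kappa_pos[OF s] rho_less_1 by (intro add_pos_pos) auto
  have "(\<lambda>n. hit_real (indicator (B n)) 1 (\<lambda>_. s) n / measure \<nu> (B n)) \<longlonglongrightarrow> (?a - 1) / ?a"
  proof (rule ratio_limit[OF distortion_tendsto distortion_pos visit_real_limit[OF s] a_pos
        tendsto_diff[OF visit_real_limit[OF s] tendsto_const]])
    show "\<forall>\<^sub>F n in sequentially. visit_real s n - 1 \<le> distortion n * (hit_real (indicator (B n)) 1 (\<lambda>_. s) n / measure \<nu> (B n)) * visit_real s n \<and>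
       hit_real (indicator (B n)) 1 (\<lambda>_. s) n / measure \<nu> (B n) * visit_real s n \<le> distortion n * (visit_real s n - 1)"
      using visit_real_eq[OF s] eventually_ge_at_top[of 1]
    proof eventually_elim
      case (elim n)
      let ?m = "measure \<nu> (B n)" and ?k = "hit_real (indicator (B n)) 1 (\<lambda>_. s) n"
      have m: "0 < ?m" by (rule B_pos[OF elim(2)])
      have fin: "(\<integral>\<^sup>+y. indicator (B n) y \<partial>\<nu>) < \<infinity>" using B_integral[OF elim(2)] by simp
      have "?m * visit_real s n - ?m \<le> distortion n * ?k * visit_real s n \<and> ?k * visit_real s n \<le> distortion n * (?m * visit_real s n - ?m)"
      proof (rule hit_bounds_real[where f="indicator (B n)" and z="disc s n"])
        show "(\<integral>\<^sup>+y. indicator (B n) y * indicator (B n) y \<partial>\<nu>) = ennreal ?m"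
          using B_integral[OF elim(2)] by (simp add: indicator_inter_arith[symmetric])
        show "(\<integral>\<^sup>+y. indicator (B n) y * hit_sum (B n) (disc s n) (\<lambda>_. 1) y \<partial>\<nu>) = ennreal ?k"
          using hit_real_eq(1)[OF fin, of "\<lambda>_. s" n 1] s by simp
      qed (use elim disc_bounds[of s n] s prefix_mono_B in \<open>auto simp: hit_real_nonneg visit_real_def less_imp_le\<close>)
      then show ?case using m by (simp add: field_simps)
    qed
  qed
  \<comment> \<open>Multiplying \<open>\<kappa> s\<close> by 1 - \<open>\<rho>\<close> gives (1 -
    \<open>\<rho>\<close>) a - 1. This exhibits the fraction as a mixture of the constant 1 and
    \<open>H_hat s\<close>.\<close>
  moreover have "(?a - 1) / ?a = W_hat s"
  proof -
    define a where "a = ?a"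
    have a: "0 < a" "\<kappa> s = a - 1 / (1 - \<rho>)" using a_pos by (auto simp: a_def)
    have "(1 - \<rho>) * \<kappa> s = (1 - \<rho>) * a - 1" using rho_less_1 unfolding a(2) by (simp add: right_diff_distrib)
    then have "W_hat s = \<rho> + ((1 - \<rho>) * a - 1) / a" using s by (simp add: W_hat_def H_hat_def a_def)
    also have "\<dots> = (a - 1) / a" using a(1) by (simp add: field_simps)
    finally show ?thesis by (simp add: a_def)
  qed
  ultimately show ?thesis by simp
qed

lemma hit_sum_mono: "0 \<le> z \<Longrightarrow> z \<le> z' \<Longrightarrow> hit_sum D z g y \<le> hit_sum D z' g y"
  unfolding hit_sum_def by (intro suminf_le mult_left_mono mult_right_mono ennreal_leI power_mono) auto

lemma hit_real_antimono:
  assumes f: "(\<integral>\<^sup>+y. f y \<partial>\<nu>) < \<infinity>" and s: "0 \<le> s" "s \<le> t"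
  shows "hit_real f 1 (\<lambda>_. t) n \<le> hit_real f 1 (\<lambda>_. s) n"
proof -
  have "disc t n \<le> disc s n" using s gamma_pos[of n] by (simp add: disc_def mult_right_mono)
  then have "(\<integral>\<^sup>+y. f y * hit_prod (B n) 1 (\<lambda>i. disc t n) y \<partial>\<nu>) \<le> (\<integral>\<^sup>+y. f y * hit_prod (B n) 1 (\<lambda>i. disc s n) y \<partial>\<nu>)"
    using less_imp_le[OF disc_bounds(1)[of t n]] by (auto intro!: nn_integral_mono mult_left_mono hit_sum_mono)
  then have "ennreal (hit_real f 1 (\<lambda>_. t) n) \<le> ennreal (hit_real f 1 (\<lambda>_. s) n)"
    using s by (subst (1 2) hit_real_eq(1)[OF f, symmetric]) auto
  then show ?thesis using hit_real_nonneg by (subst (asm) ennreal_le_iff) auto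
qed

text \<open>Divergence of \<open>\<kappa>\<close> at 0 says that the limiting waiting time is finite
  almost surely.\<close>

lemma H_hat_at_0: "(\<lambda>m. H_hat (1 / real (Suc m))) \<longlonglongrightarrow> 1"
proof -
  let ?k = "\<lambda>m. \<kappa> (1 / real (Suc m))"
  have k: "0 < ?k m" for m by (rule kappa_pos) simp
  have "(\<lambda>m. inverse (1 + 1 / (1 - \<rho>) * inverse (?k m))) \<longlonglongrightarrow> inverse (1 + 1 / (1 - \<rho>) * 0)"
    using tendsto_inverse_0_at_top[OF kappa_infinity] by (intro tendsto_intros) auto
  moreover have "inverse (1 + 1 / (1 - \<rho>) * inverse (?k m)) = H_hat (1 / real (Suc m))" for m
  proof -
    have "inverse (1 + c * inverse (?k m)) = ?k m / (c + ?k m)" if "0 < c" for c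
      using k[of m] that by (simp add: field_simps)
    from this[of "1 / (1 - \<rho>)"] show ?thesis using rho_less_1 by (simp add: H_hat_def)
  qed
  ultimately show ?thesis by simp
qed

text \<open>At s = 0 the renewal relation degenerates. The Laplace transform is monotone in s, so it
  lies between its values at 1/(m + 1) and the total mass, and both bounds meet by
  \<open>H_hat_at_0\<close>. The case s = 0 says that almost all points of the cylinder hit
  \<open>B n\<close> in the limit.\<close>

lemma hit_cylinder_limit:
  assumes w: "w \<noteq> []" and s: "0 \<le> s"
  shows "hit_real (indicator (cylinder A w)) 1 (\<lambda>_. s) \<longlonglongrightarrow> measure \<nu> (cylinder A w) * H_hat s"
proof (cases "s = 0")
  case False
  then show ?thesis using hit_cylinder_limit_pos[OF w] s by simp
next
  case True
  let ?f = "indicator (cylinder A w) :: _ \<Rightarrow> ennreal" and ?m = "measure \<nu> (cylinder A w)"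
  note fin = cylinder_integral_finite[OF w]
  have "hit_real ?f 1 (\<lambda>_. 0) \<longlonglongrightarrow> ?m * 1"
  proof (rule tendsto_squeeze_family[where start=0 and lo="\<lambda>m. hit_real ?f 1 (\<lambda>_. 1 / real (Suc m))" and up="\<lambda>_ _. ?m"
        and Lo="\<lambda>m. ?m * H_hat (1 / real (Suc m))" and Up="\<lambda>_. ?m"])
    show "\<forall>\<^sub>F n in sequentially. hit_real ?f 1 (\<lambda>_. 1 / real (Suc m)) n \<le> hit_real ?f 1 (\<lambda>_. 0) n \<and> hit_real ?f 1 (\<lambda>_. 0) n \<le> ?m" for m
    proof (intro always_eventually allI conjI)
      fix n
      show "hit_real ?f 1 (\<lambda>_. 1 / real (Suc m)) n \<le> hit_real ?f 1 (\<lambda>_. 0) n"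
        by (rule hit_real_antimono[OF fin]) auto
      show "hit_real ?f 1 (\<lambda>_. 0) n \<le> ?m"
        using hit_real_eq(2)[OF fin, of "\<lambda>_. 0" 1 n] by (simp add: measure_def)
    qed
    show "hit_real ?f 1 (\<lambda>_. 1 / real (Suc m)) \<longlonglongrightarrow> ?m * H_hat (1 / real (Suc m))" for m
      by (rule hit_cylinder_limit_pos[OF w]) simp
    show "(\<lambda>m. ?m * H_hat (1 / real (Suc m))) \<longlonglongrightarrow> ?m * 1" by (intro tendsto_intros H_hat_at_0)
  qed auto
  then show ?thesis using True by (simp add: H_hat_def)
qed

lemma hit_B_limit:
  assumes s: "0 \<le> s"
  shows "(\<lambda>n. hit_real (indicator (B n)) 1 (\<lambda>_. s) n / measure \<nu> (B n)) \<longlonglongrightarrow> W_hat s"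
proof (cases "s = 0")
  case False
  then show ?thesis using hit_B_limit_pos s by simp
next
  case True
  let ?k = "\<lambda>s n. hit_real (indicator (B n)) 1 (\<lambda>_. s) n / measure \<nu> (B n)"
  have "?k 0 \<longlonglongrightarrow> 1"
  proof (rule tendsto_squeeze_family[where start=0 and lo="\<lambda>m. ?k (1 / real (Suc m))" and up="\<lambda>_ _. 1"
        and Lo="\<lambda>m. W_hat (1 / real (Suc m))" and Up="\<lambda>_. 1"])
    show "\<forall>\<^sub>F n in sequentially. ?k (1 / real (Suc m)) n \<le> ?k 0 n \<and> ?k 0 n \<le> 1" for m
      using eventually_ge_at_top[of 1]
    proof eventually_elim
      case (elim n)
      have fin: "(\<integral>\<^sup>+y. indicator (B n) y \<partial>\<nu>) < \<infinity>" using B_integral[OF elim] by simp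
      have m: "0 < measure \<nu> (B n)" by (rule B_pos[OF elim])
      have "hit_real (indicator (B n)) 1 (\<lambda>_. 1 / real (Suc m)) n \<le> hit_real (indicator (B n)) 1 (\<lambda>_. 0) n"
        by (rule hit_real_antimono[OF fin]) auto
      moreover have "hit_real (indicator (B n)) 1 (\<lambda>_. 0) n \<le> measure \<nu> (B n)"
        using hit_real_eq(2)[OF fin, of "\<lambda>_. 0" 1 n] by (simp add: measure_def)
      ultimately show ?case using m by (simp add: divide_right_mono)
    qed
    show "?k (1 / real (Suc m)) \<longlonglongrightarrow> W_hat (1 / real (Suc m))" for m
      by (rule hit_B_limit_pos) simp
    have "(\<lambda>m. W_hat (1 / real (Suc m))) \<longlonglongrightarrow> \<rho> + (1 - \<rho>) * 1"
      unfolding W_hat_def by (intro tendsto_intros H_hat_at_0)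
    then show "(\<lambda>m. W_hat (1 / real (Suc m))) \<longlonglongrightarrow> 1" by simp
  qed auto
  then show ?thesis using True by (simp add: H_hat_def W_hat_def)
qed

text \<open>Separates the first hit from the remaining K: after the hit, up to distortion, the
  process starts afresh from the uniform law on \<open>B n\<close>.\<close>

lemma hit_real_Suc_bounds:
  fixes K :: nat and s :: "nat \<Rightarrow> real"
  assumes n: "1 \<le> n" and f: "prefix_mono n f" "f \<in> borel_measurable \<nu>" "(\<integral>\<^sup>+y. f y \<partial>\<nu>) < \<infinity>"
    and s: "\<And>i. 0 \<le> s i"
  defines "j \<equiv> hit_real (indicator (B n)) K (\<lambda>i. s (Suc i)) n / measure \<nu> (B n)"
  shows "hit_real f (Suc K) s n \<le> distortion n * hit_real f 1 (\<lambda>_. s 0) n * j"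
    and "hit_real f 1 (\<lambda>_. s 0) n * j \<le> distortion n * hit_real f (Suc K) s n"
proof -
  let ?m = "measure \<nu> (B n)" and ?J = "hit_real (indicator (B n)) K (\<lambda>i. s (Suc i)) n"
  let ?h = "hit_real f 1 (\<lambda>_. s 0) n" and ?H = "hit_real f (Suc K) s n"
  have m: "0 < ?m" "emeasure \<nu> (B n) = ennreal ?m" using B_pos[OF n] B_emeasure[OF n] by auto
  have fin: "(\<integral>\<^sup>+y. indicator (B n) y \<partial>\<nu>) < \<infinity>" using B_integral[OF n] by simp
  have J: "(\<integral>\<^sup>+y. indicator (B n) y * hit_prod (B n) K (\<lambda>i. disc (s (Suc i)) n) y \<partial>\<nu>) = ennreal ?J"
    by (rule hit_real_eq(1)[OF fin]) (rule s)
  have h: "(\<integral>\<^sup>+y. f y * hit_sum (B n) (disc (s 0) n) (\<lambda>_. 1) y \<partial>\<nu>) = ennreal ?h"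
    using hit_real_eq(1)[OF f(3), of "\<lambda>_. s 0" n 1] s by simp
  have H: "(\<integral>\<^sup>+y. f y * hit_sum (B n) (disc (s 0) n) (hit_prod (B n) K (\<lambda>i. disc (s (Suc i)) n)) y \<partial>\<nu>) = ennreal ?H"
    using hit_real_eq(1)[OF f(3), of s n "Suc K"] s by simp
  note nn = hit_real_nonneg m(1) distortion_pos[of n]
  have "ennreal (?m * ?H) \<le> ennreal (distortion n * ?h * ?J)"
    using induced_op_bounds(1)[OF n f(1,2), of "hit_prod (B n) K (\<lambda>i. disc (s (Suc i)) n)" "disc (s 0) n"] nn
    by (simp add: J h H m(2) ennreal_mult less_imp_le)
  then have "?m * ?H \<le> distortion n * ?h * ?J" using nn by (subst (asm) ennreal_le_iff) (auto intro!: mult_nonneg_nonneg less_imp_le)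
  then show "?H \<le> distortion n * ?h * j" using m(1) by (simp add: j_def field_simps)
  have "ennreal (?h * ?J) \<le> ennreal (distortion n * ?m * ?H)"
    using induced_op_bounds(2)[OF n f(1,2), of "hit_prod (B n) K (\<lambda>i. disc (s (Suc i)) n)" "disc (s 0) n"] nn
    by (simp add: J h H m(2) ennreal_mult less_imp_le)
  then have "?h * ?J \<le> distortion n * ?m * ?H" using nn by (subst (asm) ennreal_le_iff) (auto intro!: mult_nonneg_nonneg less_imp_le)
  then show "?h * j \<le> distortion n * ?H" using m(1) by (simp add: j_def field_simps)
qed

lemma product_limit:
  fixes H u j :: "nat \<Rightarrow> real"
  assumes u: "u \<longlonglongrightarrow> a" and j: "j \<longlonglongrightarrow> b"
    and ev: "\<forall>\<^sub>F n in sequentially. H n \<le> distortion n * u n * j n \<and> u n * j n \<le> distortion n * H n"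
  shows "H \<longlonglongrightarrow> a * b"
proof (rule tendsto_sandwich)
  show "\<forall>\<^sub>F n in sequentially. H n \<le> distortion n * u n * j n" using ev by eventually_elim simp
  show "\<forall>\<^sub>F n in sequentially. u n * j n / distortion n \<le> H n"
    using ev by eventually_elim (use distortion_pos in \<open>simp add: divide_le_eq mult.commute\<close>)
  have "(\<lambda>n. distortion n * u n * j n) \<longlonglongrightarrow> 1 * a * b" by (intro tendsto_intros distortion_tendsto u j)
  then show "(\<lambda>n. distortion n * u n * j n) \<longlonglongrightarrow> a * b" by simp
  have "(\<lambda>n. u n * j n / distortion n) \<longlonglongrightarrow> a * b / 1" by (intro tendsto_intros distortion_tendsto u j) simp
  then show "(\<lambda>n. u n * j n / distortion n) \<longlonglongrightarrow> a * b" by simp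
qed

text \<open>Each induction step peels off one return. The loss is one distortion factor per return,
  and K is fixed while n grows, so the product of the losses tends to 1.\<close>

lemma hit_prod_B_limit:
  assumes "\<And>i. 0 \<le> s i"
  shows "(\<lambda>n. hit_real (indicator (B n)) K s n / measure \<nu> (B n)) \<longlonglongrightarrow> (\<Prod>i<K. W_hat (s i))"
  using assms
proof (induction K arbitrary: s)
  case 0
  have "\<forall>\<^sub>F n in sequentially. hit_real (indicator (B n)) 0 s n / measure \<nu> (B n) = 1"
    using eventually_ge_at_top[of 1]
  proof eventually_elim
    case (elim n)
    then show ?case using B_pos[OF elim] B_emeasure[OF elim] by (simp add: hit_real_def)
  qed
  then show ?case by (simp add: tendsto_eventually)
next
  case (Suc K)
  show ?case
    unfolding prod.lessThan_Suc_shift o_def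
  proof (rule product_limit[OF hit_B_limit[OF Suc.prems] Suc.IH[OF Suc.prems]])
    show "\<forall>\<^sub>F n in sequentially.
       hit_real (indicator (B n)) (Suc K) s n / measure \<nu> (B n)
         \<le> distortion n * (hit_real (indicator (B n)) 1 (\<lambda>_. s 0) n / measure \<nu> (B n)) * (hit_real (indicator (B n)) K (\<lambda>i. s (Suc i)) n / measure \<nu> (B n)) \<and>
       hit_real (indicator (B n)) 1 (\<lambda>_. s 0) n / measure \<nu> (B n) * (hit_real (indicator (B n)) K (\<lambda>i. s (Suc i)) n / measure \<nu> (B n))
         \<le> distortion n * (hit_real (indicator (B n)) (Suc K) s n / measure \<nu> (B n))"
      using eventually_ge_at_top[of 1]
    proof eventually_elim
      case (elim n)
      have fin: "(\<integral>\<^sup>+y. indicator (B n) y \<partial>\<nu>) < \<infinity>" using B_integral[OF elim] by simp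
      have "indicator (B n) \<in> borel_measurable \<nu>" by simp
      note b = hit_real_Suc_bounds[OF elim prefix_mono_B this fin, of s K, OF Suc.prems]
      have m: "0 < measure \<nu> (B n)" by (rule B_pos[OF elim])
      show ?case using divide_right_mono[OF b(1), of "measure \<nu> (B n)"] divide_right_mono[OF b(2), of "measure \<nu> (B n)"] m
        by (simp add: mult_ac)
    qed
  qed
qed

lemma hit_prod_cylinder_limit:
  assumes w: "w \<noteq> []" and s: "\<And>i. 0 \<le> s i"
  shows "hit_real (indicator (cylinder A w)) (Suc K) s
    \<longlonglongrightarrow> measure \<nu> (cylinder A w) * (H_hat (s 0) * (\<Prod>i<K. W_hat (s (Suc i))))"
  unfolding mult.assoc[symmetric]
proof (rule product_limit[OF hit_cylinder_limit[OF w s] hit_prod_B_limit[OF s]])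
  show "\<forall>\<^sub>F n in sequentially.
     hit_real (indicator (cylinder A w)) (Suc K) s n
       \<le> distortion n * hit_real (indicator (cylinder A w)) 1 (\<lambda>_. s 0) n * (hit_real (indicator (B n)) K (\<lambda>i. s (Suc i)) n / measure \<nu> (B n)) \<and>
     hit_real (indicator (cylinder A w)) 1 (\<lambda>_. s 0) n * (hit_real (indicator (B n)) K (\<lambda>i. s (Suc i)) n / measure \<nu> (B n))
       \<le> distortion n * hit_real (indicator (cylinder A w)) (Suc K) s n"
    using eventually_ge_at_top[of "max 1 (length w)"]
  proof eventually_elim
    case (elim n)
    then have n: "1 \<le> n" "length w \<le> n" by auto
    have "indicator (cylinder A w) \<in> borel_measurable \<nu>" by simp
    from hit_real_Suc_bounds[OF n(1) prefix_mono_cylinder[OF n(2)] this cylinder_integral_finite[OF w], of s K, OF s]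
    show ?case by blast
  qed
qed

end

section \<open>Regular variation and an Abelian theorem\<close>

locale regular_scale =
  fixes a :: "nat \<Rightarrow> real" and \<alpha> :: real
  assumes a_mono: "mono a" and a_rv: "regularly_varying_seq \<alpha> a" and \<alpha>: "0 < \<alpha>" "\<alpha> \<le> 1"
begin

lemma a_ratio: "0 < c \<Longrightarrow> (\<lambda>n. a (nat \<lfloor>c * real n\<rfloor>) / a n) \<longlonglongrightarrow> c powr \<alpha>"
  using a_rv by (simp add: regularly_varying_seq_def)

lemma a_pos: "\<forall>\<^sub>F n in sequentially. 0 < a n"
  using a_rv by (simp add: regularly_varying_seq_def)

lemma a_le: "i \<le> j \<Longrightarrow> a i \<le> a j"
  using a_mono by (simp add: mono_def)

lemma nat_floor_double: "nat \<lfloor>2 * real n\<rfloor> = 2 * n"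
  by (metis floor_of_nat nat_int of_nat_mult of_nat_numeral)

text \<open>Each doubling of the argument eventually multiplies \<open>a\<close> by more than a
  constant above 1; monotonicity fills the gaps between the doublings.\<close>

lemma a_at_top: "filterlim a at_top sequentially"
proof -
  \<comment> \<open>The midpoint between 1 and 2 to the power \<alpha>, the limiting ratio under
    doubling.\<close>
  define c where "c = (1 + 2 powr \<alpha>) / 2"
  have c: "1 < c" "c < 2 powr \<alpha>" using \<alpha> by (auto simp: c_def)
  have "\<forall>\<^sub>F n in sequentially. c < a (2 * n) / a n \<and> 0 < a n"
    using order_tendstoD(1)[OF a_ratio[of 2], of c] c(2) a_pos by (auto simp: nat_floor_double intro: eventually_conj)
  then obtain n0 where n0: "\<And>n. n \<ge> n0 \<Longrightarrow> c < a (2 * n) / a n \<and> 0 < a n"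
    by (auto simp: eventually_sequentially)
  define n1 where "n1 = max 1 n0"
  have grow: "c ^ j * a n1 \<le> a (2 ^ j * n1)" for j
  proof (induction j)
    case (Suc j)
    have ge: "n0 \<le> 2 ^ j * n1" unfolding n1_def by (metis le_trans max.cobounded2 mult_le_mono1 mult_1 one_le_numeral one_le_power)
    have "c ^ Suc j * a n1 \<le> c * a (2 ^ j * n1)" using Suc c by simp
    also have "\<dots> \<le> a (2 * (2 ^ j * n1))" using n0[OF ge] by (auto simp: less_divide_eq)
    finally show ?case by (simp add: mult_ac)
  qed simp
  have pos: "0 < a n1" using n0[of n1] by (simp add: n1_def)
  show ?thesis
    unfolding filterlim_at_top
  proof
    fix Z :: real
    obtain j where j: "Z / a n1 < c ^ j" using real_arch_pow[OF c(1)] by blast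
    have "Z \<le> a n" if "2 ^ j * n1 \<le> n" for n
    proof -
      have "Z \<le> c ^ j * a n1" using j pos by (simp add: divide_less_eq less_imp_le)
      then show ?thesis using grow[of j] a_le[OF that] by linarith
    qed
    then show "\<forall>\<^sub>F n in sequentially. Z \<le> a n" by (auto simp: eventually_sequentially)
  qed
qed

text \<open>A Potter-type bound, uniform in u. Since 2 to the power \<alpha> is at most 2, a
  doubling eventually multiplies \<open>a\<close> by less than 4; with the number of doublings
  chosen so that 2^j is at most 2 (1 + u), the factor 4^j = (2^j)^2 is at most 4 (1 + u)^2.\<close>

lemma a_growth: "\<exists>n0\<ge>1. \<forall>N\<ge>n0. 0 < a N \<and> (\<forall>u\<ge>0. a (nat \<lfloor>u * real N\<rfloor>) \<le> 4 * (1 + u)\<^sup>2 * a N)"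
proof -
  have "2 powr \<alpha> \<le> 2 powr 1" using \<alpha> by (intro powr_mono) auto
  then have "2 powr \<alpha> < (4::real)" by simp
  then have "\<forall>\<^sub>F n in sequentially. a (2 * n) / a n < 4 \<and> 0 < a n"
    using order_tendstoD(2)[OF a_ratio[of 2], of 4] a_pos by (auto simp: nat_floor_double intro: eventually_conj)
  then obtain n0 where n0: "\<And>n. n \<ge> n0 \<Longrightarrow> a (2 * n) / a n < 4 \<and> 0 < a n"
    by (auto simp: eventually_sequentially)
  have dbl: "a (2 ^ j * N) \<le> 4 ^ j * a N" if N: "max 1 n0 \<le> N" for j N
  proof (induction j)
    case (Suc j)
    have ge: "n0 \<le> 2 ^ j * N" using N by (metis le_trans max.cobounded2 mult_le_mono1 mult_1 one_le_numeral one_le_power)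
    have "a (2 * (2 ^ j * N)) \<le> 4 * a (2 ^ j * N)" using n0[OF ge] by (auto simp: divide_less_eq)
    then show ?case using Suc by (simp add: mult_ac)
  qed simp
  have "a (nat \<lfloor>u * real N\<rfloor>) \<le> 4 * (1 + u)\<^sup>2 * a N" if N: "max 1 n0 \<le> N" and u: "0 \<le> u" for N u
  proof -
    \<comment> \<open>The least number of doublings that exceeds 1 + u. Being least, it overshoots
      by a factor of at most 2.\<close>
    define j where "j = (LEAST j. 1 + u < 2 ^ j)"
    have ex: "\<exists>j. 1 + u < 2 ^ j" by (rule real_arch_pow) simp
    have j: "1 + u < 2 ^ j" unfolding j_def by (rule LeastI_ex[OF ex])
    have "j \<noteq> 0" using j u by (cases j) auto
    then obtain i where i: "j = Suc i" by (cases j) auto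
    have "\<not> 1 + u < 2 ^ i" using not_less_Least[of i "\<lambda>j. 1 + u < 2 ^ j"] i by (simp add: j_def)
    then have le: "2 ^ j \<le> 2 * (1 + u)" by (simp add: i)
    have "u * real N \<le> 2 ^ j * real N" using j by (intro mult_right_mono) auto
    then have "nat \<lfloor>u * real N\<rfloor> \<le> 2 ^ j * N" by (simp add: nat_le_iff floor_le_iff)
    then have "a (nat \<lfloor>u * real N\<rfloor>) \<le> 4 ^ j * a N" using a_le dbl[OF N] order_trans by blast
    also have "4 ^ j = (2 ^ j :: real)\<^sup>2" by (simp add: power_mult[symmetric] mult.commute[of j] power_mult)
    also have "(2 ^ j :: real)\<^sup>2 * a N \<le> (2 * (1 + u))\<^sup>2 * a N"
      using le n0[of N] N by (intro mult_right_mono power_mono) auto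
    finally show ?thesis by (simp only: power_mult_distrib) simp
  qed
  then show ?thesis using n0 by (intro exI[of _ "max 1 n0"]) auto
qed

text \<open>Since s enters \<open>gen_inverse\<close> only through its integer part, the infimum
  there is attained at an integer, which is this one.\<close>

definition level :: "real \<Rightarrow> nat" where
  "level y = (LEAST n. y < a n)"

lemma level_above: "y < a (level y)" and level_below: "n < level y \<Longrightarrow> a n \<le> y"
proof -
  have "\<forall>\<^sub>F n in sequentially. y + 1 \<le> a n" using a_at_top by (simp add: filterlim_at_top)
  then obtain k where "y + 1 \<le> a k" by (auto simp: eventually_sequentially)
  then have "y < a k" by simp
  then show "y < a (level y)" unfolding level_def by (rule LeastI)
  show "n < level y \<Longrightarrow> a n \<le> y" using not_less_Least[of n "\<lambda>n. y < a n"] by (simp add: level_def not_less)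
qed

lemma gen_inverse_level: "gen_inverse a y = real (level y)"
  unfolding gen_inverse_def
proof (rule cInf_eq_minimum)
  show "real (level y) \<in> {s. 0 \<le> s \<and> y < a (nat \<lfloor>s\<rfloor>)}" using level_above by simp
  fix s :: real assume s: "s \<in> {s. 0 \<le> s \<and> y < a (nat \<lfloor>s\<rfloor>)}"
  then have "level y \<le> nat \<lfloor>s\<rfloor>" unfolding level_def by (intro Least_le) auto
  then show "real (level y) \<le> s" using s by (simp add: le_nat_iff le_floor_iff)
qed

lemma level_at_top: "filterlim level at_top at_top"
  unfolding filterlim_at_top
proof
  fix Z :: nat
  have "Z \<le> level y" if "a Z \<le> y" for y
  proof (rule ccontr)
    assume "\<not> ?thesis"
    then have "a (level y) \<le> a Z" by (intro a_le) simp
    then show False using level_above[of y] that by linarith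
  qed
  then show "\<forall>\<^sub>F y in at_top. Z \<le> level y" unfolding eventually_at_top_linorder by blast
qed

text \<open>By definition \<open>a\<close> exceeds y at the level and is at most y at every smaller
  index. For c < 1 the value at c times the level is thus at most y, and regular variation says that
  it is nearly c to the power \<alpha> times the value at the level.\<close>

lemma level_asymptotic: "((\<lambda>y. a (level y) / y) \<longlongrightarrow> 1) at_top"
proof (rule order_tendstoI)
  fix b :: real assume b: "b < 1"
  show "\<forall>\<^sub>F y in at_top. b < a (level y) / y"
    using eventually_gt_at_top[of 0]
  proof eventually_elim
    case (elim y)
    have "1 < a (level y) / y" using level_above[of y] elim by (simp add: less_divide_eq)
    then show ?case using b by simp
  qed
next
  fix b :: real assume b: "1 < b"
  \<comment> \<open>c is chosen so close to 1 from below that c to the power \<alpha> still exceeds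
    1 / b.\<close>
  have "((\<lambda>c. c powr \<alpha>) \<longlongrightarrow> 1 powr \<alpha>) (at_left (1::real))" by (intro tendsto_intros) auto
  then have "\<forall>\<^sub>F c in at_left (1::real). 1 / b < c powr \<alpha>"
    by (rule order_tendstoD(1)) (use b in simp)
  then have "\<forall>\<^sub>F c in at_left (1::real). 1 / b < c powr \<alpha> \<and> 0 < c \<and> c < 1"
    using eventually_at_left_real[of 0 "1::real"] by (auto elim: eventually_elim2)
  then obtain c where c: "1 / b < c powr \<alpha>" "0 < c" "c < (1::real)"
    using eventually_happens'[OF trivial_limit_at_left_real] by blast
  have "\<forall>\<^sub>F n in sequentially. 1 / b < a (nat \<lfloor>c * real n\<rfloor>) / a n \<and> 0 < a n \<and> 1 \<le> n"
    by (intro eventually_conj order_tendstoD(1)[OF a_ratio[OF c(2)] c(1)] a_pos eventually_ge_at_top)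
  then have "\<forall>\<^sub>F y in at_top. 1 / b < a (nat \<lfloor>c * real (level y)\<rfloor>) / a (level y) \<and> 0 < a (level y) \<and> 1 \<le> level y"
    by (rule eventually_compose_filterlim[OF _ level_at_top])
  then show "\<forall>\<^sub>F y in at_top. a (level y) / y < b"
    using eventually_gt_at_top[of 0]
  proof eventually_elim
    case (elim y)
    have "c * real (level y) < real (level y)" using c elim by simp
    then have "nat \<lfloor>c * real (level y)\<rfloor> < level y"
      using c elim by (simp add: nat_less_iff floor_less_iff)
    then have "a (nat \<lfloor>c * real (level y)\<rfloor>) \<le> y" by (rule level_below)
    then have "b * a (nat \<lfloor>c * real (level y)\<rfloor>) \<le> b * y" using b by simp
    moreover have "a (level y) < b * a (nat \<lfloor>c * real (level y)\<rfloor>)"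
    proof -
      have "1 / b * a (level y) < a (nat \<lfloor>c * real (level y)\<rfloor>)" using elim(1) by (auto simp: less_divide_eq)
      then show ?thesis using b by (simp add: divide_less_eq mult.commute)
    qed
    ultimately show ?case using elim(2) by (simp add: divide_less_eq)
  qed
qed

text \<open>Summation by parts in integral form: exp (- u) is the integral of exp (- t) over t >= u.
  Exchanging the sum and the integral collects, for each t, the coefficients with s \<gamma> k <=
  t.\<close>

lemma laplace_step_sum:
  fixes b :: "nat \<Rightarrow> real" and \<gamma> s :: real
  assumes b: "\<And>k. 0 \<le> b k" and \<gamma>: "0 < \<gamma>" and s: "0 < s"
  shows "(\<Sum>k. ennreal (exp (- s * \<gamma>) ^ k) * ennreal (b k))
    = (\<integral>\<^sup>+t. ennreal ((\<Sum>k<Suc (nat \<lfloor>t / (s * \<gamma>)\<rfloor>). b k) * exp (- t)) * indicator {0..} t \<partial>lborel)"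
proof -
  have tail: "ennreal (exp (- u)) = (\<integral>\<^sup>+t. ennreal (exp (- t)) * indicator {u..} t \<partial>lborel)" for u :: real
  proof -
    have "(\<integral>\<^sup>+t. ennreal (exp (- t)) * indicator {u..} t \<partial>lborel) = ennreal (0 - (- exp (- u)))"
    proof (rule nn_integral_FTC_atLeast)
      show "((\<lambda>t. - exp (- t)) \<longlongrightarrow> 0) (at_top :: real filter)"
        using tendsto_minus[OF filterlim_compose[OF exp_at_bot filterlim_uminus_at_bot_at_top]] by simp
    qed (auto intro!: derivative_eq_intros)
    then show ?thesis by simp
  qed
  have "(\<Sum>k. ennreal (exp (- s * \<gamma>) ^ k) * ennreal (b k))
      = (\<Sum>k. \<integral>\<^sup>+t. ennreal (b k) * (ennreal (exp (- t)) * indicator {s * \<gamma> * real k..} t) \<partial>lborel)"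
  proof (rule suminf_cong)
    fix k
    have "exp (- s * \<gamma>) ^ k = exp (- (s * \<gamma> * real k))" by (simp add: exp_of_nat_mult[symmetric] mult_ac)
    moreover have "(\<integral>\<^sup>+t. ennreal (b k) * (ennreal (exp (- t)) * indicator {s * \<gamma> * real k..} t) \<partial>lborel)
        = ennreal (b k) * ennreal (exp (- (s * \<gamma> * real k)))"
      unfolding tail[of "s * \<gamma> * real k"] by (rule nn_integral_cmult) simp
    ultimately show "ennreal (exp (- s * \<gamma>) ^ k) * ennreal (b k) = (\<integral>\<^sup>+t. ennreal (b k) * (ennreal (exp (- t)) * indicator {s * \<gamma> * real k..} t) \<partial>lborel)"
      by (simp only: mult.commute)
  qed
  also have "\<dots> = (\<integral>\<^sup>+t. (\<Sum>k. ennreal (b k) * (ennreal (exp (- t)) * indicator {s * \<gamma> * real k..} t)) \<partial>lborel)"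
    by (rule nn_integral_suminf[symmetric]) simp
  also have "\<dots> = (\<integral>\<^sup>+t. ennreal ((\<Sum>k<Suc (nat \<lfloor>t / (s * \<gamma>)\<rfloor>). b k) * exp (- t)) * indicator {0..} t \<partial>lborel)"
  proof (rule nn_integral_cong)
    fix t :: real
    show "(\<Sum>k. ennreal (b k) * (ennreal (exp (- t)) * indicator {s * \<gamma> * real k..} t))
      = ennreal ((\<Sum>k<Suc (nat \<lfloor>t / (s * \<gamma>)\<rfloor>). b k) * exp (- t)) * indicator {0..} t"
    proof (cases "0 \<le> t")
      case False
      have "t < s * \<gamma> * real k" for k
      proof -
        have "0 \<le> s * \<gamma> * real k" using \<gamma> s by simp
        then show ?thesis using False by linarith
      qed
      then have "indicator {s * \<gamma> * real k..} t = (0::ennreal)" for k by (simp add: indicator_def not_le)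
      then show ?thesis using False by simp
    next
      case True
      let ?M = "Suc (nat \<lfloor>t / (s * \<gamma>)\<rfloor>)"
      have "s * \<gamma> * real k \<le> t \<longleftrightarrow> k < ?M" for k
        using True \<gamma> s by (simp add: less_Suc_eq_le le_nat_iff le_floor_iff le_divide_eq mult.commute)
      then have ind: "indicator {s * \<gamma> * real k..} t = (if k < ?M then 1 else 0 :: ennreal)" for k
        by (simp add: indicator_def)
      have "(\<Sum>k. ennreal (b k) * (ennreal (exp (- t)) * indicator {s * \<gamma> * real k..} t))
          = (\<Sum>k<?M. ennreal (b k) * (ennreal (exp (- t)) * indicator {s * \<gamma> * real k..} t))"
        by (rule suminf_finite) (auto simp: ind)
      also have "\<dots> = (\<Sum>k<?M. ennreal (b k * exp (- t)))"
        by (intro sum.cong refl) (simp add: ind ennreal_mult b)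
      also have "\<dots> = ennreal ((\<Sum>k<?M. b k) * exp (- t))"
        using b by (subst sum_ennreal) (auto simp: sum_distrib_right simp del: sum.lessThan_Suc)
      finally show ?thesis using True by simp
    qed
  qed
  finally show ?thesis .
qed

text \<open>The partial sum up to t N / s is asymptotic to c a(t N / s), hence to c (t / s) to the
  power \<alpha> times a(N), and m cancels a(N). Integrating against exp (- t) under a majorant from
  \<open>a_growth\<close> produces the Gamma value.\<close>

theorem abelian_limit:
  fixes b :: "nat \<Rightarrow> real" and N :: "nat \<Rightarrow> nat" and m :: "nat \<Rightarrow> real"
  assumes b: "\<And>k. 0 \<le> b k" and c: "0 \<le> c" "(\<lambda>n. (\<Sum>k<n. b k) / a n) \<longlonglongrightarrow> c"
    and N: "filterlim N at_top sequentially" "\<And>n. 1 \<le> N n"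
    and m: "\<And>n. 0 < m n" "(\<lambda>n. m n * a (N n)) \<longlonglongrightarrow> 1" and s: "0 < s"
  shows "(\<lambda>n. ennreal (m n) * (\<Sum>k. ennreal (exp (- s * (1 / real (N n))) ^ k) * ennreal (b k)))
    \<longlonglongrightarrow> ennreal (c * Gamma (1 + \<alpha>) * s powr - \<alpha>)"
proof -
  define S where "S n = (\<Sum>k<n. b k)" for n
  have S_mono: "i \<le> j \<Longrightarrow> S i \<le> S j" for i j unfolding S_def by (intro sum_mono2) (auto simp: b)
  have S_nonneg: "0 \<le> S n" for n unfolding S_def by (intro sum_nonneg b)
  \<comment> \<open>The successor is there because the coefficient with index equal to the integer
    part is included in the partial sum.\<close>
  define M where "M n t = Suc (nat \<lfloor>t / s * real (N n)\<rfloor>)" for n t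
  have M_eq: "Suc (nat \<lfloor>t / (s * (1 / real (N n)))\<rfloor>) = M n t" for n t
    using N(2)[of n] by (simp add: M_def divide_simps)
  define u where "u n t = ennreal (m n) * (ennreal (S (M n t) * exp (- t)) * indicator {0..} t)" for n t
  have v_meas: "(\<lambda>t. ennreal (S (M n t) * exp (- t)) * indicator {0..} t) \<in> borel_measurable lborel" for n
  proof -
    have "(\<lambda>t. S (M n t)) \<in> borel_measurable borel" unfolding M_def by measurable
    then show ?thesis by measurable
  qed
  then have u_meas [measurable]: "u n \<in> borel_measurable lborel" for n
    unfolding u_def[abs_def] by (rule borel_measurable_times_ennreal[OF borel_measurable_const])
  have sum_eq: "ennreal (m n) * (\<Sum>k. ennreal (exp (- s * (1 / real (N n))) ^ k) * ennreal (b k)) = (\<integral>\<^sup>+t. u n t \<partial>lborel)" for n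
  proof -
    have g: "0 < 1 / real (N n)" using N(2)[of n] by simp
    have "(\<Sum>k. ennreal (exp (- s * (1 / real (N n))) ^ k) * ennreal (b k))
        = (\<integral>\<^sup>+t. ennreal (S (M n t) * exp (- t)) * indicator {0..} t \<partial>lborel)"
      unfolding S_def M_eq[symmetric] by (rule laplace_step_sum[OF b g s])
    then show ?thesis unfolding u_def by (simp add: nn_integral_cmult[OF v_meas])
  qed
  obtain n0 where n0: "1 \<le> n0" "\<And>k. n0 \<le> k \<Longrightarrow> 0 < a k" "\<And>k v. n0 \<le> k \<Longrightarrow> 0 \<le> v \<Longrightarrow> a (nat \<lfloor>v * real k\<rfloor>) \<le> 4 * (1 + v)\<^sup>2 * a k"
    using a_growth by blast
  have "\<forall>\<^sub>F n in sequentially. S n / a n < c + 1" using order_tendstoD(2)[OF c(2), of "c + 1"] by (simp add: S_def)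
  then obtain n1 where n1: "\<And>n. n1 \<le> n \<Longrightarrow> S n / a n < c + 1" by (auto simp: eventually_sequentially)
  define n2 where "n2 = max n0 n1"
  have S_le: "S n \<le> (c + 1) * a n" if "n2 \<le> n" for n
    using n1[of n] n0(2)[of n] that by (simp add: n2_def divide_less_eq less_imp_le)
  have "\<forall>\<^sub>F n in sequentially. m n * a (N n) < 2" using order_tendstoD(2)[OF m(2), of 2] by simp
  moreover have "\<forall>\<^sub>F n in sequentially. n2 \<le> N n" using N(1) by (simp add: filterlim_at_top)
  ultimately have "\<forall>\<^sub>F n in sequentially. m n * a (N n) < 2 \<and> n2 \<le> N n" by (rule eventually_conj)
  then obtain n3 where n3: "\<And>n. n3 \<le> n \<Longrightarrow> m n * a (N n) < 2 \<and> n2 \<le> N n" by (auto simp: eventually_sequentially)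
  \<comment> \<open>The factor 8 (c + 1) is made of c + 1 for partial sums against \<open>a\<close>,
    4 from the growth bound and 2 for m times a(N).\<close>
  define K where "K = 8 * (c + 1)"
  define w where "w t = ennreal (K * (2 + t / s)\<^sup>2 * exp (- t)) * indicator {0..} t" for t :: real
  have dom: "u n t \<le> w t" if n: "n3 \<le> n" for n t
  proof (cases "0 \<le> t")
    case True
    \<comment> \<open>The added 1 absorbs the successor in \<open>M\<close>, as N n is at least 1.
      It turns the 1 + u of the growth bound into 2 + t / s.\<close>
    let ?v = "t / s + 1"
    have v: "0 \<le> ?v" using True s by (simp add: add_nonneg_nonneg)
    have N1: "n0 \<le> N n" "n2 \<le> N n" "m n * a (N n) < 2" "1 \<le> N n" using n3[OF n] n0(1) by (auto simp: n2_def)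
    have "M n t \<le> nat \<lfloor>?v * real (N n)\<rfloor>"
    proof -
      have "\<lfloor>t / s * real (N n)\<rfloor> + 1 \<le> \<lfloor>?v * real (N n)\<rfloor>"
        using N1(4) by (simp add: le_floor_iff distrib_right)
      moreover have "0 \<le> \<lfloor>t / s * real (N n)\<rfloor>" using True s by simp
      ultimately show ?thesis unfolding M_def by linarith
    qed
    moreover have "n2 \<le> nat \<lfloor>?v * real (N n)\<rfloor>"
    proof -
      have "real (N n) \<le> ?v * real (N n)" using True s by (simp add: distrib_right)
      then have "N n \<le> nat \<lfloor>?v * real (N n)\<rfloor>" by (simp add: le_nat_floor)
      then show ?thesis using N1 by simp
    qed
    ultimately have "S (M n t) \<le> (c + 1) * a (nat \<lfloor>?v * real (N n)\<rfloor>)" using S_mono S_le order_trans by blast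
    also have "\<dots> \<le> (c + 1) * (4 * (1 + ?v)\<^sup>2 * a (N n))" using c N1 v by (intro mult_left_mono n0(3)) auto
    finally have "m n * S (M n t) \<le> m n * ((c + 1) * (4 * (1 + ?v)\<^sup>2 * a (N n)))" using m(1)[of n] by (intro mult_left_mono) auto
    also have "\<dots> = (4 * (c + 1) * (1 + ?v)\<^sup>2) * (m n * a (N n))" by (simp add: mult_ac)
    also have "\<dots> \<le> (4 * (c + 1) * (1 + ?v)\<^sup>2) * 2" using N1 c by (intro mult_left_mono) auto
    also have "\<dots> = K * (2 + t / s)\<^sup>2"
    proof -
      have 1: "1 + ?v = 2 + t / s" by simp
      have 2: "4 * (c + 1) * X * 2 = 8 * (c + 1) * X" for X by simp
      show ?thesis unfolding K_def 1 by (rule 2)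
    qed
    finally have "m n * S (M n t) \<le> K * (2 + t / s)\<^sup>2" .
    then have "m n * S (M n t) * exp (- t) \<le> K * (2 + t / s)\<^sup>2 * exp (- t)" by (intro mult_right_mono) auto
    then show ?thesis using True m(1)[of n] S_nonneg
      by (simp add: u_def w_def ennreal_mult[symmetric] mult.assoc[symmetric] ennreal_leI)
  qed (simp add: u_def)
  have w_fin: "(\<integral>\<^sup>+t. w t \<partial>lborel) < \<infinity>"
  proof -
    have K: "0 \<le> K" using c by (simp add: K_def)
    let ?p = "\<lambda>k t. ennreal (t ^ k * exp (- t)) * indicator {0..} t :: ennreal"
    have "w t \<le> ennreal (8 * K) * ?p 0 t + ennreal (2 * K / s\<^sup>2) * ?p 2 t" for t
    proof (cases "0 \<le> t")
      case True
      have "(2 + v)\<^sup>2 \<le> 8 + 2 * v\<^sup>2" for v :: real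
        using zero_le_power2[of "2 - v"] by (simp add: power2_eq_square algebra_simps)
      from this[of "t / s"] have "(2 + t / s)\<^sup>2 \<le> 8 + 2 * (t / s)\<^sup>2" .
      then have "K * (2 + t / s)\<^sup>2 * exp (- t) \<le> K * (8 + 2 * (t / s)\<^sup>2) * exp (- t)"
        using K by (intro mult_right_mono mult_left_mono) auto
      also have "\<dots> = 8 * K * (t ^ 0 * exp (- t)) + 2 * K / s\<^sup>2 * (t\<^sup>2 * exp (- t))"
        by (simp add: power_divide algebra_simps)
      finally have "ennreal (K * (2 + t / s)\<^sup>2 * exp (- t)) \<le> ennreal (8 * K * (t ^ 0 * exp (- t)) + 2 * K / s\<^sup>2 * (t\<^sup>2 * exp (- t)))"
        by (rule ennreal_leI)
      also have "\<dots> = ennreal (8 * K) * ennreal (t ^ 0 * exp (- t)) + ennreal (2 * K / s\<^sup>2) * ennreal (t\<^sup>2 * exp (- t))"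
      proof -
        have lin: "ennreal (X * x + Y * y) = ennreal X * ennreal x + ennreal Y * ennreal y"
          if "0 \<le> X" "0 \<le> x" "0 \<le> Y" "0 \<le> y" for X x Y y :: real
          using that by (simp add: ennreal_mult)
        show ?thesis by (rule lin) (use K in auto)
      qed
      finally show ?thesis using True by (simp add: w_def)
    qed (simp add: w_def)
    then have "(\<integral>\<^sup>+t. w t \<partial>lborel) \<le> (\<integral>\<^sup>+t. ennreal (8 * K) * ?p 0 t + ennreal (2 * K / s\<^sup>2) * ?p 2 t \<partial>lborel)"
      by (intro nn_integral_mono)
    also have "\<dots> = ennreal (8 * K) * (\<integral>\<^sup>+t. ?p 0 t \<partial>lborel) + ennreal (2 * K / s\<^sup>2) * (\<integral>\<^sup>+t. ?p 2 t \<partial>lborel)"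
      by (subst nn_integral_add) (auto simp: nn_integral_cmult simp del: power_0)
    also have "\<dots> < \<infinity>"
      unfolding nn_intergal_power_times_exp_Ici by (simp add: ennreal_mult_less_top)
    finally show ?thesis .
  qed
  have lim: "AE t in lborel. (\<lambda>n. u n t) \<longlonglongrightarrow> ennreal (c * s powr - \<alpha>) * (indicator {0..} t * ennreal (t powr \<alpha> / exp t))"
    using AE_lborel_singleton[of 0]
  proof eventually_elim
    case (elim t)
    show ?case
    proof (cases "0 < t")
      case False
      then show ?thesis using elim by (simp add: u_def)
    next
      case True
      define v where "v = t / s"
      have v: "0 < v" using True s by (simp add: v_def)
      have ratio: "(\<lambda>n. a (nat \<lfloor>d * real (N n)\<rfloor>) / a (N n)) \<longlonglongrightarrow> d powr \<alpha>" if "0 < d" for d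
        using filterlim_compose[OF a_ratio[OF that] N(1)] .
      have aN: "\<forall>\<^sub>F n in sequentially. 0 < a (N n)" by (rule eventually_compose_filterlim[OF a_pos N(1)])
      \<comment> \<open>\<open>M n t\<close> is one more than the integer part of v N n. That extra
        1 is dominated by (1 / Suc k) times N n once N n exceeds k, so the ratio is squeezed between
        the arguments v and v + 1 / Suc k.\<close>
      have M_ratio: "(\<lambda>n. a (M n t) / a (N n)) \<longlonglongrightarrow> v powr \<alpha>"
      proof (rule tendsto_squeeze_family[where start=0 and lo="\<lambda>_ n. a (nat \<lfloor>v * real (N n)\<rfloor>) / a (N n)"
            and up="\<lambda>k n. a (nat \<lfloor>(v + 1 / real (Suc k)) * real (N n)\<rfloor>) / a (N n)"
            and Lo="\<lambda>_. v powr \<alpha>" and Up="\<lambda>k. (v + 1 / real (Suc k)) powr \<alpha>"])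
        show "(\<lambda>n. a (nat \<lfloor>(v + 1 / real (Suc k)) * real (N n)\<rfloor>) / a (N n)) \<longlonglongrightarrow> (v + 1 / real (Suc k)) powr \<alpha>" for k
          using v by (intro ratio add_pos_pos) auto
        have "(\<lambda>k. (v + 1 / real (Suc k)) powr \<alpha>) \<longlonglongrightarrow> (v + 0) powr \<alpha>"
          using LIMSEQ_inverse_real_of_nat v by (intro tendsto_intros) (auto simp: inverse_eq_divide)
        then show "(\<lambda>k. (v + 1 / real (Suc k)) powr \<alpha>) \<longlonglongrightarrow> v powr \<alpha>" by simp
        show "\<forall>\<^sub>F n in sequentially. a (nat \<lfloor>v * real (N n)\<rfloor>) / a (N n) \<le> a (M n t) / a (N n) \<and>
          a (M n t) / a (N n) \<le> a (nat \<lfloor>(v + 1 / real (Suc k)) * real (N n)\<rfloor>) / a (N n)" for k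
        proof -
          have "\<forall>\<^sub>F n in sequentially. Suc k \<le> N n" using N(1) by (simp add: filterlim_at_top)
          then show ?thesis using aN
          proof eventually_elim
            case (elim n)
            have "1 \<le> 1 / real (Suc k) * real (N n)" using elim(1) by (simp add: le_divide_eq)
            then have "\<lfloor>v * real (N n)\<rfloor> + 1 \<le> \<lfloor>(v + 1 / real (Suc k)) * real (N n)\<rfloor>"
              unfolding distrib_right le_floor_iff by (simp add: add_mono)
            moreover have "0 \<le> \<lfloor>v * real (N n)\<rfloor>" using v by simp
            ultimately have "M n t \<le> nat \<lfloor>(v + 1 / real (Suc k)) * real (N n)\<rfloor>"
              unfolding M_def v_def[symmetric] by linarith
            moreover have "nat \<lfloor>v * real (N n)\<rfloor> \<le> M n t" by (simp add: M_def v_def)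
            ultimately show ?case using elim(2) a_le by (auto intro!: divide_right_mono)
          qed
        qed
      qed (auto intro: ratio v)
      have M_top: "filterlim (\<lambda>n. M n t) at_top sequentially"
        unfolding filterlim_at_top
      proof
        fix Z :: nat
        obtain k :: nat where k: "real Z / v \<le> real k" using real_arch_simple by blast
        have "\<forall>\<^sub>F n in sequentially. k \<le> N n" using N(1) by (simp add: filterlim_at_top)
        then show "\<forall>\<^sub>F n in sequentially. Z \<le> M n t"
        proof eventually_elim
          case (elim n)
          have "real Z \<le> v * real k" using k v by (simp add: divide_le_eq mult.commute)
          also have "\<dots> \<le> v * real (N n)" using elim v by (intro mult_left_mono) auto
          finally have "Z \<le> nat \<lfloor>v * real (N n)\<rfloor>" by (simp add: le_nat_floor)
          then show ?case by (simp add: M_def v_def)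
        qed
      qed
      have "(\<lambda>n. S (M n t) / a (M n t) * (a (M n t) / a (N n)) * (m n * a (N n))) \<longlonglongrightarrow> c * v powr \<alpha> * 1"
        using filterlim_compose[OF c(2) M_top] by (intro tendsto_mult M_ratio m(2)) (simp add: S_def)
      moreover have "\<forall>\<^sub>F n in sequentially. S (M n t) / a (M n t) * (a (M n t) / a (N n)) * (m n * a (N n)) = m n * S (M n t)"
        using aN eventually_compose_filterlim[OF a_pos M_top] by eventually_elim simp
      ultimately have "(\<lambda>n. m n * S (M n t)) \<longlonglongrightarrow> c * v powr \<alpha>"
        using Lim_transform_eventually by fastforce
      then have "(\<lambda>n. ennreal (m n * S (M n t) * exp (- t))) \<longlonglongrightarrow> ennreal (c * v powr \<alpha> * exp (- t))"
        by (intro tendsto_ennrealI tendsto_mult_right)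
      moreover have "ennreal (m n * S (M n t) * exp (- t)) = u n t" for n
        using True m(1)[of n] S_nonneg by (simp add: u_def ennreal_mult[symmetric] mult.assoc)
      moreover have "ennreal (c * v powr \<alpha> * exp (- t)) = ennreal (c * s powr - \<alpha>) * (indicator {0..} t * ennreal (t powr \<alpha> / exp t))"
        using True s c by (simp add: v_def powr_divide powr_minus exp_minus field_simps ennreal_mult[symmetric])
      ultimately show ?thesis by simp
    qed
  qed
  \<comment> \<open>The majorant is available from n3 on only, so the sequence is shifted before
    dominated convergence.\<close>
  have "(\<lambda>n. \<integral>\<^sup>+t. u (n + n3) t \<partial>lborel) \<longlonglongrightarrow> (\<integral>\<^sup>+t. ennreal (c * s powr - \<alpha>) * (indicator {0..} t * ennreal (t powr \<alpha> / exp t)) \<partial>lborel)"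
  proof (rule nn_integral_dominated_convergence[where w=w])
    show "w \<in> borel_measurable lborel" unfolding w_def by measurable
    show "AE t in lborel. u (j + n3) t \<le> w t" for j using dom[of "j + n3"] by simp
    show "AE t in lborel. (\<lambda>i. u (i + n3) t) \<longlonglongrightarrow> ennreal (c * s powr - \<alpha>) * (indicator {0..} t * ennreal (t powr \<alpha> / exp t))"
      using lim by eventually_elim (rule LIMSEQ_ignore_initial_segment)
    show "(\<integral>\<^sup>+t. w t \<partial>lborel) < \<infinity>" by (rule w_fin)
  qed (use u_meas in auto)
  also have "(\<integral>\<^sup>+t. ennreal (c * s powr - \<alpha>) * (indicator {0..} t * ennreal (t powr \<alpha> / exp t)) \<partial>lborel)
     = ennreal (c * s powr - \<alpha>) * ennreal (Gamma (1 + \<alpha>))"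
  proof -
    have "(\<integral>\<^sup>+t. indicator {0..} t * ennreal (t powr \<alpha> / exp t) \<partial>lborel)
        = (\<integral>\<^sup>+t. ennreal (indicator {0..} t * t powr (1 + \<alpha> - 1) / exp t) \<partial>lborel)"
      by (intro nn_integral_cong) (auto simp: indicator_def)
    also have "\<dots> = ennreal (Gamma (1 + \<alpha>))"
      by (rule Gamma_conv_nn_integral_real[symmetric]) (use \<alpha> in simp)
    finally show ?thesis by (subst nn_integral_cmult) auto
  qed
  also have "\<dots> = ennreal (c * Gamma (1 + \<alpha>) * s powr - \<alpha>)"
    using c \<alpha> by (subst ennreal_mult[symmetric]) (auto simp: mult_ac Gamma_real_nonneg)
  finally show ?thesis unfolding sum_eq by (rule LIMSEQ_offset)
qed

end

section \<open>Absolutely continuous initial laws\<close>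

context walters_system
begin

text \<open>Tannery's theorem, with the measures of the pieces as a summable majorant that does not
  depend on n.\<close>

lemma integral_disjoint_limit:
  fixes G :: "nat \<Rightarrow> (nat \<Rightarrow> 'v) \<Rightarrow> real" and E :: "nat \<Rightarrow> (nat \<Rightarrow> 'v) set"
  assumes G [measurable]: "\<And>n. G n \<in> borel_measurable \<nu>" and G01: "\<And>n y. 0 \<le> G n y \<and> G n y \<le> 1"
    and E: "\<And>i. E i \<in> sets \<nu>" "disjoint_family E" "emeasure \<nu> (\<Union>i. E i) < \<infinity>"
    and lim: "\<And>i. (\<lambda>n. \<integral>y. G n y * indicator (E i) y \<partial>\<nu>) \<longlonglongrightarrow> c * measure \<nu> (E i)"
  shows "(\<lambda>n. \<integral>y. G n y * indicator (\<Union>i. E i) y \<partial>\<nu>) \<longlonglongrightarrow> c * measure \<nu> (\<Union>i. E i)"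
proof -
  note [measurable] = E(1)
  have Efin: "emeasure \<nu> (E i) < \<infinity>" for i
    using emeasure_mono[of "E i" "\<Union>i. E i" \<nu>] E(3) by (auto intro: le_less_trans)
  have ind: "integrable \<nu> (\<lambda>y. indicator F y :: real)" if "F \<in> sets \<nu>" "emeasure \<nu> F < \<infinity>" for F
    using that by simp
  have GI: "integrable \<nu> (\<lambda>y. G n y * indicator F y)" if F: "F \<in> sets \<nu>" "emeasure \<nu> F < \<infinity>" for n F
    by (rule Bochner_Integration.integrable_bound[OF ind[OF F]]) (use G01 F in \<open>auto simp: indicator_def\<close>)
  have le: "norm (\<integral>y. G n y * indicator (E i) y \<partial>\<nu>) \<le> measure \<nu> (E i)" for n i
  proof -
    have "(\<integral>y. G n y * indicator (E i) y \<partial>\<nu>) \<le> (\<integral>y. indicator (E i) y \<partial>\<nu>)"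
      by (intro integral_mono GI ind E Efin) (use G01 in \<open>auto simp: indicator_def\<close>)
    moreover have "0 \<le> (\<integral>y. G n y * indicator (E i) y \<partial>\<nu>)"
      by (rule integral_nonneg_AE) (use G01 in auto)
    ultimately show ?thesis by (simp add: E)
  qed
  have sums_m: "(\<lambda>i. measure \<nu> (E i)) sums measure \<nu> (\<Union>i. E i)"
    by (rule measure_UNION) (use E in \<open>auto simp: less_top\<close>)
  have sums_G: "(\<lambda>i. \<integral>y. G n y * indicator (E i) y \<partial>\<nu>) sums (\<integral>y. G n y * indicator (\<Union>i. E i) y \<partial>\<nu>)" for n
  proof -
    have pt: "(\<lambda>i. G n y * indicator (E i) y) sums (G n y * indicator (\<Union>i. E i) y)" for y
      by (intro sums_mult indicator_sums) (use E(2) in \<open>auto simp: disjoint_family_on_def\<close>)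
    have sm: "summable (\<lambda>i. \<integral>y. norm (G n y * indicator (E i) y) \<partial>\<nu>)"
    proof (rule summable_comparison_test'[OF sums_summable[OF sums_m], of 0])
      fix i
      have "norm (G n y * indicator (E i) y) = G n y * indicator (E i) y" for y using G01[of n y] by simp
      then show "norm (\<integral>y. norm (G n y * indicator (E i) y) \<partial>\<nu>) \<le> measure \<nu> (E i)" using le[of n i] by simp
    qed
    have "(\<lambda>i. \<integral>y. G n y * indicator (E i) y \<partial>\<nu>) sums (\<integral>y. (\<Sum>i. G n y * indicator (E i) y) \<partial>\<nu>)"
    proof (rule sums_integral[OF GI[OF E(1) Efin] _ sm])
      have "norm (G n y * indicator (E i) y) = G n y * indicator (E i) y" for i y using G01[of n y] by simp
      then show "AE y in \<nu>. summable (\<lambda>i. norm (G n y * indicator (E i) y))"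
        using pt by (simp add: sums_iff)
    qed
    then show ?thesis using pt by (simp add: sums_iff)
  qed
  have "(\<lambda>n. \<Sum>i. \<integral>y. G n y * indicator (E i) y \<partial>\<nu>) \<longlonglongrightarrow> (\<Sum>i. c * measure \<nu> (E i))"
  proof (rule tannerys_theorem[where M="\<lambda>i. measure \<nu> (E i)", THEN conjunct2, THEN conjunct2])
    show "(\<lambda>n. \<integral>y. G n y * indicator (E i) y \<partial>\<nu>) \<longlonglongrightarrow> c * measure \<nu> (E i)" for i by (rule lim)
    show "\<forall>\<^sub>F (i, n) in at_top \<times>\<^sub>F sequentially. norm (\<integral>y. G n y * indicator (E i) y \<partial>\<nu>) \<le> measure \<nu> (E i)"
      by (rule always_eventually) (use le in auto)
  qed (use sums_m in \<open>auto simp: sums_iff\<close>)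
  moreover have "(\<Sum>i. c * measure \<nu> (E i)) = c * measure \<nu> (\<Union>i. E i)"
    using sums_mult[OF sums_m, of c] by (simp add: sums_iff)
  ultimately show ?thesis using sums_G by (simp add: sums_iff)
qed

text \<open>Two cylinders are nested or disjoint, according to whether the shorter word is a prefix
  of the longer one. The empty set has to be added for the disjoint case.\<close>

lemma cylinder_Int_stable: "Int_stable (insert {} (range (cylinder A)))"
proof (rule Int_stableI)
  have "cylinder A w \<inter> cylinder A w' \<in> insert {} (range (cylinder A))" if "length w \<le> length w'" for w w'
  proof (cases "\<forall>i<length w. w ! i = w' ! i")
    case True
    then have "cylinder A w \<inter> cylinder A w' = cylinder A w'" using that by (auto simp: mem_cylinder)
    then show ?thesis by simp
  next
    case False
    then have "cylinder A w \<inter> cylinder A w' = {}" using that by (fastforce simp: mem_cylinder)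
    then show ?thesis by simp
  qed
  note le = this
  have "cylinder A w \<inter> cylinder A w' \<in> insert {} (range (cylinder A))" for w w'
  proof (cases "length w \<le> length w'")
    case True
    then show ?thesis by (rule le)
  next
    case False
    then have "cylinder A w' \<inter> cylinder A w \<in> insert {} (range (cylinder A))" by (intro le) simp
    then show ?thesis by (subst Int_commute)
  qed
  then show "a \<inter> b \<in> insert {} (range (cylinder A))"
    if "a \<in> insert {} (range (cylinder A))" "b \<in> insert {} (range (cylinder A))" for a b
    using that by auto
qed

lemma cylinder_first: "cylinder A w \<inter> cylinder A [v] = {} \<or> (\<exists>u. u \<noteq> [] \<and> cylinder A w \<inter> cylinder A [v] = cylinder A u)"
proof (cases w)
  case Nil
  then have "cylinder A w \<inter> cylinder A [v] = cylinder A [v]" by (auto simp: mem_cylinder)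
  then show ?thesis by blast
next
  case (Cons v' w')
  show ?thesis
  proof (cases "v' = v")
    case True
    then have "cylinder A w \<inter> cylinder A [v] = cylinder A w" using Cons by (auto simp: mem_cylinder)
    then show ?thesis using Cons by blast
  next
    case False
    then have "cylinder A w \<inter> cylinder A [v] = {}" using Cons by (fastforce simp: mem_cylinder)
    then show ?thesis by blast
  qed
qed

text \<open>A Dynkin argument from cylinders to Borel sets. It is carried out inside each one-letter
  cylinder, where the measure is finite and complements may be subtracted; the letters are then put
  together by countable additivity.\<close>

lemma set_limit:
  fixes G :: "nat \<Rightarrow> (nat \<Rightarrow> 'v) \<Rightarrow> real"
  assumes G [measurable]: "\<And>n. G n \<in> borel_measurable \<nu>" and G01: "\<And>n y. 0 \<le> G n y \<and> G n y \<le> 1"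
    and cyl: "\<And>w. w \<noteq> [] \<Longrightarrow> (\<lambda>n. \<integral>y. G n y * indicator (cylinder A w) y \<partial>\<nu>) \<longlonglongrightarrow> c * measure \<nu> (cylinder A w)"
    and E: "E \<in> sets \<nu>" "emeasure \<nu> E < \<infinity>"
  shows "(\<lambda>n. \<integral>y. G n y * indicator E y \<partial>\<nu>) \<longlonglongrightarrow> c * measure \<nu> E"
proof -
  have fin: "emeasure \<nu> (D \<inter> cylinder A [v]) < \<infinity>" if "D \<in> sets \<nu>" for D v
    using emeasure_mono[of "D \<inter> cylinder A [v]" "cylinder A [v]" \<nu>] cylinder_finite[of "[v]"] by (auto intro: le_less_trans)
  have int: "integrable \<nu> (\<lambda>y. G n y * indicator F y)" if F: "F \<in> sets \<nu>" "emeasure \<nu> F < \<infinity>" for n F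
  proof (rule Bochner_Integration.integrable_bound)
    show "integrable \<nu> (\<lambda>y. indicator F y :: real)" using F by simp
    show "AE y in \<nu>. norm (G n y * indicator F y) \<le> norm (indicator F y :: real)"
      using G01 by (auto simp: indicator_def)
  qed (use F in measurable)
  have local: "(\<lambda>n. \<integral>y. G n y * indicator (D \<inter> cylinder A [v]) y \<partial>\<nu>) \<longlonglongrightarrow> c * measure \<nu> (D \<inter> cylinder A [v])"
    if "D \<in> sigma_sets (markov_space A) (insert {} (range (cylinder A)))" for D v
  proof -
    have sub: "insert {} (range (cylinder A)) \<subseteq> Pow (markov_space A)" by (auto simp: mem_cylinder)
    have sets: "sigma_sets (markov_space A) (insert {} (range (cylinder A))) = sets \<nu>"
      unfolding sets_nu' by (rule sigma_sets_eqI) (auto intro: sigma_sets.Empty)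
    show ?thesis
      using cylinder_Int_stable sub that
    proof (induction rule: sigma_sets_induct_disjoint)
      case (basic D)
      have "D \<inter> cylinder A [v] = {} \<or> (\<exists>u. u \<noteq> [] \<and> D \<inter> cylinder A [v] = cylinder A u)"
        using basic cylinder_first[of _ v] by auto
      then show ?case
      proof (elim disjE exE conjE)
        assume "D \<inter> cylinder A [v] = {}"
        then show ?thesis by simp
      next
        fix u assume "u \<noteq> []" "D \<inter> cylinder A [v] = cylinder A u"
        then show ?thesis using cyl[of u] by simp
      qed
    next
      case empty
      then show ?case by simp
    next
      case (compl D)
      then have D: "D \<in> sets \<nu>" by (simp add: sets)
      let ?C = "cylinder A [v]"
      have "(\<lambda>n. (\<integral>y. G n y * indicator ?C y \<partial>\<nu>) - (\<integral>y. G n y * indicator (D \<inter> ?C) y \<partial>\<nu>))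
          \<longlonglongrightarrow> c * measure \<nu> ?C - c * measure \<nu> (D \<inter> ?C)"
        by (intro tendsto_diff cyl compl) simp
      moreover have "(\<integral>y. G n y * indicator ?C y \<partial>\<nu>) - (\<integral>y. G n y * indicator (D \<inter> ?C) y \<partial>\<nu>)
          = (\<integral>y. G n y * indicator ((markov_space A - D) \<inter> ?C) y \<partial>\<nu>)" for n
      proof -
        have "(\<integral>y. G n y * indicator ?C y \<partial>\<nu>) - (\<integral>y. G n y * indicator (D \<inter> ?C) y \<partial>\<nu>)
            = (\<integral>y. G n y * indicator ?C y - G n y * indicator (D \<inter> ?C) y \<partial>\<nu>)"
          using D fin[OF D, of v] cylinder_finite[of "[v]"] by (intro Bochner_Integration.integral_diff[symmetric] int) auto
        also have "\<dots> = (\<integral>y. G n y * indicator ((markov_space A - D) \<inter> ?C) y \<partial>\<nu>)"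
          by (intro Bochner_Integration.integral_cong refl) (auto simp: indicator_def space_nu)
        finally show ?thesis .
      qed
      moreover have "measure \<nu> ((markov_space A - D) \<inter> ?C) = measure \<nu> ?C - measure \<nu> (D \<inter> ?C)"
      proof -
        have "(markov_space A - D) \<inter> ?C = ?C - (D \<inter> ?C)" by (auto simp: mem_cylinder)
        moreover have "measure \<nu> (?C - (D \<inter> ?C)) = measure \<nu> ?C - measure \<nu> (D \<inter> ?C)"
          by (rule measure_Diff) (use D cylinder_finite[of "[v]"] in auto)
        ultimately show ?thesis by simp
      qed
      ultimately show ?case by (simp add: right_diff_distrib)
    next
      case (union D)
      then have D: "D i \<in> sets \<nu>" for i by (auto simp: sets)
      have "(\<lambda>n. \<integral>y. G n y * indicator (\<Union>i. D i \<inter> cylinder A [v]) y \<partial>\<nu>) \<longlonglongrightarrow> c * measure \<nu> (\<Union>i. D i \<inter> cylinder A [v])"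
      proof (rule integral_disjoint_limit[OF G G01])
        show "disjoint_family (\<lambda>i. D i \<inter> cylinder A [v])" using union(1) by (auto simp: disjoint_family_on_def)
        have "(\<Union>i. D i \<inter> cylinder A [v]) = (\<Union>i. D i) \<inter> cylinder A [v]" by auto
        then show "emeasure \<nu> (\<Union>i. D i \<inter> cylinder A [v]) < \<infinity>" using fin[of "\<Union>i. D i" v] D by auto
      qed (use D union in auto)
      moreover have "(\<Union>i. D i \<inter> cylinder A [v]) = (\<Union>i. D i) \<inter> cylinder A [v]" by auto
      ultimately show ?case by simp
    qed
  qed
  \<comment> \<open>The family is indexed by codes of letters so as to run over the naturals;
    numbers that code no letter get the empty set.\<close>
  define F where "F i = E \<inter> (if \<exists>v::'v. to_nat v = i then cylinder A [from_nat i] else {})" for i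
  have UF: "(\<Union>i. F i) = E"
  proof
    show "(\<Union>i. F i) \<subseteq> E" by (auto simp: F_def)
    show "E \<subseteq> (\<Union>i. F i)"
    proof
      fix y assume y: "y \<in> E"
      then have "y \<in> markov_space A" using sets.sets_into_space[OF E(1)] by (auto simp: space_nu)
      then have "y \<in> F (to_nat (y 0))" using y by (auto simp: F_def mem_cylinder)
      then show "y \<in> (\<Union>i. F i)" by blast
    qed
  qed
  have "(\<lambda>n. \<integral>y. G n y * indicator (\<Union>i. F i) y \<partial>\<nu>) \<longlonglongrightarrow> c * measure \<nu> (\<Union>i. F i)"
  proof (rule integral_disjoint_limit[OF G G01])
    show "F i \<in> sets \<nu>" for i using E by (auto simp: F_def)
    show "disjoint_family F" by (auto simp: disjoint_family_on_def F_def mem_cylinder split: if_splits)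
    show "emeasure \<nu> (\<Union>i. F i) < \<infinity>" unfolding UF by (rule E(2))
    have E': "E \<in> sigma_sets (markov_space A) (insert {} (range (cylinder A)))"
    proof -
      have "sigma_sets (markov_space A) (range (cylinder A)) \<subseteq> sigma_sets (markov_space A) (insert {} (range (cylinder A)))"
        by (rule sigma_sets_subseteq) auto
      then show ?thesis using E(1) sets_nu' by auto
    qed
    show "(\<lambda>n. \<integral>y. G n y * indicator (F i) y \<partial>\<nu>) \<longlonglongrightarrow> c * measure \<nu> (F i)" for i
      using local[OF E'] by (auto simp: F_def)
  qed
  then show ?thesis unfolding UF .
qed

lemma cylinder_letters: "(\<Union>v. cylinder A [v]) = markov_space A"
  by (auto simp: mem_cylinder)

lemma sigma_finite_nu: "sigma_finite_measure \<nu>"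
proof
  show "\<exists>S. countable S \<and> S \<subseteq> sets \<nu> \<and> \<Union> S = space \<nu> \<and> (\<forall>a\<in>S. emeasure \<nu> a \<noteq> \<infinity>)"
  proof (intro exI[of _ "range (\<lambda>v. cylinder A [v])"] conjI ballI)
    show "countable (range (\<lambda>v. cylinder A [v]))" by (rule countable_image) (rule countableI_type)
    show "range (\<lambda>v. cylinder A [v]) \<subseteq> sets \<nu>" by (intro image_subsetI) simp
    show "\<Union> (range (\<lambda>v. cylinder A [v])) = space \<nu>" using cylinder_letters by (simp add: space_nu)
    show "emeasure \<nu> a \<noteq> \<infinity>" if a: "a \<in> range (\<lambda>v. cylinder A [v])" for a
    proof -
      obtain v where "a = cylinder A [v]" using a by (rule imageE)
      then show ?thesis using cylinder_finite[of "[v]"] by simp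
    qed
  qed
qed

text \<open>Since \<open>G n\<close> takes values in the unit interval, replacing \<open>f\<close>
  by an approximation costs at most their L1 distance, uniformly in n. This is what lets the limit
  step of the induction through.\<close>

lemma function_limit:
  fixes G :: "nat \<Rightarrow> (nat \<Rightarrow> 'v) \<Rightarrow> real"
  assumes G [measurable]: "\<And>n. G n \<in> borel_measurable \<nu>" and G01: "\<And>n y. 0 \<le> G n y \<and> G n y \<le> 1"
    and cyl: "\<And>w. w \<noteq> [] \<Longrightarrow> (\<lambda>n. \<integral>y. G n y * indicator (cylinder A w) y \<partial>\<nu>) \<longlonglongrightarrow> c * measure \<nu> (cylinder A w)"
    and f: "integrable \<nu> (f :: (nat \<Rightarrow> 'v) \<Rightarrow> real)"
  shows "(\<lambda>n. \<integral>y. G n y * f y \<partial>\<nu>) \<longlonglongrightarrow> c * (\<integral>y. f y \<partial>\<nu>)"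
  using f
proof (induction rule: integrable_induct)
  case (base E d)
  have "(\<lambda>n. (\<integral>y. G n y * indicator E y \<partial>\<nu>) * d) \<longlonglongrightarrow> c * measure \<nu> E * d"
    by (intro tendsto_mult_right set_limit[OF G G01 cyl]) (use base in auto)
  moreover have "(\<integral>y. G n y * (indicator E y *\<^sub>R d) \<partial>\<nu>) = (\<integral>y. G n y * indicator E y \<partial>\<nu>) * d" for n
    by (simp add: mult.assoc[symmetric])
  ultimately show ?case using base by (simp add: mult.assoc)
next
  case (add f g)
  have i: "integrable \<nu> (\<lambda>y. G n y * u y)" if "integrable \<nu> u" for u n
    by (rule Bochner_Integration.integrable_bound[OF that])
       (use G01 that in \<open>auto simp: abs_mult intro!: mult_left_le_one_le\<close>)
  show ?case using tendsto_add[OF add.IH] add.hyps by (simp add: distrib_left i)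
next
  case (lim f s)
  have i: "integrable \<nu> (\<lambda>y. G n y * u y)" if "integrable \<nu> u" for u n
    by (rule Bochner_Integration.integrable_bound[OF that])
       (use G01 that in \<open>auto simp: abs_mult intro!: mult_left_le_one_le\<close>)
  have "(\<lambda>k. \<integral>y. norm (s k y - f y) \<partial>\<nu>) \<longlonglongrightarrow> (\<integral>y. 0 \<partial>\<nu>)"
  proof (rule integral_dominated_convergence[where w="\<lambda>y. 3 * norm (f y)"])
    show "AE y in \<nu>. (\<lambda>k. norm (s k y - f y)) \<longlonglongrightarrow> 0"
    proof (rule AE_I2)
      fix y assume "y \<in> space \<nu>"
      then have "(\<lambda>k. s k y) \<longlonglongrightarrow> f y" by (rule lim)
      then show "(\<lambda>k. norm (s k y - f y)) \<longlonglongrightarrow> 0" using tendsto_norm_zero LIM_zero by blast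
    qed
    show "AE y in \<nu>. norm (norm (s k y - f y)) \<le> 3 * norm (f y)" for k
    proof (rule AE_I2)
      fix y assume "y \<in> space \<nu>"
      then have "norm (s k y) \<le> 2 * norm (f y)" by (rule lim)
      then show "norm (norm (s k y - f y)) \<le> 3 * norm (f y)" using norm_triangle_ineq4[of "s k y" "f y"] by simp
    qed
  qed (use lim in auto)
  then have L1: "(\<lambda>k. \<integral>y. norm (s k y - f y) \<partial>\<nu>) \<longlonglongrightarrow> 0" by simp
  have close: "\<bar>(\<integral>y. G n y * f y \<partial>\<nu>) - (\<integral>y. G n y * s k y \<partial>\<nu>)\<bar> \<le> (\<integral>y. norm (s k y - f y) \<partial>\<nu>)" for n k
  proof -
    have "\<bar>(\<integral>y. G n y * f y \<partial>\<nu>) - (\<integral>y. G n y * s k y \<partial>\<nu>)\<bar> = \<bar>\<integral>y. G n y * f y - G n y * s k y \<partial>\<nu>\<bar>"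
      using i lim by simp
    also have "\<dots> \<le> (\<integral>y. \<bar>G n y * f y - G n y * s k y\<bar> \<partial>\<nu>)" by (rule integral_abs_bound)
    also have "\<dots> \<le> (\<integral>y. norm (s k y - f y) \<partial>\<nu>)"
    proof (rule integral_mono)
      show "\<bar>G n y * f y - G n y * s k y\<bar> \<le> norm (s k y - f y)" for y
        using G01[of n y] by (simp add: right_diff_distrib[symmetric] abs_mult abs_minus_commute mult_left_le_one_le)
    qed (use i lim in auto)
    finally show ?thesis .
  qed
  have ints: "(\<lambda>k. \<integral>y. s k y \<partial>\<nu>) \<longlonglongrightarrow> (\<integral>y. f y \<partial>\<nu>)"
    by (rule integral_dominated_convergence[where w="\<lambda>y. 2 * norm (f y)"]) (use lim in auto)
  show ?case
  proof (rule tendsto_squeeze_family[where start=0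
      and lo="\<lambda>k n. (\<integral>y. G n y * s k y \<partial>\<nu>) - (\<integral>y. norm (s k y - f y) \<partial>\<nu>)"
      and up="\<lambda>k n. (\<integral>y. G n y * s k y \<partial>\<nu>) + (\<integral>y. norm (s k y - f y) \<partial>\<nu>)"
      and Lo="\<lambda>k. c * (\<integral>y. s k y \<partial>\<nu>) - (\<integral>y. norm (s k y - f y) \<partial>\<nu>)"
      and Up="\<lambda>k. c * (\<integral>y. s k y \<partial>\<nu>) + (\<integral>y. norm (s k y - f y) \<partial>\<nu>)"])
    show "\<forall>\<^sub>F n in sequentially. (\<integral>y. G n y * s k y \<partial>\<nu>) - (\<integral>y. norm (s k y - f y) \<partial>\<nu>) \<le> (\<integral>y. G n y * f y \<partial>\<nu>) \<and>
       (\<integral>y. G n y * f y \<partial>\<nu>) \<le> (\<integral>y. G n y * s k y \<partial>\<nu>) + (\<integral>y. norm (s k y - f y) \<partial>\<nu>)" for k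
    proof (intro always_eventually allI)
      fix n
      show "(\<integral>y. G n y * s k y \<partial>\<nu>) - (\<integral>y. norm (s k y - f y) \<partial>\<nu>) \<le> (\<integral>y. G n y * f y \<partial>\<nu>) \<and>
         (\<integral>y. G n y * f y \<partial>\<nu>) \<le> (\<integral>y. G n y * s k y \<partial>\<nu>) + (\<integral>y. norm (s k y - f y) \<partial>\<nu>)"
        using close[of n k] by linarith
    qed
    show "(\<lambda>k. c * (\<integral>y. s k y \<partial>\<nu>) - (\<integral>y. norm (s k y - f y) \<partial>\<nu>)) \<longlonglongrightarrow> c * (\<integral>y. f y \<partial>\<nu>)"
      using tendsto_diff[OF tendsto_mult_left[OF ints, of c] L1] by simp
    show "(\<lambda>k. c * (\<integral>y. s k y \<partial>\<nu>) + (\<integral>y. norm (s k y - f y) \<partial>\<nu>)) \<longlonglongrightarrow> c * (\<integral>y. f y \<partial>\<nu>)"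
      using tendsto_add[OF tendsto_mult_left[OF ints, of c] L1] by simp
  qed (intro tendsto_intros lim)+
qed

text \<open>Convergence against every cylinder is weak convergence of \<open>G n\<close> to the
  constant c, tested against integrable functions, and an absolutely continuous law is such a test
  through its density. Hence the limit is the same for every initial law.\<close>

lemma probability_limit:
  fixes G :: "nat \<Rightarrow> (nat \<Rightarrow> 'v) \<Rightarrow> real"
  assumes G: "\<And>n. G n \<in> borel_measurable \<nu>" and G01: "\<And>n y. 0 \<le> G n y \<and> G n y \<le> 1"
    and cyl: "\<And>w. w \<noteq> [] \<Longrightarrow> (\<lambda>n. \<integral>y. G n y * indicator (cylinder A w) y \<partial>\<nu>) \<longlonglongrightarrow> c * measure \<nu> (cylinder A w)"
    and P: "prob_space P" "sets P = sets \<nu>" "absolutely_continuous \<nu> P"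
  shows "(\<lambda>n. \<integral>y. G n y \<partial>P) \<longlonglongrightarrow> c"
proof -
  interpret P: prob_space P by fact
  interpret sigma_finite_measure \<nu> by (rule sigma_finite_nu)
  obtain f where f: "f \<in> borel_measurable \<nu>" "density \<nu> f = P" using Radon_Nikodym[OF P(3,2)] by blast
  have one: "(\<integral>\<^sup>+y. f y \<partial>\<nu>) = 1"
  proof -
    have sp: "space P = space \<nu>" using P(2) by (rule sets_eq_imp_space_eq)
    have "1 = emeasure (density \<nu> f) (space \<nu>)" using P.emeasure_space_1 unfolding f(2) sp by simp
    also have "\<dots> = (\<integral>\<^sup>+y. f y * indicator (space \<nu>) y \<partial>\<nu>)" by (rule emeasure_density) (use f(1) in auto)
    also have "\<dots> = (\<integral>\<^sup>+y. f y \<partial>\<nu>)" by (rule nn_integral_cong) simp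
    finally show ?thesis by simp
  qed
  then have fin: "AE y in \<nu>. f y \<noteq> \<infinity>" by (intro nn_integral_PInf_AE f) simp
  define g where "g y = enn2real (f y)" for y
  have g: "g \<in> borel_measurable \<nu>" "\<And>y. 0 \<le> g y" using f(1) by (simp_all add: g_def[abs_def])
  have fg: "AE y in \<nu>. f y = ennreal (g y)" using fin by eventually_elim (simp add: g_def less_top)
  have Pg: "P = density \<nu> (\<lambda>y. ennreal (g y))" unfolding f(2)[symmetric] by (rule density_cong) (use f g fg in auto)
  have gi: "(\<integral>\<^sup>+y. ennreal (g y) \<partial>\<nu>) = 1" using one nn_integral_cong_AE[OF fg] by simp
  then have int: "integrable \<nu> g" "(\<integral>y. g y \<partial>\<nu>) = 1"
    using g by (auto intro!: integrableI_nonneg simp: integral_eq_nn_integral)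
  have "(\<integral>y. G n y \<partial>P) = (\<integral>y. G n y * g y \<partial>\<nu>)" for n
    unfolding Pg using G g by (subst integral_density) (auto simp: mult.commute)
  then show ?thesis using function_limit[OF G G01 cyl int(1)] int(2) by simp
qed

end

section \<open>Convergence of moments\<close>

text \<open>A mapping theorem for \<open>G\<close> that is continuous on \<open>E\<close> only. It
  is approximated from below by functions that are Lipschitz on the whole space; each gives a lower
  bound in the limit, and these increase to \<open>G\<close> on \<open>E\<close>. Measurability is
  asked of \<open>f\<close> and \<open>f0\<close> rather than of \<open>E\<close> or
  \<open>G\<close>.\<close>

lemma weak_limit_on_subset_lower:
  fixes G :: "'a::{metric_space, second_countable_topology} \<Rightarrow> real"
    and X :: "nat \<Rightarrow> 'b \<Rightarrow> 'a" and Y :: "'c \<Rightarrow> 'a"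
  assumes P: "\<And>n. prob_space (P n)" and Q: "prob_space Q"
    and X: "\<And>n. X n \<in> borel_measurable (P n)" and Y: "Y \<in> borel_measurable Q"
    and conv: "\<And>g :: 'a \<Rightarrow> real. continuous_on UNIV g \<Longrightarrow> bounded (range g) \<Longrightarrow>
      (\<lambda>n. \<integral>w. g (X n w) \<partial>P n) \<longlonglongrightarrow> (\<integral>w. g (Y w) \<partial>Q)"
    and G: "continuous_on E G" "\<And>x. x \<in> E \<Longrightarrow> \<bar>G x\<bar> \<le> c"
    and f: "\<And>n. f n \<in> borel_measurable (P n)" "\<And>n. AE w in P n. X n w \<in> E \<and> f n w = G (X n w)"
    and f0: "f0 \<in> borel_measurable Q" "AE w in Q. Y w \<in> E \<and> f0 w = G (Y w)"
    and e: "0 < e"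
  shows "\<forall>\<^sub>F n in sequentially. (\<integral>w. f0 w \<partial>Q) - e \<le> (\<integral>w. f n w \<partial>P n)"
proof -
  interpret Q: prob_space Q by (rule Q)
  interpret P: prob_space "P n" for n by (rule P)
  have E: "E \<noteq> {}"
  proof
    assume "E = {}"
    then have "AE w in Q. False" using f0(2) by auto
    then show False by simp
  qed
  then obtain z where z: "z \<in> E" by blast
  have c: "0 \<le> c" using G(2)[OF z] by linarith
  \<comment> \<open>The largest function with Lipschitz constant m below \<open>G\<close> on
    \<open>E\<close> (inf-convolution with m times the distance).\<close>
  define g where "g m t = (INF s\<in>E. G s + real m * dist t s)" for m :: nat and t
  define h where "h m t = min c (g m t)" for m t
  have bdd: "bdd_below ((\<lambda>s. G s + real m * dist t s) ` E)" for m t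
    by (rule bdd_belowI2[of _ "- c"]) (use G(2) in \<open>auto simp: abs_le_iff intro: add_increasing2\<close>, smt (verit, best) mult_nonneg_nonneg of_nat_0_le_iff zero_le_dist)
  have g_low: "- c \<le> g m t" for m t unfolding g_def
    by (rule cINF_greatest[OF E]) (smt (verit, best) G(2) mult_nonneg_nonneg of_nat_0_le_iff zero_le_dist)
  have g_le: "g m t \<le> G s + real m * dist t s" if "s \<in> E" for m t s
    unfolding g_def by (rule cINF_lower[OF bdd that])
  have g_lip: "g m t \<le> g m u + real m * dist t u" for m t u
  proof -
    have "g m t - real m * dist t u \<le> g m u"
      unfolding g_def[of m u]
    proof (rule cINF_greatest[OF E])
      fix s assume s: "s \<in> E"
      have "real m * dist t s \<le> real m * (dist t u + dist u s)"
        by (intro mult_left_mono dist_triangle) auto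
      with g_le[OF s, of m t] show "g m t - real m * dist t u \<le> G s + real m * dist u s"
        by (simp add: algebra_simps)
    qed
    then show ?thesis by simp
  qed
  have "continuous_on UNIV (g m)" for m
  proof (rule lipschitz_on_continuous_on[where L="real m"], rule lipschitz_onI)
    fix t u show "dist (g m t) (g m u) \<le> real m * dist t u"
      using g_lip[of m t u] g_lip[of m u t] by (auto simp: dist_real_def abs_le_iff dist_commute)
  qed simp
  then have h_cont: "continuous_on UNIV (h m)" for m
    unfolding h_def by (intro continuous_intros) auto
  have h_abs: "\<bar>h m t\<bar> \<le> c" for m t using g_low[of m t] c by (auto simp: h_def)
  then have h_bdd: "bounded (range (h m))" for m by (auto simp: bounded_iff)
  have h_le: "h m t \<le> G t" if "t \<in> E" for m t
    using g_le[OF that, of m t] by (auto simp: h_def)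
  have h_meas: "h m \<in> borel_measurable borel" for m
    using h_cont[of m] by (rule borel_measurable_continuous_onI)
  have h_lim: "(\<lambda>m. h m t) \<longlonglongrightarrow> G t" if t: "t \<in> E" for t
  proof (rule LIMSEQ_I)
    fix r :: real assume r: "0 < r"
    obtain d where d: "0 < d" "\<And>s. s \<in> E \<Longrightarrow> dist s t < d \<Longrightarrow> dist (G s) (G t) < r / 2"
      using G(1) t r unfolding continuous_on_iff by (metis half_gt_zero)
    \<comment> \<open>Beyond distance d the penalty reaches 2 c, the largest possible oscillation of
      \<open>G\<close>, so far points cannot undercut the value at \<open>t\<close>.\<close>
    obtain M :: nat where M: "2 * c / d < real M" using reals_Archimedean2 by blast
    have "norm (h m t - G t) < r" if m: "M \<le> m" for m
    proof -
      have "G t - r / 2 \<le> g m t" unfolding g_def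
      proof (rule cINF_greatest[OF E])
        fix s assume s: "s \<in> E"
        show "G t - r / 2 \<le> G s + real m * dist t s"
        proof (cases "dist s t < d")
          case True
          have "0 \<le> real m * dist t s" by simp
          moreover have "G t - r / 2 < G s" using d(2)[OF s True] unfolding dist_real_def by linarith
          ultimately show ?thesis by linarith
        next
          case False
          have "2 * c \<le> real M * d" using M d(1) by (auto simp: field_simps)
          also have "\<dots> \<le> real m * dist t s"
            using False m d(1) by (intro mult_mono) (auto simp: dist_commute)
          finally show ?thesis using G(2)[OF s] G(2)[OF t] r by (auto simp: abs_le_iff)
        qed
      qed
      then show ?thesis using h_le[OF t, of m] r G(2)[OF t] by (auto simp: h_def)
    qed
    then show "\<exists>no. \<forall>n\<ge>no. norm (h n t - G t) < r" by blast
  qed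
  have "(\<lambda>m. \<integral>w. h m (Y w) \<partial>Q) \<longlonglongrightarrow> (\<integral>w. f0 w \<partial>Q)"
  proof (rule integral_dominated_convergence[where w="\<lambda>_. c"])
    show "AE w in Q. (\<lambda>m. h m (Y w)) \<longlonglongrightarrow> f0 w"
      using f0(2) by eventually_elim (auto intro: h_lim)
  qed (use f0(1) measurable_compose[OF Y h_meas] h_abs in auto)
  then obtain m where m: "(\<integral>w. f0 w \<partial>Q) - e / 2 < (\<integral>w. h m (Y w) \<partial>Q)"
    using e by (smt (verit) LIMSEQ_D half_gt_zero le_refl real_norm_def field_sum_of_halves)
  have "\<forall>\<^sub>F n in sequentially. (\<integral>w. h m (Y w) \<partial>Q) - e / 2 < (\<integral>w. h m (X n w) \<partial>P n)"
    using conv[OF h_cont h_bdd, of m] e by (intro order_tendstoD(1)) auto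
  then show ?thesis
  proof eventually_elim
    case (elim n)
    have "(\<integral>w. h m (X n w) \<partial>P n) \<le> (\<integral>w. f n w \<partial>P n)"
    proof (rule integral_mono_AE)
      show "integrable (P n) (\<lambda>w. h m (X n w))"
        by (rule P.integrable_const_bound[where B=c]) (use h_abs measurable_compose[OF X h_meas] in auto)
      show "integrable (P n) (f n)"
        by (rule P.integrable_const_bound[where B=c])
           (use f(2)[of n] G(2) f(1)[of n] in \<open>auto elim: eventually_mono\<close>)
      show "AE w in P n. h m (X n w) \<le> f n w"
        using f(2)[of n] by eventually_elim (auto intro: h_le)
    qed
    then show ?case using m elim by linarith
  qed
qed

text \<open>The hypotheses are symmetric under changing the sign of \<open>G\<close>, so the lower
  bound applied to both signs gives the limit.\<close>

lemma weak_limit_on_subset: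
  fixes G :: "'a::{metric_space, second_countable_topology} \<Rightarrow> real"
    and X :: "nat \<Rightarrow> 'b \<Rightarrow> 'a" and Y :: "'c \<Rightarrow> 'a"
  assumes P: "\<And>n. prob_space (P n)" and Q: "prob_space Q"
    and X: "\<And>n. X n \<in> borel_measurable (P n)" and Y: "Y \<in> borel_measurable Q"
    and conv: "\<And>g :: 'a \<Rightarrow> real. continuous_on UNIV g \<Longrightarrow> bounded (range g) \<Longrightarrow>
      (\<lambda>n. \<integral>w. g (X n w) \<partial>P n) \<longlonglongrightarrow> (\<integral>w. g (Y w) \<partial>Q)"
    and G: "continuous_on E G" "\<And>x. x \<in> E \<Longrightarrow> \<bar>G x\<bar> \<le> c"
    and f: "\<And>n. f n \<in> borel_measurable (P n)" "\<And>n. AE w in P n. X n w \<in> E \<and> f n w = G (X n w)"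
    and f0: "f0 \<in> borel_measurable Q" "AE w in Q. Y w \<in> E \<and> f0 w = G (Y w)"
  shows "(\<lambda>n. \<integral>w. f n w \<partial>P n) \<longlonglongrightarrow> (\<integral>w. f0 w \<partial>Q)"
proof (rule LIMSEQ_I)
  fix r :: real assume r: "0 < r"
  have 1: "\<forall>\<^sub>F n in sequentially. (\<integral>w. f0 w \<partial>Q) - r / 2 \<le> (\<integral>w. f n w \<partial>P n)"
    by (rule weak_limit_on_subset_lower[OF P Q X Y conv G f f0]) (use r in auto)
  have 2: "\<forall>\<^sub>F n in sequentially. (\<integral>w. - f0 w \<partial>Q) - r / 2 \<le> (\<integral>w. - f n w \<partial>P n)"
  proof (rule weak_limit_on_subset_lower[OF P Q X Y conv, where G="\<lambda>x. - G x" and E=E and c=c])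
    show "continuous_on E (\<lambda>x. - G x)" by (intro continuous_intros G)
    show "\<bar>- G x\<bar> \<le> c" if "x \<in> E" for x using G(2)[OF that] by simp
    show "(\<lambda>w. - f n w) \<in> borel_measurable (P n)" for n using f(1) by measurable
    show "AE w in P n. X n w \<in> E \<and> - f n w = - G (X n w)" for n using f(2)[of n] by simp
    show "(\<lambda>w. - f0 w) \<in> borel_measurable Q" using f0(1) by measurable
    show "AE w in Q. Y w \<in> E \<and> - f0 w = - G (Y w)" using f0(2) by simp
  qed (use r in auto)
  have "\<forall>\<^sub>F n in sequentially. norm ((\<integral>w. f n w \<partial>P n) - (\<integral>w. f0 w \<partial>Q)) < r"
    using 1 2 by eventually_elim (use r in \<open>auto simp: abs_le_iff\<close>)
  then show "\<exists>no. \<forall>n\<ge>no. norm ((\<integral>w. f n w \<partial>P n) - (\<integral>w. f0 w \<partial>Q)) < r"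
    by (auto simp: eventually_sequentially)
qed

section \<open>Polynomials and Stone-Weierstrass on the cube\<close>

definition unit_cube :: "(nat \<Rightarrow> real) set" where
  "unit_cube = {v. \<forall>i. 0 \<le> v i \<and> v i \<le> 1}"

lemma compact_unit_cube: "compact unit_cube"
proof -
  have "unit_cube = (\<Pi>\<^sub>E i\<in>UNIV. {0..1::real})" by (auto simp: unit_cube_def PiE_def Pi_def)
  moreover have "compactin (product_topology (\<lambda>_::nat. euclidean) UNIV) (\<Pi>\<^sub>E i\<in>UNIV. {0..1::real})"
    by (subst compactin_PiE) auto
  ultimately show ?thesis by (simp add: euclidean_product_topology)
qed

text \<open>Polynomials in finitely many coordinates, generated by monomials and sums alone:
  convergence of moments passes through exactly these operations. Closure under products, needed for
  an algebra, is proved afterwards.\<close>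

inductive cube_poly :: "((nat \<Rightarrow> real) \<Rightarrow> real) \<Rightarrow> bool" where
  mono: "cube_poly (\<lambda>v. c * (\<Prod>i<K. v i ^ m i))"
| add: "cube_poly f \<Longrightarrow> cube_poly g \<Longrightarrow> cube_poly (\<lambda>v. f v + g v)"

lemma cube_poly_mult_mono:
  assumes "cube_poly f"
  shows "cube_poly (\<lambda>v. f v * (c * (\<Prod>i<K. v i ^ m i)))"
  using assms
proof induction
  case (mono d l L)
  \<comment> \<open>Both monomials are padded with exponents 0 to a common number of
    coordinates.\<close>
  have eq1: "(\<Prod>i<L. v i ^ l i) * (\<Prod>i<K. v i ^ m i)
      = (\<Prod>i<max L K. v i ^ ((if i < L then l i else 0) + (if i < K then m i else 0)))" for v :: "nat \<Rightarrow> real"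
  proof -
    have "(\<Prod>i<L. v i ^ l i) = (\<Prod>i<max L K. v i ^ (if i < L then l i else 0))"
      by (rule prod.mono_neutral_cong_left) auto
    moreover have "(\<Prod>i<K. v i ^ m i) = (\<Prod>i<max L K. v i ^ (if i < K then m i else 0))"
      by (rule prod.mono_neutral_cong_left) auto
    ultimately show ?thesis by (simp add: prod.distrib power_add)
  qed
  have eq: "(\<lambda>v::nat\<Rightarrow>real. (d * (\<Prod>i<L. v i ^ l i)) * (c * (\<Prod>i<K. v i ^ m i)))
      = (\<lambda>v. (d * c) * (\<Prod>i<max L K. v i ^ ((if i < L then l i else 0) + (if i < K then m i else 0))))"
    unfolding eq1[symmetric] by (rule ext) (simp only: mult_ac)
  show ?case unfolding eq by (rule cube_poly.mono)
next
  case (add f g)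
  then show ?case by (simp add: distrib_right cube_poly.add)
qed

lemma cube_poly_mult:
  assumes f: "cube_poly f" and "cube_poly g"
  shows "cube_poly (\<lambda>v. f v * g v)"
  using assms(2)
proof induction
  case (mono d l L)
  show ?case by (rule cube_poly_mult_mono[OF f])
next
  case (add g1 g2)
  then show ?case by (simp add: distrib_left cube_poly.add)
qed

lemma cube_poly_continuous: "cube_poly f \<Longrightarrow> continuous_on UNIV f"
proof (induction rule: cube_poly.induct)
  case (mono c m K)
  then show ?case
    by (intro continuous_intros continuous_on_product_coordinates)
qed (auto intro: continuous_intros)

lemma cube_poly_dense:
  assumes "continuous_on unit_cube f" "0 < e"
  shows "\<exists>g. cube_poly g \<and> (\<forall>v\<in>unit_cube. \<bar>f v - g v\<bar> < e)"
proof -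
  interpret function_ring_on "Collect cube_poly" unit_cube
  proof
    show "compact unit_cube" by (rule compact_unit_cube)
    show "\<And>f. f \<in> Collect cube_poly \<Longrightarrow> continuous_on unit_cube f"
      by (auto intro: continuous_on_subset[OF cube_poly_continuous])
    show "\<And>f g. f \<in> Collect cube_poly \<Longrightarrow> g \<in> Collect cube_poly \<Longrightarrow> (\<lambda>x. f x + g x) \<in> Collect cube_poly"
      by (auto intro: cube_poly.add)
    show "\<And>f g. f \<in> Collect cube_poly \<Longrightarrow> g \<in> Collect cube_poly \<Longrightarrow> (\<lambda>x. f x * g x) \<in> Collect cube_poly"
      by (auto intro: cube_poly_mult)
    show "(\<lambda>_. c) \<in> Collect cube_poly" for c
      using cube_poly.mono[where c=c and K=0 and m="\<lambda>_. 0"] by simp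
    fix x y :: "nat \<Rightarrow> real" assume "x \<noteq> y"
    then obtain i where i: "x i \<noteq> y i" by blast
    have p: "cube_poly (\<lambda>v. 1 * (\<Prod>j<Suc i. v j ^ (if j = i then 1 else 0)))" by (rule cube_poly.mono)
    have eq: "(\<lambda>v::nat \<Rightarrow> real. 1 * (\<Prod>j<Suc i. v j ^ (if j = i then 1 else 0))) = (\<lambda>v. v i)"
      by (rule ext) (simp add: prod.lessThan_Suc)
    have "cube_poly (\<lambda>v. v i)" using p unfolding eq .
    then show "\<exists>f\<in>Collect cube_poly. f x \<noteq> f y"
      using i by (intro bexI[of _ "\<lambda>v. v i"]) auto
  qed
  obtain g where "g \<in> Collect cube_poly" "\<forall>v\<in>unit_cube. \<bar>f v - g v\<bar> < e"
    using Stone_Weierstrass_basic[OF assms] ..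
  then show ?thesis by auto
qed

text \<open>Almost sure confinement to the compact cube lets \<open>g\<close> be replaced by a
  polynomial with an error independent of n. Only values on the cube matter, though \<open>g\<close>
  is continuous on the whole space.\<close>

theorem moments_weak_limit:
  fixes X :: "nat \<Rightarrow> 'b \<Rightarrow> nat \<Rightarrow> real" and Y :: "'c \<Rightarrow> nat \<Rightarrow> real"
  assumes P: "\<And>n. prob_space (P n)" and Q: "prob_space Q"
    and X: "\<And>n. X n \<in> borel_measurable (P n)" "\<And>n. AE w in P n. X n w \<in> unit_cube"
    and Y: "Y \<in> borel_measurable Q" "AE w in Q. Y w \<in> unit_cube"
    and moments: "\<And>K m. (\<lambda>n. \<integral>w. (\<Prod>i<K. X n w i ^ m i) \<partial>P n) \<longlonglongrightarrow> (\<integral>w. (\<Prod>i<K. Y w i ^ m i) \<partial>Q)"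
    and g: "continuous_on UNIV (g :: (nat \<Rightarrow> real) \<Rightarrow> real)" "bounded (range g)"
  shows "(\<lambda>n. \<integral>w. g (X n w) \<partial>P n) \<longlonglongrightarrow> (\<integral>w. g (Y w) \<partial>Q)"
proof -
  interpret Q: prob_space Q by (rule Q)
  interpret P: prob_space "P n" for n by (rule P)
  have intg: "integrable M (\<lambda>w. p (Z w))"
    if "prob_space M" "Z \<in> borel_measurable M" "AE w in M. Z w \<in> unit_cube"
      "continuous_on UNIV (p :: (nat \<Rightarrow> real) \<Rightarrow> real)" for p Z and M :: "'d measure"
  proof -
    interpret M: prob_space M by fact
    have "compact (p ` unit_cube)"
      using that(4) compact_unit_cube continuous_on_subset compact_continuous_image by blast
    then obtain b where b: "\<And>v. v \<in> unit_cube \<Longrightarrow> \<bar>p v\<bar> \<le> b"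
      using compact_imp_bounded[THEN bounded_iff[THEN iffD1]] by fastforce
    have "(\<lambda>w. p (Z w)) \<in> borel_measurable M"
      using measurable_compose[OF that(2) borel_measurable_continuous_onI[OF that(4)]] .
    then show ?thesis
      by (rule M.integrable_const_bound[where B=b, rotated]) (use that(3) b in \<open>auto elim: eventually_mono\<close>)
  qed
  have poly: "(\<lambda>n. \<integral>w. p (X n w) \<partial>P n) \<longlonglongrightarrow> (\<integral>w. p (Y w) \<partial>Q)" if "cube_poly p" for p
    using that
  proof induction
    case (mono c m K)
    then show ?case using tendsto_mult_left[OF moments[where K=K and m=m], of c] by simp
  next
    case (add f g)
    have "(\<integral>w. f (X n w) + g (X n w) \<partial>P n) = (\<integral>w. f (X n w) \<partial>P n) + (\<integral>w. g (X n w) \<partial>P n)" for n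
      by (intro Bochner_Integration.integral_add intg P X cube_poly_continuous add)
    moreover have "(\<integral>w. f (Y w) + g (Y w) \<partial>Q) = (\<integral>w. f (Y w) \<partial>Q) + (\<integral>w. g (Y w) \<partial>Q)"
      by (intro Bochner_Integration.integral_add intg Q Y cube_poly_continuous add)
    ultimately show ?case using tendsto_add[OF add(3,4)] by simp
  qed
  have close: "\<bar>(\<integral>w. g (Z w) \<partial>M) - (\<integral>w. p (Z w) \<partial>M)\<bar> \<le> e"
    if "prob_space M" "Z \<in> borel_measurable M" "AE w in M. Z w \<in> unit_cube" "cube_poly p"
      "\<And>v. v \<in> unit_cube \<Longrightarrow> \<bar>g v - p v\<bar> < e" for p Z e and M :: "'d measure"
  proof -
    interpret M: prob_space M by fact
    have i: "integrable M (\<lambda>w. g (Z w))" "integrable M (\<lambda>w. p (Z w))"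
      by (rule intg[OF that(1-3) g(1)], rule intg[OF that(1-3) cube_poly_continuous[OF that(4)]])
    have "\<bar>(\<integral>w. g (Z w) \<partial>M) - (\<integral>w. p (Z w) \<partial>M)\<bar> = \<bar>\<integral>w. g (Z w) - p (Z w) \<partial>M\<bar>"
      using i by simp
    also have "\<dots> \<le> (\<integral>w. \<bar>g (Z w) - p (Z w)\<bar> \<partial>M)" by (rule integral_abs_bound)
    also have "\<dots> \<le> (\<integral>w. e \<partial>M)"
      using i that(3) by (intro integral_mono_AE) (auto elim!: eventually_mono intro: less_imp_le that(5))
    finally show ?thesis by (simp add: M.prob_space)
  qed
  show ?thesis
  proof (rule LIMSEQ_I)
    fix r :: real assume r: "0 < r"
    obtain p where p: "cube_poly p" "\<And>v. v \<in> unit_cube \<Longrightarrow> \<bar>g v - p v\<bar> < r / 4"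
      using cube_poly_dense[OF continuous_on_subset[OF g(1) subset_UNIV], of "r / 4"] r by auto
    have "\<forall>\<^sub>F n in sequentially. dist (\<integral>w. p (X n w) \<partial>P n) (\<integral>w. p (Y w) \<partial>Q) < r / 4"
      using poly[OF p(1)] r by (intro tendstoD) auto
    then have "\<forall>\<^sub>F n in sequentially. norm ((\<integral>w. g (X n w) \<partial>P n) - (\<integral>w. g (Y w) \<partial>Q)) < r"
    proof eventually_elim
      case (elim n)
      then show ?case
        using close[OF P X p, of n] close[OF Q Y p] r unfolding dist_real_def real_norm_def by linarith
    qed
    then show "\<exists>no. \<forall>n\<ge>no. norm ((\<integral>w. g (X n w) \<partial>P n) - (\<integral>w. g (Y w) \<partial>Q)) < r"
      by (auto simp: eventually_sequentially)
  qed
qed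

section \<open>Point processes and waiting times\<close>

text \<open>Measurable sets of the half-line contain no negative number, so negative locations never
  contribute to a preimage. Formulas for \<open>point_sum\<close> thus hold even where the location
  map leaves the half-line.\<close>

lemma point_sum_restrict: "point_sum I m t = point_sum {i\<in>I. 0 \<le> t i} m t"
proof -
  let ?D = "\<lambda>I. density (count_space I) (\<lambda>i. of_nat (m i) :: ennreal)"
  have sub: "A \<subseteq> {0..}" if "A \<in> sets half_line" for A
    using sets.sets_into_space[OF that] by (auto simp: half_line_def space_restrict_space)
  have "emeasure (?D I) (t -` A \<inter> I) = emeasure (?D {i\<in>I. 0 \<le> t i}) (t -` A \<inter> {i\<in>I. 0 \<le> t i})"
    if A: "A \<in> sets half_line" for A
  proof -
    have eq: "t -` A \<inter> {i\<in>I. 0 \<le> t i} = t -` A \<inter> I" using sub[OF A] by auto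
    have "(\<integral>\<^sup>+i. of_nat (m i) * indicator (t -` A \<inter> I) i \<partial>count_space I)
       = (\<integral>\<^sup>+i. of_nat (m i) * indicator (t -` A \<inter> I) i \<partial>count_space {i\<in>I. 0 \<le> t i})"
      by (rule nn_integral_count_space_eq) (use sub[OF A] in \<open>auto simp: indicator_def\<close>)
    then show ?thesis unfolding eq using sub[OF A] by (subst (1 2) emeasure_density) auto
  qed
  then show ?thesis unfolding point_sum_def distr_def
    by (intro measure_of_eq) (auto simp: sets.space_closed sets.sigma_sets_eq)
qed

lemma emeasure_point_sum':
  assumes "B \<in> sets half_line"
  shows "emeasure (point_sum I m t) B = (\<integral>\<^sup>+i. of_nat (m i) * indicator B (t i) \<partial>count_space I)"
proof -
  have "B \<subseteq> {0..}"
    using sets.sets_into_space[OF assms] by (auto simp: half_line_def space_restrict_space)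
  then have "(\<integral>\<^sup>+i. of_nat (m i) * indicator B (t i) \<partial>count_space {i\<in>I. 0 \<le> t i})
      = (\<integral>\<^sup>+i. of_nat (m i) * indicator B (t i) \<partial>count_space I)"
    by (intro nn_integral_count_space_eq) (auto simp: indicator_def)
  then show ?thesis
    by (subst point_sum_restrict, subst emeasure_point_sum[OF _ assms]) auto
qed

lemma sets_point_sum [simp]: "sets (point_sum I m t) = sets half_line"
  by (simp add: point_sum_def)

lemma nn_integral_point_sum:
  assumes f: "f \<in> borel_measurable half_line"
  shows "(\<integral>\<^sup>+x. f x \<partial>point_sum I m t) = (\<integral>\<^sup>+i. of_nat (m i) * (f (t i) * indicator {0..} (t i)) \<partial>count_space I)"
proof -
  let ?J = "{i\<in>I. 0 \<le> t i}"
  have t: "t \<in> measurable (density (count_space ?J) (\<lambda>i. of_nat (m i))) half_line"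
    by (auto simp: half_line_def space_restrict_space)
  have "(\<integral>\<^sup>+x. f x \<partial>point_sum I m t) = (\<integral>\<^sup>+i. of_nat (m i) * f (t i) \<partial>count_space ?J)"
    by (subst point_sum_restrict, subst point_sum_def, subst nn_integral_distr[OF t]) (simp_all add: f nn_integral_density)
  also have "\<dots> = (\<integral>\<^sup>+i. of_nat (m i) * (f (t i) * indicator {0..} (t i)) \<partial>count_space ?J)"
    by (intro nn_integral_cong) (auto simp: indicator_def)
  also have "\<dots> = (\<integral>\<^sup>+i. of_nat (m i) * (f (t i) * indicator {0..} (t i)) \<partial>count_space I)"
    by (intro nn_integral_count_space_eq) (auto simp: indicator_def)
  finally show ?thesis .
qed

lemma interval_in_half_line: "{0..r} \<in> sets half_line"
  by (auto simp: half_line_def sets_restrict_space)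

text \<open>Finiteness on bounded intervals suffices because integer values come for free from
  integer multiplicities. The criterion is a countable conjunction, which later makes the
  exceptional set measurable.\<close>

lemma point_sum_in_pp_iff:
  "point_sum I m t \<in> pp_space \<longleftrightarrow> (\<forall>n::nat. emeasure (point_sum I m t) {0..real n} < \<infinity>)"
proof safe
  fix n :: nat assume "point_sum I m t \<in> pp_space"
  then obtain k :: nat where "emeasure (point_sum I m t) {0..real n} = of_nat k"
    using interval_in_half_line[of "real n"] bounded_closed_interval[of 0 "real n"] unfolding pp_space_def by blast
  then show "emeasure (point_sum I m t) {0..real n} < \<infinity>" by (simp add: less_top of_nat_less_top)
next
  assume fin: "\<forall>n::nat. emeasure (point_sum I m t) {0..real n} < \<infinity>"
  show "point_sum I m t \<in> pp_space"
    unfolding pp_space_def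
  proof (clarsimp)
    fix B assume B: "B \<in> sets half_line" "bounded B"
    have B0: "B \<subseteq> {0..}"
      using sets.sets_into_space[OF B(1)] by (auto simp: half_line_def space_restrict_space)
    obtain c where c: "\<And>x. x \<in> B \<Longrightarrow> \<bar>x\<bar> \<le> c" using B(2) by (auto simp: bounded_iff)
    obtain n :: nat where n: "c \<le> real n" using real_arch_simple by blast
    \<comment> \<open>Points of multiplicity 0 are dropped, so that finite mass forces finitely many
      indices.\<close>
    define J where "J = {i\<in>I. t i \<in> {0..real n} \<and> m i \<noteq> 0}"
    have one: "k \<noteq> 0 \<Longrightarrow> (1::ennreal) \<le> of_nat k" for k :: nat
      using of_nat_mono[of 1 k, where 'a=ennreal] by simp
    have "finite J"
    proof (rule ccontr)
      assume "infinite J"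
      then have "\<infinity> = (\<integral>\<^sup>+i. indicator J i \<partial>count_space I)"
        by (subst nn_integral_indicator) (auto simp: J_def)
      also have "\<dots> \<le> (\<integral>\<^sup>+i. of_nat (m i) * indicator {0..real n} (t i) \<partial>count_space I)"
        by (intro nn_integral_mono) (auto simp: J_def indicator_def one)
      also have "\<dots> = emeasure (point_sum I m t) {0..real n}"
        by (rule emeasure_point_sum'[OF interval_in_half_line, symmetric])
      finally show False using fin[rule_format, of n] by simp
    qed
    have "emeasure (point_sum I m t) B = (\<integral>\<^sup>+i. of_nat (m i) * indicator B (t i) \<partial>count_space I)"
      by (rule emeasure_point_sum'[OF B(1)])
    also have "\<dots> = (\<integral>\<^sup>+i. of_nat (m i) * indicator B (t i) \<partial>count_space J)"
      by (rule nn_integral_count_space_eq)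
        (use B0 c n in \<open>auto simp: J_def indicator_def abs_le_iff split: if_splits\<close>, force+)
    also have "\<dots> = (\<Sum>i\<in>J. of_nat (m i) * indicator B (t i))"
      using \<open>finite J\<close> by (rule nn_integral_count_space_finite)
    also have "\<dots> = of_nat (\<Sum>i\<in>J. m i * (if t i \<in> B then 1 else 0))"
      unfolding of_nat_sum by (intro sum.cong) (auto simp: indicator_def)
    finally show "\<exists>k::nat. emeasure (point_sum I m t) B = of_nat k" by blast
  qed
qed

lemma vague_test_measurable: "f \<in> vague_tests \<Longrightarrow> f \<in> borel_measurable half_line"
  by (auto simp: vague_tests_def half_line_def intro!: borel_measurable_continuous_on_restrict)

lemma integrable_vague_test:
  assumes xi: "\<xi> \<in> pp_space" and f: "f \<in> vague_tests"
  shows "integrable \<xi> f"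
proof -
  obtain R where R: "\<And>x. x > R \<Longrightarrow> f x = 0" and cont: "continuous_on {0..} f"
    using f by (auto simp: vague_tests_def)
  have "compact (f ` {0..R})"
    using continuous_on_subset[OF cont, of "{0..R}"] by (intro compact_continuous_image) auto
  then obtain b where b: "\<And>x. x \<in> {0..R} \<Longrightarrow> \<bar>f x\<bar> \<le> b"
    using compact_imp_bounded[THEN bounded_iff[THEN iffD1]] by fastforce
  have sets: "sets \<xi> = sets half_line" using xi by (auto simp: pp_space_def)
  then have sp: "space \<xi> = {0..}" by (simp add: sets_eq_imp_space_eq half_line_def space_restrict_space)
  obtain k :: nat where k: "emeasure \<xi> {0..R} = of_nat k"
    using xi interval_in_half_line[of R] by (auto simp: pp_space_def)
  show ?thesis
  proof (rule Bochner_Integration.integrable_bound)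
    show "integrable \<xi> (\<lambda>x. b * indicator {0..R} x)"
      using interval_in_half_line[of R] k sets
      by (intro integrable_mult_right integrable_real_indicator) (auto simp: less_top of_nat_less_top)
    show "f \<in> borel_measurable \<xi>"
      using vague_test_measurable[OF f] measurable_cong_sets[OF sets refl] by auto
    show "AE x in \<xi>. norm (f x) \<le> norm (b * indicator {0..R} x)"
      using b R by (intro AE_I2) (auto simp: sp indicator_def not_le, force)
  qed
qed

section \<open>A countable base of the vague topology\<close>

definition cutoff :: "real \<Rightarrow> real \<Rightarrow> real" where
  "cutoff R x = max 0 (min 1 (R + 1 - x))"

lemma cutoff_test: "cutoff R \<in> vague_tests"
  unfolding vague_tests_def
proof (intro CollectI conjI exI allI impI)
  show "continuous_on {0..} (cutoff R)" unfolding cutoff_def by (intro continuous_intros)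
  show "R + 1 < x \<Longrightarrow> cutoff R x = 0" for x by (auto simp: cutoff_def)
qed

text \<open>A countable family of tests: Bernstein polynomials with rational coefficients, rescaled
  from [0, R + 1] to the unit interval and multiplied by a cutoff that equals 1 up to R and vanishes
  beyond R + 1.\<close>

definition bern_test :: "nat \<times> rat list \<Rightarrow> real \<Rightarrow> real" where
  "bern_test = (\<lambda>(R, qs) x. cutoff (real R) x *
     (\<Sum>k\<le>length qs - 1. real_of_rat (qs ! k) * Bernstein (length qs - 1) k (x / (real R + 1))))"

lemma bern_test_test: "bern_test i \<in> vague_tests"
proof -
  obtain R qs where i: "i = (R, qs)" by fastforce
  show ?thesis unfolding i vague_tests_def
  proof (intro CollectI conjI exI allI impI)
    show "continuous_on {0..} (bern_test (R, qs))"
      unfolding bern_test_def cutoff_def Bernstein_def prod.case by (intro continuous_intros) auto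
    show "real R + 1 < x \<Longrightarrow> bern_test (R, qs) x = 0" for x by (auto simp: bern_test_def cutoff_def)
  qed
qed

lemma bern_test_cutoff: "bern_test (R, [1]) = cutoff (real R)"
  by (auto simp: bern_test_def Bernstein_def fun_eq_iff)

text \<open>The error is bounded by a multiple of the cutoff rather than by a constant, so it can be
  integrated against point processes of infinite total mass. Half of e goes to Bernstein
  approximation, half to the rational coefficients.\<close>

lemma bern_test_approx:
  assumes f: "continuous_on {0..} f" "\<And>x. x > real R \<Longrightarrow> f x = 0" and e: "0 < e"
  shows "\<exists>qs. \<forall>x\<ge>0. \<bar>f x - bern_test (R, qs) x\<bar> \<le> e * cutoff (real R) x"
proof -
  define g where "g y = f ((real R + 1) * y)" for y
  have "continuous_on {0..1} g"
    unfolding g_def by (rule continuous_on_compose2[OF f(1)]) (auto intro!: continuous_intros)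
  then obtain N where N: "\<And>x. x \<in> {0..1} \<Longrightarrow> \<bar>g x - (\<Sum>k\<le>N. g (k / N) * Bernstein N k x)\<bar> < e / 2"
    using Bernstein_Weierstrass[of g "e / 2"] e by (metis half_gt_zero order_refl)
  have "\<exists>q. \<bar>real_of_rat q - g (k / N)\<bar> < e / 2" for k :: nat
  proof -
    obtain r where "r \<in> \<rat>" "g (k / N) - e / 2 < r" "r < g (k / N) + e / 2"
      using Rats_dense_in_real[of "g (k / N) - e / 2" "g (k / N) + e / 2"] e by auto
    then obtain q where "g (k / N) - e / 2 < real_of_rat q" "real_of_rat q < g (k / N) + e / 2"
      by (auto elim!: Rats_cases)
    then show ?thesis by (intro exI[of _ q]) linarith
  qed
  then obtain q where q: "\<And>k. \<bar>real_of_rat (q k) - g (real k / N)\<bar> < e / 2" by metis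
  define qs where "qs = map q [0..<Suc N]"
  have len: "length qs - 1 = N" by (simp add: qs_def)
  have "\<bar>f x - bern_test (R, qs) x\<bar> \<le> e * cutoff (real R) x" if x: "0 \<le> x" for x
  proof (cases "x \<le> real R + 1")
    case False
    then show ?thesis using f(2)[of x] by (auto simp: bern_test_def cutoff_def)
  next
    case True
    define y where "y = x / (real R + 1)"
    have y: "0 \<le> y" "y \<le> 1" using x True by (auto simp: y_def)
    have "(real R + 1) * y = x" by (simp add: y_def)
    then have fy: "f x = g y" by (simp add: g_def)
    let ?S = "\<Sum>k\<le>N. real_of_rat (qs ! k) * Bernstein N k y"
    have "\<bar>(\<Sum>k\<le>N. g (k / N) * Bernstein N k y) - ?S\<bar>
        = \<bar>\<Sum>k\<le>N. (g (k / N) - real_of_rat (qs ! k)) * Bernstein N k y\<bar>"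
      by (simp add: sum_subtractf left_diff_distrib)
    also have "\<dots> \<le> (\<Sum>k\<le>N. \<bar>(g (k / N) - real_of_rat (qs ! k)) * Bernstein N k y\<bar>)"
      by (rule sum_abs)
    also have "\<dots> \<le> (\<Sum>k\<le>N. e / 2 * Bernstein N k y)"
    proof (rule sum_mono)
      fix k assume "k \<in> {..N}"
      then have "qs ! k = q k" unfolding qs_def by (subst nth_map) (auto simp del: upt_Suc)
      then show "\<bar>(g (k / N) - real_of_rat (qs ! k)) * Bernstein N k y\<bar> \<le> e / 2 * Bernstein N k y"
        using q[of k] Bernstein_nonneg[OF y, of N k] mult_right_mono[of "\<bar>g (k / N) - real_of_rat (q k)\<bar>" "e / 2" "Bernstein N k y"]
        by (auto simp: abs_mult abs_minus_commute)
    qed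
    also have "\<dots> = e / 2" unfolding sum_distrib_left[symmetric] sum_Bernstein by simp
    finally have "\<bar>(\<Sum>k\<le>N. g (k / N) * Bernstein N k y) - ?S\<bar> \<le> e / 2" .
    moreover have "\<bar>g y - (\<Sum>k\<le>N. g (k / N) * Bernstein N k y)\<bar> < e / 2" using N[of y] y by simp
    ultimately have "\<bar>f x - ?S\<bar> \<le> e" unfolding fy by linarith
    then have "\<bar>f x - ?S\<bar> * cutoff (real R) x \<le> e * cutoff (real R) x"
      by (intro mult_right_mono) (auto simp: cutoff_def)
    moreover have "f x = f x * cutoff (real R) x"
      using f(2)[of x] by (cases "x \<le> real R") (auto simp: cutoff_def)
    then have "f x - bern_test (R, qs) x = (f x - ?S) * cutoff (real R) x"
      unfolding bern_test_def prod.case len y_def[symmetric] by (simp add: algebra_simps)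
    ultimately show ?thesis by (simp add: abs_mult cutoff_def)
  qed
  then show ?thesis by blast
qed

text \<open>Finitely many rational constraints on tests from the countable family. The index type is
  countable, which is what reduces Borel measurability to measurability of integrals of
  tests.\<close>

definition vague_basic :: "((nat \<times> rat list) \<times> rat \<times> rat) list \<Rightarrow> real measure set" where
  "vague_basic l = {\<xi>\<in>pp_space. \<forall>(i, q, r)\<in>set l. \<bar>(\<integral>x. bern_test i x \<partial>\<xi>) - real_of_rat q\<bar> < real_of_rat r}"

lemma vague_basic_single:
  assumes xi: "\<xi> \<in> pp_space" and f: "f \<in> vague_tests" and e: "0 < e"
  shows "\<exists>l. \<xi> \<in> vague_basic l \<and> (\<forall>\<xi>'\<in>vague_basic l. \<bar>(\<integral>x. f x \<partial>\<xi>') - (\<integral>x. f x \<partial>\<xi>)\<bar> < e)"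
proof -
  obtain R0 where R0: "\<And>x. x > R0 \<Longrightarrow> f x = 0" and cont: "continuous_on {0..} f"
    using f by (auto simp: vague_tests_def)
  obtain R :: nat where "R0 \<le> real R" using real_arch_simple by blast
  then have R: "\<And>x. x > real R \<Longrightarrow> f x = 0" using R0 by auto
  let ?c = "cutoff (real R)"
  define C where "C = (\<integral>x. ?c x \<partial>\<xi>)"
  have C: "0 \<le> C" unfolding C_def by (rule integral_nonneg_AE) (auto simp: cutoff_def)
  \<comment> \<open>A basic neighbourhood will force the integral of the cutoff below C + 2: it is
    within 1 of \<open>q0\<close>, which is within 1 of C. Each approximation error is then at most
    e / 3.\<close>
  define d where "d = e / (3 * (C + 2))"
  have d: "0 < d" using e C by (auto simp: d_def)
  obtain qs where qs: "\<And>x. x \<ge> 0 \<Longrightarrow> \<bar>f x - bern_test (R, qs) x\<bar> \<le> d * ?c x"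
    using bern_test_approx[OF cont R d] by blast
  have app: "\<bar>(\<integral>x. f x \<partial>\<zeta>) - (\<integral>x. bern_test (R, qs) x \<partial>\<zeta>)\<bar> \<le> d * (\<integral>x. ?c x \<partial>\<zeta>)" if z: "\<zeta> \<in> pp_space" for \<zeta>
  proof -
    have sets: "sets \<zeta> = sets half_line" using z by (auto simp: pp_space_def)
    then have sp: "space \<zeta> = {0..}" by (simp add: sets_eq_imp_space_eq half_line_def space_restrict_space)
    note i = integrable_vague_test[OF z f] integrable_vague_test[OF z bern_test_test] integrable_vague_test[OF z cutoff_test]
    have "\<bar>(\<integral>x. f x \<partial>\<zeta>) - (\<integral>x. bern_test (R, qs) x \<partial>\<zeta>)\<bar> = \<bar>\<integral>x. f x - bern_test (R, qs) x \<partial>\<zeta>\<bar>"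
      using i by simp
    also have "\<dots> \<le> (\<integral>x. \<bar>f x - bern_test (R, qs) x\<bar> \<partial>\<zeta>)" by (rule integral_abs_bound)
    also have "\<dots> \<le> (\<integral>x. d * ?c x \<partial>\<zeta>)"
      using i qs by (intro integral_mono) (auto simp: sp)
    finally show ?thesis by simp
  qed
  obtain q0 where q0: "\<bar>real_of_rat q0 - C\<bar> < 1"
  proof -
    obtain r where "r \<in> \<rat>" "C - 1 < r" "r < C + 1"
      using Rats_dense_in_real[of "C - 1" "C + 1"] by auto
    then show ?thesis by (intro that[of "SOME q. r = real_of_rat q"]) (auto elim!: Rats_cases simp: abs_less_iff)
  qed
  \<comment> \<open>Two deviations below e / 6 and two approximation errors of at most e / 3 stay
    below e.\<close>
  obtain s where s: "0 < real_of_rat s" "real_of_rat s < e / 6"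
  proof -
    obtain r where "r \<in> \<rat>" "0 < r" "r < e / 6" using Rats_dense_in_real[of 0 "e / 6"] e by auto
    then show ?thesis by (intro that[of "SOME q. r = real_of_rat q"]) (auto elim!: Rats_cases)
  qed
  let ?g = "\<integral>x. bern_test (R, qs) x \<partial>\<xi>"
  obtain q1 where q1: "\<bar>real_of_rat q1 - ?g\<bar> < real_of_rat s"
  proof -
    obtain r where "r \<in> \<rat>" "?g - real_of_rat s < r" "r < ?g + real_of_rat s"
      using Rats_dense_in_real[of "?g - real_of_rat s" "?g + real_of_rat s"] s by auto
    then show ?thesis by (intro that[of "SOME q. r = real_of_rat q"]) (auto elim!: Rats_cases simp: abs_less_iff)
  qed
  define l where "l = [((R, [1::rat]), q0, 1::rat), ((R, qs), q1, s)]"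
  have "\<xi> \<in> vague_basic l"
    using xi q0 q1 by (auto simp: vague_basic_def l_def bern_test_cutoff C_def[symmetric] abs_minus_commute)
  moreover have "\<bar>(\<integral>x. f x \<partial>\<xi>') - (\<integral>x. f x \<partial>\<xi>)\<bar> < e" if "\<xi>' \<in> vague_basic l" for \<xi>'
  proof -
    have x': "\<xi>' \<in> pp_space" "\<bar>(\<integral>x. ?c x \<partial>\<xi>') - real_of_rat q0\<bar> < 1"
      "\<bar>(\<integral>x. bern_test (R, qs) x \<partial>\<xi>') - real_of_rat q1\<bar> < real_of_rat s"
      using that by (auto simp: vague_basic_def l_def bern_test_cutoff)
    have "d * (\<integral>x. ?c x \<partial>\<xi>') \<le> d * (C + 2)" "d * C \<le> d * (C + 2)"
      using x'(2) q0 d by (auto intro!: mult_left_mono)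
    moreover have "d * (C + 2) = e / 3" using C by (simp add: d_def divide_simps)
    ultimately show ?thesis
      using app[OF x'(1)] app[OF xi, folded C_def] x'(3) q1 s(2) by linarith
  qed
  ultimately show ?thesis by blast
qed

lemma vague_basic_nhds:
  assumes U: "openin pp_topology U" and xi: "\<xi> \<in> U"
  shows "\<exists>l. \<xi> \<in> vague_basic l \<and> vague_basic l \<subseteq> U"
proof -
  let ?I = "\<lambda>\<xi>. restrict (\<lambda>f. \<integral>x. f x \<partial>\<xi>) vague_tests"
  obtain V where V: "openin (product_topology (\<lambda>_. euclideanreal) vague_tests) V" "U = ?I -` V \<inter> pp_space"
    using U unfolding pp_topology_def openin_pullback_topology by blast
  have xi': "\<xi> \<in> pp_space" "?I \<xi> \<in> V" using xi V by auto
  obtain W where W: "finite {i \<in> vague_tests. W i \<noteq> UNIV}" "\<And>i. i \<in> vague_tests \<Longrightarrow> open (W i)"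
    "?I \<xi> \<in> Pi\<^sub>E vague_tests W" "Pi\<^sub>E vague_tests W \<subseteq> V"
    using V(1) xi'(2) unfolding openin_product_topology_alt by fastforce
  define J where "J = {i \<in> vague_tests. W i \<noteq> UNIV}"
  have "\<exists>l. \<xi> \<in> vague_basic l \<and> (\<forall>\<xi>'\<in>vague_basic l. (\<integral>x. f x \<partial>\<xi>') \<in> W f)" if f: "f \<in> J" for f
  proof -
    have ft: "f \<in> vague_tests" using f by (auto simp: J_def)
    then have "(\<integral>x. f x \<partial>\<xi>) \<in> W f" using W(3) by (auto simp: PiE_def Pi_def)
    then obtain e where e: "0 < e" "\<And>y. dist y (\<integral>x. f x \<partial>\<xi>) < e \<Longrightarrow> y \<in> W f"
      using W(2)[OF ft] unfolding open_dist by blast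
    show ?thesis using vague_basic_single[OF xi'(1) ft e(1)] e(2) unfolding dist_real_def by blast
  qed
  then obtain L where L: "\<And>f. f \<in> J \<Longrightarrow> \<xi> \<in> vague_basic (L f)"
    "\<And>f \<xi>'. f \<in> J \<Longrightarrow> \<xi>' \<in> vague_basic (L f) \<Longrightarrow> (\<integral>x. f x \<partial>\<xi>') \<in> W f"
    by metis
  obtain js where js: "set js = J" using W(1) finite_list unfolding J_def by blast
  define l where "l = concat (map L js)"
  have set_l: "set l = (\<Union>f\<in>J. set (L f))" by (simp add: l_def js)
  have "\<xi> \<in> vague_basic l"
    using xi'(1) L(1) by (force simp: vague_basic_def set_l)
  moreover have "vague_basic l \<subseteq> U"
  proof
    fix \<zeta> assume z: "\<zeta> \<in> vague_basic l"
    then have zp: "\<zeta> \<in> pp_space" by (simp add: vague_basic_def)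
    have "(\<integral>x. f x \<partial>\<zeta>) \<in> W f" if f: "f \<in> J" for f
    proof -
      have "\<zeta> \<in> vague_basic (L f)" using z f by (force simp: vague_basic_def set_l)
      then show ?thesis by (rule L(2)[OF f])
    qed
    then have "?I \<zeta> \<in> Pi\<^sub>E vague_tests W" by (auto simp: J_def)
    then have "?I \<zeta> \<in> V" using W(4) by blast
    then show "\<zeta> \<in> U" using V(2) zp by blast
  qed
  ultimately show ?thesis by blast
qed

text \<open>By the countable base, every open set is a countable union of sets defined by finitely
  many integrals of tests.\<close>

lemma pp_borel_measurableI:
  assumes X: "\<And>w. w \<in> space M \<Longrightarrow> X w \<in> pp_space"
    and tests: "\<And>f. f \<in> vague_tests \<Longrightarrow> (\<lambda>w. \<integral>x. f x \<partial>X w) \<in> borel_measurable M"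
  shows "X \<in> measurable M pp_borel"
  unfolding pp_borel_def
proof (rule measurable_measure_of)
  show "{U. openin pp_topology U} \<subseteq> Pow pp_space"
    using openin_subset topspace_pp_topology by fastforce
  show "X \<in> space M \<rightarrow> pp_space" using X by auto
  fix U assume "U \<in> {U. openin pp_topology U}"
  then have U: "openin pp_topology U" by simp
  have "U = (\<Union>l\<in>{l. vague_basic l \<subseteq> U}. vague_basic l)"
    using vague_basic_nhds[OF U] by blast
  then have "X -` U \<inter> space M = (\<Union>l\<in>{l. vague_basic l \<subseteq> U}. X -` vague_basic l \<inter> space M)"
    by blast
  also have "\<dots> \<in> sets M"
  proof (rule sets.countable_UN'')
    show "countable {l. vague_basic l \<subseteq> U}" by (rule countableI_type)
    fix l
    have "X -` vague_basic l \<inter> space M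
        = {w\<in>space M. \<forall>p\<in>set l. \<bar>(\<integral>x. bern_test (fst p) x \<partial>X w) - real_of_rat (fst (snd p))\<bar> < real_of_rat (snd (snd p))}"
      using X by (auto simp: vague_basic_def)
    also have "\<dots> \<in> sets M"
      using tests[OF bern_test_test] by measurable
    finally show "X -` vague_basic l \<inter> space M \<in> sets M" .
  qed
  finally show "X -` U \<inter> space M \<in> sets M" .
qed

section \<open>Point processes as functions of encoded waiting times\<close>

definition proper_waits :: "(nat \<Rightarrow> real) set" where
  "proper_waits = {v \<in> unit_cube. (\<lambda>i. \<Prod>j\<le>i. v j) \<longlonglongrightarrow> 0}"

text \<open>The coordinates of \<open>v\<close> are \<open>exp (- w)\<close> for the successive waiting times \<open>w\<close>; the value \<open>0\<close>
  encodes an infinite waiting time.\<close>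

definition pp_of :: "(nat \<Rightarrow> real) \<Rightarrow> real measure" where
  "pp_of v = point_sum {i. 0 < (\<Prod>j\<le>i. v j)} (\<lambda>_. 1) (\<lambda>i. - ln (\<Prod>j\<le>i. v j))"

lemma unit_cube_prod:
  assumes "v \<in> unit_cube"
  shows "0 \<le> (\<Prod>j\<le>i. v j)" "(\<Prod>j\<le>i. v j) \<le> 1" "i \<le> k \<Longrightarrow> (\<Prod>j\<le>k. v j) \<le> (\<Prod>j\<le>i. v j)"
proof -
  have v: "0 \<le> v j" "v j \<le> 1" for j using assms by (auto simp: unit_cube_def)
  show "0 \<le> (\<Prod>j\<le>i. v j)" by (intro prod_nonneg) (simp add: v)
  show "(\<Prod>j\<le>i. v j) \<le> 1" by (intro prod_le_1) (simp add: v)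
  assume "i \<le> k"
  then have "(\<Prod>j\<le>k. v j) = (\<Prod>j\<le>i. v j) * (\<Prod>j\<in>{i<..k}. v j)"
    by (subst prod.union_disjoint[symmetric]) (auto intro: prod.cong)
  also have "\<dots> \<le> (\<Prod>j\<le>i. v j) * 1"
    by (intro mult_left_mono prod_le_1 prod_nonneg) (auto simp: v)
  finally show "(\<Prod>j\<le>k. v j) \<le> (\<Prod>j\<le>i. v j)" by simp
qed

lemma proper_waits_small:
  assumes "v \<in> proper_waits"
  obtains k where "(\<Prod>j\<le>k. v j) < exp (- R)"
proof -
  have "\<forall>\<^sub>F i in sequentially. (\<Prod>j\<le>i. v j) < exp (- R)"
    using assms by (intro order_tendstoD(2)[of _ 0]) (auto simp: proper_waits_def)
  then show ?thesis using that by (auto simp: eventually_sequentially)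
qed

text \<open>The product up to i is exp of minus the i-th arrival time. Its convergence to 0 means
  that arrival times exceed every bound, so a bounded interval meets only finitely many of
  them.\<close>

lemma pp_of_space:
  assumes v: "v \<in> proper_waits"
  shows "pp_of v \<in> pp_space"
  unfolding pp_of_def point_sum_in_pp_iff
proof
  fix n :: nat
  let ?I = "{i. 0 < (\<Prod>j\<le>i. v j)}" and ?t = "\<lambda>i. - ln (\<Prod>j\<le>i. v j)"
  obtain k where k: "(\<Prod>j\<le>k. v j) < exp (- real n)" using proper_waits_small[OF v] .
  have vc: "v \<in> unit_cube" using v by (simp add: proper_waits_def)
  have sub: "{i \<in> ?I. ?t i \<in> {0..real n}} \<subseteq> {..<k}"
  proof (rule subsetI, rule ccontr)
    fix i assume "i \<in> {i \<in> ?I. ?t i \<in> {0..real n}}" "i \<notin> {..<k}"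
    then have i: "0 < (\<Prod>j\<le>i. v j)" "- ln (\<Prod>j\<le>i. v j) \<le> real n" "k \<le> i" by auto
    have "exp (- real n) \<le> (\<Prod>j\<le>i. v j)" using i by (subst ln_ge_iff[symmetric]) auto
    then show False using unit_cube_prod(3)[OF vc i(3)] k by linarith
  qed
  have "emeasure (point_sum ?I (\<lambda>_. 1) ?t) {0..real n} = (\<integral>\<^sup>+i. indicator {i \<in> ?I. ?t i \<in> {0..real n}} i \<partial>count_space ?I)"
    by (subst emeasure_point_sum'[OF interval_in_half_line]) (auto intro!: nn_integral_cong simp: indicator_def)
  also have "\<dots> = emeasure (count_space ?I) {i \<in> ?I. ?t i \<in> {0..real n}}"
    by (rule nn_integral_indicator) auto
  also have "\<dots> < \<infinity>" using finite_subset[OF sub] by (subst emeasure_count_space_finite) (auto simp: of_nat_less_top)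
  finally show "emeasure (point_sum ?I (\<lambda>_. 1) ?t) {0..real n} < \<infinity>" .
qed

text \<open>A formula with a fixed number k of terms, whatever the number of points in the support
  of \<open>f\<close>. The truncation at exp (- (R + 1)) avoids the logarithm of 0 and changes
  nothing, because \<open>f\<close> vanishes at every location it affects.\<close>

lemma integral_pp_of:
  assumes v: "v \<in> proper_waits" and f: "f \<in> vague_tests" and R: "\<And>x. x > R \<Longrightarrow> f x = 0"
    and k: "(\<Prod>j\<le>k. v j) < exp (- R)"
  shows "(\<integral>x. f x \<partial>pp_of v) = (\<Sum>i<k. f (- ln (max (exp (- (R + 1))) (\<Prod>j\<le>i. v j))))"
proof -
  let ?I = "{i. 0 < (\<Prod>j\<le>i. v j)}" and ?t = "\<lambda>i. - ln (\<Prod>j\<le>i. v j)"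
  have vc: "v \<in> unit_cube" using v by (simp add: proper_waits_def)
  note pr = unit_cube_prod[OF vc]
  have t: "?t \<in> measurable (count_space ?I) half_line"
    using pr by (auto simp: half_line_def space_restrict_space)
  have zero: "f (?t i) = 0" if "0 < (\<Prod>j\<le>i. v j)" "(\<Prod>j\<le>i. v j) < exp (- R)" for i
  proof (rule R)
    have "ln (\<Prod>j\<le>i. v j) < ln (exp (- R))" using that by (subst ln_less_cancel_iff) auto
    then show "R < ?t i" by simp
  qed
  have sub: "{i\<in>?I. f (?t i) \<noteq> 0} \<subseteq> {..<k}"
  proof (rule subsetI, rule ccontr)
    fix i assume i: "i \<in> {i\<in>?I. f (?t i) \<noteq> 0}" "i \<notin> {..<k}"
    then show False using zero[of i] pr(3)[of k i] k by auto
  qed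
  have "(\<integral>x. f x \<partial>pp_of v) = (\<integral>i. f (?t i) \<partial>count_space ?I)"
    unfolding pp_of_def point_sum_def of_nat_1 density_1
    by (rule integral_distr[OF t vague_test_measurable[OF f]])
  also have "\<dots> = (\<Sum>i\<in>{i\<in>?I. f (?t i) \<noteq> 0}. f (?t i))"
    using finite_subset[OF sub] by (intro lebesgue_integral_count_space_finite_support) auto
  also have "\<dots> = (\<Sum>i<k. f (- ln (max (exp (- (R + 1))) (\<Prod>j\<le>i. v j))))"
  proof (rule sum.mono_neutral_cong_left)
    show "\<forall>i\<in>{..<k} - {i\<in>?I. f (?t i) \<noteq> 0}. f (- ln (max (exp (- (R + 1))) (\<Prod>j\<le>i. v j))) = 0"
    proof
      fix i assume i: "i \<in> {..<k} - {i\<in>?I. f (?t i) \<noteq> 0}"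
      show "f (- ln (max (exp (- (R + 1))) (\<Prod>j\<le>i. v j))) = 0"
      proof (cases "exp (- (R + 1)) \<le> (\<Prod>j\<le>i. v j)")
        case True
        then have "0 < (\<Prod>j\<le>i. v j)" by (meson exp_gt_zero less_le_trans)
        then show ?thesis using i True by (auto simp: max_def)
      next
        case False
        then show ?thesis using R[of "R + 1"] by (simp add: max_def add.commute)
      qed
    qed
    fix i assume i: "i \<in> {i\<in>?I. f (?t i) \<noteq> 0}"
    then have "exp (- R) \<le> (\<Prod>j\<le>i. v j)" using zero[of i] by force
    then have "exp (- (R + 1)) \<le> (\<Prod>j\<le>i. v j)" by (smt (verit) exp_le_cancel_iff)
    then show "f (?t i) = f (- ln (max (exp (- (R + 1))) (\<Prod>j\<le>i. v j)))" by (simp add: max_def)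
  qed (use sub in auto)
  finally show ?thesis .
qed

text \<open>That the k-th arrival lies beyond the support of \<open>f\<close> is an open condition
  on finitely many coordinates. The same finite sum therefore represents the integral in a whole
  neighbourhood.\<close>

lemma continuous_on_integral_pp_of:
  assumes f: "f \<in> vague_tests"
  shows "continuous_on proper_waits (\<lambda>v. \<integral>x. f x \<partial>pp_of v)"
  unfolding continuous_on_def
proof
  fix v assume v: "v \<in> proper_waits"
  obtain R0 where R0: "\<And>x. x > R0 \<Longrightarrow> f x = 0" and cont: "continuous_on {0..} f"
    using f by (auto simp: vague_tests_def)
  \<comment> \<open>A nonnegative R keeps the truncated locations in the half-line, where
    \<open>f\<close> is continuous.\<close>
  define R where "R = max 0 R0"
  have R: "f x = 0" if "x > R" for x using that R0 by (auto simp: R_def)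
  obtain k where k: "(\<Prod>j\<le>k. v j) < exp (- R)" using proper_waits_small[OF v] .
  define U where "U = {u :: nat \<Rightarrow> real. (\<Prod>j\<le>k. u j) < exp (- R)}"
  have U: "open U" unfolding U_def
    by (intro open_Collect_less continuous_intros continuous_on_product_coordinates)
  define g where "g u = (\<Sum>i<k. f (- ln (max (exp (- (R + 1))) (\<Prod>j\<le>i. u j))))" for u
  have "continuous_on proper_waits g"
    unfolding g_def
  proof (intro continuous_intros)
    fix i
    show "continuous_on proper_waits (\<lambda>u. f (- ln (max (exp (- (R + 1))) (\<Prod>j\<le>i. u j))))"
    proof (rule continuous_on_compose2[OF cont])
      have "max (exp (- (R + 1))) z \<noteq> 0" for z :: real by (smt (verit) exp_gt_zero)
      then show "continuous_on proper_waits (\<lambda>u. - ln (max (exp (- (R + 1))) (\<Prod>j\<le>i. u j)))"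
        by (intro continuous_intros continuous_on_subset[OF continuous_on_product_coordinates]) auto
      show "(\<lambda>u. - ln (max (exp (- (R + 1))) (\<Prod>j\<le>i. u j))) ` proper_waits \<subseteq> {0..}"
      proof safe
        fix u assume "u \<in> proper_waits"
        then have u: "u \<in> unit_cube" by (simp add: proper_waits_def)
        have "max (exp (- (R + 1))) (\<Prod>j\<le>i. u j) \<le> 1"
          using unit_cube_prod(2)[OF u, of i] by (auto simp: R_def)
        moreover have "0 < max (exp (- (R + 1))) (\<Prod>j\<le>i. u j)" by (simp add: less_max_iff_disj)
        ultimately show "0 \<le> - ln (max (exp (- (R + 1))) (\<Prod>j\<le>i. u j))" by simp
      qed
    qed
  qed
  then have "(g \<longlongrightarrow> g v) (at v within proper_waits)" using v by (simp add: continuous_on_def)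
  moreover have "\<forall>\<^sub>F u in at v within proper_waits. (\<integral>x. f x \<partial>pp_of u) = g u"
    unfolding eventually_at_topological
  proof (intro exI[of _ U] conjI ballI impI)
    show "v \<in> U" using k by (simp add: U_def)
    fix u assume "u \<in> U" "u \<in> proper_waits"
    then show "(\<integral>x. f x \<partial>pp_of u) = g u"
      unfolding g_def U_def by (intro integral_pp_of[OF _ f R]) auto
  qed (rule U)
  moreover have "(\<integral>x. f x \<partial>pp_of v) = g v"
    unfolding g_def by (rule integral_pp_of[OF v f R k])
  ultimately show "((\<lambda>v. \<integral>x. f x \<partial>pp_of v) \<longlongrightarrow> (\<integral>x. f x \<partial>pp_of v)) (at v within proper_waits)"
    by (simp add: tendsto_cong)
qed

lemma continuous_map_pp_of: "continuous_map (top_of_set proper_waits) pp_topology pp_of"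
  unfolding pp_topology_def
proof (rule continuous_map_pullback')
  show "topspace (top_of_set proper_waits) \<subseteq> pp_of -` pp_space" using pp_of_space by auto
  show "continuous_map (top_of_set proper_waits) (product_topology (\<lambda>_. euclideanreal) vague_tests)
     ((\<lambda>\<xi>. restrict (\<lambda>f. \<integral>x. f x \<partial>\<xi>) vague_tests) \<circ> pp_of)"
    unfolding continuous_map_componentwise using continuous_on_integral_pp_of by auto
qed

lemma continuous_on_pp_of:
  assumes "continuous_map pp_topology euclideanreal F"
  shows "continuous_on proper_waits (\<lambda>v. F (pp_of v))"
  using continuous_map_compose[OF continuous_map_pp_of assms] by (simp add: o_def)

lemma pp_functional_measurable:
  assumes "continuous_map pp_topology euclideanreal F"
  shows "F \<in> borel_measurable pp_borel"
proof (rule borel_measurableI)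
  fix S :: "real set" assume S: "open S"
  have sp: "space pp_borel = pp_space"
    unfolding pp_borel_def by (rule space_measure_of) (use openin_subset topspace_pp_topology in fastforce)
  have "openin pp_topology {x \<in> topspace pp_topology. F x \<in> S}"
    using assms S by (auto simp: continuous_map_def)
  then have "{x \<in> pp_space. F x \<in> S} \<in> sets pp_borel"
    unfolding pp_borel_def topspace_pp_topology
    by (subst sets_measure_of) (use openin_subset topspace_pp_topology in \<open>fastforce intro: sigma_sets.Basic\<close>)+
  then show "F -` S \<inter> space pp_borel \<in> sets pp_borel"
    by (simp add: sp vimage_def Int_def conj_commute)
qed

lemma space_pp_borel: "space pp_borel = pp_space"
  unfolding pp_borel_def by (rule space_measure_of) (use openin_subset topspace_pp_topology in fastforce)

text \<open>\<open>distr\<close> is usually applied to measurable functions only. The maps that define \<open>RPP\<close> and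
  \<open>CFPP\<close> leave \<open>pp_space\<close> on a null set, which does not affect the resulting law.\<close>

lemma distr_eq_off_null_set:
  assumes S: "S \<in> sets M" "AE w in M. w \<in> S"
    and f: "\<And>w. w \<in> space M \<Longrightarrow> w \<notin> S \<Longrightarrow> f w \<notin> space N"
    and g: "g \<in> measurable M N" "\<And>w. w \<in> S \<Longrightarrow> f w = g w"
  shows "distr M N f = distr M N g"
proof -
  have "emeasure M (f -` A \<inter> space M) = emeasure M (g -` A \<inter> space M)" if A: "A \<in> sets N" for A
  proof -
    have "f w \<in> A \<longleftrightarrow> w \<in> S \<and> g w \<in> A" if "w \<in> space M" for w
      using f[OF that] g(2)[of w] sets.sets_into_space[OF A] by (cases "w \<in> S") auto
    then have "f -` A \<inter> space M = (g -` A \<inter> space M) \<inter> S" by auto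
    moreover have "(g -` A \<inter> space M) \<in> sets M" using g(1) A by (rule measurable_sets)
    ultimately show ?thesis
      using S by (auto intro!: emeasure_eq_AE elim!: eventually_mono)
  qed
  then show ?thesis unfolding distr_def
    by (intro measure_of_eq) (auto simp: sets.space_closed sets.sigma_sets_eq)
qed

text \<open>Provides a genuinely measurable version of a process that may fail to be boundedly
  finite on a null set, with the same image law.\<close>

lemma distr_point_sum:
  fixes T :: "'a \<Rightarrow> nat \<Rightarrow> real" and k :: "'a \<Rightarrow> nat \<Rightarrow> nat"
  assumes T [measurable]: "\<And>i. (\<lambda>w. T w i) \<in> borel_measurable M"
    and k [measurable]: "\<And>i. (\<lambda>w. k w i) \<in> measurable M (count_space UNIV)"
    and AE: "AE w in M. point_sum UNIV (k w) (T w) \<in> pp_space"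
  shows "\<exists>g. g \<in> measurable M pp_borel \<and> (AE w in M. g w = point_sum UNIV (k w) (T w)) \<and>
    distr M pp_borel (\<lambda>w. point_sum UNIV (k w) (T w)) = distr M pp_borel g"
proof -
  let ?X = "\<lambda>w. point_sum UNIV (k w) (T w)"
  define S where "S = {w\<in>space M. \<forall>n::nat. (\<Sum>i. of_nat (k w i) * indicator {0..real n} (T w i) :: ennreal) < \<infinity>}"
  have S_meas: "S \<in> sets M" unfolding S_def by measurable
  have S_iff: "w \<in> S \<longleftrightarrow> ?X w \<in> pp_space" if "w \<in> space M" for w
    using that unfolding S_def point_sum_in_pp_iff emeasure_point_sum'[OF interval_in_half_line]
    by (simp add: nn_integral_count_space_nat)
  \<comment> \<open>The empty configuration, an arbitrary element of \<open>pp_space\<close> for the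
    exceptional set.\<close>
  define \<xi>0 where "\<xi>0 = point_sum UNIV (\<lambda>_. 0) (\<lambda>_. 0)"
  have xi0: "\<xi>0 \<in> pp_space" unfolding \<xi>0_def point_sum_in_pp_iff
    by (simp add: emeasure_point_sum'[OF interval_in_half_line])
  define g where "g w = (if w \<in> S then ?X w else \<xi>0)" for w
  have g_space: "g w \<in> pp_space" if "w \<in> space M" for w
    using that xi0 S_iff by (auto simp: g_def)
  have nn: "(\<lambda>w. \<integral>\<^sup>+x. ennreal (f x) \<partial>g w) \<in> borel_measurable M" if f: "f \<in> borel_measurable half_line" for f :: "real \<Rightarrow> real"
  proof -
    have fm [measurable]: "(\<lambda>x. ennreal (f x) * indicator {0..} x) \<in> borel_measurable borel"
      using f unfolding half_line_def by (subst borel_measurable_restrict_space_iff_ennreal[symmetric]) auto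
    have f': "(\<lambda>x. ennreal (f x)) \<in> borel_measurable half_line" using f by measurable
    have "(\<integral>\<^sup>+x. ennreal (f x) \<partial>g w) = (if w \<in> S then (\<Sum>i. of_nat (k w i) * (ennreal (f (T w i)) * indicator {0..} (T w i))) else 0)" for w
      by (simp add: g_def \<xi>0_def nn_integral_point_sum[OF f'] nn_integral_count_space_nat)
    then show ?thesis using S_meas by simp
  qed
  have g: "g \<in> measurable M pp_borel"
  proof (rule pp_borel_measurableI[OF g_space])
    fix f assume f: "f \<in> vague_tests"
    have "(\<lambda>w. enn2real (\<integral>\<^sup>+x. ennreal (f x) \<partial>g w) - enn2real (\<integral>\<^sup>+x. ennreal (- f x) \<partial>g w)) \<in> borel_measurable M"
      using nn[OF vague_test_measurable[OF f]] nn[OF borel_measurable_uminus[OF vague_test_measurable[OF f]]] by measurable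
    moreover have "(\<integral>x. f x \<partial>g w) = enn2real (\<integral>\<^sup>+x. ennreal (f x) \<partial>g w) - enn2real (\<integral>\<^sup>+x. ennreal (- f x) \<partial>g w)"
      if "w \<in> space M" for w
      by (rule real_lebesgue_integral_def[OF integrable_vague_test[OF g_space[OF that] f]])
    ultimately show "(\<lambda>w. \<integral>x. f x \<partial>g w) \<in> borel_measurable M"
      by (subst measurable_cong) auto
  qed
  have AE_S: "AE w in M. w \<in> S" using AE AE_space by eventually_elim (simp add: S_iff)
  have "distr M pp_borel ?X = distr M pp_borel g"
    by (rule distr_eq_off_null_set[OF S_meas AE_S _ g]) (auto simp: S_iff space_pp_borel g_def)
  moreover have "AE w in M. g w = ?X w" using AE_S by eventually_elim (simp add: g_def)
  ultimately show ?thesis using g by blast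
qed

section \<open>The limit laws\<close>

definition H_char :: "real \<Rightarrow> real \<Rightarrow> real measure \<Rightarrow> bool" where
  "H_char \<alpha> l M \<longleftrightarrow> prob_space M \<and> sets M = sets borel \<and> (AE x in M. 0 \<le> x) \<and>
     (\<forall>s\<ge>0. (\<integral>x. exp (- s * x) \<partial>M) = l / (l + s powr \<alpha>))"

text \<open>The values at integers are the moments of exp (- x), a variable in the unit interval, so
  they determine its law as in the Hausdorff moment problem. Bounded continuous functions of x are
  recovered through the logarithm, and characteristic functions finish the proof.\<close>

lemma laplace_transform_unique:
  fixes M N :: "real measure"
  assumes M: "prob_space M" "sets M = sets borel" "AE x in M. 0 \<le> x"
    and N: "prob_space N" "sets N = sets borel" "AE x in N. 0 \<le> x"
    and eq: "\<And>n::nat. (\<integral>x. exp (- real n * x) \<partial>M) = (\<integral>x. exp (- real n * x) \<partial>N)"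
  shows "M = N"
proof -
  \<comment> \<open>A constant sequence, so that the moment theorem on the cube applies as it
    stands; a mixed moment is then a plain power.\<close>
  define V where "V = (\<lambda>(x::real) (i::nat). exp (- x))"
  have V: "V \<in> borel_measurable borel"
  proof -
    have "continuous_on UNIV V" unfolding V_def
      by (intro continuous_on_coordinatewise_then_product continuous_intros)
    then show ?thesis by (rule borel_measurable_continuous_onI)
  qed
  have VM: "V \<in> borel_measurable M" and VN: "V \<in> borel_measurable N"
    using V measurable_cong_sets[OF M(2) refl] measurable_cong_sets[OF N(2) refl] by auto
  have cube: "x \<ge> 0 \<Longrightarrow> V x \<in> unit_cube" for x by (auto simp: V_def unit_cube_def)
  have mom: "(\<Prod>i<K. V x i ^ m i) = exp (- real (\<Sum>i<K. m i) * x)" for K m x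
    unfolding V_def
    by (simp add: exp_of_nat_mult[symmetric] exp_sum[symmetric] sum_distrib_right[symmetric] sum_negf)
  have W: "(\<lambda>n. \<integral>w. g (V w) \<partial>M) \<longlonglongrightarrow> (\<integral>w. g (V w) \<partial>N)"
    if "continuous_on UNIV (g :: (nat \<Rightarrow> real) \<Rightarrow> real)" "bounded (range g)" for g
  proof (rule moments_weak_limit[where P="\<lambda>_. M" and X="\<lambda>_. V" and Y=V, OF M(1) N(1) VM _ VN _ _ that])
    show "AE w in M. V w \<in> unit_cube" using M(3) by eventually_elim (rule cube)
    show "AE w in N. V w \<in> unit_cube" using N(3) by eventually_elim (rule cube)
    show "(\<lambda>n. \<integral>w. (\<Prod>i<K. V w i ^ m i) \<partial>M) \<longlonglongrightarrow> (\<integral>w. (\<Prod>i<K. V w i ^ m i) \<partial>N)" for K m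
      unfolding mom by (simp only: eq tendsto_const)
  qed
  \<comment> \<open>The logarithm of the coordinate is continuous where that coordinate is positive,
    which always holds for \<open>V\<close>.\<close>
  have trig: "(\<integral>x. f x \<partial>M) = (\<integral>x. f x \<partial>N)"
    if f: "continuous_on UNIV f" "\<And>x. \<bar>f x\<bar> \<le> 1" for f :: "real \<Rightarrow> real"
  proof -
    let ?E = "{v::nat\<Rightarrow>real. 0 < v 0}"
    have fM: "f \<in> borel_measurable M" "f \<in> borel_measurable N"
      using borel_measurable_continuous_onI[OF f(1)] measurable_cong_sets[OF M(2) refl] measurable_cong_sets[OF N(2) refl] by auto
    have "(\<lambda>n. \<integral>w. f w \<partial>M) \<longlonglongrightarrow> (\<integral>w. f w \<partial>N)"
    proof (rule weak_limit_on_subset[where P="\<lambda>_. M" and X="\<lambda>_. V" and Y=V and E="?E" and G="\<lambda>v. f (- ln (v 0))" and c=1,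
          OF M(1) N(1) VM VN W])
      show "continuous_on ?E (\<lambda>v. f (- ln (v 0)))"
        by (rule continuous_on_compose2[OF f(1)])
           (auto intro!: continuous_intros continuous_on_subset[OF continuous_on_product_coordinates])
    qed (use f(2) fM in \<open>auto simp: V_def\<close>)
    then show ?thesis by (simp add: LIMSEQ_const_iff)
  qed
  interpret M: prob_space M by fact
  interpret N: prob_space N by fact
  have RM: "real_distribution M" and RN: "real_distribution N"
    using M N by (auto simp: real_distribution_def real_distribution_axioms_def)
  have "char M t = char N t" for t
  proof -
    have c: "(\<integral>x. cos (t * x) \<partial>M) = (\<integral>x. cos (t * x) \<partial>N)"
      "(\<integral>x. sin (t * x) \<partial>M) = (\<integral>x. sin (t * x) \<partial>N)"
      by (intro trig; auto intro!: continuous_intros)+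
    have *: "char K t = Complex (\<integral>x. cos (t * x) \<partial>K) (\<integral>x. sin (t * x) \<partial>K)" if "real_distribution K" for K
    proof -
      interpret K: real_distribution K by fact
      have i: "integrable K (\<lambda>x. iexp (t * x))"
        by (rule K.integrable_iexp) auto
      show ?thesis unfolding char_def
        using integral_Re[OF i] integral_Im[OF i] by (simp add: complex_eq_iff Re_exp Im_exp)
    qed
    show ?thesis using *[OF RM] *[OF RN] c by simp
  qed
  then show ?thesis using Levy_uniqueness[OF RM RN] by blast
qed

lemma H_char_unique: "H_char \<alpha> l M \<Longrightarrow> H_char \<alpha> l N \<Longrightarrow> M = N"
  unfolding H_char_def by (intro laplace_transform_unique) auto

lemma H_law_char: "H_char \<alpha> l M \<Longrightarrow> H_char \<alpha> l (H_law \<alpha> l)"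
  unfolding H_law_def H_char_def[symmetric] by (rule theI) (auto intro: H_char_unique)

text \<open>Laws on the unit interval are tight, so some subsequence converges weakly. Its limit has
  the prescribed power means for s > 0, and letting s tend to 0 shows that no mass sits at 0. Minus
  the logarithm then carries this limit to the law sought.\<close>

lemma H_char_exists:
  fixes V :: "nat \<Rightarrow> 'b \<Rightarrow> real"
  assumes l: "0 < l" and \<alpha>: "0 < \<alpha>" and P: "\<And>n. prob_space (P n)"
    and V: "\<And>n. V n \<in> borel_measurable (P n)" "\<And>n w. 0 \<le> V n w" "\<And>n w. V n w \<le> 1"
    and lim: "\<And>s. 0 < s \<Longrightarrow> (\<lambda>n. \<integral>w. V n w powr s \<partial>P n) \<longlonglongrightarrow> l / (l + s powr \<alpha>)"
  shows "\<exists>M. H_char \<alpha> l M"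
proof -
  interpret P: prob_space "P n" for n by (rule P)
  define \<mu> where "\<mu> n = distr (P n) borel (V n)" for n
  have rd: "real_distribution (\<mu> n)" for n
    unfolding \<mu>_def real_distribution_def real_distribution_axioms_def using P.prob_space_distr[OF V(1)] by auto
  have "measure (\<mu> n) {-1<..2} = 1" for n
  proof -
    have "V n -` {-1<..2} \<inter> space (P n) = space (P n)"
    proof -
      have "-1 < V n w" "V n w \<le> 2" for w using V(2,3)[of n w] by linarith+
      then show ?thesis by auto
    qed
    then show ?thesis unfolding \<mu>_def by (subst measure_distr[OF V(1)]) (auto simp: P.prob_space)
  qed
  then have "tight \<mu>" unfolding tight_def using rd
    by (intro conjI allI impI, simp) (rule exI[of _ "-1"], rule exI[of _ 2], auto)
  then obtain r M where r: "strict_mono r" and M: "real_distribution M" and wc: "weak_conv_m (\<mu> \<circ> id \<circ> r) M"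
    using tight_imp_convergent_subsubsequence[of \<mu> id] by (auto simp: strict_mono_def)
  interpret M: real_distribution M by fact
  \<comment> \<open>The limit measure lives on the whole line, so powers are taken of a clamped
    value, which agrees with the identity on the range of all \<open>V n\<close>.\<close>
  define c where "c u = max 0 (min 1 u)" for u :: real
  have c: "0 \<le> c u" "c u \<le> 1" for u by (auto simp: c_def)
  have c_cont: "isCont c u" for u unfolding c_def by (intro continuous_intros)
  have [measurable]: "c \<in> borel_measurable borel" unfolding c_def by measurable
  have int: "(\<integral>u. c u powr s \<partial>M) = l / (l + s powr \<alpha>)" if s: "0 < s" for s
  proof -
    have "(\<lambda>n. \<integral>u. c u powr s \<partial>(\<mu> \<circ> id \<circ> r) n) \<longlonglongrightarrow> (\<integral>u. c u powr s \<partial>M)"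
    proof (rule weak_conv_imp_integral_bdd_continuous_conv[OF _ M wc, where B=1])
      show "real_distribution ((\<mu> \<circ> id \<circ> r) n)" for n using rd by simp
      show "isCont (\<lambda>u. c u powr s) x" for x
        unfolding isCont_def using s c
        by (intro tendsto_powr' c_cont[unfolded isCont_def] tendsto_const) auto
      show "norm (c u powr s) \<le> 1" for u using c s by (auto intro!: powr_le1)
    qed
    moreover have "(\<integral>u. c u powr s \<partial>\<mu> n) = (\<integral>w. V n w powr s \<partial>P n)" for n
      unfolding \<mu>_def using V by (subst integral_distr) (auto simp: c_def)
    ultimately have "(\<lambda>n. \<integral>w. V (r n) w powr s \<partial>P (r n)) \<longlonglongrightarrow> (\<integral>u. c u powr s \<partial>M)" by simp
    moreover have "(\<lambda>n. \<integral>w. V (r n) w powr s \<partial>P (r n)) \<longlonglongrightarrow> l / (l + s powr \<alpha>)"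
      using LIMSEQ_subseq_LIMSEQ[OF lim[OF s] r] by (simp add: o_def)
    ultimately show ?thesis by (rule LIMSEQ_unique)
  qed
  \<comment> \<open>As s decreases to 0, the power of \<open>c u\<close> tends to the indicator of
    its positivity, while l / (l + s powr \<alpha>) tends to 1.\<close>
  have pos: "AE u in M. 0 < c u"
  proof -
    define s where "s n = inverse (real (Suc n))" for n
    have s0: "s \<longlonglongrightarrow> 0" unfolding s_def by (rule LIMSEQ_inverse_real_of_nat)
    have sp: "0 < s n" for n by (simp add: s_def)
    have "(\<lambda>n. \<integral>u. c u powr s n \<partial>M) \<longlonglongrightarrow> (\<integral>u. indicator {u. 0 < c u} u \<partial>M)"
    proof (rule integral_dominated_convergence[where w="\<lambda>_. 1"])
      show "AE u in M. (\<lambda>n. c u powr s n) \<longlonglongrightarrow> indicator {u. 0 < c u} u"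
      proof (rule AE_I2)
        fix u
        show "(\<lambda>n. c u powr s n) \<longlonglongrightarrow> indicator {u. 0 < c u} u"
        proof (cases "0 < c u")
          case True
          then have "(\<lambda>n. c u powr s n) \<longlonglongrightarrow> c u powr 0" by (intro tendsto_powr s0 tendsto_const) auto
          then show ?thesis using True by simp
        next
          case False
          then have "c u = 0" using c[of u] by auto
          then show ?thesis by simp
        qed
      qed
      show "AE u in M. norm (c u powr s n) \<le> 1" for n
        using c sp[of n] by (auto intro!: powr_le1)
    qed auto
    moreover have "(\<lambda>n. l / (l + s n powr \<alpha>)) \<longlonglongrightarrow> l / (l + 0)"
    proof (intro tendsto_divide tendsto_add tendsto_const)
      have "(\<lambda>n. s n powr \<alpha>) \<longlonglongrightarrow> 0 powr \<alpha>"
        using sp \<alpha> by (intro tendsto_powr' s0 tendsto_const) (auto intro!: always_eventually less_imp_le)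
      then show "(\<lambda>n. s n powr \<alpha>) \<longlonglongrightarrow> 0" by simp
    qed (use l in auto)
    ultimately have "(\<integral>u. indicator {u. 0 < c u} u \<partial>M) = (1::real)"
      using l by (simp add: int sp) (metis LIMSEQ_unique)
    then have "M.prob {u. 0 < c u} = 1" by simp
    then show ?thesis by (subst (asm) M.prob_eq_1) auto
  qed
  define Y where "Y u = - ln (c u)" for u
  have Y: "Y \<in> borel_measurable M" unfolding Y_def by measurable
  have "H_char \<alpha> l (distr M borel Y)"
    unfolding H_char_def
  proof (intro conjI allI impI)
    show "prob_space (distr M borel Y)" by (rule M.prob_space_distr[OF Y])
    show "AE x in distr M borel Y. 0 \<le> x"
      using Y pos by (subst AE_distr_iff) (auto simp: Y_def elim!: eventually_mono intro: c)
    fix s :: real assume s: "0 \<le> s"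
    have "(\<integral>x. exp (- s * x) \<partial>distr M borel Y) = (\<integral>u. exp (- s * Y u) \<partial>M)"
      by (rule integral_distr[OF Y]) simp
    also have "\<dots> = (\<integral>u. c u powr s \<partial>M)"
      using pos by (intro integral_cong_AE) (use Y in \<open>auto simp: Y_def powr_def elim!: eventually_mono\<close>)
    also have "\<dots> = l / (l + s powr \<alpha>)"
    proof (cases "s = 0")
      case True
      have "(\<integral>u. c u powr 0 \<partial>M) = (\<integral>u. 1 \<partial>M)"
        using pos by (intro integral_cong_AE) (auto elim!: eventually_mono)
      moreover have "M.prob UNIV = 1" using M.prob_space by simp
      ultimately show ?thesis using True l by simp
    qed (use s int in auto)
    finally show "(\<integral>x. exp (- s * x) \<partial>distr M borel Y) = l / (l + s powr \<alpha>)" .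
  qed simp
  then show ?thesis by blast
qed

section \<open>The waiting law with an atom at zero\<close>

definition W_char :: "real \<Rightarrow> real measure \<Rightarrow> real measure \<Rightarrow> bool" where
  "W_char \<theta> H M \<longleftrightarrow> prob_space M \<and> sets M = sets borel \<and> (AE x in M. 0 \<le> x) \<and>
     (\<forall>t\<ge>0. measure M {..t} = 1 - \<theta> + \<theta> * measure H {..t})"

lemma W_char_unique:
  assumes M: "W_char \<theta> H M" and N: "W_char \<theta> H N"
  shows "M = N"
proof (rule cdf_unique)
  show "real_distribution M" "real_distribution N"
    using M N by (auto simp: W_char_def real_distribution_def real_distribution_axioms_def)
  have neg: "cdf K t = 0" if "W_char \<theta> H K" "t < 0" for K t
  proof -
    have "AE x in K. x \<notin> {..t}" using that unfolding W_char_def by (auto elim!: eventually_mono)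
    then have "emeasure K {..t} = 0"
      using that by (subst AE_iff_measurable[symmetric, where P="\<lambda>x. x \<notin> {..t}"]) (auto simp: W_char_def dest: sets_eq_imp_space_eq)
    then show ?thesis by (simp add: cdf_def measure_def)
  qed
  show "cdf M = cdf N"
  proof
    fix t show "cdf M t = cdf N t"
    proof (cases "t < 0")
      case True
      then show ?thesis using neg M N by simp
    next
      case False
      then show ?thesis using M N by (simp add: W_char_def cdf_def)
    qed
  qed
qed

text \<open>The law is realised by an independent Bernoulli switch between 0 and a variable of law
  \<open>H_law\<close>. One integral formula for this construction yields both the distribution
  function and the Laplace transform.\<close>

lemma W_law_props:
  assumes H: "prob_space (H_law \<alpha> l)" "sets (H_law \<alpha> l) = sets borel" "AE x in H_law \<alpha> l. 0 \<le> x"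
    and \<theta>: "0 \<le> \<theta>" "\<theta> \<le> 1"
  shows "prob_space (W_law \<alpha> \<theta> l)" "sets (W_law \<alpha> \<theta> l) = sets borel" "AE x in W_law \<alpha> \<theta> l. 0 \<le> x"
    "\<And>s. 0 \<le> s \<Longrightarrow> (\<integral>x. exp (- s * x) \<partial>W_law \<alpha> \<theta> l) = 1 - \<theta> + \<theta> * (\<integral>x. exp (- s * x) \<partial>H_law \<alpha> l)"
proof -
  let ?H = "H_law \<alpha> l"
  interpret H: prob_space ?H by fact
  have Hm [measurable_cong]: "sets ?H = sets borel" by (rule H(2))
  let ?B = "measure_pmf (bernoulli_pmf \<theta>)"
  interpret BH: pair_prob_space ?B ?H by standard
  define M where "M = distr (?B \<Otimes>\<^sub>M ?H) borel (\<lambda>(b, x). if b then x else 0)"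
  have f: "(\<lambda>(b, x). if b then x else 0) \<in> borel_measurable (?B \<Otimes>\<^sub>M ?H)"
    unfolding split_beta by measurable
  have int: "(\<integral>x. g x \<partial>M) = (1 - \<theta>) * g 0 + \<theta> * (\<integral>x. g x \<partial>?H)"
    if g: "g \<in> borel_measurable borel" "\<And>x. x \<ge> 0 \<Longrightarrow> \<bar>g x\<bar> \<le> 1" for g :: "real \<Rightarrow> real"
  proof -
    have gf: "(\<lambda>p. g (case p of (b, x) \<Rightarrow> if b then x else 0)) \<in> borel_measurable (?B \<Otimes>\<^sub>M ?H)"
      using measurable_compose[OF f g(1)] .
    have AE0: "AE p in ?B \<Otimes>\<^sub>M ?H. 0 \<le> snd p"
    proof (rule BH.AE_pair_measure)
      show "{x \<in> space (?B \<Otimes>\<^sub>M ?H). 0 \<le> snd x} \<in> sets (?B \<Otimes>\<^sub>M ?H)" by measurable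
      show "AE x in ?B. AE y in ?H. 0 \<le> snd (x, y)" using H(3) by simp
    qed
    have i: "integrable (?B \<Otimes>\<^sub>M ?H) (\<lambda>p. g (case p of (b, x) \<Rightarrow> if b then x else 0))"
      by (rule BH.P.integrable_const_bound[where B=1])
         (use AE0 gf g(2) in \<open>auto simp: split_beta elim!: eventually_mono\<close>)
    have "(\<integral>x. g x \<partial>M) = (\<integral>p. g (case p of (b, x) \<Rightarrow> if b then x else 0) \<partial>(?B \<Otimes>\<^sub>M ?H))"
      unfolding M_def by (rule integral_distr[OF f g(1)])
    also have eq: "(\<lambda>p. g (case p of (b, x) \<Rightarrow> if b then x else 0)) = (\<lambda>(b, x). g (if b then x else 0))"
      by (auto simp: fun_eq_iff)
    also have "(\<integral>p. (case p of (b, x) \<Rightarrow> g (if b then x else 0)) \<partial>(?B \<Otimes>\<^sub>M ?H))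
        = (\<integral>b. \<integral>x. g (if b then x else 0) \<partial>?H \<partial>?B)"
      by (rule BH.integral_fst[symmetric]) (use i in \<open>simp only: eq\<close>)
    also have "\<dots> = (\<integral>x. g x \<partial>?H) * \<theta> + (\<integral>x. g 0 \<partial>?H) * (1 - \<theta>)"
      using \<theta> by (simp add: integral_bernoulli_pmf)
    finally show ?thesis by (simp add: H.prob_space)
  qed
  have Wc: "W_char \<theta> ?H M"
    unfolding W_char_def
  proof (intro conjI allI impI)
    show "prob_space M" unfolding M_def by (rule BH.P.prob_space_distr[OF f])
    then interpret M: prob_space M .
    show "sets M = sets borel" by (simp add: M_def)
    show "AE x in M. 0 \<le> x" unfolding M_def
    proof (subst AE_distr_iff[OF f])
      show "AE p in ?B \<Otimes>\<^sub>M ?H. 0 \<le> (case p of (b, x) \<Rightarrow> if b then x else 0)"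
      proof (rule BH.AE_pair_measure)
        show "{x \<in> space (?B \<Otimes>\<^sub>M ?H). 0 \<le> (case x of (b, x) \<Rightarrow> if b then x else 0)} \<in> sets (?B \<Otimes>\<^sub>M ?H)"
          using f by measurable
        show "AE x in ?B. AE y in ?H. 0 \<le> (case (x, y) of (b, x) \<Rightarrow> if b then x else 0)"
          using H(3) by (auto elim!: eventually_mono)
      qed
    qed auto
    fix t :: real assume t: "0 \<le> t"
    have "measure M {..t} = (\<integral>x. indicator {..t} x \<partial>M)" by (simp add: M_def)
    also have "\<dots> = (1 - \<theta>) * indicator {..t} 0 + \<theta> * (\<integral>x. indicator {..t} x \<partial>?H)"
      by (rule int) (auto simp: indicator_def)
    finally show "measure M {..t} = 1 - \<theta> + \<theta> * measure ?H {..t}" using t by simp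
  qed
  have eqW: "W_law \<alpha> \<theta> l = M"
    unfolding W_law_def W_char_def[symmetric] by (rule the_equality) (auto intro: Wc W_char_unique)
  have lap: "(\<integral>x. exp (- s * x) \<partial>M) = 1 - \<theta> + \<theta> * (\<integral>x. exp (- s * x) \<partial>?H)" if "0 \<le> s" for s
    using that by (subst int) auto
  show "prob_space (W_law \<alpha> \<theta> l)" "sets (W_law \<alpha> \<theta> l) = sets borel" "AE x in W_law \<alpha> \<theta> l. 0 \<le> x"
    "\<And>s. 0 \<le> s \<Longrightarrow> (\<integral>x. exp (- s * x) \<partial>W_law \<alpha> \<theta> l) = 1 - \<theta> + \<theta> * (\<integral>x. exp (- s * x) \<partial>H_law \<alpha> l)"
    unfolding eqW using Wc lap by (simp_all only: W_char_def)
qed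

text \<open>\<open>L\<close> is the law of the point process coded by \<open>Y\<close>. The
  auxiliary \<open>g\<close> is a measurable version, since \<open>pp_of\<close> composed with
  \<open>Y\<close> is tied to \<open>pp_space\<close> only almost everywhere.\<close>

definition waits_law :: "real measure measure \<Rightarrow> 'b measure \<Rightarrow> ('b \<Rightarrow> nat \<Rightarrow> real) \<Rightarrow> bool" where
  "waits_law L Q Y \<longleftrightarrow> prob_space Q \<and> Y \<in> borel_measurable Q \<and> (AE w in Q. Y w \<in> proper_waits) \<and>
     (\<exists>g. g \<in> measurable Q pp_borel \<and> (AE w in Q. g w = pp_of (Y w)) \<and> L = distr Q pp_borel g)"

text \<open>A vaguely continuous functional composed with \<open>pp_of\<close> is continuous on
  \<open>proper_waits\<close> only, so the weak convergence obtained from moments is passed on by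
  \<open>weak_limit_on_subset\<close>.\<close>

lemma waits_law_converge:
  assumes X: "\<And>n. waits_law (L n) (P n) (X n)" and Y: "waits_law L' Q Y"
    and moments: "\<And>K m. (\<lambda>n. \<integral>w. (\<Prod>i<K. X n w i ^ m i) \<partial>P n) \<longlonglongrightarrow> (\<integral>w. (\<Prod>i<K. Y w i ^ m i) \<partial>Q)"
  shows "pp_converges_in_law L L'"
  unfolding pp_converges_in_law_def
proof (intro allI impI, elim conjE)
  fix F assume F: "continuous_map pp_topology euclideanreal F" and bdd: "bounded (F ` pp_space)"
  obtain c where c: "\<And>x. x \<in> pp_space \<Longrightarrow> \<bar>F x\<bar> \<le> c" using bdd by (auto simp: bounded_iff)
  have Fm: "F \<in> borel_measurable pp_borel" by (rule pp_functional_measurable[OF F])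
  have ex: "\<exists>g. g \<in> measurable (P n) pp_borel \<and> (AE w in P n. g w = pp_of (X n w)) \<and> L n = distr (P n) pp_borel g" for n
    using X[of n] unfolding waits_law_def by blast
  define g where "g n = (SOME g. g \<in> measurable (P n) pp_borel \<and> (AE w in P n. g w = pp_of (X n w)) \<and> L n = distr (P n) pp_borel g)" for n
  have g: "g n \<in> measurable (P n) pp_borel" "AE w in P n. g n w = pp_of (X n w)" "L n = distr (P n) pp_borel (g n)" for n
    using someI_ex[OF ex[of n]] unfolding g_def by blast+
  obtain g' where g': "g' \<in> measurable Q pp_borel" "AE w in Q. g' w = pp_of (Y w)" "L' = distr Q pp_borel g'"
    using Y unfolding waits_law_def by blast
  have X': "prob_space (P n)" "X n \<in> borel_measurable (P n)" "AE w in P n. X n w \<in> proper_waits" for n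
    using X[of n] unfolding waits_law_def by blast+
  have Y': "prob_space Q" "Y \<in> borel_measurable Q" "AE w in Q. Y w \<in> proper_waits"
    using Y unfolding waits_law_def by blast+
  have sub: "v \<in> proper_waits \<Longrightarrow> v \<in> unit_cube" for v by (simp add: proper_waits_def)
  have cube: "AE w in P n. X n w \<in> unit_cube" "AE w in Q. Y w \<in> unit_cube" for n
    using eventually_mono[OF X'(3) sub] eventually_mono[OF Y'(3) sub] by auto
  have "(\<lambda>n. \<integral>w. F (g n w) \<partial>P n) \<longlonglongrightarrow> (\<integral>w. F (g' w) \<partial>Q)"
  proof (rule weak_limit_on_subset[where X=X and Y=Y and E=proper_waits and G="\<lambda>v. F (pp_of v)" and c=c,
        OF X'(1) Y'(1) X'(2) Y'(2)])
    fix h :: "(nat \<Rightarrow> real) \<Rightarrow> real" assume "continuous_on UNIV h" "bounded (range h)"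
    then show "(\<lambda>n. \<integral>w. h (X n w) \<partial>P n) \<longlonglongrightarrow> (\<integral>w. h (Y w) \<partial>Q)"
      by (rule moments_weak_limit[OF X'(1) Y'(1) X'(2) cube(1) Y'(2) cube(2) moments])
  next
    show "continuous_on proper_waits (\<lambda>v. F (pp_of v))" by (rule continuous_on_pp_of[OF F])
    show "\<bar>F (pp_of v)\<bar> \<le> c" if "v \<in> proper_waits" for v by (rule c[OF pp_of_space[OF that]])
    show "(\<lambda>w. F (g n w)) \<in> borel_measurable (P n)" for n using measurable_compose[OF g(1) Fm] .
    show "(\<lambda>w. F (g' w)) \<in> borel_measurable Q" using measurable_compose[OF g'(1) Fm] .
    show "AE w in P n. X n w \<in> proper_waits \<and> F (g n w) = F (pp_of (X n w))" for n
      using X'(3)[of n] g(2)[of n] by eventually_elim simp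
    show "AE w in Q. Y w \<in> proper_waits \<and> F (g' w) = F (pp_of (Y w))"
      using Y'(3) g'(2) by eventually_elim simp
  qed
  moreover have "(\<integral>\<xi>. F \<xi> \<partial>L n) = (\<integral>w. F (g n w) \<partial>P n)" for n
    unfolding g(3) by (rule integral_distr[OF g(1) Fm])
  moreover have "(\<integral>\<xi>. F \<xi> \<partial>L') = (\<integral>w. F (g' w) \<partial>Q)"
    unfolding g'(3) by (rule integral_distr[OF g'(1) Fm])
  ultimately show "(\<lambda>n. \<integral>\<xi>. F \<xi> \<partial>L n) \<longlonglongrightarrow> (\<integral>\<xi>. F \<xi> \<partial>L')" by simp
qed

lemma AE_tendsto_0_of_summable_integrals:
  fixes f :: "nat \<Rightarrow> 'a \<Rightarrow> real"
  assumes f: "\<And>i. f i \<in> borel_measurable M" and sum: "(\<Sum>i. \<integral>\<^sup>+w. ennreal (f i w) \<partial>M) < \<infinity>"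
    and nonneg: "AE w in M. \<forall>i. 0 \<le> f i w"
  shows "AE w in M. (\<lambda>i. f i w) \<longlonglongrightarrow> 0"
proof -
  have "(\<integral>\<^sup>+w. (\<Sum>i. ennreal (f i w)) \<partial>M) = (\<Sum>i. \<integral>\<^sup>+w. ennreal (f i w) \<partial>M)"
    using f by (intro nn_integral_suminf) measurable
  then have "AE w in M. (\<Sum>i. ennreal (f i w)) \<noteq> \<infinity>"
    using sum f by (intro nn_integral_PInf_AE) (auto simp: less_top)
  then show ?thesis using nonneg
  proof eventually_elim
    case (elim w)
    then have "summable (\<lambda>i. f i w)" by (intro summable_suminf_not_top) (auto simp: top_ennreal_def)
    then show ?case by (rule summable_LIMSEQ_zero)
  qed
qed

text \<open>Summable expectations make the series of products finite almost surely, so its terms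
  tend to 0. No independence is required at this point.\<close>

lemma waits_proper:
  fixes Y :: "'a \<Rightarrow> nat \<Rightarrow> real"
  assumes Y: "\<And>i. (\<lambda>w. Y w i) \<in> borel_measurable M" "AE w in M. Y w \<in> unit_cube"
    and sum: "(\<Sum>i. \<integral>\<^sup>+w. ennreal (\<Prod>j\<le>i. Y w j) \<partial>M) < \<infinity>"
  shows "AE w in M. Y w \<in> proper_waits"
proof -
  have "AE w in M. (\<lambda>i. \<Prod>j\<le>i. Y w j) \<longlonglongrightarrow> 0"
    by (rule AE_tendsto_0_of_summable_integrals[OF _ sum])
       (use Y in \<open>auto elim!: eventually_mono intro: unit_cube_prod\<close>)
  with Y(2) show ?thesis by eventually_elim (simp add: proper_waits_def)
qed

section \<open>The renewal point process\<close>

lemma measurable_seq_borel: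
  fixes Y :: "'a \<Rightarrow> nat \<Rightarrow> real"
  assumes "\<And>i. (\<lambda>w. Y w i) \<in> borel_measurable M"
  shows "Y \<in> borel_measurable M"
proof -
  have "(\<lambda>w i. Y w i) \<in> measurable M (Pi\<^sub>M UNIV (\<lambda>_. borel))"
    by (rule measurable_abs_UNIV) (rule assms)
  then show ?thesis using measurable_cong_sets[OF refl sets_PiM_equal_borel] by blast
qed

lemma (in sequence_space) nn_integral_iter:
  assumes f: "f \<in> borel_measurable S"
  shows "(\<integral>\<^sup>+\<omega>. f \<omega> \<partial>S) = (\<integral>\<^sup>+x. \<integral>\<^sup>+\<omega>. f (case_nat x \<omega>) \<partial>S \<partial>M)"
proof -
  have c: "(\<lambda>(s, \<omega>). case_nat s \<omega>) \<in> measurable (M \<Otimes>\<^sub>M S) S" by measurable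
  have fc: "(\<lambda>p. f (case p of (s, \<omega>) \<Rightarrow> case_nat s \<omega>)) \<in> borel_measurable (M \<Otimes>\<^sub>M S)"
    using measurable_compose[OF c f] .
  have "(\<integral>\<^sup>+\<omega>. f \<omega> \<partial>S) = (\<integral>\<^sup>+\<omega>. f \<omega> \<partial>distr (M \<Otimes>\<^sub>M S) S (\<lambda>(s, \<omega>). case_nat s \<omega>))"
    unfolding PiM_iter ..
  also have "\<dots> = (\<integral>\<^sup>+p. f (case p of (s, \<omega>) \<Rightarrow> case_nat s \<omega>) \<partial>(M \<Otimes>\<^sub>M S))"
    by (rule nn_integral_distr[OF c]) (simp add: f)
  also have "\<dots> = (\<integral>\<^sup>+x. \<integral>\<^sup>+\<omega>. f (case_nat x \<omega>) \<partial>S \<partial>M)"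
    by (subst P.nn_integral_fst[OF fc, symmetric]) simp
  finally show ?thesis .
qed

lemma (in sequence_space) nn_integral_prod:
  assumes g: "\<And>i. g i \<in> borel_measurable M"
  shows "(\<integral>\<^sup>+\<omega>. (\<Prod>i<K. g i (\<omega> i)) \<partial>S) = (\<Prod>i<K. \<integral>\<^sup>+x. g i x \<partial>M)"
  using g
proof (induction K arbitrary: g)
  case 0
  then show ?case by (simp add: P.emeasure_space_1)
next
  case (Suc K)
  note [measurable] = Suc.prems
  have "(\<integral>\<^sup>+\<omega>. (\<Prod>i<Suc K. g i (\<omega> i)) \<partial>S) = (\<integral>\<^sup>+x. \<integral>\<^sup>+\<omega>. (\<Prod>i<Suc K. g i (case_nat x \<omega> i)) \<partial>S \<partial>M)"
    by (rule nn_integral_iter) measurable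
  also have "\<dots> = (\<integral>\<^sup>+x. g 0 x * (\<Prod>i<K. \<integral>\<^sup>+x. g (Suc i) x \<partial>M) \<partial>M)"
    unfolding prod.lessThan_Suc_shift by (subst Suc.IH[symmetric]) (auto simp: nn_integral_cmult)
  also have "\<dots> = (\<Prod>i<Suc K. \<integral>\<^sup>+x. g i x \<partial>M)"
    unfolding prod.lessThan_Suc_shift by (simp add: nn_integral_multc)
  finally show ?case .
qed

lemma prod_exp_power: "(\<Prod>i<K. exp (- w i) ^ m i) = (\<Prod>i<K. exp (- real (m i) * w i))"
  by (simp add: exp_of_nat_mult[symmetric])

lemma pp_of_exp: "pp_of (\<lambda>i. exp (- w i)) = point_sum UNIV (\<lambda>_. 1) (\<lambda>i. \<Sum>j\<le>i. w j)"
  unfolding pp_of_def by (simp add: exp_sum[symmetric] sum_negf)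

context
  fixes W :: "real measure"
  assumes W: "prob_space W" "sets W = sets borel" "AE x in W. 0 \<le> x"
begin

lemma W_borel [measurable_cong]: "sets W = sets borel" by (rule W(2))

lemma laplace_nn: "0 \<le> s \<Longrightarrow> (\<integral>\<^sup>+x. ennreal (exp (- s * x)) \<partial>W) = ennreal (\<integral>x. exp (- s * x) \<partial>W)"
proof (rule nn_integral_eq_integral)
  interpret W: prob_space W by (rule W(1))
  assume "0 \<le> s"
  then show "integrable W (\<lambda>x. exp (- s * x))"
    by (intro W.integrable_const_bound[where B=1]) (use W(3) in \<open>auto elim!: eventually_mono\<close>)
qed simp

lemma RPP_moments:
  "(\<integral>w. (\<Prod>i<K. exp (- w i) ^ m i) \<partial>Pi\<^sub>M (UNIV :: nat set) (\<lambda>_. W)) = (\<Prod>i<K. \<integral>x. exp (- real (m i) * x) \<partial>W)"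
proof -
  interpret sequence_space W by (rule sequence_space.intro) (use W(1) in \<open>simp add: product_prob_spaceI\<close>)
  have nonneg: "0 \<le> (\<Prod>i<K. \<integral>x. exp (- real (m i) * x) \<partial>W)" by (intro prod_nonneg) simp
  have "(\<integral>\<^sup>+w. ennreal (\<Prod>i<K. exp (- w i) ^ m i) \<partial>S) = (\<integral>\<^sup>+w. (\<Prod>i<K. ennreal (exp (- real (m i) * w i))) \<partial>S)"
    unfolding prod_exp_power by (intro nn_integral_cong prod_ennreal[symmetric]) simp
  also have "\<dots> = (\<Prod>i<K. \<integral>\<^sup>+x. ennreal (exp (- real (m i) * x)) \<partial>W)"
    by (rule nn_integral_prod) simp
  also have "\<dots> = (\<Prod>i<K. ennreal (\<integral>x. exp (- real (m i) * x) \<partial>W))"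
    by (intro prod.cong refl laplace_nn) simp
  also have "\<dots> = ennreal (\<Prod>i<K. \<integral>x. exp (- real (m i) * x) \<partial>W)"
    by (rule prod_ennreal) simp
  finally show ?thesis
    by (intro integral_eq_nn_integral[THEN trans]) (auto simp: prod_nonneg nonneg)
qed

text \<open>The assumption excludes a waiting time that is 0 almost surely. By independence the
  expected products are powers of a number below 1, so arrival times diverge.\<close>

lemma waits_law_RPP:
  assumes "(\<integral>x. exp (- x) \<partial>W) < 1"
  shows "waits_law (RPP W) (Pi\<^sub>M UNIV (\<lambda>_. W)) (\<lambda>w i. exp (- w i))"
proof -
  interpret sequence_space W by (rule sequence_space.intro) (use W(1) in \<open>simp add: product_prob_spaceI\<close>)
  let ?Y = "\<lambda>(w::nat \<Rightarrow> real) i. exp (- w i)"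
  have Y: "(\<lambda>w. ?Y w i) \<in> borel_measurable S" for i by measurable
  have "AE w in S. 0 \<le> w i" for i
    by (rule AE_PiM_component) (use W in auto)
  then have pos: "AE w in S. \<forall>i. 0 \<le> w i" by (simp add: AE_all_countable)
  then have cube: "AE w in S. ?Y w \<in> unit_cube" by eventually_elim (simp add: unit_cube_def)
  define p where "p = (\<integral>x. exp (- x) \<partial>W)"
  have p: "0 \<le> p" "p < 1" using assms by (auto simp: p_def)
  have "(\<integral>\<^sup>+w. ennreal (\<Prod>j\<le>i. ?Y w j) \<partial>S) = ennreal (p ^ Suc i)" for i
  proof -
    have "(\<integral>\<^sup>+w. ennreal (\<Prod>j\<le>i. ?Y w j) \<partial>S) = (\<integral>\<^sup>+w. (\<Prod>j<Suc i. ennreal (?Y w j)) \<partial>S)"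
      unfolding lessThan_Suc_atMost by (intro nn_integral_cong prod_ennreal[symmetric]) simp
    also have "\<dots> = (\<Prod>j<Suc i. \<integral>\<^sup>+x. ennreal (exp (- x)) \<partial>W)" by (rule nn_integral_prod) simp
    also have "\<dots> = ennreal (p ^ Suc i)"
      using laplace_nn[of 1] p by (simp add: p_def[symmetric] ennreal_power del: power_Suc)
    finally show ?thesis .
  qed
  moreover have "(\<Sum>i. ennreal (p ^ Suc i)) < \<infinity>"
    using p summable_mult[OF summable_geometric[of p], of p]
    by (subst suminf_ennreal2) (auto simp del: power_Suc simp: power_Suc[symmetric])
  ultimately have proper: "AE w in S. ?Y w \<in> proper_waits"
    by (intro waits_proper[OF Y cube]) simp
  have eq: "pp_of (?Y w) = point_sum UNIV (\<lambda>_. 1) (\<lambda>i. \<Sum>j\<le>i. w j)" for w by (rule pp_of_exp)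
  have AE: "AE w in S. point_sum UNIV (\<lambda>_. 1) (\<lambda>i. \<Sum>j\<le>i. w j) \<in> pp_space"
    using proper
  proof eventually_elim
    case (elim w)
    show ?case using pp_of_space[OF elim] unfolding eq .
  qed
  have meas1: "(\<lambda>w. \<Sum>j\<le>i. w j) \<in> borel_measurable S" for i by measurable
  have meas2: "(\<lambda>w. 1) \<in> measurable S (count_space UNIV)" for i :: nat by simp
  obtain g where g: "g \<in> measurable S pp_borel" "AE w in S. g w = point_sum UNIV (\<lambda>_. 1) (\<lambda>i. \<Sum>j\<le>i. w j)"
    "distr S pp_borel (\<lambda>w. point_sum UNIV (\<lambda>_. 1) (\<lambda>i. \<Sum>j\<le>i. w j)) = distr S pp_borel g"
    using distr_point_sum[where M=S and k="\<lambda>_ _. 1" and T="\<lambda>w i. \<Sum>j\<le>i. w j", OF meas1 meas2 AE] by blast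
  show ?thesis
    unfolding waits_law_def RPP_def
  proof (intro conjI exI[of _ g])
    show "?Y \<in> borel_measurable S" by (rule measurable_seq_borel[OF Y])
    show "AE w in S. g w = pp_of (?Y w)" using g(2) unfolding eq .
    show "prob_space S" by (rule P.prob_space_axioms)
  qed (rule proper g)+
qed

end

text \<open>The points of a \<open>CFPP\<close>, listed with multiplicity, are read off one at a time: as long as the
  current multiplicity is at least \<open>2\<close> the next waiting time is \<open>0\<close>.\<close>

definition cluster_step :: "(nat \<Rightarrow> real) \<times> (nat \<Rightarrow> nat) \<Rightarrow> (nat \<Rightarrow> real) \<times> (nat \<Rightarrow> nat)" where
  "cluster_step = (\<lambda>(w, k). if 2 \<le> k 0 then (w(0 := 0), k(0 := k 0 - 1))
     else (\<lambda>i. w (Suc i), \<lambda>i. k (Suc i)))"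

definition cluster_wait :: "(nat \<Rightarrow> real) \<times> (nat \<Rightarrow> nat) \<Rightarrow> nat \<Rightarrow> real" where
  "cluster_wait p i = fst ((cluster_step ^^ i) p) 0"

section \<open>Compound processes read one point at a time\<close>

lemma cluster_wait_0: "cluster_wait (w, k) 0 = w 0"
  by (simp add: cluster_wait_def)

lemma cluster_wait_Suc: "cluster_wait p (Suc i) = cluster_wait (cluster_step p) i"
  by (simp add: cluster_wait_def funpow_swap1)

lemma cluster_step_pos:
  assumes "\<And>i. 0 \<le> w i" "\<And>i. 1 \<le> k i" "cluster_step (w, k) = (w', k')"
  shows "0 \<le> w' i" "1 \<le> k' i"
  using assms by (auto simp: cluster_step_def split: if_splits)

lemma cluster_wait_nonneg:
  assumes "\<And>i. 0 \<le> w i" "\<And>i. 1 \<le> k i"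
  shows "0 \<le> cluster_wait (w, k) n"
  using assms
proof (induction n arbitrary: w k)
  case 0
  then show ?case by (simp add: cluster_wait_0)
next
  case (Suc n)
  obtain w' k' where s: "cluster_step (w, k) = (w', k')" by fastforce
  show ?case
    unfolding cluster_wait_Suc s by (rule Suc.IH) (use cluster_step_pos[OF Suc.prems s] in auto)
qed

lemma sum_atMost_shift: "(\<Sum>j\<le>Suc i. f j) = f 0 + (\<Sum>j\<le>i. f (Suc j))" for f :: "nat \<Rightarrow> 'a::comm_monoid_add"
  by (rule sum.atMost_Suc_shift)

text \<open>Clusters are finite, so reading points one by one reaches every arrival time. The inner
  induction exhausts the current cluster, the outer one moves to the next.\<close>

lemma cluster_wait_reaches:
  assumes "\<And>i. 1 \<le> k i"
  shows "\<exists>n. (\<Sum>j\<le>n. cluster_wait (w, k) j) = (\<Sum>j\<le>i. w j)"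
  using assms
proof (induction i arbitrary: w k)
  case 0
  show ?case by (rule exI[of _ 0]) (simp add: cluster_wait_0)
next
  case (Suc i)
  show ?case using Suc.prems
  proof (induction "k 0" arbitrary: w k)
    case 0
    then show ?case by (metis not_one_le_zero)
  next
    case (Suc m)
    show ?case
    proof (cases "2 \<le> k 0")
      case True
      let ?w = "w(0 := 0)" and ?k = "k(0 := k 0 - 1)"
      have "\<exists>n. (\<Sum>j\<le>n. cluster_wait (?w, ?k) j) = (\<Sum>j\<le>Suc i. ?w j)"
        by (rule Suc.hyps(1)) (use Suc.hyps(2) Suc.prems True in auto)
      then obtain n where n: "(\<Sum>j\<le>n. cluster_wait (?w, ?k) j) = (\<Sum>j\<le>Suc i. ?w j)" by blast
      have s: "cluster_step (w, k) = (?w, ?k)" using True by (simp add: cluster_step_def)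
      show ?thesis
        by (rule exI[of _ "Suc n"])
           (use n in \<open>simp add: sum_atMost_shift cluster_wait_0 cluster_wait_Suc s del: sum.atMost_Suc\<close>)
    next
      case False
      let ?w = "\<lambda>i. w (Suc i)" and ?k = "\<lambda>i. k (Suc i)"
      obtain n where n: "(\<Sum>j\<le>n. cluster_wait (?w, ?k) j) = (\<Sum>j\<le>i. ?w j)"
        using \<open>\<And>w k. (\<And>i. 1 \<le> k i) \<Longrightarrow> \<exists>n. (\<Sum>j\<le>n. cluster_wait (w, k) j) = (\<Sum>j\<le>i. w j)\<close>[of ?k ?w] Suc.prems by auto
      have s: "cluster_step (w, k) = (?w, ?k)" using False by (simp add: cluster_step_def)
      show ?thesis
        by (rule exI[of _ "Suc n"])
           (use n in \<open>simp add: sum_atMost_shift cluster_wait_0 cluster_wait_Suc s del: sum.atMost_Suc\<close>)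
    qed
  qed
qed

lemma suminf_split_first: "(\<Sum>i. f i) = f 0 + (\<Sum>i. f (Suc i))" for f :: "nat \<Rightarrow> ennreal"
  using suminf_offset[of f 1] by simp

text \<open>One step removes exactly one unit of mass. The offset c records the elapsed time: inside
  a cluster the new first wait is 0, so the remaining points keep their locations.\<close>

lemma cluster_sum_step:
  fixes g :: "real \<Rightarrow> ennreal"
  assumes k: "\<And>i. 1 \<le> k i" and s: "cluster_step (w, k) = (w', k')"
  shows "(\<Sum>i. of_nat (k i) * g (c + (\<Sum>j\<le>i. w j)))
    = g (c + w 0) + (\<Sum>i. of_nat (k' i) * g (c + w 0 + (\<Sum>j\<le>i. w' j)))"
proof (cases "2 \<le> k 0")
  case True
  have w': "w' = w(0 := 0)" and k': "k' = k(0 := k 0 - 1)" using s True by (auto simp: cluster_step_def)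
  obtain m where m: "k 0 = Suc m" using k[of 0] by (cases "k 0") auto
  have shift: "c + (w 0 + (\<Sum>j\<le>i. w (Suc j))) = c + w 0 + (0 + (\<Sum>j\<le>i. w (Suc j)))" for i by simp
  show ?thesis
    unfolding w' k'
    by (subst (1 2) suminf_split_first)
       (simp add: m sum_atMost_shift add.assoc distrib_right del: sum.atMost_Suc)
next
  case False
  then have k0: "k 0 = 1" using k[of 0] by simp
  have w': "w' = (\<lambda>i. w (Suc i))" and k': "k' = (\<lambda>i. k (Suc i))" using s False by (auto simp: cluster_step_def)
  show ?thesis
    unfolding w' k'
    by (subst suminf_split_first) (simp add: k0 sum_atMost_shift add.assoc del: sum.atMost_Suc)
qed

lemma cluster_sum_steps:
  fixes g :: "real \<Rightarrow> ennreal"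
  assumes "\<And>i. 0 \<le> w i" "\<And>i. 1 \<le> k i"
  shows "\<exists>w' k'. (\<forall>i. 0 \<le> w' i) \<and> (\<forall>i. 1 \<le> k' i) \<and>
    (\<Sum>i. of_nat (k i) * g (c + (\<Sum>j\<le>i. w j)))
    = (\<Sum>m\<le>n. g (c + (\<Sum>j\<le>m. cluster_wait (w, k) j)))
      + (\<Sum>i. of_nat (k' i) * g (c + (\<Sum>j\<le>n. cluster_wait (w, k) j) + (\<Sum>j\<le>i. w' j)))"
  using assms
proof (induction n arbitrary: w k c)
  case 0
  obtain w' k' where s: "cluster_step (w, k) = (w', k')" by fastforce
  show ?case
    using cluster_step_pos[OF 0 s] cluster_sum_step[OF 0(2) s, of g c]
    by (intro exI[of _ w'] exI[of _ k']) (auto simp: cluster_wait_0)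
next
  case (Suc n)
  obtain w1 k1 where s: "cluster_step (w, k) = (w1, k1)" by fastforce
  obtain w' k' where IH: "\<forall>i. 0 \<le> w' i" "\<forall>i. 1 \<le> k' i"
    "(\<Sum>i. of_nat (k1 i) * g (c + w 0 + (\<Sum>j\<le>i. w1 j)))
    = (\<Sum>m\<le>n. g (c + w 0 + (\<Sum>j\<le>m. cluster_wait (w1, k1) j)))
      + (\<Sum>i. of_nat (k' i) * g (c + w 0 + (\<Sum>j\<le>n. cluster_wait (w1, k1) j) + (\<Sum>j\<le>i. w' j)))"
    using Suc.IH[of w1 k1 "c + w 0"] cluster_step_pos[OF Suc.prems s] by blast
  show ?case
    using IH cluster_sum_step[OF Suc.prems(2) s, of g c]
    by (intro exI[of _ w'] exI[of _ k'])
       (simp add: sum_atMost_shift cluster_wait_0 cluster_wait_Suc s add.assoc del: sum.atMost_Suc)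
qed

text \<open>Both sides are compared on bounded sets first. Once the reading has passed r, what is
  left of either process lies beyond r, and \<open>cluster_sum_steps\<close> identifies the finite
  parts; monotone limits in r remove the bound.\<close>

lemma cluster_point_sum:
  assumes w: "\<And>i. 0 \<le> w i" and k: "\<And>i. 1 \<le> k i"
    and lim: "filterlim (\<lambda>i. \<Sum>j\<le>i. w j) at_top sequentially"
  shows "point_sum UNIV k (\<lambda>i. \<Sum>j\<le>i. w j) = point_sum UNIV (\<lambda>_. 1) (\<lambda>i. \<Sum>j\<le>i. cluster_wait (w, k) j)"
    (is "?L = ?R")
proof -
  have "emeasure ?L B = emeasure ?R B" if B: "B \<in> sets half_line" for B
  proof -
    have bdd: "emeasure ?L (B \<inter> {0..real r}) = emeasure ?R (B \<inter> {0..real r})" for r :: nat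
    proof -
      let ?g = "indicator (B \<inter> {0..real r}) :: real \<Rightarrow> ennreal"
      let ?t = "\<lambda>m. \<Sum>j\<le>m. cluster_wait (w, k) j"
      have B': "B \<inter> {0..real r} \<in> sets half_line" using B interval_in_half_line by auto
      obtain i where i: "real r < (\<Sum>j\<le>i. w j)"
        using lim by (auto simp: filterlim_at_top_dense eventually_sequentially)
      obtain n where n: "?t n = (\<Sum>j\<le>i. w j)" using cluster_wait_reaches[of k w i] k by blast
      obtain w' k' where w': "\<forall>i. 0 \<le> w' i"
        "(\<Sum>i. of_nat (k i) * ?g (0 + (\<Sum>j\<le>i. w j)))
          = (\<Sum>m\<le>n. ?g (0 + ?t m)) + (\<Sum>i. of_nat (k' i) * ?g (0 + ?t n + (\<Sum>j\<le>i. w' j)))"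
        using cluster_sum_steps[where w=w and k=k and g="?g" and c=0 and n=n, OF w k] by blast
      have "?g (0 + ?t n + (\<Sum>j\<le>i. w' j)) = 0" for i
        using n \<open>real r < _\<close> sum_nonneg[of "{..i}" w'] w'(1) by (auto simp: indicator_def)
      then have eq: "(\<Sum>i. of_nat (k i) * ?g (\<Sum>j\<le>i. w j)) = (\<Sum>m\<le>n. ?g (?t m))" using w'(2) by simp
      have "?g (?t m) = 0" if "n < m" for m
      proof -
        have "?t n \<le> ?t m"
          using that cluster_wait_nonneg[of w k] w k by (intro sum_mono2) auto
        then show ?thesis using n \<open>real r < _\<close> by (auto simp: indicator_def)
      qed
      then have "(\<Sum>m. ?g (?t m)) = (\<Sum>m\<le>n. ?g (?t m))" by (intro suminf_finite) auto
      then show ?thesis using eq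
        by (simp add: emeasure_point_sum'[OF B'] nn_integral_count_space_nat)
    qed
    have "B \<subseteq> {0..}" using sets.sets_into_space[OF B] by (auto simp: half_line_def space_restrict_space)
    then have un: "B = (\<Union>r::nat. B \<inter> {0..real r})" using real_arch_simple by fastforce
    have inc: "incseq (\<lambda>r::nat. B \<inter> {0..real r})" by (auto simp: incseq_def)
    have rng: "range (\<lambda>r::nat. B \<inter> {0..real r}) \<subseteq> sets half_line" using B interval_in_half_line by auto
    have "emeasure ?L B = (SUP r::nat. emeasure ?L (B \<inter> {0..real r}))"
      using SUP_emeasure_incseq[of "\<lambda>r::nat. B \<inter> {0..real r}" ?L] rng inc un by simp
    also have "\<dots> = (SUP r::nat. emeasure ?R (B \<inter> {0..real r}))" unfolding bdd ..
    also have "\<dots> = emeasure ?R B"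
      using SUP_emeasure_incseq[of "\<lambda>r::nat. B \<inter> {0..real r}" ?R] rng inc un by simp
    finally show ?thesis .
  qed
  then show ?thesis by (intro measure_eqI) auto
qed


text \<open>The lack of memory of the geometric law, obtained by conditioning on the first
  trial.\<close>

lemma Geo_nn_integral:
  assumes "0 < \<theta>" "\<theta> \<le> 1"
  shows "(\<integral>\<^sup>+j. f j \<partial>measure_pmf (Geo \<theta>))
    = ennreal \<theta> * f 1 + ennreal (1 - \<theta>) * (\<integral>\<^sup>+j. f (Suc j) \<partial>measure_pmf (Geo \<theta>))"
proof -
  let ?g = "geometric_pmf \<theta>"
  have "(\<integral>\<^sup>+j. f j \<partial>measure_pmf (Geo \<theta>)) = (\<integral>\<^sup>+n. f (Suc n) \<partial>measure_pmf ?g)"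
    by (simp add: Geo_def)
  also have "\<dots> = (\<integral>\<^sup>+b. (if b then f 1 else \<integral>\<^sup>+n. f (Suc (Suc n)) \<partial>measure_pmf ?g) \<partial>measure_pmf (bernoulli_pmf \<theta>))"
    using assms by (subst geometric_bind_pmf_unfold) (auto simp: nn_integral_bind_pmf intro!: nn_integral_cong)
  also have "\<dots> = ennreal \<theta> * f 1 + ennreal (1 - \<theta>) * (\<integral>\<^sup>+n. f (Suc (Suc n)) \<partial>measure_pmf ?g)"
    using assms by (simp add: nn_integral_bernoulli_pmf mult.commute)
  also have "(\<integral>\<^sup>+n. f (Suc (Suc n)) \<partial>measure_pmf ?g) = (\<integral>\<^sup>+j. f (Suc j) \<partial>measure_pmf (Geo \<theta>))"
    by (simp add: Geo_def)
  finally show ?thesis .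
qed

lemma Geo_pos: "AE j in measure_pmf (Geo \<theta>). 1 \<le> j"
  by (auto simp: Geo_def AE_measure_pmf_iff)

context
  fixes H :: "real measure" and \<theta> :: real
  assumes H: "prob_space H" "sets H = sets borel" "AE x in H. 0 \<le> x"
    and \<theta>: "0 < \<theta>" "\<theta> \<le> 1"
begin

interpretation H: sequence_space H
  by (rule sequence_space.intro) (use H(1) in \<open>simp add: product_prob_spaceI\<close>)

interpretation G: sequence_space "measure_pmf (Geo \<theta>)"
  by (rule sequence_space.intro) (simp add: product_prob_spaceI measure_pmf.prob_space_axioms)

abbreviation "HS \<equiv> Pi\<^sub>M (UNIV :: nat set) (\<lambda>_. H)"
abbreviation "GS \<equiv> Pi\<^sub>M (UNIV :: nat set) (\<lambda>_. measure_pmf (Geo \<theta>))"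

interpretation HG: pair_prob_space HS GS by standard

lemma space_H: "space H = UNIV" using sets_eq_imp_space_eq[OF H(2)] by simp

lemma borel_measurable_H: "f \<in> borel_measurable borel \<Longrightarrow> f \<in> borel_measurable H"
  unfolding measurable_cong_sets[OF H(2) refl] .

lemma fst_coord [measurable]: "(\<lambda>p. fst p i) \<in> borel_measurable (HS \<Otimes>\<^sub>M GS)"
proof -
  have "(\<lambda>w. w i) \<in> measurable HS H" by simp
  then have "(\<lambda>w. w i) \<in> borel_measurable HS" unfolding measurable_cong_sets[OF refl H(2)] .
  then show ?thesis by (rule measurable_compose[OF measurable_fst])
qed

lemma snd_coord [measurable]: "(\<lambda>p. snd p i) \<in> measurable (HS \<Otimes>\<^sub>M GS) (count_space UNIV)"
proof -
  have "(\<lambda>k. k i) \<in> measurable GS (measure_pmf (Geo \<theta>))" by simp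
  then have "(\<lambda>k. k i) \<in> measurable GS (count_space UNIV)" by simp
  then show ?thesis by (rule measurable_compose[OF measurable_snd])
qed

lemma cluster_step_measurable [measurable]: "cluster_step \<in> measurable (HS \<Otimes>\<^sub>M GS) (HS \<Otimes>\<^sub>M GS)"
proof -
  have 1: "(\<lambda>p i. if 2 \<le> snd p 0 then (if i = 0 then 0 else fst p i) else fst p (Suc i)) \<in> measurable (HS \<Otimes>\<^sub>M GS) HS"
  proof (rule measurable_abs_UNIV)
    fix i
    have "(\<lambda>p. if 2 \<le> snd p 0 then (if i = 0 then 0 else fst p i) else fst p (Suc i)) \<in> borel_measurable (HS \<Otimes>\<^sub>M GS)"
      by measurable
    then show "(\<lambda>p. if 2 \<le> snd p 0 then (if i = 0 then 0 else fst p i) else fst p (Suc i)) \<in> measurable (HS \<Otimes>\<^sub>M GS) H"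
      unfolding measurable_cong_sets[OF refl H(2)] .
  qed
  have 2: "(\<lambda>p i. if 2 \<le> snd p 0 then (if i = 0 then snd p 0 - 1 else snd p i) else snd p (Suc i)) \<in> measurable (HS \<Otimes>\<^sub>M GS) GS"
  proof (rule measurable_abs_UNIV)
    fix i
    have "(\<lambda>p. if 2 \<le> snd p 0 then (if i = 0 then snd p 0 - 1 else snd p i) else snd p (Suc i)) \<in> measurable (HS \<Otimes>\<^sub>M GS) (count_space UNIV)"
      by measurable
    then show "(\<lambda>p. if 2 \<le> snd p 0 then (if i = 0 then snd p 0 - 1 else snd p i) else snd p (Suc i)) \<in> measurable (HS \<Otimes>\<^sub>M GS) (measure_pmf (Geo \<theta>))"
      by simp
  qed
  have "cluster_step = (\<lambda>p. (\<lambda>i. if 2 \<le> snd p 0 then (if i = 0 then 0 else fst p i) else fst p (Suc i),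
      \<lambda>i. if 2 \<le> snd p 0 then (if i = 0 then snd p 0 - 1 else snd p i) else snd p (Suc i)))"
    by (auto simp: cluster_step_def fun_eq_iff split_beta)
  then show ?thesis using measurable_Pair[OF 1 2] by simp
qed

lemma cluster_wait_measurable [measurable]: "(\<lambda>p. cluster_wait p i) \<in> borel_measurable (HS \<Otimes>\<^sub>M GS)"
proof (induction i)
  case 0
  have "(\<lambda>p. cluster_wait p 0) = (\<lambda>p. fst p 0)" by (auto simp: cluster_wait_def)
  then show ?case by simp
next
  case (Suc i)
  then show ?case unfolding cluster_wait_Suc by measurable
qed

definition cluster_exp :: "nat \<Rightarrow> (nat \<Rightarrow> real) \<Rightarrow> (nat \<Rightarrow> real) \<times> (nat \<Rightarrow> nat) \<Rightarrow> ennreal" where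
  "cluster_exp K s p = (\<Prod>i<K. ennreal (exp (- s i * cluster_wait p i)))"

lemma cluster_exp_measurable [measurable]: "cluster_exp K s \<in> borel_measurable (HS \<Otimes>\<^sub>M GS)"
  unfolding cluster_exp_def by measurable

lemma cluster_exp_Suc:
  "cluster_exp (Suc K) s p = ennreal (exp (- s 0 * fst p 0)) * cluster_exp K (\<lambda>i. s (Suc i)) (cluster_step p)"
  unfolding cluster_exp_def prod.lessThan_Suc_shift cluster_wait_Suc by (simp add: cluster_wait_def)

lemma case_nat_measurable [measurable]:
  "x \<in> space H \<Longrightarrow> (\<lambda>p. (case_nat x (fst p), snd p)) \<in> measurable (HS \<Otimes>\<^sub>M GS) (HS \<Otimes>\<^sub>M GS)"
  "(\<lambda>p. (fst p, case_nat j (snd p))) \<in> measurable (HS \<Otimes>\<^sub>M GS) (HS \<Otimes>\<^sub>M GS)"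
  by measurable

lemma nn_integral_first_wait:
  assumes f [measurable]: "f \<in> borel_measurable (HS \<Otimes>\<^sub>M GS)"
  shows "(\<integral>\<^sup>+p. f p \<partial>(HS \<Otimes>\<^sub>M GS)) = (\<integral>\<^sup>+x. \<integral>\<^sup>+p. f (case_nat x (fst p), snd p) \<partial>(HS \<Otimes>\<^sub>M GS) \<partial>H)"
proof -
  have "(\<integral>\<^sup>+p. f p \<partial>(HS \<Otimes>\<^sub>M GS)) = (\<integral>\<^sup>+w. \<integral>\<^sup>+k. f (w, k) \<partial>GS \<partial>HS)"
    by (rule G.P.nn_integral_fst[symmetric]) measurable
  also have "\<dots> = (\<integral>\<^sup>+x. \<integral>\<^sup>+w. \<integral>\<^sup>+k. f (case_nat x w, k) \<partial>GS \<partial>HS \<partial>H)"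
    by (rule H.nn_integral_iter) measurable
  also have "\<dots> = (\<integral>\<^sup>+x. \<integral>\<^sup>+p. f (case_nat x (fst p), snd p) \<partial>(HS \<Otimes>\<^sub>M GS) \<partial>H)"
  proof (intro nn_integral_cong)
    fix x assume "x \<in> space H"
    then have "(\<lambda>p. f (case_nat x (fst p), snd p)) \<in> borel_measurable (HS \<Otimes>\<^sub>M GS)"
      using measurable_compose[OF case_nat_measurable(1) f] by blast
    from G.P.nn_integral_fst[OF this]
    show "(\<integral>\<^sup>+w. \<integral>\<^sup>+k. f (case_nat x w, k) \<partial>GS \<partial>HS) = (\<integral>\<^sup>+p. f (case_nat x (fst p), snd p) \<partial>(HS \<Otimes>\<^sub>M GS))"
      by simp
  qed
  finally show ?thesis .
qed

lemma nn_integral_first_size: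
  assumes f [measurable]: "f \<in> borel_measurable (HS \<Otimes>\<^sub>M GS)"
  shows "(\<integral>\<^sup>+p. f p \<partial>(HS \<Otimes>\<^sub>M GS))
    = (\<integral>\<^sup>+j. \<integral>\<^sup>+p. f (fst p, case_nat j (snd p)) \<partial>(HS \<Otimes>\<^sub>M GS) \<partial>measure_pmf (Geo \<theta>))"
proof -
  have "(\<integral>\<^sup>+p. f p \<partial>(HS \<Otimes>\<^sub>M GS)) = (\<integral>\<^sup>+k. \<integral>\<^sup>+w. f (w, k) \<partial>HS \<partial>GS)"
    by (rule HG.nn_integral_snd[symmetric]) measurable
  also have "\<dots> = (\<integral>\<^sup>+j. \<integral>\<^sup>+k. \<integral>\<^sup>+w. f (w, case_nat j k) \<partial>HS \<partial>GS \<partial>measure_pmf (Geo \<theta>))"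
    by (rule G.nn_integral_iter) measurable
  also have "\<dots> = (\<integral>\<^sup>+j. \<integral>\<^sup>+p. f (fst p, case_nat j (snd p)) \<partial>(HS \<Otimes>\<^sub>M GS) \<partial>measure_pmf (Geo \<theta>))"
  proof (intro nn_integral_cong)
    fix j
    have "(\<lambda>p. f (fst p, case_nat j (snd p))) \<in> borel_measurable (HS \<Otimes>\<^sub>M GS)"
      using measurable_compose[OF case_nat_measurable(2) f] .
    from HG.nn_integral_snd[OF this]
    show "(\<integral>\<^sup>+k. \<integral>\<^sup>+w. f (w, case_nat j k) \<partial>HS \<partial>GS) = (\<integral>\<^sup>+p. f (fst p, case_nat j (snd p)) \<partial>(HS \<Otimes>\<^sub>M GS))"
      by simp
  qed
  finally show ?thesis .
qed

definition laplace_H :: "real \<Rightarrow> ennreal" where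
  "laplace_H s = (\<integral>\<^sup>+x. ennreal (exp (- s * x)) \<partial>H)"

text \<open>The expectation of what follows the first point. The first waiting time has then been
  consumed and has no further influence (\<open>cluster_step_case'\<close>), so a dummy 0 stands in
  its place.\<close>

definition cluster_tail :: "nat \<Rightarrow> (nat \<Rightarrow> real) \<Rightarrow> ennreal" where
  "cluster_tail K s = (\<integral>\<^sup>+p. cluster_exp K s (cluster_step (case_nat 0 (fst p), snd p)) \<partial>(HS \<Otimes>\<^sub>M GS))"

lemma cluster_step_case: "cluster_step (case_nat x w, case_nat j k)
   = (if 2 \<le> j then (case_nat 0 w, case_nat (j - 1) k) else (w, k))"
  by (auto simp: cluster_step_def fun_eq_iff split: nat.split)

lemma cluster_step_case': "cluster_step (case_nat x w, k) = cluster_step (case_nat 0 w, k)"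
  by (auto simp: cluster_step_def fun_eq_iff split: nat.split)

lemma nn_cluster_exp_Suc:
  "(\<integral>\<^sup>+p. cluster_exp (Suc K) s p \<partial>(HS \<Otimes>\<^sub>M GS)) = laplace_H (s 0) * cluster_tail K (\<lambda>i. s (Suc i))"
proof -
  let ?s = "\<lambda>i. s (Suc i)"
  let ?f = "\<lambda>p. cluster_exp K ?s (cluster_step (case_nat 0 (fst p), snd p))"
  have f: "?f \<in> borel_measurable (HS \<Otimes>\<^sub>M GS)"
    by (rule measurable_compose[OF case_nat_measurable(1) measurable_compose[OF cluster_step_measurable cluster_exp_measurable]])
       (simp add: space_H)
  have "(\<integral>\<^sup>+p. cluster_exp (Suc K) s p \<partial>(HS \<Otimes>\<^sub>M GS))
    = (\<integral>\<^sup>+x. \<integral>\<^sup>+p. cluster_exp (Suc K) s (case_nat x (fst p), snd p) \<partial>(HS \<Otimes>\<^sub>M GS) \<partial>H)"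
    by (rule nn_integral_first_wait[OF cluster_exp_measurable])
  also have "\<dots> = (\<integral>\<^sup>+x. \<integral>\<^sup>+p. ennreal (exp (- s 0 * x)) * ?f p \<partial>(HS \<Otimes>\<^sub>M GS) \<partial>H)"
  proof (intro nn_integral_cong)
    fix x :: real and p :: "(nat \<Rightarrow> real) \<times> (nat \<Rightarrow> nat)"
    show "cluster_exp (Suc K) s (case_nat x (fst p), snd p) = ennreal (exp (- s 0 * x)) * ?f p"
      unfolding cluster_exp_Suc cluster_step_case'[of x] by simp
  qed
  also have "\<dots> = (\<integral>\<^sup>+x. ennreal (exp (- s 0 * x)) * cluster_tail K ?s \<partial>H)"
    unfolding cluster_tail_def by (simp only: nn_integral_cmult[OF f])
  also have "\<dots> = laplace_H (s 0) * cluster_tail K ?s"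
    unfolding laplace_H_def by (rule nn_integral_multc, rule borel_measurable_H) measurable
  finally show ?thesis .
qed

text \<open>Conditioning on the current multiplicity: with probability \<theta> the cluster ends and
  a fresh wait of law \<open>H\<close> begins; otherwise the next wait is 0 and the remaining
  multiplicity is again geometric. Hence every wait after the first is an independent mixture with
  weight 1 - \<theta> at 0.\<close>

lemma cluster_tail_Suc:
  "cluster_tail (Suc K) s = (ennreal (1 - \<theta>) + ennreal \<theta> * laplace_H (s 0)) * cluster_tail K (\<lambda>i. s (Suc i))"
proof -
  let ?s = "\<lambda>i. s (Suc i)"
  let ?f = "\<lambda>p. cluster_exp (Suc K) s (cluster_step (case_nat 0 (fst p), snd p))"
  let ?g = "\<lambda>p. cluster_exp (Suc K) s (case_nat 0 (fst p), snd p)"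
  have f: "?f \<in> borel_measurable (HS \<Otimes>\<^sub>M GS)"
    by (rule measurable_compose[OF case_nat_measurable(1) measurable_compose[OF cluster_step_measurable cluster_exp_measurable]])
       (simp add: space_H)
  have g: "?g \<in> borel_measurable (HS \<Otimes>\<^sub>M GS)"
    by (rule measurable_compose[OF case_nat_measurable(1) cluster_exp_measurable]) (simp add: space_H)
  have "cluster_tail (Suc K) s
    = (\<integral>\<^sup>+j. \<integral>\<^sup>+p. ?f (fst p, case_nat j (snd p)) \<partial>(HS \<Otimes>\<^sub>M GS) \<partial>measure_pmf (Geo \<theta>))"
    unfolding cluster_tail_def by (rule nn_integral_first_size[OF f])
  also have "\<dots> = ennreal \<theta> * (\<integral>\<^sup>+p. cluster_exp (Suc K) s p \<partial>(HS \<Otimes>\<^sub>M GS))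
     + ennreal (1 - \<theta>) * (\<integral>\<^sup>+j. \<integral>\<^sup>+p. ?f (fst p, case_nat (Suc j) (snd p)) \<partial>(HS \<Otimes>\<^sub>M GS) \<partial>measure_pmf (Geo \<theta>))"
    by (subst Geo_nn_integral[OF \<theta>]) (simp add: cluster_step_case)
  also have "(\<integral>\<^sup>+j. \<integral>\<^sup>+p. ?f (fst p, case_nat (Suc j) (snd p)) \<partial>(HS \<Otimes>\<^sub>M GS) \<partial>measure_pmf (Geo \<theta>))
     = (\<integral>\<^sup>+j. \<integral>\<^sup>+p. ?g (fst p, case_nat j (snd p)) \<partial>(HS \<Otimes>\<^sub>M GS) \<partial>measure_pmf (Geo \<theta>))"
    by (rule nn_integral_cong_AE) (auto simp: cluster_step_case AE_measure_pmf_iff Geo_def)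
  also have "\<dots> = (\<integral>\<^sup>+p. ?g p \<partial>(HS \<Otimes>\<^sub>M GS))"
    by (rule nn_integral_first_size[OF g, symmetric])
  also have "\<dots> = cluster_tail K ?s"
    unfolding cluster_exp_Suc cluster_tail_def by simp
  finally show ?thesis
    unfolding nn_cluster_exp_Suc by (simp add: distrib_right mult.assoc add.commute)
qed

lemma cluster_tail_eq:
  "cluster_tail K s = (\<Prod>i<K. ennreal (1 - \<theta>) + ennreal \<theta> * laplace_H (s i))"
proof (induction K arbitrary: s)
  case 0
  show ?case by (simp add: cluster_tail_def cluster_exp_def HG.P.emeasure_space_1)
next
  case (Suc K)
  show ?case unfolding cluster_tail_Suc Suc.IH prod.lessThan_Suc_shift ..
qed

lemma CFPP_moments:
  "(\<integral>p. (\<Prod>i<Suc K. exp (- cluster_wait p i) ^ m i) \<partial>(HS \<Otimes>\<^sub>M GS))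
    = (\<integral>x. exp (- real (m 0) * x) \<partial>H) * (\<Prod>i<K. 1 - \<theta> + \<theta> * (\<integral>x. exp (- real (m (Suc i)) * x) \<partial>H))"
proof -
  define h where "h s = (\<integral>x. exp (- s * x) \<partial>H)" for s
  have h: "0 \<le> h s" for s by (simp add: h_def)
  have lh: "laplace_H (real n) = ennreal (h (real n))" for n
    unfolding laplace_H_def h_def by (rule laplace_nn[OF H]) simp
  have "(\<integral>\<^sup>+p. ennreal (\<Prod>i<Suc K. exp (- cluster_wait p i) ^ m i) \<partial>(HS \<Otimes>\<^sub>M GS))
    = (\<integral>\<^sup>+p. cluster_exp (Suc K) (\<lambda>i. real (m i)) p \<partial>(HS \<Otimes>\<^sub>M GS))"
    unfolding prod_exp_power cluster_exp_def by (intro nn_integral_cong prod_ennreal[symmetric]) simp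
  also have "\<dots> = ennreal (h (m 0)) * (\<Prod>i<K. ennreal (1 - \<theta> + \<theta> * h (m (Suc i))))"
    using \<theta> h unfolding nn_cluster_exp_Suc cluster_tail_eq lh by (simp add: ennreal_mult ennreal_plus)
  also have "\<dots> = ennreal (h (m 0) * (\<Prod>i<K. 1 - \<theta> + \<theta> * h (m (Suc i))))"
    using \<theta> h by (subst prod_ennreal) (auto simp: ennreal_mult prod_nonneg)
  finally show ?thesis
    unfolding h_def[symmetric] using \<theta> h
    by (intro integral_eq_nn_integral[THEN trans]) (auto simp: prod_nonneg simp del: prod.lessThan_Suc)
qed

text \<open>The divergence of the uncompounded arrival times, taken from
  \<open>waits_law_RPP\<close>, is what permits the rewriting by \<open>cluster_point_sum\<close>;
  the encoded cluster waits have to be shown proper separately.\<close>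

lemma waits_law_CFPP:
  assumes less: "(\<integral>x. exp (- x) \<partial>H) < 1"
  shows "waits_law (distr (HS \<Otimes>\<^sub>M GS) pp_borel (\<lambda>(w, k). point_sum UNIV k (\<lambda>i. \<Sum>j\<le>i. w j)))
    (HS \<Otimes>\<^sub>M GS) (\<lambda>p i. exp (- cluster_wait p i))"
proof -
  let ?Q = "HS \<Otimes>\<^sub>M GS" and ?Y = "\<lambda>p i. exp (- cluster_wait p i)"
  have "AE p in ?Q. 0 \<le> fst p i" for i
  proof (rule HG.AE_pair_measure)
    show "{p \<in> space ?Q. 0 \<le> fst p i} \<in> sets ?Q" by measurable
    have "AE w in HS. 0 \<le> w i" by (rule AE_PiM_component[where M="\<lambda>_. H" and P="\<lambda>x. 0 \<le> x"]) (rule H UNIV_I)+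
    then show "AE w in HS. AE k in GS. 0 \<le> fst (w, k) i" by simp
  qed
  then have pos: "AE p in ?Q. \<forall>i. 0 \<le> fst p i" by (simp add: AE_all_countable)
  have "AE p in ?Q. 1 \<le> snd p i" for i
  proof (rule HG.AE_pair_measure)
    show "{p \<in> space ?Q. 1 \<le> snd p i} \<in> sets ?Q" by measurable
    have "AE k in GS. 1 \<le> k i"
      by (rule AE_PiM_component[where M="\<lambda>_. measure_pmf (Geo \<theta>)" and P="\<lambda>j. 1 \<le> j"])
         (rule measure_pmf.prob_space_axioms UNIV_I Geo_pos)+
    then show "AE w in HS. AE k in GS. 1 \<le> snd (w, k) i" by simp
  qed
  then have size: "AE p in ?Q. \<forall>i. 1 \<le> snd p i" by (simp add: AE_all_countable)
  have inf: "AE p in ?Q. (\<lambda>i. exp (- fst p i)) \<in> proper_waits"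
  proof (rule AE_distrD[OF measurable_fst])
    have "AE w in HS. (\<lambda>i. exp (- w i)) \<in> proper_waits"
      using waits_law_RPP[OF H less] unfolding waits_law_def by (elim conjE)
    then show "AE w in distr ?Q HS fst. (\<lambda>i. exp (- w i)) \<in> proper_waits"
      unfolding G.P.distr_pair_fst .
  qed
  have lim: "filterlim (\<lambda>i. \<Sum>j\<le>i. w j) at_top sequentially"
    if "(\<lambda>i. exp (- w i)) \<in> proper_waits" for w :: "nat \<Rightarrow> real"
  proof -
    have "(\<lambda>i. exp (- (\<Sum>j\<le>i. w j))) \<longlonglongrightarrow> 0"
      using that by (simp add: proper_waits_def exp_sum sum_negf[symmetric])
    then have "\<forall>\<^sub>F i in sequentially. exp (- (\<Sum>j\<le>i. w j)) < exp (- Z)" for Z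
      by (rule order_tendstoD(2)) simp
    then show ?thesis unfolding filterlim_at_top_dense by simp
  qed
  have eq: "AE p in ?Q. point_sum UNIV (snd p) (\<lambda>i. \<Sum>j\<le>i. fst p j) = pp_of (?Y p)"
    using pos size inf
  proof eventually_elim
    case (elim p)
    show ?case
      using cluster_point_sum[of "fst p" "snd p"] elim lim[OF elim(3)] unfolding pp_of_exp by simp
  qed
  have cube: "AE p in ?Q. ?Y p \<in> unit_cube"
    using pos size
  proof eventually_elim
    case (elim p)
    show ?case using cluster_wait_nonneg[of "fst p" "snd p"] elim by (simp add: unit_cube_def)
  qed
  have meas: "(\<lambda>p. ?Y p i) \<in> borel_measurable ?Q" for i by measurable
  define c where "c = (\<integral>x. exp (- x) \<partial>H)"
  \<comment> \<open>The mean of exp (- wait) for each wait after the first. It is below 1 because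
    \<theta> is positive, which makes the expected products geometric.\<close>
  define r where "r = 1 - \<theta> + \<theta> * c"
  have c: "0 \<le> c" "c < 1" using less by (auto simp: c_def)
  have r: "0 \<le> r" "r < 1"
    using c \<theta> mult_strict_left_mono[OF c(2) \<theta>(1)] by (auto simp: r_def)
  have int: "(\<integral>\<^sup>+p. ennreal (\<Prod>j\<le>i. ?Y p j) \<partial>?Q) = ennreal (c * r ^ i)" for i
  proof -
    have lh: "laplace_H 1 = ennreal c"
      unfolding laplace_H_def c_def using laplace_nn[OF H, of 1] by simp
    have "(\<integral>\<^sup>+p. ennreal (\<Prod>j\<le>i. ?Y p j) \<partial>?Q) = (\<integral>\<^sup>+p. cluster_exp (Suc i) (\<lambda>_. 1) p \<partial>?Q)"
      unfolding cluster_exp_def lessThan_Suc_atMost by (intro nn_integral_cong) (simp add: prod_ennreal)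
    also have "\<dots> = ennreal c * ennreal r ^ i"
      using \<theta> c unfolding nn_cluster_exp_Suc cluster_tail_eq lh by (simp add: ennreal_mult ennreal_plus r_def)
    finally show ?thesis using c r by (simp add: ennreal_mult ennreal_power)
  qed
  have proper: "AE p in ?Q. ?Y p \<in> proper_waits"
  proof (rule waits_proper[OF meas cube])
    have "(\<Sum>i. ennreal (c * r ^ i)) < \<infinity>"
      using c r summable_mult[OF summable_geometric[of r], of c] by (subst suminf_ennreal2) auto
    then show "(\<Sum>i. \<integral>\<^sup>+p. ennreal (\<Prod>j\<le>i. ?Y p j) \<partial>?Q) < \<infinity>" unfolding int .
  qed
  have "AE p in ?Q. point_sum UNIV (snd p) (\<lambda>i. \<Sum>j\<le>i. fst p j) \<in> pp_space"
    using proper eq by eventually_elim (simp add: pp_of_space)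
  note ex = distr_point_sum[where M="?Q" and k=snd and T="\<lambda>p i. \<Sum>j\<le>i. fst p j", OF _ snd_coord this]
  have "(\<lambda>p. \<Sum>j\<le>i. fst p j) \<in> borel_measurable ?Q" for i by measurable
  from ex[OF this] obtain g where g: "g \<in> measurable ?Q pp_borel"
    "AE p in ?Q. g p = point_sum UNIV (snd p) (\<lambda>i. \<Sum>j\<le>i. fst p j)"
    "distr ?Q pp_borel (\<lambda>p. point_sum UNIV (snd p) (\<lambda>i. \<Sum>j\<le>i. fst p j)) = distr ?Q pp_borel g"
    by blast
  show ?thesis
    unfolding waits_law_def
  proof (intro conjI exI[of _ g])
    show "prob_space ?Q" by (rule HG.P.prob_space_axioms)
    show "?Y \<in> borel_measurable ?Q" by (rule measurable_seq_borel[OF meas])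
    show "AE p in ?Q. g p = pp_of (?Y p)" using g(2) eq by eventually_elim simp
    show "distr ?Q pp_borel (\<lambda>(w, k). point_sum UNIV k (\<lambda>i. \<Sum>j\<le>i. w j)) = distr ?Q pp_borel g"
      unfolding g(3)[symmetric] split_beta ..
  qed (rule proper g)+
qed

end

section \<open>The return process\<close>

lemma Inf_enat_image_add:
  fixes S :: "enat set"
  assumes "S \<noteq> {}"
  shows "Inf ((+) (enat n) ` S) = enat n + Inf S"
proof (rule antisym)
  have "Inf S \<in> S" using assms by (rule wellorder_InfI[OF ex_in_conv[THEN iffD2, THEN someI_ex]])
  then show "Inf ((+) (enat n) ` S) \<le> enat n + Inf S" by (intro Inf_lower imageI)
  show "enat n + Inf S \<le> Inf ((+) (enat n) ` S)"
    by (rule Inf_greatest) (auto intro!: add_left_mono Inf_lower)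
qed

lemma point_sum_reindex:
  assumes f: "bij_betw f J I" and t: "\<And>i. i \<in> I \<Longrightarrow> 0 \<le> t i" and u: "\<And>j. j \<in> J \<Longrightarrow> u j = t (f j)"
  shows "point_sum I (\<lambda>_. 1) t = point_sum J (\<lambda>_. 1) u"
proof -
  have tm: "t \<in> measurable (count_space I) half_line"
    using t by (auto simp: half_line_def space_restrict_space)
  have fm: "f \<in> measurable (count_space J) (count_space I)" using f by (auto simp: bij_betw_def)
  have "distr (count_space I) half_line t = distr (distr (count_space J) (count_space I) f) half_line t"
    using distr_bij_count_space[OF f] by simp
  also have "\<dots> = distr (count_space J) half_line (t \<circ> f)" by (rule distr_distr[OF tm fm])
  also have "\<dots> = distr (count_space J) half_line u" by (rule distr_cong) (use u in auto)
  finally show ?thesis unfolding point_sum_def by (simp add: density_1)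
qed

context walters_system
begin

text \<open>The i-th coordinate is exp (- g r) for the i-th gap r between hits, counted from 0.
  Later gaps are reached by walking to the next hit without discount, hence the parameter 1; a
  missing hit yields 0, the code of an infinite wait.\<close>

primrec waits :: "(nat \<Rightarrow> 'v) set \<Rightarrow> real \<Rightarrow> nat \<Rightarrow> (nat \<Rightarrow> 'v) \<Rightarrow> real" where
  "waits D g 0 = (\<lambda>y. enn2real (hit_sum D (exp (- g)) (\<lambda>_. 1) y))"
| "waits D g (Suc i) = (\<lambda>y. enn2real (hit_sum D 1 (\<lambda>u. ennreal (waits D g i u)) y))"

lemma waits_measurable [measurable]:
  assumes [measurable]: "D \<in> sets \<nu>"
  shows "waits D g i \<in> borel_measurable \<nu>"
  by (induction i) simp_all

lemma waits_nonneg: "0 \<le> waits D g i y"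
  by (cases i) auto

lemma waits_hit:
  assumes "y \<in> first_hit D n"
  shows "waits D g 0 y = exp (- g * real n)" and "waits D g (Suc i) y = waits D g i ((lshift ^^ n) y)"
  using waits_nonneg by (simp_all add: hit_sum_hit[OF assms] exp_of_nat_mult[symmetric] mult.commute)

lemma waits_no_hit: "(\<And>n. y \<notin> first_hit D n) \<Longrightarrow> waits D g i y = 0"
  by (cases i) (simp_all add: hit_sum_no_hit)

lemma waits_le: "0 \<le> g \<Longrightarrow> waits D g i y \<le> exp (- g)"
proof (induction i arbitrary: y)
  case 0
  show ?case
  proof (cases "\<exists>n. y \<in> first_hit D n")
    case True
    then obtain n where n: "y \<in> first_hit D n" by (rule exE)
    then have "1 \<le> real n" by (auto simp: first_hit_def)
    then have "g * 1 \<le> g * real n" using 0 by (rule mult_left_mono)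
    then show ?thesis unfolding waits_hit(1)[OF n] by simp
  next
    case False
    then have "\<And>n. y \<notin> first_hit D n" by simp
    then have "waits D g 0 y = 0" by (rule waits_no_hit)
    then show ?thesis by (simp del: waits.simps)
  qed
next
  case (Suc i)
  show ?case
  proof (cases "\<exists>n. y \<in> first_hit D n")
    case True
    then obtain n where n: "y \<in> first_hit D n" by (rule exE)
    show ?thesis unfolding waits_hit(2)[OF n] by (rule Suc.IH[OF Suc.prems])
  next
    case False
    then have "\<And>n. y \<notin> first_hit D n" by simp
    then have "waits D g (Suc i) y = 0" by (rule waits_no_hit)
    then show ?thesis by (simp del: waits.simps)
  qed
qed

text \<open>Successive hits are at least one time unit apart, so the products decay geometrically
  for every single point, with no exceptional set.\<close>

lemma waits_proper_waits:
  assumes g: "0 < g"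
  shows "(\<lambda>i. waits D g i y) \<in> proper_waits"
proof -
  have 1: "waits D g i y \<le> 1" for i
  proof -
    have "waits D g i y \<le> exp (- g)" using g by (intro waits_le) simp
    also have "exp (- g) \<le> 1" using g by simp
    finally show ?thesis .
  qed
  have "(\<lambda>i. \<Prod>j\<le>i. waits D g j y) \<longlonglongrightarrow> 0"
  proof (rule tendsto_sandwich)
    show "\<forall>\<^sub>F i in sequentially. 0 \<le> (\<Prod>j\<le>i. waits D g j y)"
      by (intro always_eventually allI prod_nonneg waits_nonneg)
    show "\<forall>\<^sub>F i in sequentially. (\<Prod>j\<le>i. waits D g j y) \<le> exp (- g) ^ Suc i"
    proof (intro always_eventually allI)
      fix i
      have "(\<Prod>j\<le>i. waits D g j y) \<le> (\<Prod>j\<le>i. exp (- g))"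
        by (rule prod_mono) (use waits_nonneg waits_le[of g D _ y] g in simp)
      then show "(\<Prod>j\<le>i. waits D g j y) \<le> exp (- g) ^ Suc i" by simp
    qed
    show "(\<lambda>i. exp (- g) ^ Suc i) \<longlonglongrightarrow> 0"
      by (rule LIMSEQ_Suc[OF LIMSEQ_power_zero]) (use g in simp)
  qed (rule tendsto_const)
  then show ?thesis using 1 waits_nonneg[of D g _ y] unfolding proper_waits_def unit_cube_def by blast
qed

text \<open>The identity includes exponents 0: \<open>hit_prod\<close> vanishes as soon as a hit is
  missing, and correspondingly 0 powr 0 is 0.\<close>

lemma hit_prod_waits:
  "hit_prod D K (\<lambda>i. exp (- s i * g)) y = ennreal (\<Prod>i<K. waits D g i y powr s i)"
proof (induction K arbitrary: s y)
  case (Suc K)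
  show ?case
  proof (cases "\<exists>n. y \<in> first_hit D n")
    case True
    then obtain n where n: "y \<in> first_hit D n" by (rule exE)
    have "hit_prod D (Suc K) (\<lambda>i. exp (- s i * g)) y
        = ennreal (exp (- s 0 * g) ^ n) * ennreal (\<Prod>i<K. waits D g i ((lshift ^^ n) y) powr s (Suc i))"
      by (simp only: hit_prod.simps hit_sum_hit[OF n] Suc.IH)
    also have "\<dots> = ennreal (exp (- s 0 * g) ^ n * (\<Prod>i<K. waits D g (Suc i) y powr s (Suc i)))"
      unfolding waits_hit(2)[OF n] by (subst ennreal_mult) (simp_all add: prod_nonneg)
    also have "exp (- s 0 * g) ^ n = waits D g 0 y powr s 0"
      unfolding waits_hit(1)[OF n] by (simp add: exp_of_nat_mult[symmetric] powr_def mult_ac)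
    finally show ?thesis by (simp only: prod.lessThan_Suc_shift o_def)
  next
    case False
    then have no: "\<And>n. y \<notin> first_hit D n" by simp
    show ?thesis unfolding hit_prod.simps hit_sum_no_hit[OF no] prod.lessThan_Suc_shift waits_no_hit[OF no] by simp
  qed
qed simp

text \<open>Turns the recursion of \<open>return_time\<close>, which appends a return at the end,
  into one that removes the first, as the recursion of \<open>waits\<close> does.\<close>

lemma return_time_hit:
  assumes y: "y \<in> first_hit D n"
  shows "return_time D (Suc k) y = enat n + return_time D k ((lshift ^^ n) y)"
proof (induction k)
  case 0
  have "{enat m |m. (0::enat) < enat m \<and> (lshift ^^ m) y \<in> D} \<noteq> {}" using y by (auto simp: first_hit_def zero_enat_def)
  have "Inf {enat m |m. return_time D 0 y < enat m \<and> (lshift ^^ m) y \<in> D} = enat n"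
  proof (rule antisym)
    show "Inf {enat m |m. return_time D 0 y < enat m \<and> (lshift ^^ m) y \<in> D} \<le> enat n"
      by (rule Inf_lower) (use y in \<open>auto simp: first_hit_def zero_enat_def\<close>)
    show "enat n \<le> Inf {enat m |m. return_time D 0 y < enat m \<and> (lshift ^^ m) y \<in> D}"
    proof (rule Inf_greatest)
      fix e assume "e \<in> {enat m |m. return_time D 0 y < enat m \<and> (lshift ^^ m) y \<in> D}"
      then obtain m where m: "e = enat m" "0 < m" "(lshift ^^ m) y \<in> D" by (auto simp: zero_enat_def)
      then have "\<not> m < n" using y by (auto simp: first_hit_def)
      then show "enat n \<le> e" using m by simp
    qed
  qed
  then show ?case by simp
next
  case (Suc k)
  let ?y = "(lshift ^^ n) y"
  have shift: "(lshift ^^ (n + m)) y = (lshift ^^ m) ?y" for m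
    by (simp add: add.commute[of n m] funpow_add)
  let ?S = "{enat m |m. return_time D k ?y < enat m \<and> (lshift ^^ m) ?y \<in> D}"
  have eq: "{enat m |m. enat n + return_time D k ?y < enat m \<and> (lshift ^^ m) y \<in> D} = (+) (enat n) ` ?S"
  proof (rule set_eqI, rule iffI)
    fix e assume "e \<in> {enat m |m. enat n + return_time D k ?y < enat m \<and> (lshift ^^ m) y \<in> D}"
    then obtain m where m: "e = enat m" "enat n + return_time D k ?y < enat m" "(lshift ^^ m) y \<in> D" by blast
    have "n \<le> m" using m(2) by (cases "return_time D k ?y") auto
    then obtain m' where m': "m = n + m'" by (auto simp: le_iff_add)
    have "return_time D k ?y < enat m'" using m(2) m' by (cases "return_time D k ?y") auto
    then have "enat m' \<in> ?S" using m(3) m' shift by auto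
    then show "e \<in> (+) (enat n) ` ?S" using m(1) m' by (intro image_eqI[of _ _ "enat m'"]) auto
  next
    fix e assume "e \<in> (+) (enat n) ` ?S"
    then obtain m where m: "e = enat n + enat m" "return_time D k ?y < enat m" "(lshift ^^ m) ?y \<in> D" by blast
    then have "enat n + return_time D k ?y < enat (n + m)" by (cases "return_time D k ?y") auto
    then show "e \<in> {enat m |m. enat n + return_time D k ?y < enat m \<and> (lshift ^^ m) y \<in> D}"
      using m shift by auto
  qed
  have "return_time D (Suc (Suc k)) y = Inf ((+) (enat n) ` ?S)"
    unfolding return_time.simps(2)[of D "Suc k" y] Suc.IH eq by (rule refl)
  also have "\<dots> = enat n + Inf ?S"
  proof (cases "?S = {}")
    case True
    then show ?thesis by (simp add: Inf_enat_def)
  next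
    case False
    then show ?thesis by (rule Inf_enat_image_add)
  qed
  finally show ?case by simp
qed

lemma return_time_no_hit:
  assumes y: "y \<in> markov_space A" "\<And>n. y \<notin> first_hit D n"
  shows "return_time D (Suc k) y = \<infinity>"
proof -
  have "{enat m |m. return_time D k y < enat m \<and> (lshift ^^ m) y \<in> D} = {}"
  proof (rule equals0I)
    fix e assume "e \<in> {enat m |m. return_time D k y < enat m \<and> (lshift ^^ m) y \<in> D}"
    then obtain m where m: "return_time D k y < enat m" "(lshift ^^ m) y \<in> D" by blast
    have "0 < m" using m(1) by (cases m) (auto simp: zero_enat_def[symmetric])
    then obtain n where "y \<in> first_hit D n" using first_hit_exists[OF y(1) _ m(2)] by blast
    then show False using y(2) by blast
  qed
  then show ?thesis unfolding return_time.simps by (simp add: Inf_enat_def)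
qed

lemma waits_return_time:
  assumes "y \<in> markov_space A"
  shows "(\<Prod>j\<le>i. waits D g j y) =
    (if return_time D (Suc i) y < \<infinity> then exp (- g * real (the_enat (return_time D (Suc i) y))) else 0)"
  using assms
proof (induction i arbitrary: y)
  case 0
  show ?case
  proof (cases "\<exists>n. y \<in> first_hit D n")
    case True
    then obtain n where n: "y \<in> first_hit D n" by (rule exE)
    show ?thesis unfolding return_time_hit[OF n] using waits_hit(1)[OF n, of g] by simp
  next
    case False
    then have no: "\<And>n. y \<notin> first_hit D n" by simp
    show ?thesis unfolding return_time_no_hit[OF 0 no] using waits_no_hit[OF no, of g 0] by simp
  qed
next
  case (Suc i)
  show ?case
  proof (cases "\<exists>n. y \<in> first_hit D n")
    case True
    then obtain n where n: "y \<in> first_hit D n" by (rule exE)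
    let ?y = "(lshift ^^ n) y"
    have y: "?y \<in> markov_space A" using Suc.prems by (rule lshift_markov)
    have "(\<Prod>j\<le>Suc i. waits D g j y) = exp (- g * real n) * (\<Prod>j\<le>i. waits D g j ?y)"
      unfolding prod.atMost_Suc_shift waits_hit[OF n] by (rule refl)
    also have "(\<Prod>j\<le>i. waits D g j ?y) =
      (if return_time D (Suc i) ?y < \<infinity> then exp (- g * real (the_enat (return_time D (Suc i) ?y))) else 0)"
      by (rule Suc.IH[OF y])
    also have "exp (- g * real n) * \<dots> =
      (if enat n + return_time D (Suc i) ?y < \<infinity> then exp (- g * real (the_enat (enat n + return_time D (Suc i) ?y))) else 0)"
      by (cases "return_time D (Suc i) ?y") (simp_all add: exp_add[symmetric] ring_distribs)
    finally show ?thesis by (simp only: return_time_hit[OF n, of "Suc i"])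
  next
    case False
    then have no: "\<And>n. y \<notin> first_hit D n" by simp
    show ?thesis unfolding return_time_no_hit[OF Suc.prems no] prod.atMost_Suc waits_no_hit[OF no] by simp
  qed
qed

lemma return_process_waits:
  assumes g: "scaling a (measure \<mu> D) = g" "0 < g" and y: "y \<in> markov_space A"
  shows "return_process a \<mu> D y = pp_of (\<lambda>i. waits D g i y)"
  unfolding return_process_def pp_of_def g(1)
proof (rule point_sum_reindex[where f=Suc])
  have pos: "0 < (\<Prod>j\<le>i. waits D g j y) \<longleftrightarrow> return_time D (Suc i) y < \<infinity>" for i
    unfolding waits_return_time[OF y] by simp
  show "bij_betw Suc {i. 0 < (\<Prod>j\<le>i. waits D g j y)} {k. 1 \<le> k \<and> return_time D k y < \<infinity>}"
    unfolding pos
  proof (rule bij_betwI')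
    fix k assume "k \<in> {k. 1 \<le> k \<and> return_time D k y < \<infinity>}"
    then show "\<exists>i\<in>{i. return_time D (Suc i) y < \<infinity>}. k = Suc i" by (cases k) auto
  qed auto
  show "- ln (\<Prod>j\<le>i. waits D g j y) = g * real (the_enat (return_time D (Suc i) y))"
    if "i \<in> {i. 0 < (\<Prod>j\<le>i. waits D g j y)}" for i
    using that unfolding mem_Collect_eq pos unfolding waits_return_time[OF y] by simp
qed (use g in simp)

text \<open>Encoded waits are proper at every point, so the return process is measurable as a
  continuous function of a measurable sequence and serves as its own version.\<close>

lemma waits_law_return_process:
  assumes D [measurable]: "D \<in> sets \<nu>" and g: "scaling a (measure \<mu> D) = g" "0 < g"
    and P: "prob_space P" "sets P = sets \<nu>"
  shows "waits_law (distr P pp_borel (return_process a \<mu> D)) P (\<lambda>y i. waits D g i y)"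
proof -
  have sp: "space P = markov_space A" using sets_eq_imp_space_eq[OF P(2)] by (simp add: space_nu)
  have wm: "(\<lambda>y. waits D g i y) \<in> borel_measurable P" for i
    using waits_measurable[OF D, of g i] measurable_cong_sets[OF P(2) refl] by blast
  have Y: "(\<lambda>y i. waits D g i y) \<in> borel_measurable P" by (rule measurable_seq_borel[OF wm])
  have "return_process a \<mu> D \<in> measurable P pp_borel"
  proof (rule pp_borel_measurableI)
    show "return_process a \<mu> D y \<in> pp_space" if "y \<in> space P" for y
      using that unfolding sp return_process_waits[OF g that[unfolded sp]] by (intro pp_of_space waits_proper_waits g)
    fix f assume f: "f \<in> vague_tests"
    have "(\<lambda>y. \<integral>t. f t \<partial>pp_of (\<lambda>i. waits D g i y)) \<in> borel_measurable P"
    proof -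
      have 1: "(\<lambda>v. \<integral>t. f t \<partial>pp_of v) \<in> borel_measurable (restrict_space borel proper_waits)"
        by (rule borel_measurable_continuous_on_restrict[OF continuous_on_integral_pp_of[OF f]])
      have 2: "(\<lambda>y i. waits D g i y) \<in> measurable P (restrict_space borel proper_waits)"
        by (rule measurable_restrict_space2[OF _ Y]) (use waits_proper_waits[OF g(2)] in blast)
      show ?thesis by (rule measurable_compose[OF 2 1])
    qed
    moreover have "(\<integral>t. f t \<partial>return_process a \<mu> D y) = (\<integral>t. f t \<partial>pp_of (\<lambda>i. waits D g i y))" if "y \<in> space P" for y
      using return_process_waits[OF g that[unfolded sp]] by simp
    ultimately show "(\<lambda>y. \<integral>t. f t \<partial>return_process a \<mu> D y) \<in> borel_measurable P"
      by (simp cong: measurable_cong)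
  qed
  then show ?thesis unfolding waits_law_def
    using P(1) Y waits_proper_waits[OF g(2)] return_process_waits[OF g] by (intro conjI exI[of _ "return_process a \<mu> D"] AE_I2) (simp_all add: sp)
qed

end

section \<open>From the eigenmeasure to the invariant measure\<close>

context periodic_point
begin

definition \<mu> :: "(nat \<Rightarrow> 'a) measure" where
  "\<mu> = density \<nu> (\<lambda>y. ennreal (h y))"

lemma sets_mu [simp, measurable_cong]: "sets \<mu> = sets \<nu>" by (simp add: \<mu>_def)

lemma space_mu: "space \<mu> = markov_space A" by (simp add: \<mu>_def space_nu)

lemma h_near_B: "0 < e \<Longrightarrow> \<forall>\<^sub>F n in sequentially. \<forall>y\<in>B n. \<bar>h y - h x\<bar> < e"
  using h_near[OF x_mem, of e] by (simp add: eventually_sequentially B_def)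

text \<open>A continuous h may be unbounded on a given cylinder, so integrability is secured on a
  \<open>B n\<close> on which h stays near its value at \<open>x\<close>.\<close>

lemma weighted_integrable:
  assumes n: "1 \<le> n" and bd: "\<forall>y\<in>B n. \<bar>h y - h x\<bar> < e"
    and F: "F \<in> borel_measurable \<nu>" "\<And>y. 0 \<le> F y \<and> F y \<le> (1::real)"
  shows "integrable \<nu> (\<lambda>y. F y * h y * indicator (B n) y)" "integrable \<nu> (\<lambda>y. F y * indicator (B n) y)"
proof -
  have i: "integrable \<nu> (\<lambda>y. c * indicator (B n) y :: real)" for c
    by (intro integrable_mult_right integrable_real_indicator B_finite[OF n]) simp
  show "integrable \<nu> (\<lambda>y. F y * h y * indicator (B n) y)"
  proof (rule Bochner_Integration.integrable_bound[OF i[of "\<bar>h x\<bar> + e"]])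
    show "AE y in \<nu>. norm (F y * h y * indicator (B n) y) \<le> norm ((\<bar>h x\<bar> + e) * indicator (B n) y)"
    proof (rule AE_I2)
      fix y
      show "norm (F y * h y * indicator (B n) y) \<le> norm ((\<bar>h x\<bar> + e) * indicator (B n) y)"
      proof (cases "y \<in> B n")
        case True
        then have "\<bar>h y - h x\<bar> < e" using bd by blast
        then have "\<bar>h y\<bar> \<le> \<bar>h x\<bar> + e" by linarith
        moreover have "\<bar>F y\<bar> * \<bar>h y\<bar> \<le> 1 * \<bar>h y\<bar>" using F(2)[of y] by (intro mult_right_mono) auto
        ultimately have "\<bar>F y\<bar> * \<bar>h y\<bar> \<le> \<bar>\<bar>h x\<bar> + e\<bar>" by linarith
        then show ?thesis using True by (simp add: abs_mult)
      qed simp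
    qed
  qed (use F in measurable)
  show "integrable \<nu> (\<lambda>y. F y * indicator (B n) y)"
    by (rule Bochner_Integration.integrable_bound[OF i[of 1]]) (use F in \<open>auto simp: indicator_def\<close>)
qed

text \<open>By continuity h is within e / 2 of h x on \<open>B n\<close> for large n. The weight
  therefore factors out of normalised integrals, uniformly over integrands with values in the unit
  interval.\<close>

lemma h_weight_limit:
  assumes F: "\<And>n. F n \<in> borel_measurable \<nu>" "\<And>n y. 0 \<le> F n y \<and> F n y \<le> (1::real)"
    and lim: "(\<lambda>n. (\<integral>y. F n y * indicator (B n) y \<partial>\<nu>) / measure \<nu> (B n)) \<longlonglongrightarrow> c"
  shows "(\<lambda>n. (\<integral>y. F n y * h y * indicator (B n) y \<partial>\<nu>) / measure \<nu> (B n)) \<longlonglongrightarrow> h x * c"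
proof -
  let ?X = "\<lambda>n. (\<integral>y. F n y * h y * indicator (B n) y \<partial>\<nu>) / measure \<nu> (B n)"
  let ?Y = "\<lambda>n. (\<integral>y. F n y * indicator (B n) y \<partial>\<nu>) / measure \<nu> (B n)"
  have "(\<lambda>n. ?X n - h x * ?Y n) \<longlonglongrightarrow> 0"
  proof (rule tendstoI)
    fix e :: real assume e: "0 < e"
    then have e2: "0 < e / 2" by simp
    show "\<forall>\<^sub>F n in sequentially. dist (?X n - h x * ?Y n) 0 < e"
      using eventually_ge_at_top[of 1] h_near_B[OF e2]
    proof eventually_elim
      case (elim n)
      note int = weighted_integrable[OF elim F(1)[of n] F(2)[of n]]
      have m: "0 < measure \<nu> (B n)" by (rule B_pos[OF elim(1)])
      have i: "integrable \<nu> (\<lambda>y. e / 2 * indicator (B n) y :: real)"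
        by (intro integrable_mult_right integrable_real_indicator B_finite[OF elim(1)]) simp
      have "\<bar>(\<integral>y. F n y * h y * indicator (B n) y \<partial>\<nu>) - h x * (\<integral>y. F n y * indicator (B n) y \<partial>\<nu>)\<bar>
          = \<bar>\<integral>y. F n y * h y * indicator (B n) y - h x * (F n y * indicator (B n) y) \<partial>\<nu>\<bar>"
        using int by simp
      also have "\<dots> \<le> (\<integral>y. \<bar>F n y * h y * indicator (B n) y - h x * (F n y * indicator (B n) y)\<bar> \<partial>\<nu>)"
        by (rule integral_abs_bound)
      also have "\<dots> \<le> (\<integral>y. e / 2 * indicator (B n) y \<partial>\<nu>)"
      proof (rule integral_mono)
        fix y assume "y \<in> space \<nu>"
        show "\<bar>F n y * h y * indicator (B n) y - h x * (F n y * indicator (B n) y)\<bar> \<le> e / 2 * indicator (B n) y"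
        proof (cases "y \<in> B n")
          case True
          then have "\<bar>h y - h x\<bar> < e / 2" using elim(2) by blast
          then have "\<bar>F n y\<bar> * \<bar>h y - h x\<bar> \<le> 1 * (e / 2)" using F(2)[of n y] by (intro mult_mono) auto
          moreover have "F n y * h y - h x * F n y = F n y * (h y - h x)" by (simp add: algebra_simps)
          ultimately show ?thesis using True by (simp add: abs_mult)
        qed simp
      qed (use int i in auto)
      also have "\<dots> = e / 2 * measure \<nu> (B n)" by simp
      finally have "\<bar>(\<integral>y. F n y * h y * indicator (B n) y \<partial>\<nu>) - h x * (\<integral>y. F n y * indicator (B n) y \<partial>\<nu>)\<bar> \<le> e / 2 * measure \<nu> (B n)" .
      moreover have "?X n - h x * ?Y n = ((\<integral>y. F n y * h y * indicator (B n) y \<partial>\<nu>) - h x * (\<integral>y. F n y * indicator (B n) y \<partial>\<nu>)) / measure \<nu> (B n)"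
        by (simp add: diff_divide_distrib)
      ultimately have "\<bar>?X n - h x * ?Y n\<bar> \<le> e / 2" using m by (simp add: abs_divide divide_le_eq)
      then show ?case using e by (simp add: dist_real_def)
    qed
  qed
  from tendsto_add[OF this tendsto_mult_left[OF lim, of "h x"]] show ?thesis by simp
qed

lemma mu_B_emeasure:
  assumes n: "1 \<le> n" and bd: "\<forall>y\<in>B n. \<bar>h y - h x\<bar> < e"
  shows "emeasure \<mu> (B n) = ennreal (\<integral>y. h y * indicator (B n) y \<partial>\<nu>)" "0 < (\<integral>y. h y * indicator (B n) y \<partial>\<nu>)"
proof -
  have int: "integrable \<nu> (\<lambda>y. h y * indicator (B n) y)"
    using weighted_integrable(1)[OF n bd, of "\<lambda>_. 1"] by simp
  have nn: "AE y in \<nu>. 0 \<le> h y * indicator (B n) y"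
    using h_pos by (intro AE_I2) (auto simp: space_nu less_imp_le indicator_def)
  have "emeasure \<mu> (B n) = (\<integral>\<^sup>+y. ennreal (h y) * indicator (B n) y \<partial>\<nu>)"
    unfolding \<mu>_def by (rule emeasure_density) simp_all
  also have "\<dots> = (\<integral>\<^sup>+y. ennreal (h y * indicator (B n) y) \<partial>\<nu>)"
    by (intro nn_integral_cong) (auto simp: indicator_def)
  also have "\<dots> = ennreal (\<integral>y. h y * indicator (B n) y \<partial>\<nu>)"
    by (rule nn_integral_eq_integral[OF int nn])
  finally show *: "emeasure \<mu> (B n) = ennreal (\<integral>y. h y * indicator (B n) y \<partial>\<nu>)" .
  have "emeasure \<mu> (B n) \<noteq> 0"
  proof
    assume "emeasure \<mu> (B n) = 0"
    then have "(\<integral>\<^sup>+y. ennreal (h y) * indicator (B n) y \<partial>\<nu>) = 0"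
      unfolding \<mu>_def by (subst (asm) emeasure_density) simp_all
    then have "AE y in \<nu>. ennreal (h y) * indicator (B n) y = 0"
      by (subst (asm) nn_integral_0_iff_AE) simp_all
    then have "AE y in \<nu>. y \<notin> B n"
    proof eventually_elim
      case (elim y)
      then show ?case using h_pos[of y] by (cases "y \<in> B n") (simp_all add: mem_B)
    qed
    then have "emeasure \<nu> (B n) = 0"
      by (subst (asm) AE_iff_measurable[OF B_sets, of _ n]) (auto simp: space_nu mem_B)
    then show False using B_pos[OF n] by (simp add: measure_def)
  qed
  then show "0 < (\<integral>y. h y * indicator (B n) y \<partial>\<nu>)" unfolding * by (simp add: ennreal_eq_0_iff not_le)
qed

lemma mu_B_measure:
  assumes n: "1 \<le> n" and bd: "\<forall>y\<in>B n. \<bar>h y - h x\<bar> < e"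
  shows "measure \<mu> (B n) = (\<integral>y. h y * indicator (B n) y \<partial>\<nu>)" "0 < measure \<mu> (B n)" "emeasure \<mu> (B n) = ennreal (measure \<mu> (B n))"
  using mu_B_emeasure[OF assms] by (simp_all add: measure_def)

lemma mu_B_eventually:
  "\<forall>\<^sub>F n in sequentially. 0 < measure \<mu> (B n) \<and> emeasure \<mu> (B n) = ennreal (measure \<mu> (B n))"
  using eventually_ge_at_top[of 1] h_near_B[OF zero_less_one]
  by eventually_elim (use mu_B_measure in blast)

lemma mu_B_ratio: "(\<lambda>n. measure \<mu> (B n) / measure \<nu> (B n)) \<longlonglongrightarrow> h x"
proof -
  have "(\<lambda>n. (\<integral>y. 1 * indicator (B n) y \<partial>\<nu>) / measure \<nu> (B n)) \<longlonglongrightarrow> 1"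
  proof (rule tendsto_eventually)
    show "\<forall>\<^sub>F n in sequentially. (\<integral>y. 1 * indicator (B n) y \<partial>\<nu>) / measure \<nu> (B n) = 1"
      using eventually_ge_at_top[of 1] by eventually_elim (use B_pos in force)
  qed
  from h_weight_limit[OF _ _ this] have "(\<lambda>n. (\<integral>y. h y * indicator (B n) y \<partial>\<nu>) / measure \<nu> (B n)) \<longlonglongrightarrow> h x" by simp
  moreover have "\<forall>\<^sub>F n in sequentially. (\<integral>y. h y * indicator (B n) y \<partial>\<nu>) / measure \<nu> (B n) = measure \<mu> (B n) / measure \<nu> (B n)"
    using eventually_ge_at_top[of 1] h_near_B[OF zero_less_one]
    by eventually_elim (use mu_B_measure(1) in simp)
  ultimately show ?thesis by (rule Lim_transform_eventually)
qed

text \<open>The factor h x appears in the numerator and in the ratio of the two masses of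
  \<open>B n\<close>, and cancels; limits computed under \<open>\<nu>\<close> thus hold for the
  normalised restriction of \<open>\<mu>\<close>.\<close>

lemma uniform_limit_B:
  assumes F: "\<And>n. F n \<in> borel_measurable \<nu>" "\<And>n y. 0 \<le> F n y \<and> F n y \<le> (1::real)"
    and lim: "(\<lambda>n. (\<integral>y. F n y * indicator (B n) y \<partial>\<nu>) / measure \<nu> (B n)) \<longlonglongrightarrow> c"
  shows "(\<lambda>n. \<integral>y. F n y \<partial>uniform_measure \<mu> (B n)) \<longlonglongrightarrow> c"
proof -
  let ?X = "\<lambda>n. (\<integral>y. F n y * h y * indicator (B n) y \<partial>\<nu>) / measure \<nu> (B n)"
  have hx: "h x \<noteq> 0" using h_pos[OF x_mem] by simp
  have "(\<lambda>n. ?X n / (measure \<mu> (B n) / measure \<nu> (B n))) \<longlonglongrightarrow> h x * c / h x"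
    by (intro tendsto_divide h_weight_limit F lim mu_B_ratio hx)
  moreover have "\<forall>\<^sub>F n in sequentially. ?X n / (measure \<mu> (B n) / measure \<nu> (B n)) = (\<integral>y. F n y \<partial>uniform_measure \<mu> (B n))"
    using eventually_ge_at_top[of 1] mu_B_eventually
  proof eventually_elim
    case (elim n)
    have m: "0 < measure \<mu> (B n)" "emeasure \<mu> (B n) = ennreal (measure \<mu> (B n))" using elim by auto
    \<comment> \<open>The mass is finite and positive here, so division in \<open>ennreal\<close>
      may be replaced by a real density.\<close>
    have "uniform_measure \<mu> (B n) = density \<mu> (\<lambda>y. ennreal (indicator (B n) y / measure \<mu> (B n)))"
      unfolding uniform_measure_def m(2)
      by (rule density_cong) (use m in \<open>auto simp: indicator_def divide_ennreal ennreal_zero_divide simp flip: ennreal_1\<close>)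
    then have "(\<integral>y. F n y \<partial>uniform_measure \<mu> (B n)) = (\<integral>y. indicator (B n) y / measure \<mu> (B n) * F n y \<partial>\<mu>)"
      using F(1)[of n] by (simp add: integral_density)
    also have "\<dots> = (\<integral>y. h y * (indicator (B n) y / measure \<mu> (B n) * F n y) \<partial>\<nu>)"
      unfolding \<mu>_def[symmetric] using F(1)[of n]
      by (subst \<mu>_def, subst integral_density) (use h_pos in \<open>auto simp: space_nu less_imp_le intro!: AE_I2\<close>)
    also have "\<dots> = (\<integral>y. F n y * h y * indicator (B n) y / measure \<mu> (B n) \<partial>\<nu>)"
      by (intro Bochner_Integration.integral_cong) (auto simp: mult_ac)
    finally show ?case using B_pos[OF elim(1)] by simp
  qed
  ultimately have "(\<lambda>n. \<integral>y. F n y \<partial>uniform_measure \<mu> (B n)) \<longlonglongrightarrow> h x * c / h x" by (rule Lim_transform_eventually)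
  then show ?thesis using hx by simp
qed

end

section \<open>Moments of the encoded return process\<close>

context hitting_asymptotics
begin

lemma hit_prod_real:
  assumes "\<And>i. 0 \<le> s i"
  shows "hit_prod (B n) K (\<lambda>i. disc (s i) n) y = ennreal (\<Prod>i<K. waits (B n) (\<gamma> n) i y powr s i)"
  unfolding disc_def by (rule hit_prod_waits)

lemma waits_01: "0 \<le> waits (B n) (\<gamma> n) i y \<and> waits (B n) (\<gamma> n) i y \<le> 1"
proof -
  have "waits (B n) (\<gamma> n) i y \<le> exp (- \<gamma> n)" using gamma_pos[of n] by (intro waits_le) simp
  also have "exp (- \<gamma> n) \<le> 1" using gamma_pos[of n] by simp
  finally show ?thesis using waits_nonneg by simp
qed

lemma powr_01:
  assumes "\<And>i. 0 \<le> s i"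
  shows "0 \<le> (\<Prod>i<K. waits (B n) (\<gamma> n) i y powr s i) \<and> (\<Prod>i<K. waits (B n) (\<gamma> n) i y powr s i) \<le> 1"
proof
  show "0 \<le> (\<Prod>i<K. waits (B n) (\<gamma> n) i y powr s i)" by (intro prod_nonneg) simp
  show "(\<Prod>i<K. waits (B n) (\<gamma> n) i y powr s i) \<le> 1"
    by (intro prod_le_1) (use waits_01 assms in \<open>simp add: powr_le1\<close>)
qed

lemma powr_measurable [measurable]: "(\<lambda>y. \<Prod>i<K. waits (B n) (\<gamma> n) i y powr s i) \<in> borel_measurable \<nu>"
  by measurable

lemma integral_hit_real:
  assumes D: "D \<in> sets \<nu>" "emeasure \<nu> D < \<infinity>" and s: "\<And>i. 0 \<le> s i"
  shows "(\<integral>y. (\<Prod>i<K. waits (B n) (\<gamma> n) i y powr s i) * indicator D y \<partial>\<nu>) = hit_real (indicator D) K s n"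
proof -
  have "(\<integral>y. (\<Prod>i<K. waits (B n) (\<gamma> n) i y powr s i) * indicator D y \<partial>\<nu>)
    = enn2real (\<integral>\<^sup>+y. ennreal ((\<Prod>i<K. waits (B n) (\<gamma> n) i y powr s i) * indicator D y) \<partial>\<nu>)"
    using powr_01[where s=s, OF s] D(1) by (intro integral_eq_nn_integral) auto
  also have "(\<integral>\<^sup>+y. ennreal ((\<Prod>i<K. waits (B n) (\<gamma> n) i y powr s i) * indicator D y) \<partial>\<nu>)
    = (\<integral>\<^sup>+y. indicator D y * hit_prod (B n) K (\<lambda>i. disc (s i) n) y \<partial>\<nu>)"
    unfolding hit_prod_real[where s=s, OF s] by (intro nn_integral_cong) (auto simp: indicator_def)
  finally show ?thesis by (simp add: hit_real_def)
qed

lemma probability_powr_limit: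
  assumes P: "prob_space P" "sets P = sets \<nu>" "absolutely_continuous \<nu> P" and s: "\<And>i. 0 \<le> s i"
  shows "(\<lambda>n. \<integral>y. (\<Prod>i<Suc K. waits (B n) (\<gamma> n) i y powr s i) \<partial>P) \<longlonglongrightarrow> H_hat (s 0) * (\<Prod>i<K. W_hat (s (Suc i)))"
proof (rule probability_limit[OF powr_measurable _ _ P])
  show "0 \<le> (\<Prod>i<Suc K. waits (B n) (\<gamma> n) i y powr s i) \<and> (\<Prod>i<Suc K. waits (B n) (\<gamma> n) i y powr s i) \<le> 1" for n y
    by (rule powr_01[OF s])
  fix w :: "'a list" assume w: "w \<noteq> []"
  show "(\<lambda>n. \<integral>y. (\<Prod>i<Suc K. waits (B n) (\<gamma> n) i y powr s i) * indicator (cylinder A w) y \<partial>\<nu>)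
      \<longlonglongrightarrow> H_hat (s 0) * (\<Prod>i<K. W_hat (s (Suc i))) * measure \<nu> (cylinder A w)"
    using hit_prod_cylinder_limit[OF w, of s K] s cylinder_finite[OF w]
    by (subst integral_hit_real[OF _ _ s]) (simp_all only: cylinder_sets mult.commute)
qed

lemma uniform_powr_limit:
  assumes s: "\<And>i. 0 \<le> s i"
  shows "(\<lambda>n. \<integral>y. (\<Prod>i<K. waits (B n) (\<gamma> n) i y powr s i) \<partial>uniform_measure \<mu> (B n)) \<longlonglongrightarrow> (\<Prod>i<K. W_hat (s i))"
proof (rule uniform_limit_B[OF powr_measurable powr_01[OF s]])
  have "\<forall>\<^sub>F n in sequentially. hit_real (indicator (B n)) K s n / measure \<nu> (B n)
     = (\<integral>y. (\<Prod>i<K. waits (B n) (\<gamma> n) i y powr s i) * indicator (B n) y \<partial>\<nu>) / measure \<nu> (B n)"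
    using eventually_ge_at_top[of 1]
  proof eventually_elim
    case (elim n)
    show ?case by (simp only: integral_hit_real[OF B_sets B_finite[OF elim] s])
  qed
  then show "(\<lambda>n. (\<integral>y. (\<Prod>i<K. waits (B n) (\<gamma> n) i y powr s i) * indicator (B n) y \<partial>\<nu>) / measure \<nu> (B n)) \<longlonglongrightarrow> (\<Prod>i<K. W_hat (s i))"
    by (rule Lim_transform_eventually[OF hit_prod_B_limit[OF s]])
qed

text \<open>Moments use \<open>0 ^ 0 = 1\<close>, whereas \<open>0 powr 0 = 0\<close>; the two differ only on the event that one of
  the waits is infinite, whose probability is controlled by the exponents \<open>s = 0\<close>.\<close>

lemma moments_of_powr:
  assumes P: "\<And>n. n \<ge> start \<Longrightarrow> prob_space (P n) \<and> sets (P n) = sets \<nu>" and c: "c (\<lambda>_. 0) = 1"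
    and lim: "\<And>s. (\<And>i. 0 \<le> s i) \<Longrightarrow>
      (\<lambda>n. \<integral>y. (\<Prod>i<K. waits (B n) (\<gamma> n) i y powr s i) \<partial>P n) \<longlonglongrightarrow> c s"
  shows "(\<lambda>n. \<integral>y. (\<Prod>i<K. waits (B n) (\<gamma> n) i y ^ m i) \<partial>P n) \<longlonglongrightarrow> c (\<lambda>i. real (m i))"
proof -
  let ?v = "\<lambda>n i y. waits (B n) (\<gamma> n) i y"
  let ?s = "\<lambda>i. real (m i)"
  let ?G = "\<lambda>s n y. \<Prod>i<K. ?v n i y powr s i" and ?M = "\<lambda>n y. \<Prod>i<K. ?v n i y ^ m i"
  let ?z = "\<lambda>_::nat. 0::real"
  have M01: "0 \<le> ?M n y \<and> ?M n y \<le> 1" for n y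
    using waits_01 by (auto intro!: prod_nonneg prod_le_1 power_le_one)
  have bounds: "?G ?s n y \<le> ?M n y \<and> ?M n y \<le> ?G ?s n y + (1 - ?G ?z n y)" for n y
  proof (cases "\<exists>i<K. ?v n i y = 0")
    case True
    then obtain j where j: "j < K" "?v n j y = 0" by blast
    have "?G s n y = 0" for s by (rule prod_zero[OF finite_lessThan]) (use j in \<open>auto intro!: bexI[of _ j]\<close>)
    then show ?thesis using M01[of n y] by (simp only: simp_thms) simp
  next
    case False
    then have pos: "0 < ?v n i y" if "i < K" for i using that waits_01[of n i y] by (auto simp: less_le)
    have "?G ?s n y = ?M n y" by (intro prod.cong refl) (use pos powr_realpow in auto)
    moreover have "?G ?z n y = 1" by (intro prod.neutral ballI) (use pos in force)
    ultimately show ?thesis by simp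
  qed
  show ?thesis
  proof (rule tendsto_sandwich)
    have int: "integrable (P n) (?G s n)" "integrable (P n) (?M n)" if n: "n \<ge> start" and s: "\<And>i. 0 \<le> s i" for n s
    proof -
      interpret prob_space "P n" using P[OF n] by simp
      have sets: "measurable (P n) borel = measurable \<nu> borel" using P[OF n] by (intro measurable_cong_sets) auto
      show "integrable (P n) (?G s n)"
        by (rule integrable_const_bound[where B=1]) (use powr_01[where s=s, OF s] in \<open>auto simp: sets\<close>)
      show "integrable (P n) (?M n)"
        by (rule integrable_const_bound[where B=1]) (use M01 in \<open>auto simp: sets\<close>)
    qed
    show "\<forall>\<^sub>F n in sequentially. (\<integral>y. ?G ?s n y \<partial>P n) \<le> (\<integral>y. ?M n y \<partial>P n)"
      using eventually_ge_at_top[of start]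
    proof eventually_elim
      case (elim n)
      show ?case by (rule integral_mono) (use int[OF elim, of ?s] bounds in auto)
    qed
    show "\<forall>\<^sub>F n in sequentially. (\<integral>y. ?M n y \<partial>P n) \<le> (\<integral>y. ?G ?s n y \<partial>P n) + (1 - (\<integral>y. ?G ?z n y \<partial>P n))"
      using eventually_ge_at_top[of start]
    proof eventually_elim
      case (elim n)
      interpret prob_space "P n" using P[OF elim] by simp
      have i: "integrable (P n) (?G ?s n)" "integrable (P n) (?G ?z n)" "integrable (P n) (?M n)"
        using int[OF elim, of ?s] int[OF elim, of ?z] by auto
      have "(\<integral>y. ?M n y \<partial>P n) \<le> (\<integral>y. ?G ?s n y + (1 - ?G ?z n y) \<partial>P n)"
        by (rule integral_mono) (use i bounds in auto)
      also have "\<dots> = (\<integral>y. ?G ?s n y \<partial>P n) + (1 - (\<integral>y. ?G ?z n y \<partial>P n))"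
        using i by (subst Bochner_Integration.integral_add) (simp_all add: prob_space)
      finally show ?case .
    qed
    show "(\<lambda>n. \<integral>y. ?G ?s n y \<partial>P n) \<longlonglongrightarrow> c ?s" by (rule lim) simp
    have "(\<lambda>n. (\<integral>y. ?G ?s n y \<partial>P n) + (1 - (\<integral>y. ?G ?z n y \<partial>P n))) \<longlonglongrightarrow> c ?s + (1 - c ?z)"
      by (intro tendsto_intros lim) simp_all
    then show "(\<lambda>n. (\<integral>y. ?G ?s n y \<partial>P n) + (1 - (\<integral>y. ?G ?z n y \<partial>P n))) \<longlonglongrightarrow> c ?s" using c by simp
  qed
qed

lemma H_hat_0: "H_hat 0 = 1" and W_hat_0: "W_hat 0 = 1"
  by (simp_all add: H_hat_def W_hat_def)

lemma probability_moments:
  assumes P: "prob_space P" "sets P = sets \<nu>" "absolutely_continuous \<nu> P"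
  shows "(\<lambda>n. \<integral>y. (\<Prod>i<Suc K. waits (B n) (\<gamma> n) i y ^ m i) \<partial>P)
    \<longlonglongrightarrow> H_hat (real (m 0)) * (\<Prod>i<K. W_hat (real (m (Suc i))))"
  using moments_of_powr[of 0 "\<lambda>_. P" "\<lambda>s. H_hat (s 0) * (\<Prod>i<K. W_hat (s (Suc i)))" "Suc K" m]
    probability_powr_limit[OF P] P by (simp add: H_hat_0 W_hat_0)

lemma uniform_moments:
  "(\<lambda>n. \<integral>y. (\<Prod>i<K. waits (B n) (\<gamma> n) i y ^ m i) \<partial>uniform_measure \<mu> (B n)) \<longlonglongrightarrow> (\<Prod>i<K. W_hat (real (m i)))"
proof -
  obtain n0 where n0: "\<forall>n\<ge>n0. 0 < measure \<mu> (B n) \<and> emeasure \<mu> (B n) = ennreal (measure \<mu> (B n))"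
    using mu_B_eventually unfolding eventually_sequentially by (rule exE)
  show ?thesis
  proof (rule moments_of_powr[where c="\<lambda>s. \<Prod>i<K. W_hat (s i)" and start=n0])
    fix n assume "n0 \<le> n"
    then have "0 < measure \<mu> (B n)" "emeasure \<mu> (B n) = ennreal (measure \<mu> (B n))" using n0 by auto
    then show "prob_space (uniform_measure \<mu> (B n)) \<and> sets (uniform_measure \<mu> (B n)) = sets \<nu>"
      by (auto intro!: prob_space_uniform_measure)
  qed (simp_all add: W_hat_0 uniform_powr_limit)
qed

end

text \<open>Discards the finitely many n for which the scaling identity or the finiteness of the
  mass may fail.\<close>

lemma pp_converges_in_law_offset:
  assumes "pp_converges_in_law (\<lambda>n. L (n + k)) L'"
  shows "pp_converges_in_law L L'"
  unfolding pp_converges_in_law_def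
proof (intro allI impI)
  fix F assume "continuous_map pp_topology euclideanreal F \<and> bounded (F ` pp_space)"
  then have "(\<lambda>n. \<integral>\<xi>. F \<xi> \<partial>L (n + k)) \<longlonglongrightarrow> (\<integral>\<xi>. F \<xi> \<partial>L')"
    using assms unfolding pp_converges_in_law_def by blast
  then show "(\<lambda>n. \<integral>\<xi>. F \<xi> \<partial>L n) \<longlonglongrightarrow> (\<integral>\<xi>. F \<xi> \<partial>L')" by (rule LIMSEQ_offset)
qed

context hitting_asymptotics
begin

section \<open>Identification of the limit laws\<close>

context
  fixes \<alpha> c l :: real and a :: "nat \<Rightarrow> real" and start :: nat
  assumes \<alpha>: "0 < \<alpha>" and c: "0 < c" and kappa: "\<And>s. 0 < s \<Longrightarrow> \<kappa> s = c * s powr (- \<alpha>)"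
    and l_def: "l = (1 - \<rho>) * c"
    and scal: "\<And>n. start \<le> n \<Longrightarrow> scaling a (measure \<mu> (B n)) = \<gamma> n"
    and mass: "\<And>n. start \<le> n \<Longrightarrow> 0 < measure \<mu> (B n) \<and> emeasure \<mu> (B n) = ennreal (measure \<mu> (B n))"
begin

lemma l_pos: "0 < l" using c rho_less_1 by (simp add: l_def)

text \<open>Numerator and denominator are multiplied by (1 - \<open>\<rho>\<close>) times s powr
  \<alpha>. The parameter l is what this leaves in place of c.\<close>

lemma H_hat_eq: "0 \<le> s \<Longrightarrow> H_hat s = l / (l + s powr \<alpha>)"
proof (cases "s = 0")
  case False
  assume "0 \<le> s"
  then have s: "0 < s" using False by simp
  then have p: "0 < s powr \<alpha>" "s powr (- \<alpha>) = 1 / s powr \<alpha>" by (simp_all add: powr_minus_divide)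
  have r: "0 < 1 - \<rho>" using rho_less_1 by simp
  have "c * (1 / t) / (1 / r + c * (1 / t)) = r * c / (r * c + t)" if "0 < t" "0 < r" for r t :: real
  proof -
    have "0 < r * c + t" using that c by (simp add: add_pos_pos)
    then have "c * (1 / t) / (1 / r + c * (1 / t)) = c * (1 / t) * (r * t) / ((1 / r + c * (1 / t)) * (r * t))"
      using that by simp
    also have "(1 / r + c * (1 / t)) * (r * t) = r * c + t" using that by (simp add: distrib_right)
    finally show ?thesis using that by (simp add: mult.commute)
  qed
  from this[OF p(1) r] show ?thesis using s unfolding H_hat_def kappa[OF s] p(2) l_def by simp
qed (use l_pos \<alpha> in \<open>simp add: H_hat_def\<close>)

text \<open>The first encoded wait under one particular absolutely continuous law, the uniform one
  on \<open>B 1\<close>, supplies the converging power means from which the law is built.\<close>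

lemma H_law_props: "H_char \<alpha> l (H_law \<alpha> l)"
proof -
  let ?C = "B 1"
  have C: "emeasure \<nu> ?C \<noteq> 0" "emeasure \<nu> ?C < \<infinity>"
    using cylinder_positive[OF x_mem, of 1] B_finite[of 1] by (simp_all add: B_def)
  let ?P = "uniform_measure \<nu> ?C"
  have P: "prob_space ?P" "sets ?P = sets \<nu>" "absolutely_continuous \<nu> ?P"
  proof -
    show "prob_space ?P" by (rule prob_space_uniform_measure) (use C in auto)
    show "absolutely_continuous \<nu> ?P" unfolding uniform_measure_def
      by (rule absolutely_continuousI_density) simp
  qed simp
  have "\<exists>M. H_char \<alpha> l M"
  proof (rule H_char_exists[OF l_pos \<alpha> P(1), where V="\<lambda>n. waits (B n) (\<gamma> n) 0"])
    have "waits (B n) (\<gamma> n) 0 \<in> borel_measurable \<nu>" for n by (rule waits_measurable) simp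
    then show "waits (B n) (\<gamma> n) 0 \<in> borel_measurable ?P" for n
      using measurable_cong_sets[OF P(2) refl] by blast
    show "0 \<le> waits (B n) (\<gamma> n) 0 w" "waits (B n) (\<gamma> n) 0 w \<le> 1" for n w
      using waits_01[of n 0 w] by (simp_all del: waits.simps)
    fix s :: real assume s: "0 < s"
    have "(\<lambda>n. \<integral>y. (\<Prod>i<Suc 0. waits (B n) (\<gamma> n) i y powr s) \<partial>?P) \<longlonglongrightarrow> H_hat s"
      using probability_powr_limit[OF P, where s="\<lambda>_. s" and K=0] s by (simp del: waits.simps)
    then show "(\<lambda>n. \<integral>w. waits (B n) (\<gamma> n) 0 w powr s \<partial>?P) \<longlonglongrightarrow> l / (l + s powr \<alpha>)"
      using s by (simp add: H_hat_eq del: waits.simps)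
  qed
  then obtain M where "H_char \<alpha> l M" by (rule exE)
  then show ?thesis by (rule H_law_char)
qed

lemma H_law_prob: "prob_space (H_law \<alpha> l)" "sets (H_law \<alpha> l) = sets borel" "AE x in H_law \<alpha> l. 0 \<le> x"
  and H_law_laplace: "0 \<le> s \<Longrightarrow> (\<integral>x. exp (- s * x) \<partial>H_law \<alpha> l) = H_hat s"
  using H_law_props H_hat_eq unfolding H_char_def by simp_all

lemma H_hat_less_1: "H_hat 1 < 1"
  using l_pos by (simp add: H_hat_eq)

lemma W_law_prob:
  "prob_space (W_law \<alpha> (1 - \<rho>) l)" "sets (W_law \<alpha> (1 - \<rho>) l) = sets borel" "AE x in W_law \<alpha> (1 - \<rho>) l. 0 \<le> x"
  and W_law_laplace: "0 \<le> s \<Longrightarrow> (\<integral>x. exp (- s * x) \<partial>W_law \<alpha> (1 - \<rho>) l) = W_hat s"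
  using W_law_props[OF H_law_prob, of "1 - \<rho>"] rho_pos rho_less_1 H_law_laplace[of s] by (simp_all add: W_hat_def)

lemma probability_law_limit:
  assumes P: "prob_space P" "sets P = sets \<nu>" "absolutely_continuous \<nu> P"
  shows "pp_converges_in_law (\<lambda>n. distr P pp_borel (return_process a \<mu> (B n))) (CFPP \<alpha> l (Geo (1 - \<rho>)))"
proof (rule pp_converges_in_law_offset[where k=start])
  let ?H = "H_law \<alpha> l"
  have \<theta>: "0 < 1 - \<rho>" "1 - \<rho> \<le> 1" using rho_pos rho_less_1 by auto
  have L: "(\<integral>x. exp (- real k * x) \<partial>?H) = H_hat (real k)" for k by (rule H_law_laplace) simp
  have less: "(\<integral>x. exp (- x) \<partial>?H) < 1" using L[of 1] H_hat_less_1 by simp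
  note CF = waits_law_CFPP[OF H_law_prob \<theta> less]
  show "pp_converges_in_law (\<lambda>n. distr P pp_borel (return_process a \<mu> (B (n + start)))) (CFPP \<alpha> l (Geo (1 - \<rho>)))"
    unfolding CFPP_def
  proof (rule waits_law_converge[OF _ CF])
    show "waits_law (distr P pp_borel (return_process a \<mu> (B (n + start)))) P (\<lambda>y i. waits (B (n + start)) (\<gamma> (n + start)) i y)" for n
      by (rule waits_law_return_process[OF B_sets scal gamma_pos P(1,2)]) simp
    show "(\<lambda>n. \<integral>w. (\<Prod>i<K. waits (B (n + start)) (\<gamma> (n + start)) i w ^ m i) \<partial>P) \<longlonglongrightarrow>
        (\<integral>w. (\<Prod>i<K. exp (- cluster_wait w i) ^ m i) \<partial>(Pi\<^sub>M UNIV (\<lambda>_. ?H) \<Otimes>\<^sub>M Pi\<^sub>M UNIV (\<lambda>_. measure_pmf (Geo (1 - \<rho>)))))" for K m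
    \<comment> \<open>The moment formula treats the first wait apart from the rest, so the empty
      product is settled by total mass 1.\<close>
    proof (cases K)
      case 0
      interpret P: prob_space P by (rule P(1))
      interpret Q: prob_space "Pi\<^sub>M (UNIV :: nat set) (\<lambda>_. ?H) \<Otimes>\<^sub>M Pi\<^sub>M (UNIV :: nat set) (\<lambda>_. measure_pmf (Geo (1 - \<rho>)))"
        using CF unfolding waits_law_def by (rule conjunct1)
      show ?thesis unfolding 0 by (simp add: P.prob_space Q.prob_space)
    next
      case (Suc K')
      show ?thesis
        unfolding Suc CFPP_moments[OF H_law_prob \<theta>] L
        using LIMSEQ_ignore_initial_segment[OF probability_moments[OF P, where K=K' and m=m], of start] by (simp add: W_hat_def)
    qed
  qed
qed

lemma uniform_law_limit:
  "pp_converges_in_law (\<lambda>n. distr (uniform_measure \<mu> (B n)) pp_borel (return_process a \<mu> (B n))) (RPP (W_law \<alpha> (1 - \<rho>) l))"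
proof (rule pp_converges_in_law_offset[where k=start])
  let ?W = "W_law \<alpha> (1 - \<rho>) l"
  have L: "(\<integral>x. exp (- real k * x) \<partial>?W) = W_hat (real k)" for k by (rule W_law_laplace) simp
  have "W_hat 1 < 1"
  proof -
    have "(1 - \<rho>) * H_hat 1 < (1 - \<rho>) * 1" using rho_less_1 H_hat_less_1 by (intro mult_strict_left_mono) auto
    then show ?thesis by (simp add: W_hat_def)
  qed
  then have less: "(\<integral>x. exp (- x) \<partial>?W) < 1" using L[of 1] by simp
  show "pp_converges_in_law (\<lambda>n. distr (uniform_measure \<mu> (B (n + start))) pp_borel (return_process a \<mu> (B (n + start)))) (RPP ?W)"
  proof (rule waits_law_converge[OF _ waits_law_RPP[OF W_law_prob less]])
    fix n
    have "prob_space (uniform_measure \<mu> (B (n + start)))"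
    proof (rule prob_space_uniform_measure)
      have m: "0 < measure \<mu> (B (n + start))" "emeasure \<mu> (B (n + start)) = ennreal (measure \<mu> (B (n + start)))"
        using mass[of "n + start"] by auto
      show "emeasure \<mu> (B (n + start)) \<noteq> 0" "emeasure \<mu> (B (n + start)) \<noteq> \<infinity>"
        unfolding m(2) using m(1) by auto
    qed
    then show "waits_law (distr (uniform_measure \<mu> (B (n + start))) pp_borel (return_process a \<mu> (B (n + start))))
        (uniform_measure \<mu> (B (n + start))) (\<lambda>y i. waits (B (n + start)) (\<gamma> (n + start)) i y)"
      by (intro waits_law_return_process[OF B_sets scal gamma_pos]) simp_all
  next
    show "(\<lambda>n. \<integral>w. (\<Prod>i<K. waits (B (n + start)) (\<gamma> (n + start)) i w ^ m i) \<partial>uniform_measure \<mu> (B (n + start))) \<longlonglongrightarrow>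
        (\<integral>w. (\<Prod>i<K. exp (- w i) ^ m i) \<partial>Pi\<^sub>M UNIV (\<lambda>_. ?W))" for K m
      unfolding RPP_moments[OF W_law_prob] L by (rule LIMSEQ_ignore_initial_segment[OF uniform_moments])
  qed
qed

end

end

section \<open>Pointwise dual ergodicity\<close>

text \<open>Testing with the sign of the difference gives its L1 norm. It identifies the arbitrary
  choice made in \<open>transfer_op\<close> up to null sets.\<close>

lemma AE_eq_of_bounded_tests:
  fixes g g' :: "'b \<Rightarrow> real"
  assumes g: "integrable M g" "integrable M g'"
    and eq: "\<And>u. u \<in> borel_measurable M \<Longrightarrow> \<exists>c. \<forall>x\<in>space M. \<bar>u x\<bar> \<le> c \<Longrightarrow> (\<integral>x. g x * u x \<partial>M) = (\<integral>x. g' x * u x \<partial>M)"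
  shows "AE x in M. g x = g' x"
proof -
  let ?u = "\<lambda>x. sgn (g x - g' x)"
  have [measurable]: "g \<in> borel_measurable M" "g' \<in> borel_measurable M" using g by auto
  have u: "?u \<in> borel_measurable M" by measurable
  have b: "\<bar>?u x\<bar> \<le> 1" for x by (simp add: sgn_real_def)
  have int: "integrable M (\<lambda>x. k x * ?u x)" if "integrable M k" for k :: "'b \<Rightarrow> real"
    by (rule Bochner_Integration.integrable_bound[OF that])
       (use u that b in \<open>auto simp: abs_mult intro!: mult_right_le_one_le\<close>)
  have "(\<integral>x. \<bar>g x - g' x\<bar> \<partial>M) = (\<integral>x. g x * ?u x - g' x * ?u x \<partial>M)"
    by (intro Bochner_Integration.integral_cong refl) (simp add: left_diff_distrib[symmetric] abs_sgn)
  also have "\<dots> = 0"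
    using eq[OF u exI[of _ 1]] b int[OF g(1)] int[OF g(2)] by (subst Bochner_Integration.integral_diff) auto
  finally have "AE x in M. \<bar>g x - g' x\<bar> = 0"
    using g by (subst (asm) integral_nonneg_eq_0_iff_AE) auto
  then show ?thesis by eventually_elim simp
qed

text \<open>The argument \<open>f'\<close> need only agree with \<open>f\<close> almost everywhere.
  This is required for iteration, because each application of \<open>transfer_op\<close> returns
  some chosen version.\<close>

lemma transfer_op_AE:
  assumes T: "T \<in> measurable M M" and f: "f \<in> borel_measurable M" "f' \<in> borel_measurable M" "AE x in M. f' x = f x"
    and g: "integrable M g"
    and dual: "\<And>u. u \<in> borel_measurable M \<Longrightarrow> \<exists>c. \<forall>x\<in>space M. \<bar>u x\<bar> \<le> c \<Longrightarrow>
      (\<integral>x. f x * u (T x) \<partial>M) = (\<integral>x. g x * u x \<partial>M)"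
  shows "integrable M (transfer_op M T f')" "AE x in M. transfer_op M T f' x = g x"
proof -
  have dual': "(\<integral>x. f' x * u (T x) \<partial>M) = (\<integral>x. g x * u x \<partial>M)"
    if u: "u \<in> borel_measurable M" "\<exists>c. \<forall>x\<in>space M. \<bar>u x\<bar> \<le> c" for u
  proof -
    have "(\<lambda>x. u (T x)) \<in> borel_measurable M" using measurable_compose[OF T u(1)] .
    then have "(\<integral>x. f' x * u (T x) \<partial>M) = (\<integral>x. f x * u (T x) \<partial>M)"
      using f by (intro integral_cong_AE) auto
    then show ?thesis using dual[OF u] by simp
  qed
  let ?Q = "\<lambda>g. integrable M g \<and> (\<forall>u\<in>borel_measurable M. (\<exists>c. \<forall>x\<in>space M. \<bar>u x\<bar> \<le> c) \<longrightarrow>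
        (\<integral>x. f' x * u (T x) \<partial>M) = (\<integral>x. g x * u x \<partial>M))"
  have "?Q g" using g dual' by blast
  then have Q: "?Q (transfer_op M T f')" unfolding transfer_op_def by (rule someI[where P="?Q"])
  then show "integrable M (transfer_op M T f')" by (rule conjunct1)
  have eq: "(\<integral>x. transfer_op M T f' x * u x \<partial>M) = (\<integral>x. g x * u x \<partial>M)"
    if u: "u \<in> borel_measurable M" "\<exists>c. \<forall>x\<in>space M. \<bar>u x\<bar> \<le> c" for u
  proof -
    have "(\<integral>x. f' x * u (T x) \<partial>M) = (\<integral>x. transfer_op M T f' x * u x \<partial>M)" using Q u by blast
    then show ?thesis using dual'[OF u] by simp
  qed
  show "AE x in M. transfer_op M T f' x = g x"
    by (rule AE_eq_of_bounded_tests[OF conjunct1[OF Q] g eq])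
qed

context periodic_point
begin

definition Pit_real :: "nat \<Rightarrow> 'a list \<Rightarrow> (nat \<Rightarrow> 'a) \<Rightarrow> real" where
  "Pit_real k w y = enn2real (Pit k (indicator (cylinder A w)) y)"

lemma Pit_real_measurable [measurable]: "Pit_real k w \<in> borel_measurable \<nu>"
  unfolding Pit_real_def by measurable

lemma Pit_real_AE:
  assumes "w \<noteq> []"
  shows "AE y in \<nu>. Pit k (indicator (cylinder A w)) y = ennreal (Pit_real k w y)"
proof -
  have "(\<integral>\<^sup>+y. Pit k (indicator (cylinder A w)) y \<partial>\<nu>) = emeasure \<nu> (cylinder A w)"
    by (subst Pit_integral) simp_all
  then have "(\<integral>\<^sup>+y. Pit k (indicator (cylinder A w)) y \<partial>\<nu>) \<noteq> \<infinity>" using cylinder_finite[OF assms] by simp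
  then have "AE y in \<nu>. Pit k (indicator (cylinder A w)) y \<noteq> \<infinity>" by (intro nn_integral_PInf_AE) simp_all
  then show ?thesis by eventually_elim (simp add: Pit_real_def less_top)
qed

lemma Pit_real_dual_nonneg:
  assumes w: "w \<noteq> []" and u: "u \<in> borel_measurable \<nu>" "\<And>y. 0 \<le> u y"
  shows "(\<integral>y. Pit_real k w y * u (lshift y) \<partial>\<nu>) = (\<integral>y. Pit_real (Suc k) w y * u y \<partial>\<nu>)"
proof -
  let ?I = "indicator (cylinder A w) :: _ \<Rightarrow> ennreal"
  have sh: "lshift \<in> measurable \<nu> \<nu>" using lshift_measurable[of 1] by simp
  have us: "(\<lambda>y. u (lshift y)) \<in> borel_measurable \<nu>" by (rule measurable_compose[OF sh u(1)])
  have nn: "0 \<le> Pit_real j w y" for j y by (simp add: Pit_real_def)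
  have "(\<integral>y. Pit_real k w y * u (lshift y) \<partial>\<nu>) = enn2real (\<integral>\<^sup>+y. ennreal (Pit_real k w y * u (lshift y)) \<partial>\<nu>)"
    by (rule integral_eq_nn_integral) (use us u nn in auto)
  also have "(\<integral>\<^sup>+y. ennreal (Pit_real k w y * u (lshift y)) \<partial>\<nu>) = (\<integral>\<^sup>+y. Pit k ?I y * ennreal (u ((lshift ^^ 1) y)) \<partial>\<nu>)"
    by (rule nn_integral_cong_AE) (use Pit_real_AE[OF w, of k] u nn in \<open>auto elim!: eventually_mono simp: ennreal_mult\<close>)
  also have "\<dots> = (\<integral>\<^sup>+y. Pit 1 (Pit k ?I) y * ennreal (u y) \<partial>\<nu>)"
    by (rule Pit_dual[symmetric]) (use u in auto)
  also have "\<dots> = (\<integral>\<^sup>+y. Pit (Suc k) ?I y * ennreal (u y) \<partial>\<nu>)" by (simp only: Pit_Suc)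
  also have "\<dots> = (\<integral>\<^sup>+y. ennreal (Pit_real (Suc k) w y * u y) \<partial>\<nu>)"
    by (rule nn_integral_cong_AE) (use Pit_real_AE[OF w, of "Suc k"] u nn in \<open>auto elim!: eventually_mono simp: ennreal_mult\<close>)
  also have "enn2real \<dots> = (\<integral>y. Pit_real (Suc k) w y * u y \<partial>\<nu>)"
    by (rule integral_eq_nn_integral[symmetric]) (use u nn in auto)
  finally show ?thesis .
qed

lemma Pit_real_integrable:
  assumes w: "w \<noteq> []"
  shows "integrable \<nu> (Pit_real k w)" "(\<integral>y. Pit_real k w y \<partial>\<nu>) = measure \<nu> (cylinder A w)"
proof -
  have "(\<integral>\<^sup>+y. ennreal (Pit_real k w y) \<partial>\<nu>) = (\<integral>\<^sup>+y. Pit k (indicator (cylinder A w)) y \<partial>\<nu>)"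
    by (rule nn_integral_cong_AE) (use Pit_real_AE[OF w, of k] in \<open>auto elim!: eventually_mono\<close>)
  also have "\<dots> = emeasure \<nu> (cylinder A w)" by (subst Pit_integral) simp_all
  finally have nn: "(\<integral>\<^sup>+y. ennreal (Pit_real k w y) \<partial>\<nu>) = emeasure \<nu> (cylinder A w)" .
  have pos: "AE y in \<nu>. 0 \<le> Pit_real k w y" by (intro AE_I2) (simp add: Pit_real_def)
  show "integrable \<nu> (Pit_real k w)"
    by (rule integrableI_nonneg[OF Pit_real_measurable pos]) (use nn cylinder_finite[OF w] in simp)
  show "(\<integral>y. Pit_real k w y \<partial>\<nu>) = measure \<nu> (cylinder A w)"
    using integral_eq_nn_integral[OF Pit_real_measurable pos] nn by (simp add: measure_def)
qed

text \<open>A bounded test becomes nonnegative after adding c. Both sides then grow by the same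
  amount, since \<open>Pit_real\<close> has the same integral at every step.\<close>

lemma Pit_real_dual:
  assumes w: "w \<noteq> []" and u: "u \<in> borel_measurable \<nu>" "\<exists>c. \<forall>y\<in>space \<nu>. \<bar>u y\<bar> \<le> c"
  shows "(\<integral>y. Pit_real k w y * u (lshift y) \<partial>\<nu>) = (\<integral>y. Pit_real (Suc k) w y * u y \<partial>\<nu>)"
proof -
  obtain c where c: "\<forall>y\<in>space \<nu>. \<bar>u y\<bar> \<le> c" using u(2) by (rule exE)
  have sh: "lshift \<in> measurable \<nu> \<nu>" using lshift_measurable[of 1] by simp
  have ush: "(\<lambda>y. u (lshift y)) \<in> borel_measurable \<nu>" by (rule measurable_compose[OF sh u(1)])
  have int: "integrable \<nu> (\<lambda>y. Pit_real j w y * v y)" if v: "v \<in> borel_measurable \<nu>" "\<And>y. y \<in> space \<nu> \<Longrightarrow> \<bar>v y\<bar> \<le> c" for j v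
  proof (rule Bochner_Integration.integrable_bound[OF integrable_mult_left[OF Pit_real_integrable(1)[OF w, of j], of c]])
    show "AE y in \<nu>. norm (Pit_real j w y * v y) \<le> norm (Pit_real j w y * c)"
    proof (rule AE_I2)
      fix y assume "y \<in> space \<nu>"
      then have "\<bar>v y\<bar> \<le> \<bar>c\<bar>" using v(2)[of y] by linarith
      then show "norm (Pit_real j w y * v y) \<le> norm (Pit_real j w y * c)"
        by (simp add: abs_mult mult_left_mono)
    qed
  qed (use v in measurable)
  have pint: "(\<integral>y. Pit_real j w y * c \<partial>\<nu>) = measure \<nu> (cylinder A w) * c" for j
    using Pit_real_integrable[OF w, of j] by simp
  have icon: "integrable \<nu> (\<lambda>y. Pit_real j w y * c)" for j using Pit_real_integrable(1)[OF w, of j] by simp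
  \<comment> \<open>The maximum makes the test nonnegative at every sequence, also outside the
    space, where no bound on \<open>u\<close> is known.\<close>
  let ?u = "\<lambda>y. max 0 (u y + c)"
  have "(\<integral>y. Pit_real k w y * ?u (lshift y) \<partial>\<nu>) = (\<integral>y. Pit_real (Suc k) w y * ?u y \<partial>\<nu>)"
    by (rule Pit_real_dual_nonneg[OF w]) (use u(1) in auto)
  moreover have "(\<integral>y. Pit_real k w y * ?u (lshift y) \<partial>\<nu>) = (\<integral>y. Pit_real k w y * u (lshift y) \<partial>\<nu>) + measure \<nu> (cylinder A w) * c"
  proof -
    have "\<bar>u (lshift y)\<bar> \<le> c" if "y \<in> space \<nu>" for y using c measurable_space[OF sh that] by blast
    then have "(\<integral>y. Pit_real k w y * ?u (lshift y) \<partial>\<nu>) = (\<integral>y. Pit_real k w y * u (lshift y) + Pit_real k w y * c \<partial>\<nu>)"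
      by (intro Bochner_Integration.integral_cong refl) (smt (verit) distrib_left)
    also have "\<dots> = (\<integral>y. Pit_real k w y * u (lshift y) \<partial>\<nu>) + (\<integral>y. Pit_real k w y * c \<partial>\<nu>)"
      by (intro Bochner_Integration.integral_add int ush icon) (use c measurable_space[OF sh] in blast)
    finally show ?thesis by (simp only: pint)
  qed
  moreover have "(\<integral>y. Pit_real (Suc k) w y * ?u y \<partial>\<nu>) = (\<integral>y. Pit_real (Suc k) w y * u y \<partial>\<nu>) + measure \<nu> (cylinder A w) * c"
  proof -
    have "(\<integral>y. Pit_real (Suc k) w y * ?u y \<partial>\<nu>) = (\<integral>y. Pit_real (Suc k) w y * u y + Pit_real (Suc k) w y * c \<partial>\<nu>)"
    proof (intro Bochner_Integration.integral_cong refl)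
      fix y assume "y \<in> space \<nu>"
      then have "\<bar>u y\<bar> \<le> c" using c by blast
      then have "max 0 (u y + c) = u y + c" by simp
      then show "Pit_real (Suc k) w y * ?u y = Pit_real (Suc k) w y * u y + Pit_real (Suc k) w y * c"
        by (simp only: distrib_left)
    qed
    also have "\<dots> = (\<integral>y. Pit_real (Suc k) w y * u y \<partial>\<nu>) + (\<integral>y. Pit_real (Suc k) w y * c \<partial>\<nu>)"
      by (intro Bochner_Integration.integral_add int u(1) icon) (use c in blast)
    finally show ?thesis by (simp only: pint)
  qed
  ultimately show ?thesis by simp
qed

lemma mu_integral:
  fixes u :: "(nat \<Rightarrow> 'a) \<Rightarrow> real"
  assumes f: "f \<in> borel_measurable \<nu>" and u: "u \<in> borel_measurable \<nu>"
  shows "(\<integral>y. f y / h y * u y \<partial>\<mu>) = (\<integral>y. f y * u y \<partial>\<nu>)"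
proof -
  have "(\<integral>y. f y / h y * u y \<partial>\<mu>) = (\<integral>y. h y * (f y / h y * u y) \<partial>\<nu>)"
    unfolding \<mu>_def using f u by (subst integral_density) (use h_pos in \<open>auto simp: space_nu less_imp_le intro!: AE_I2\<close>)
  also have "\<dots> = (\<integral>y. f y * u y \<partial>\<nu>)"
  proof (intro Bochner_Integration.integral_cong refl)
    fix y assume "y \<in> space \<nu>"
    then have "h y \<noteq> 0" using h_pos[of y] by (simp add: space_nu)
    then show "h y * (f y / h y * u y) = f y * u y" by simp
  qed
  finally show ?thesis .
qed

lemma mu_integrable:
  assumes f: "integrable \<nu> f"
  shows "integrable \<mu> (\<lambda>y. f y / h y)"
proof -
  have "integrable \<nu> (\<lambda>y. h y * (f y / h y))"
  proof (rule Bochner_Integration.integrable_cong[THEN iffD1, OF refl _ f])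
    fix y assume "y \<in> space \<nu>"
    then have "h y \<noteq> 0" using h_pos[of y] by (simp add: space_nu)
    then show "f y = h y * (f y / h y)" by simp
  qed
  then show ?thesis
    unfolding \<mu>_def using f by (subst integrable_density) (use h_pos in \<open>auto simp: space_nu less_imp_le intro!: AE_I2\<close>)
qed

lemma mu_AE: "(AE y in \<mu>. Q y) \<longleftrightarrow> (AE y in \<nu>. Q y)"
proof -
  have "(AE y in \<mu>. Q y) \<longleftrightarrow> (AE y in \<nu>. 0 < ennreal (h y) \<longrightarrow> Q y)"
    unfolding \<mu>_def by (rule AE_density) simp
  also have "\<dots> \<longleftrightarrow> (AE y in \<nu>. Q y)"
    by (rule AE_cong) (use h_pos in \<open>simp add: space_nu\<close>)
  finally show ?thesis .
qed

text \<open>The transfer operator of \<open>\<mu>\<close> is that of \<open>\<nu>\<close> conjugated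
  by h, hence the quotients. Iteration works with versions, so the induction carries measurability
  along with the almost sure identity.\<close>

lemma transfer_op_Pit:
  assumes w: "w \<noteq> []"
  shows "((transfer_op \<mu> lshift) ^^ k) (\<lambda>y. Pit_real 0 w y / h y) \<in> borel_measurable \<mu> \<and>
    (AE y in \<mu>. ((transfer_op \<mu> lshift) ^^ k) (\<lambda>y. Pit_real 0 w y / h y) y = Pit_real k w y / h y)"
proof (induction k)
  case 0
  show ?case by simp
next
  case (Suc k)
  let ?f = "((transfer_op \<mu> lshift) ^^ k) (\<lambda>y. Pit_real 0 w y / h y)"
  have sh: "lshift \<in> measurable \<mu> \<mu>" using lshift_measurable[of 1] by simp
  have fm: "(\<lambda>y. Pit_real k w y / h y) \<in> borel_measurable \<mu>" by simp
  have dual: "(\<integral>y. Pit_real k w y / h y * u (lshift y) \<partial>\<mu>) = (\<integral>y. Pit_real (Suc k) w y / h y * u y \<partial>\<mu>)"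
    if u: "u \<in> borel_measurable \<mu>" "\<exists>c. \<forall>y\<in>space \<mu>. \<bar>u y\<bar> \<le> c" for u
  proof -
    have u': "u \<in> borel_measurable \<nu>" "\<exists>c. \<forall>y\<in>space \<nu>. \<bar>u y\<bar> \<le> c" using u by (simp_all add: space_mu space_nu)
    have ush: "(\<lambda>y. u (lshift y)) \<in> borel_measurable \<nu>"
      using measurable_compose[OF _ u'(1), of lshift \<nu>] lshift_measurable[of 1] by simp
    show ?thesis
      unfolding mu_integral[OF Pit_real_measurable ush] mu_integral[OF Pit_real_measurable u'(1)]
      by (rule Pit_real_dual[OF w u'])
  qed
  note t = transfer_op_AE[OF sh fm conjunct1[OF Suc] conjunct2[OF Suc] mu_integrable[OF Pit_real_integrable(1)[OF w]] dual]
  show ?case unfolding funpow.simps o_def using t by auto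
qed

text \<open>Pointwise dual ergodicity is applied to the indicator divided by h, whose
  \<open>\<mu>\<close>-integral is the \<open>\<nu>\<close>-measure of the cylinder; multiplying
  back by h gives averages of \<open>Pit\<close>. The two almost sure statements are joined so that
  one null set serves both.\<close>

lemma Pit_average:
  assumes norm: "normalizing_sequence \<mu> lshift a" and w: "w \<noteq> []"
  shows "AE y in \<nu>. (\<forall>k. Pit k (indicator (cylinder A w)) y = ennreal (Pit_real k w y)) \<and>
    (\<lambda>n. (\<Sum>k<n. Pit_real k w y) / a n) \<longlonglongrightarrow> h y * measure \<nu> (cylinder A w)"
proof -
  let ?f = "\<lambda>y. Pit_real 0 w y / h y"
  have "(\<integral>y. ?f y \<partial>\<mu>) = measure \<nu> (cylinder A w)"
    using mu_integral[OF Pit_real_measurable, of "\<lambda>_. 1" 0 w] Pit_real_integrable(2)[OF w] by simp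
  then have "AE y in \<mu>. (\<lambda>n. (1 / a n) * (\<Sum>k<n. ((transfer_op \<mu> lshift) ^^ k) ?f y)) \<longlonglongrightarrow> measure \<nu> (cylinder A w)"
    using norm[unfolded normalizing_sequence_def, rule_format, OF mu_integrable[OF Pit_real_integrable(1)[OF w, of 0]]]
    by (simp only:)
  moreover have "AE y in \<mu>. \<forall>k. ((transfer_op \<mu> lshift) ^^ k) ?f y = Pit_real k w y / h y"
    unfolding AE_all_countable using transfer_op_Pit[OF w] by blast
  moreover have "AE y in \<mu>. \<forall>k. Pit k (indicator (cylinder A w)) y = ennreal (Pit_real k w y)"
    unfolding AE_all_countable mu_AE using Pit_real_AE[OF w] by blast
  moreover have "AE y in \<mu>. 0 < h y" by (rule AE_I2) (simp add: space_mu h_pos)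
  ultimately have "AE y in \<mu>. (\<forall>k. Pit k (indicator (cylinder A w)) y = ennreal (Pit_real k w y)) \<and>
    (\<lambda>n. (\<Sum>k<n. Pit_real k w y) / a n) \<longlonglongrightarrow> h y * measure \<nu> (cylinder A w)"
  proof eventually_elim
    case (elim y)
    have "(1 / a n) * (\<Sum>k<n. ((transfer_op \<mu> lshift) ^^ k) ?f y) = (\<Sum>k<n. Pit_real k w y) / a n / h y" for n
      using elim(2) by (simp add: sum_divide_distrib[symmetric] field_simps)
    then have "(\<lambda>n. h y * ((\<Sum>k<n. Pit_real k w y) / a n / h y)) \<longlonglongrightarrow> h y * measure \<nu> (cylinder A w)"
      using elim(1) by (intro tendsto_mult_left) simp
    then show ?case using elim by simp
  qed
  then show ?thesis unfolding mu_AE .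
qed

end

section \<open>The time scale given by the normalizing sequence\<close>

locale scaled_system = periodic_point + regular_scale +
  assumes norm: "normalizing_sequence \<mu> lshift a"
begin

text \<open>The generalised inverse of \<open>a\<close> at 1 / \<open>\<mu>\<close> (B n), and so
  the reciprocal of the scaling. The maximum with 1 matters for finitely many n only and keeps
  \<open>\<gamma>\<close> positive throughout.\<close>

definition N :: "nat \<Rightarrow> nat" where
  "N n = max 1 (level (1 / measure \<mu> (B n)))"

definition \<gamma> :: "nat \<Rightarrow> real" where
  "\<gamma> n = 1 / real (N n)"

definition \<kappa> :: "real \<Rightarrow> real" where
  "\<kappa> s = Gamma (1 + \<alpha>) * s powr - \<alpha>"

lemma N_ge_1: "1 \<le> N n" by (simp add: N_def)

lemma mu_B_tendsto_0: "(\<lambda>n. measure \<mu> (B n)) \<longlonglongrightarrow> 0"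
proof -
  have "(\<lambda>n. measure \<mu> (B n) / measure \<nu> (B n) * measure \<nu> (B n)) \<longlonglongrightarrow> h x * 0"
    by (intro tendsto_mult mu_B_ratio measure_B_tendsto_0)
  moreover have "\<forall>\<^sub>F n in sequentially. measure \<mu> (B n) / measure \<nu> (B n) * measure \<nu> (B n) = measure \<mu> (B n)"
    using eventually_ge_at_top[of 1] by eventually_elim (use B_pos in force)
  ultimately show ?thesis using Lim_transform_eventually by fastforce
qed

lemma mu_B_inverse: "filterlim (\<lambda>n. 1 / measure \<mu> (B n)) at_top sequentially"
proof -
  have "\<forall>\<^sub>F n in sequentially. 0 < measure \<mu> (B n)"
    using mu_B_eventually by eventually_elim blast
  from filterlim_inverse_at_top[OF mu_B_tendsto_0 this] show ?thesis by (simp add: inverse_eq_divide)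
qed

lemma level_mu_at_top: "filterlim (\<lambda>n. level (1 / measure \<mu> (B n))) at_top sequentially"
  by (rule filterlim_compose[OF level_at_top mu_B_inverse])

lemma N_eq_level: "\<forall>\<^sub>F n in sequentially. N n = level (1 / measure \<mu> (B n))"
proof -
  have "\<forall>\<^sub>F n in sequentially. 1 \<le> level (1 / measure \<mu> (B n))"
    using level_mu_at_top by (simp add: filterlim_at_top)
  then show ?thesis by eventually_elim (simp add: N_def)
qed

lemma N_at_top: "filterlim N at_top sequentially"
  using level_mu_at_top N_eq_level by (subst filterlim_cong[OF refl refl]) auto

lemma mu_a_N: "(\<lambda>n. measure \<mu> (B n) * a (N n)) \<longlonglongrightarrow> 1"
proof -
  have "(\<lambda>n. a (level (1 / measure \<mu> (B n))) / (1 / measure \<mu> (B n))) \<longlonglongrightarrow> 1"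
    by (rule filterlim_compose[OF level_asymptotic mu_B_inverse])
  moreover have "\<forall>\<^sub>F n in sequentially. a (level (1 / measure \<mu> (B n))) / (1 / measure \<mu> (B n)) = measure \<mu> (B n) * a (N n)"
    using N_eq_level by eventually_elim (simp add: mult.commute)
  ultimately show ?thesis by (rule Lim_transform_eventually)
qed

lemma scaling_eq: "\<forall>\<^sub>F n in sequentially. scaling a (measure \<mu> (B n)) = \<gamma> n"
  using N_eq_level by eventually_elim (simp add: scaling_def gen_inverse_level \<gamma>_def)

text \<open>Geometric decay per period beats n squared; the square matches the quadratic bound on
  the growth of \<open>a\<close>.\<close>

lemma square_measure_B: "(\<lambda>n. (real n)\<^sup>2 * measure \<nu> (B n)) \<longlonglongrightarrow> 0"
proof -
  define \<sigma> where "\<sigma> = (1 + \<rho>) / 2"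
  have \<sigma>: "\<rho> < \<sigma>" "0 < \<sigma>" "\<sigma> < 1" using rho_pos rho_less_1 by (auto simp: \<sigma>_def)
  \<comment> \<open>The square root lets the geometric factor be moved inside the square, where j
    times r^j tends to 0.\<close>
  define r where "r = sqrt \<sigma>"
  have r: "\<bar>r\<bar> < 1" "r ^ 2 = \<sigma>" using \<sigma> by (auto simp: r_def)
  obtain k where k: "1 \<le> k" "\<And>j. measure \<nu> (B (k + q * j)) \<le> \<sigma> ^ j * measure \<nu> (B k)"
    using measure_B_geometric[OF \<sigma>(1)] unfolding eventually_sequentially by blast
  define g where "g j = ((real k + real q) * r ^ j + real q * (real j * r ^ j))\<^sup>2 * measure \<nu> (B k)" for j
  have "g \<longlonglongrightarrow> ((real k + real q) * 0 + real q * 0)\<^sup>2 * measure \<nu> (B k)"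
    unfolding g_def by (intro tendsto_intros LIMSEQ_power_zero powser_times_n_limit_0) (use r in auto)
  then have g: "g \<longlonglongrightarrow> 0" by simp
  define j where "j n = (n - k) div q" for n
  have j_top: "filterlim j at_top sequentially"
    unfolding filterlim_at_top
  proof
    fix Z
    have "Z \<le> j n" if "k + q * Z \<le> n" for n
    proof -
      have "q * Z \<le> n - k" using that by simp
      then have "q * Z div q \<le> j n" unfolding j_def by (rule div_le_mono)
      then show ?thesis using q_pos by simp
    qed
    then show "\<forall>\<^sub>F n in sequentially. Z \<le> j n" unfolding eventually_sequentially by blast
  qed
  have le: "(real n)\<^sup>2 * measure \<nu> (B n) \<le> g (j n)" if n: "k \<le> n" for n
  proof -
    have split: "n - k = q * j n + (n - k) mod q" unfolding j_def by simp
    have "(n - k) mod q < q" using q_pos by simp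
    then have up: "n \<le> k + q * j n + q" and lo: "k + q * j n \<le> n" using n split by linarith+
    have "emeasure \<nu> (B n) \<le> emeasure \<nu> (B (k + q * j n))" by (intro emeasure_mono B_mono lo) simp
    then have "measure \<nu> (B n) \<le> measure \<nu> (B (k + q * j n))"
      using B_emeasure[of n] B_emeasure[of "k + q * j n"] n k(1) by (simp add: ennreal_le_iff)
    then have m: "measure \<nu> (B n) \<le> \<sigma> ^ j n * measure \<nu> (B k)" using k(2)[of "j n"] by linarith
    have "real n \<le> real (k + q * j n + q)" using up by (rule of_nat_mono)
    then have "(real n)\<^sup>2 \<le> (real k + real q * real (j n) + real q)\<^sup>2" by (intro power_mono) auto
    then have "(real n)\<^sup>2 * measure \<nu> (B n) \<le> (real k + real q * real (j n) + real q)\<^sup>2 * (\<sigma> ^ j n * measure \<nu> (B k))"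
      using m by (intro mult_mono) auto
    also have "\<dots> = g (j n)"
    proof -
      have "\<sigma> ^ j n = (r ^ j n)\<^sup>2" unfolding r(2)[symmetric] by (simp add: power_mult[symmetric] mult.commute)
      then have "(real k + real q * real (j n) + real q)\<^sup>2 * \<sigma> ^ j n = ((real k + real q * real (j n) + real q) * r ^ j n)\<^sup>2"
        by (simp add: power_mult_distrib)
      also have "(real k + real q * real (j n) + real q) * r ^ j n = (real k + real q) * r ^ j n + real q * (real (j n) * r ^ j n)"
        by (simp add: algebra_simps)
      finally show ?thesis by (simp add: g_def mult.assoc[symmetric])
    qed
    finally show ?thesis .
  qed
  show ?thesis
  proof (rule tendsto_sandwich[OF _ _ tendsto_const filterlim_compose[OF g j_top]])
    show "\<forall>\<^sub>F n in sequentially. (real n)\<^sup>2 * measure \<nu> (B n) \<le> g (j n)"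
      using eventually_ge_at_top[of k] by eventually_elim (rule le)
  qed (simp add: always_eventually)
qed

text \<open>As \<open>a\<close> grows at most quadratically and \<open>\<mu>\<close> (B n) times a(N
  n) tends to 1, N n is at least of the order of the inverse square root of that measure. Hence (n
  \<open>\<gamma> n\<close>)^2 is at most a constant times n^2 \<open>\<mu>\<close> (B n), which
  tends to 0.\<close>

lemma small_gamma: "(\<lambda>n. real n * \<gamma> n) \<longlonglongrightarrow> 0"
proof -
  obtain M where M: "1 \<le> M" "\<forall>N\<ge>M. 0 < a N \<and> (\<forall>u\<ge>0. a (nat \<lfloor>u * real N\<rfloor>) \<le> 4 * (1 + u)\<^sup>2 * a N)"
    using a_growth by blast
  have aM: "0 < a M" "\<And>u. 0 \<le> u \<Longrightarrow> a (nat \<lfloor>u * real M\<rfloor>) \<le> 4 * (1 + u)\<^sup>2 * a M" using M(2) by auto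
  \<comment> \<open>\<open>a_growth\<close> at u = k / M, where 1 + k / M is at most 2 k; this gives
    16 = 4 * 4. The 32 below comes from the bound 1 / 2 for \<open>\<mu>\<close> (B n) times a(N
    n).\<close>
  have growth: "a k \<le> 16 * a M * (real k)\<^sup>2" if k: "1 \<le> k" for k
  proof -
    have "nat \<lfloor>real k / real M * real M\<rfloor> = k" using M(1) by simp
    then have "a k \<le> 4 * (1 + real k / real M)\<^sup>2 * a M" using aM(2)[of "real k / real M"] by simp
    also have "\<dots> \<le> 4 * (2 * real k)\<^sup>2 * a M"
    proof -
      have "real k / real M \<le> real k / 1" using M(1) by (intro divide_left_mono) auto
      then have "1 + real k / real M \<le> 2 * real k" using k by simp
      then have "(1 + real k / real M)\<^sup>2 \<le> (2 * real k)\<^sup>2" by (intro power_mono) auto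
      then show ?thesis using aM(1) by (intro mult_right_mono mult_left_mono) auto
    qed
    finally show ?thesis by (simp add: power_mult_distrib mult_ac)
  qed
  have "(\<lambda>n. measure \<mu> (B n) / measure \<nu> (B n) * ((real n)\<^sup>2 * measure \<nu> (B n))) \<longlonglongrightarrow> h x * 0"
    by (intro tendsto_mult mu_B_ratio square_measure_B)
  moreover have "\<forall>\<^sub>F n in sequentially. measure \<mu> (B n) / measure \<nu> (B n) * ((real n)\<^sup>2 * measure \<nu> (B n)) = (real n)\<^sup>2 * measure \<mu> (B n)"
    using eventually_ge_at_top[of 1]
  proof eventually_elim
    case (elim n)
    then show ?case using B_pos[OF elim] by (simp add: field_simps)
  qed
  ultimately have "(\<lambda>n. (real n)\<^sup>2 * measure \<mu> (B n)) \<longlonglongrightarrow> h x * 0" by (rule Lim_transform_eventually)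
  then have "(\<lambda>n. sqrt (32 * a M * ((real n)\<^sup>2 * measure \<mu> (B n)))) \<longlonglongrightarrow> sqrt (32 * a M * (h x * 0))"
    by (intro tendsto_real_sqrt tendsto_mult_left)
  then have lim: "(\<lambda>n. sqrt (32 * a M * ((real n)\<^sup>2 * measure \<mu> (B n)))) \<longlonglongrightarrow> 0" by simp
  have half: "\<forall>\<^sub>F n in sequentially. 1 / 2 < measure \<mu> (B n) * a (N n)"
    by (rule order_tendstoD(1)[OF mu_a_N]) simp
  show ?thesis
  proof (rule tendsto_sandwich[OF _ _ tendsto_const lim])
    show "\<forall>\<^sub>F n in sequentially. 0 \<le> real n * \<gamma> n" by (intro always_eventually allI) (simp add: \<gamma>_def)
    show "\<forall>\<^sub>F n in sequentially. real n * \<gamma> n \<le> sqrt (32 * a M * ((real n)\<^sup>2 * measure \<mu> (B n)))"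
      using half
    proof eventually_elim
      case (elim n)
      have Np: "0 < real (N n)" using N_ge_1[of n] by simp
      have "measure \<mu> (B n) * a (N n) \<le> measure \<mu> (B n) * (16 * a M * (real (N n))\<^sup>2)"
        using growth[OF N_ge_1[of n]] by (intro mult_left_mono) auto
      then have "1 \<le> 32 * a M * measure \<mu> (B n) * (real (N n))\<^sup>2"
        using elim by (simp add: mult_ac)
      then have "(real n)\<^sup>2 * 1 \<le> (real n)\<^sup>2 * (32 * a M * measure \<mu> (B n) * (real (N n))\<^sup>2)"
        by (intro mult_left_mono) auto
      then have "(real n)\<^sup>2 / (real (N n))\<^sup>2 \<le> 32 * a M * ((real n)\<^sup>2 * measure \<mu> (B n))"
        using Np by (simp add: divide_le_eq mult_ac)
      then have "(real n * \<gamma> n)\<^sup>2 \<le> 32 * a M * ((real n)\<^sup>2 * measure \<mu> (B n))"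
        by (simp add: \<gamma>_def power_divide)
      then show ?case by (rule real_le_rsqrt)
    qed
  qed
qed

lemma Gamma_pos: "0 < Gamma (1 + \<alpha>)"
  using \<alpha> by (intro Gamma_real_pos) simp

text \<open>The Abelian theorem is applied to the sequence of \<open>Pit_real\<close> at a fixed
  good point. The exceptional set depends on the word only, hence the quantifier over s stands
  inside the almost sure statement.\<close>

lemma green_scaled_limit:
  assumes w: "w \<noteq> []"
  shows "AE y in \<nu>. \<forall>s>0. (\<lambda>n. ennreal (measure \<nu> (B n)) * green (exp (- s * \<gamma> n)) (indicator (cylinder A w)) y)
        \<longlonglongrightarrow> ennreal (h y / h x * measure \<nu> (cylinder A w) * \<kappa> s)"
proof -
  have hx: "0 < h x" by (rule h_pos[OF x_mem])
  have "AE y in \<nu>. 0 < h y" by (intro AE_I2) (simp add: h_pos space_nu)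
  with Pit_average[OF norm w] show ?thesis
  proof eventually_elim
    case (elim y)
    let ?b = "\<lambda>k. Pit_real k w y" and ?c = "h y * measure \<nu> (cylinder A w)"
    \<comment> \<open>Asymptotically \<open>\<mu>\<close> (B n), but written with
      \<open>\<nu>\<close> so that division by h x returns exactly the factor in the conclusion. At
      n = 0 the cylinder is the whole space, possibly of infinite measure, so a positive value is
      put by hand.\<close>
    define m where "m n = (if n = 0 then 1 else h x * measure \<nu> (B n))" for n
    show ?case
    proof (intro allI impI)
      fix s :: real assume s: "0 < s"
      have "(\<lambda>n. ennreal (m n) * (\<Sum>k. ennreal (exp (- s * (1 / real (N n))) ^ k) * ennreal (?b k)))
        \<longlonglongrightarrow> ennreal (?c * Gamma (1 + \<alpha>) * s powr - \<alpha>)"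
      proof (rule abelian_limit[OF _ _ _ N_at_top N_ge_1 _ _ s])
        show "0 \<le> ?b k" for k by (simp add: Pit_real_def)
        show "0 \<le> ?c" using elim by simp
        show "(\<lambda>n. (\<Sum>k<n. ?b k) / a n) \<longlonglongrightarrow> ?c" using elim by simp
        show "0 < m n" for n using hx B_pos[of n] by (simp add: m_def)
        have "(\<lambda>n. h x / (measure \<mu> (B n) / measure \<nu> (B n)) * (measure \<mu> (B n) * a (N n))) \<longlonglongrightarrow> h x / h x * 1"
          using hx by (intro tendsto_intros mu_B_ratio mu_a_N) simp
        then have lim: "(\<lambda>n. h x / (measure \<mu> (B n) / measure \<nu> (B n)) * (measure \<mu> (B n) * a (N n))) \<longlonglongrightarrow> 1" using hx by simp
        show "(\<lambda>n. m n * a (N n)) \<longlonglongrightarrow> 1"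
        proof (rule Lim_transform_eventually[OF lim])
          show "\<forall>\<^sub>F n in sequentially. h x / (measure \<mu> (B n) / measure \<nu> (B n)) * (measure \<mu> (B n) * a (N n)) = m n * a (N n)"
            using eventually_ge_at_top[of 1] mu_B_eventually by eventually_elim (simp add: m_def)
        qed
      qed
      then have "(\<lambda>n. ennreal (1 / h x) * (ennreal (m n) * (\<Sum>k. ennreal (exp (- s * (1 / real (N n))) ^ k) * ennreal (?b k))))
        \<longlonglongrightarrow> ennreal (1 / h x) * ennreal (?c * Gamma (1 + \<alpha>) * s powr - \<alpha>)"
        by (intro ennreal_tendsto_cmult) simp_all
      also have "ennreal (1 / h x) * ennreal (?c * Gamma (1 + \<alpha>) * s powr - \<alpha>) = ennreal (h y / h x * measure \<nu> (cylinder A w) * \<kappa> s)"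
        using hx elim Gamma_pos by (subst ennreal_mult[symmetric]) (auto simp: \<kappa>_def mult_ac)
      finally show "(\<lambda>n. ennreal (measure \<nu> (B n)) * green (exp (- s * \<gamma> n)) (indicator (cylinder A w)) y)
        \<longlonglongrightarrow> ennreal (h y / h x * measure \<nu> (cylinder A w) * \<kappa> s)"
      proof (rule Lim_transform_eventually)
        show "\<forall>\<^sub>F n in sequentially. ennreal (1 / h x) * (ennreal (m n) * (\<Sum>k. ennreal (exp (- s * (1 / real (N n))) ^ k) * ennreal (?b k)))
          = ennreal (measure \<nu> (B n)) * green (exp (- s * \<gamma> n)) (indicator (cylinder A w)) y"
          using eventually_ge_at_top[of 1]
        proof eventually_elim
          case n: (elim n)
          have "ennreal (1 / h x) * ennreal (m n) = ennreal (measure \<nu> (B n))"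
            using hx n by (subst ennreal_mult[symmetric]) (auto simp: m_def)
          then show ?case using elim by (simp add: green_def \<gamma>_def mult.assoc[symmetric])
        qed
      qed
    qed
  qed
qed

lemma kappa_at_top: "filterlim (\<lambda>m. \<kappa> (1 / real (Suc m))) at_top sequentially"
proof -
  have "filterlim (\<lambda>m. real (Suc m) powr \<alpha>) at_top sequentially"
    unfolding filterlim_at_top
  proof
    fix Z :: real
    show "\<forall>\<^sub>F m in sequentially. Z \<le> real (Suc m) powr \<alpha>"
      using eventually_ge_at_top[of "nat \<lceil>max 1 Z powr (1 / \<alpha>)\<rceil>"]
    proof eventually_elim
      case (elim m)
      then have "max 1 Z powr (1 / \<alpha>) \<le> real (Suc m)" by linarith
      then have "(max 1 Z powr (1 / \<alpha>)) powr \<alpha> \<le> real (Suc m) powr \<alpha>"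
        using \<alpha> by (intro powr_mono2) auto
      then show ?case using \<alpha> by (simp add: powr_powr)
    qed
  qed
  then have "filterlim (\<lambda>m. Gamma (1 + \<alpha>) * real (Suc m) powr \<alpha>) at_top sequentially"
    by (rule filterlim_tendsto_pos_mult_at_top[OF tendsto_const Gamma_pos])
  moreover have "\<kappa> (1 / real (Suc m)) = Gamma (1 + \<alpha>) * real (Suc m) powr \<alpha>" for m
    by (simp add: \<kappa>_def powr_divide powr_minus_divide)
  ultimately show ?thesis by simp
qed

sublocale hitting_asymptotics A \<phi> h \<eta> lam \<nu> x q \<gamma> \<kappa>
proof
  show "0 < \<gamma> n" for n using N_ge_1[of n] by (simp add: \<gamma>_def)
  show "0 < \<kappa> s" if "0 < s" for s using that Gamma_pos by (simp add: \<kappa>_def)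
qed (rule small_gamma kappa_at_top green_scaled_limit; assumption?)+

theorem law_limits:
  "(\<forall>P. prob_space P \<and> sets P = sets \<mu> \<and> absolutely_continuous \<mu> P \<longrightarrow>
      pp_converges_in_law (\<lambda>n. distr P pp_borel (return_process a \<mu> (B n))) (CFPP \<alpha> ((1 - \<rho>) * Gamma (1 + \<alpha>)) (Geo (1 - \<rho>)))) \<and>
   pp_converges_in_law (\<lambda>n. distr (uniform_measure \<mu> (B n)) pp_borel (return_process a \<mu> (B n)))
      (RPP (W_law \<alpha> (1 - \<rho>) ((1 - \<rho>) * Gamma (1 + \<alpha>))))"
proof -
  have "\<forall>\<^sub>F n in sequentially. scaling a (measure \<mu> (B n)) = \<gamma> n \<and>
     (0 < measure \<mu> (B n) \<and> emeasure \<mu> (B n) = ennreal (measure \<mu> (B n)))"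
    by (rule eventually_conj[OF scaling_eq mu_B_eventually])
  then obtain start where start: "\<And>n. start \<le> n \<Longrightarrow> scaling a (measure \<mu> (B n)) = \<gamma> n"
    "\<And>n. start \<le> n \<Longrightarrow> 0 < measure \<mu> (B n) \<and> emeasure \<mu> (B n) = ennreal (measure \<mu> (B n))"
    unfolding eventually_sequentially by blast
  have \<kappa>: "\<kappa> s = Gamma (1 + \<alpha>) * s powr - \<alpha>" for s by (rule \<kappa>_def)
  show ?thesis
  proof (intro conjI allI impI)
    fix P assume P: "prob_space P \<and> sets P = sets \<mu> \<and> absolutely_continuous \<mu> P"
    \<comment> \<open>h is positive, so \<open>\<mu>\<close> and \<open>\<nu>\<close> have the same
      null sets.\<close>
    have "absolutely_continuous \<nu> P"
      unfolding absolutely_continuous_def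
    proof
      fix E assume "E \<in> null_sets \<nu>"
      then have "E \<in> sets \<nu>" "AE y in \<mu>. y \<notin> E" unfolding mu_AE by (auto intro: AE_not_in)
      then have "E \<in> null_sets \<mu>" by (subst AE_iff_null_sets) simp_all
      then show "E \<in> null_sets P" using P by (auto simp: absolutely_continuous_def)
    qed
    then show "pp_converges_in_law (\<lambda>n. distr P pp_borel (return_process a \<mu> (B n))) (CFPP \<alpha> ((1 - \<rho>) * Gamma (1 + \<alpha>)) (Geo (1 - \<rho>)))"
      using P by (intro probability_law_limit[OF \<alpha>(1) Gamma_pos \<kappa> refl start]) simp_all
  next
    show "pp_converges_in_law (\<lambda>n. distr (uniform_measure \<mu> (B n)) pp_borel (return_process a \<mu> (B n)))
      (RPP (W_law \<alpha> (1 - \<rho>) ((1 - \<rho>) * Gamma (1 + \<alpha>))))"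
      by (rule uniform_law_limit[OF \<alpha>(1) Gamma_pos \<kappa> refl start])
  qed
qed

end

theorem theorem4p2:
  fixes A :: "'v::countable \<Rightarrow> 'v \<Rightarrow> bool"
    and \<phi> h :: "(nat \<Rightarrow> 'v) \<Rightarrow> real"
    and \<nu> \<mu> :: "(nat \<Rightarrow> 'v) measure"
    and a :: "nat \<Rightarrow> real"
    and \<eta> \<alpha> \<theta> :: real
    and x :: "nat \<Rightarrow> 'v"
    and q :: nat
    and B :: "nat \<Rightarrow> (nat \<Rightarrow> 'v) set"
  assumes "infinite (UNIV :: 'v set)"
    and "0 < \<eta>" and "\<eta> < 1"
    and "topologically_mixing A"
    and "\<phi> \<in> borel_measurable (markov_borel \<eta> A)"
    and "walters_condition A \<phi>"
    and "gurevich_pressure A \<phi> < \<infinity>"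
    and "null_recurrent A \<phi>"
    and "ruelle_eigenpair \<eta> A \<phi> h \<nu>"
    and "\<mu> = density \<nu> (\<lambda>y. ennreal (h y))"
    and "mono a"
    and "normalizing_sequence \<mu> lshift a"
    and "0 < \<alpha>" and "\<alpha> \<le> 1"
    and "regularly_varying_seq \<alpha> a"
    and "x \<in> markov_space A"
    and "prime_period x q"
    and "\<And>n. B n = cylinder A (map x [0..<n])"
    and "\<theta> = 1 - exp (birkhoff_sum \<phi> q x - real q * real_of_ereal (gurevich_pressure A \<phi>))"
  shows "(\<forall>P. prob_space P \<and> sets P = sets \<mu> \<and> absolutely_continuous \<mu> P \<longrightarrow>
            pp_converges_in_law (\<lambda>n. distr P pp_borel (return_process a \<mu> (B n)))
              (CFPP \<alpha> (\<theta> * Gamma (1 + \<alpha>)) (Geo \<theta>))) \<and>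
         pp_converges_in_law
           (\<lambda>n. distr (uniform_measure \<mu> (B n)) pp_borel (return_process a \<mu> (B n)))
           (RPP (W_law \<alpha> \<theta> (\<theta> * Gamma (1 + \<alpha>))))"
proof -
  define lam where "lam = pressure_eigenvalue A \<phi>"
  have lam: "0 < lam" "lam ^ q = exp (real q * real_of_ereal (gurevich_pressure A \<phi>))"
    by (simp_all add: lam_def pressure_eigenvalue_def exp_of_nat_mult)
  interpret P: periodic_point A \<phi> h \<eta> lam \<nu> x q
    using assms lam(1) unfolding ruelle_eigenpair_def lam_def[symmetric] by unfold_locales auto
  have B: "P.B = B" using assms(18) by (auto simp: P.B_def)
  have \<mu>: "P.\<mu> = \<mu>" by (simp add: P.\<mu>_def assms(10))
  \<comment> \<open>The eigenvalue is exp of the pressure, so dividing by its q-th power subtracts q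
    times the pressure inside the exponential.\<close>
  have \<rho>: "1 - P.\<rho> = \<theta>" unfolding P.\<rho>_def lam(2) assms(19) by (simp add: exp_diff)
  interpret S: scaled_system A \<phi> h \<eta> lam \<nu> x q a \<alpha>
    by unfold_locales (use assms in \<open>simp_all add: \<mu>\<close>)
  show ?thesis using S.law_limits unfolding B \<mu> \<rho> .
qed

end
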